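(* Let $V$ be a vertex operator algebra, $g$ an automorphism of $V$ with $g^T=1$, and $\mathbf x\colon\bar C\to\mathbb P^1$ the twisted projective line. Let $M^1$ be an admissible untwisted $V$-module of some conformal weight $h_1$, and let $U^2$ (resp. $U^3$) be a left (resp. right) $A_g(V)$-module on which $[\omega]$ acts as the scalar $h_2$ (resp. $h_3$); put $h=h_1+h_2-h_3$. Then the map $\varphi\mapsto S_\varphi$ is an isomorphism of vector spaces from the space $\mathscr C(\Sigma_1(U^3,M^1,U^2))$ of twisted restricted conformal blocks associated to the datum $\Sigma_1(U^3,M^1,U^2)=(\mathbf x\colon\bar C\to\mathbb P^1,\infty,1,0,U^3,M^1,U^2)$ onto the space $\mathrm{Cor}(\Sigma_1(U^3,M^1,U^2))$ of $g$-twisted restricted correlation functions associated to the same datum.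
   Context: Everything is over $\mathbb C$; $\mathbb N=\{0,1,2,\dots\}$. VOAs and Zhu's algebra. A vertex operator algebra $V=\bigoplus_{k\in\mathbb N}V_k$ is $\mathbb N$-graded with $\dim V_k<\infty$, has vertex operators $Y(a,z)=\sum_{n\in\mathbb Z}a_{(n)}z^{-n-1}$, vacuum $\mathbf 1\in V_0$, conformal vector $\omega\in V_2$ with $Y(\omega,z)=\sum L_nz^{-n-2}$, and satisfies the usual axioms; $\mathrm{wt}\,a=k$ for $a\in V_k$. For an automorphism $g$ (linear, fixing $\mathbf 1,\omega$, $gY(a,z)g^{-1}=Y(ga,z)$) with $g^T=1$, $V^r=\{a: ga=e^{2\pi ir/T}a\}$, $0\le r\le T-1$. An admissible untwisted module $M^1=\bigoplus_{n\in\mathbb N}M^1(n)$ satisfies $a_{(m)}M^1(n)\subset M^1(\mathrm{wt}\,a-m-1+n)$ and has conformal weight $h_1$ if $L_0=h_1+n$ on $M^1(n)$. $\delta(0)=1$, $\delta(r)=0$ for $r\ne0$. The $g$-twisted Zhu's algebra is $A_g(V)=V/O_g(V)$, with $O_g(V)$ spanned by $\mathrm{Res}_z\frac{(1+z)^{\mathrm{wt}\,a-1+\delta(r)+r/T}}{z^{1+\delta(r)}}Y(a,z)b$ for homogeneous $a\in V^r$, $b\in V$, and product $[a]*_g[b]=[\mathrm{Res}_zY(a,z)b\frac{(1+z)^{\mathrm{wt}\,a}}z]$ for $a\in V^0$, and $0$ for $a\in V^r$, $r\ne0$ (note $[a]=0$ for $a\in V^r$, $r\neq 0$). Twisted projective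 line. $\bar C$ is $\mathbb P^1$ with coordinate $z^{1/T}$, and $\mathbf x\colon\bar C\to\mathbb P^1$ is $z=(z^{1/T})^T$, with Galois group $G\cong\mathbb Z/T$ acting on $V$ through $g$ (the Deck generator at $0$; the one at $\infty$ is $g^{-1}$) and branch points $0,\infty$. $C^\circ=\bar C\setminus\{0,\infty\}$. For $q\in C^\circ$ with coordinate $t=w^{1/T}(q)$ put $w=t^T$, $w^{s/T}=t^s$; points $p_i\in C^\circ$ have coordinates $z_i^{1/T}$, $z_i=(z_i^{1/T})^T$. "$1$" denotes a fixed point of $C^\circ$ with $w(1)=1$. $U^3,M^1,U^2$ are attached to $\infty,\mathbf x(q),0$, with fibres identified with the modules through the coordinates $z^{-1/T}$, $z-w$, $z^{1/T}$. Restricted conformal blocks. The constrained Lie algebra $\mathcal L^\circ_{\mathbb P^1\setminus\{w\}}(\mathcal V^G)_{\le0}$ is the subalgebra of the twisted chiral Lie algebra $(V\otimes\mathbb C[z^{\pm1/T},(z-w)^{-1}]dz)^g/\mathrm{Im}(L_{-1}\otimes1+1\otimes\partial_z)$ (bracket $[a\otimes f\,dz,b\otimes f'dz]=\sum_{j\ge0}\frac1{j!}(a_{(j)}b)\otimes(\partial_z^jf)f'dz$) spanned by the classes of $\alpha=a\otimes\frac{z^{r/T+m}}{(z-w)^n}dz$ with $a\in V^r$ homogeneous, $m\in\mathbb Z$, $n\in\mathbb N$ and $\frac rT+m-n\le\mathrm{wt}\,a-1\le\frac rT+m$. Such $\alpha$ acts on $U^3\otimes M^1\otimes U^2$ by the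 sum of: on $U^3$, $u_3\mapsto-u_3\cdot[a]$ if $\frac rT+m-n=\mathrm{wt}\,a-1$ and $0$ otherwise; on $M^1$, $\sum_{j\ge0}\binom{r/T+m}jw^{r/T+m-j}a_{(j-n)}$; on $U^2$, $u_2\mapsto(-w)^{-n}[a]\cdot u_2$ if $\frac rT+m=\mathrm{wt}\,a-1$ and $0$ otherwise. $\mathscr C(\Sigma_q(U^3,M^1,U^2))$ is the space of linear functionals on $U^3\otimes M^1\otimes U^2$ vanishing on the image of this action; $\Sigma_1$ is the case $q=1$. Restricted conformal blocks with additional copies of $V$ attached to $\mathbf x(p_1),\dots,\mathbf x(p_k)$ ($z_1,\dots,z_k,w$ distinct) are defined in the same way: functionals on $U^3\otimes V^{\otimes k}\otimes M^1\otimes U^2$ invariant under the classes in $(V\otimes\mathbb C[z^{\pm1/T},(z-w)^{-1},(z-z_i)^{-1}]dz)^g/\mathrm{Im}$ of sums of $a\otimes f\,dz$, $a$ homogeneous, with order of vanishing of $f$ at $z=0$ (in powers of $z$) at least $\mathrm{wt}\,a-1$ and $f=O(z^{\mathrm{wt}\,a-1})$ at $z=\infty$; $a\otimes f\,dz$ acts on the $i$-th copy of $V$ by $\mathrm{Res}_{z-z_i}Y(a,z-z_i)f$ ($f$ expanded at $p_i$), similarly on $M^1$, on $U^2$ by $c\,[a]$ with $c$ the coefficient of $z^{\mathrm{wt}\,a-1}$ in $f$ at $0$, and on $U^3$ by $-c'\,u_3\cdot[a]$ with $c'$ the coefficient of $z^{\mathrm{wt}\,a-1}$ in $f$ at $\infty$.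 The map. For $\varphi\in\mathscr C(\Sigma_1)$ and $q\in C^\circ$, put $\langle\varphi_q,u_3\otimes v\otimes u_2\rangle=\langle\varphi,u_3\otimes w^{-L_0+h_1}v\otimes u_2\rangle$, a restricted conformal block for $\Sigma_q$. Restriction to $\mathbf 1\otimes\cdots\otimes\mathbf 1$ on the additional copies of $V$ is an isomorphism between spaces of restricted conformal blocks with and without the additional points; let $\xi^{-1}_{p_\bullet}\varphi_q$ be the preimage of $\varphi_q$ and $S_\varphi\langle u_3|(a^1,p_1)\cdots(a^k,p_k)(v,q)|u_2\rangle=\langle\xi^{-1}_{p_\bullet}\varphi_q,u_3\otimes a^1\otimes\cdots\otimes a^k\otimes v\otimes u_2\rangle$. Restricted correlation functions. $\mathrm{Cor}(\Sigma_1(U^3,M^1,U^2))$ is the vector space of systems $S$ of linear maps, one for each $k\ge0$, assigning to $u_3\otimes a^1\otimes\cdots\otimes a^k\otimes v\otimes u_2$ a rational function $S\langle u_3|(a^1,p_1)\cdots(a^k,p_k)(v,q)|u_2\rangle$ in $\mathbb C[z_i^{\pm1/T},w^{\pm1/T},(z_i-z_j)^{-1},(z_i-w)^{-1}]$ such that: (1) monomial property: for $v\in M^1(d)$, $S\langle u_3|(v,q)|u_2\rangle$ is a constant multiple of $w^{-d}$; (2) locality: the value does not depend on the order of the pairs $(a^i,p_i)$, $(v,q)$; (3) homogeneous property: if $a^i\in V^r$, then $z_i^{r/T}S$ is a rational function of $z_i$; (4) vacuum: a pair $(\mathbf 1,p)$ may be deleted; (5) $L_{-1}$-property: $S\langle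 u_3|\cdots(L_{-1}a^i,p_i)\cdots|u_2\rangle=\partial_{z_i}S\langle u_3|\cdots(a^i,p_i)\cdots|u_2\rangle$ and $S\langle u_3|\cdots(L_{-1}v,q)|u_2\rangle=w^h\partial_w\big(w^{-h}S\langle u_3|\cdots(v,q)|u_2\rangle\big)$; (6) associativity: for $n\in\mathbb Z$, $\mathrm{Res}_{p_1=q}S\langle u_3|(a^1,p_1)\cdots(v,q)|u_2\rangle(z_1-w)^ndz_1=S\langle u_3|\cdots(a^1_{(n)}v,q)|u_2\rangle$ and $\mathrm{Res}_{p_1=p_2}S\langle u_3|(a^1,p_1)(a^2,p_2)\cdots|u_2\rangle(z_1-z_2)^ndz_1=S\langle u_3|(a^1_{(n)}a^2,p_2)\cdots|u_2\rangle$; (7) recursive formulas: with $F_{n,i}(p,p')=\frac{z^{-n}}{i!}\partial_{z'}^i\frac{(z')^n}{z-z'}$ ($z,z'$ the coordinates of $\mathbf x(p),\mathbf x(p')$), for homogeneous $a\in V^r$, $S\langle u_3|(a,p)(a^1,p_1)\cdots(a^k,p_k)(v,q)|u_2\rangle$ equals $$z^{-\mathrm{wt}\,a}S\langle u_3\cdot[a]|(a^1,p_1)\cdots(v,q)|u_2\rangle+\sum_{l=1}^k\sum_{i\ge0}F_{N,i}(p,p_l)S\langle u_3|\cdots(a_{(i)}a^l,p_l)\cdots|u_2\rangle+\sum_{i\ge0}F_{N,i}(p,q)S\langle u_3|\cdots(a_{(i)}v,q)|u_2\rangle$$ with $N=\mathrm{wt}\,a-1+\delta(r)+\frac rT$,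 and also equals the same expression with the first term replaced by $z^{-\mathrm{wt}\,a}S\langle u_3|(a^1,p_1)\cdots(v,q)|[a]\cdot u_2\rangle$ and with $N=\mathrm{wt}\,a-1+\frac rT$. *)

theory Defs
  imports
    "HOL-Complex_Analysis.Complex_Analysis"
    "HOL-Library.Function_Algebras"
    "HOL-Library.Groups_Big_Fun"
    "HOL-Library.Landau_Symbols"
    "HOL-Library.Multiset"
begin

class complex_vs = ab_group_add +
  fixes scaleC :: "complex \<Rightarrow> 'a \<Rightarrow> 'a"  (infixr \<open>*\<^sub>C\<close> 75)
  assumes scaleC_add_right: "c *\<^sub>C (x + y) = c *\<^sub>C x + c *\<^sub>C y"
    and scaleC_add_left: "(c + d) *\<^sub>C x = c *\<^sub>C x + d *\<^sub>C x"
    and scaleC_scaleC: "c *\<^sub>C d *\<^sub>C x = (c * d) *\<^sub>C x"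
    and scaleC_one: "1 *\<^sub>C x = x"

global_interpretation complex_vs: vector_space "scaleC :: complex \<Rightarrow> 'a \<Rightarrow> 'a::complex_vs"
  defines csubspace = complex_vs.subspace
    and cspan = complex_vs.span
  by unfold_locales
    (simp_all add: scaleC_add_right scaleC_add_left scaleC_scaleC scaleC_one)

abbreviation clinear :: "('a::complex_vs \<Rightarrow> 'b::complex_vs) \<Rightarrow> bool"
  where "clinear \<equiv> Vector_Spaces.linear scaleC scaleC"

instantiation complex :: complex_vs
begin
definition scaleC_complex :: "complex \<Rightarrow> complex \<Rightarrow> complex"
  where "scaleC_complex c x = c * x"
instance by standard (simp_all add: scaleC_complex_def algebra_simps)
end

instantiation "fun" :: (type, complex_vs) complex_vs
begin
definition scaleC_fun :: "complex \<Rightarrow> ('a \<Rightarrow> 'b) \<Rightarrow> 'a \<Rightarrow> 'b"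
  where "scaleC_fun c f = (\<lambda>x. c *\<^sub>C f x)"
instance by standard
    (simp_all add: scaleC_fun_def fun_eq_iff scaleC_add_right scaleC_add_left scaleC_scaleC scaleC_one)
end

definition vs_isomorphism_on ::
  "('a::complex_vs \<Rightarrow> 'b::complex_vs) \<Rightarrow> 'a set \<Rightarrow> 'b set \<Rightarrow> bool"
  where "vs_isomorphism_on f A B \<longleftrightarrow>
    csubspace A \<and> csubspace B \<and>
    (\<forall>x\<in>A. \<forall>y\<in>A. f (x + y) = f x + f y) \<and>
    (\<forall>c. \<forall>x\<in>A. f (c *\<^sub>C x) = c *\<^sub>C f x) \<and>
    bij_betw f A B"

text \<open>\<^const>\<open>Sum_any\<close> is the sum of a finitely supported family; all uses below are of this kind.\<close>

definition is_decomposition ::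
  "(nat \<Rightarrow> 'a::complex_vs set) \<Rightarrow> 'a \<Rightarrow> (nat \<Rightarrow> 'a) \<Rightarrow> bool"
  where "is_decomposition gr x f \<longleftrightarrow>
    finite {n. f n \<noteq> 0} \<and> (\<forall>n. f n \<in> gr n) \<and> x = Sum_any f"

definition direct_sum_grading :: "(nat \<Rightarrow> 'a::complex_vs set) \<Rightarrow> bool"
  where "direct_sum_grading gr \<longleftrightarrow>
    (\<forall>n. csubspace (gr n)) \<and> (\<forall>x. \<exists>!f. is_decomposition gr x f)"

definition component :: "(nat \<Rightarrow> 'a::complex_vs set) \<Rightarrow> 'a \<Rightarrow> nat \<Rightarrow> 'a"
  where "component gr x = (THE f. is_decomposition gr x f)"

text \<open>Membership in the homogeneous subspace of integer degree, which is zero in negative degrees.\<close>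

definition in_degree :: "(nat \<Rightarrow> 'a::complex_vs set) \<Rightarrow> int \<Rightarrow> 'a \<Rightarrow> bool"
  where "in_degree gr d x \<longleftrightarrow> (if d < 0 then x = 0 else x \<in> gr (nat d))"

text \<open>Here \<open>mode V a n b\<close> is $a_{(n)}b$.\<close>

record 'v voa_data =
  grade :: "nat \<Rightarrow> 'v set"
  mode :: "'v \<Rightarrow> int \<Rightarrow> 'v \<Rightarrow> 'v"
  vac :: 'v
  conf :: 'v

record ('v, 'm) module_data =
  mgrade :: "nat \<Rightarrow> 'm set"
  act :: "'v \<Rightarrow> int \<Rightarrow> 'm \<Rightarrow> 'm"

text \<open>The Jacobi identity is expressed in modes, as the Borcherds identity for all
  integers \<open>l\<close>, \<open>m\<close>, \<open>n\<close>.\<close>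

definition weak_module ::
  "'v::complex_vs voa_data \<Rightarrow> ('v \<Rightarrow> int \<Rightarrow> 'm::complex_vs \<Rightarrow> 'm) \<Rightarrow> bool"
  where "weak_module V A \<longleftrightarrow>
    (\<forall>a n. clinear (A a n)) \<and>
    (\<forall>n w. clinear (\<lambda>a. A a n w)) \<and>
    (\<forall>a w. \<exists>N. \<forall>n\<ge>N. A a n w = 0) \<and>
    (\<forall>n w. A (vac V) n w = (if n = -1 then w else 0)) \<and>
    (\<forall>a b l m n w.
      Sum_any (\<lambda>i::nat. (of_int m gchoose i) *\<^sub>C A (mode V a (l + int i) b) (m + n - int i) w) =
      Sum_any (\<lambda>i::nat. ((-1) ^ i * (of_int l gchoose i)) *\<^sub>C
        (A a (m + l - int i) (A b (n + int i) w)
         - ((-1) powi l) *\<^sub>C A b (n + l - int i) (A a (m + int i) w))))"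

definition Vir :: "'v voa_data \<Rightarrow> ('v \<Rightarrow> int \<Rightarrow> 'm \<Rightarrow> 'm) \<Rightarrow> int \<Rightarrow> 'm \<Rightarrow> 'm"
  where "Vir V A n w = A (conf V) (n + 1) w"

definition voa :: "'v::complex_vs voa_data \<Rightarrow> bool"
  where "voa V \<longleftrightarrow>
    direct_sum_grading (grade V) \<and>
    (\<forall>k. \<exists>B. finite B \<and> grade V k \<subseteq> cspan B) \<and>
    vac V \<in> grade V 0 \<and> conf V \<in> grade V 2 \<and>
    weak_module V (mode V) \<and>
    (\<forall>k l n. \<forall>a\<in>grade V k. \<forall>b\<in>grade V l.
      in_degree (grade V) (int k + int l - n - 1) (mode V a n b)) \<and>
    (\<forall>a. mode V a (-1) (vac V) = a \<and> (\<forall>n\<ge>0. mode V a n (vac V) = 0)) \<and>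
    (\<exists>c::complex. \<forall>m n b.
      Vir V (mode V) m (Vir V (mode V) n b) - Vir V (mode V) n (Vir V (mode V) m b) =
      of_int (m - n) *\<^sub>C Vir V (mode V) (m + n) b +
      (if m + n = 0 then (of_int (m ^ 3 - m) / 12 * c) *\<^sub>C b else 0)) \<and>
    (\<forall>k. \<forall>a\<in>grade V k. Vir V (mode V) 0 a = of_nat k *\<^sub>C a) \<and>
    (\<forall>a n b. mode V (Vir V (mode V) (-1) a) n b = (- of_int n) *\<^sub>C mode V a (n - 1) b)"

definition voa_automorphism :: "'v::complex_vs voa_data \<Rightarrow> ('v \<Rightarrow> 'v) \<Rightarrow> bool"
  where "voa_automorphism V g \<longleftrightarrow>
    clinear g \<and> bij g \<and> g (vac V) = vac V \<and> g (conf V) = conf V \<and>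
    (\<forall>a n b. g (mode V a n b) = mode V (g a) n (g b))"

definition eigensp :: "('v::complex_vs \<Rightarrow> 'v) \<Rightarrow> nat \<Rightarrow> nat \<Rightarrow> 'v set"
  where "eigensp g T r = {a. g a = cis (2 * pi * real r / real T) *\<^sub>C a}"

definition admissible_module ::
  "'v::complex_vs voa_data \<Rightarrow> ('v, 'm::complex_vs) module_data \<Rightarrow> bool"
  where "admissible_module V M \<longleftrightarrow>
    weak_module V (act M) \<and> direct_sum_grading (mgrade M) \<and>
    (\<forall>k m n. \<forall>a\<in>grade V k. \<forall>v\<in>mgrade M n.
      in_degree (mgrade M) (int k - m - 1 + int n) (act M a m v))"

definition has_conformal_weight ::
  "'v::complex_vs voa_data \<Rightarrow> ('v, 'm::complex_vs) module_data \<Rightarrow> complex \<Rightarrow> bool"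
  where "has_conformal_weight V M h1 \<longleftrightarrow>
    (\<forall>n. \<forall>v\<in>mgrade M n. Vir V (act M) 0 v = (h1 + of_nat n) *\<^sub>C v)"

definition delta :: "nat \<Rightarrow> nat"
  where "delta r = (if r = 0 then 1 else 0)"

definition zhu_O :: "'v::complex_vs voa_data \<Rightarrow> ('v \<Rightarrow> 'v) \<Rightarrow> nat \<Rightarrow> 'v set"
  where "zhu_O V g T = cspan
    {Sum_any (\<lambda>i::nat. ((of_nat k - 1 + of_nat (delta r) + of_nat r / of_nat T) gchoose i) *\<^sub>C
        mode V a (int i - 1 - int (delta r)) b)
     | a b r k. r < T \<and> a \<in> grade V k \<inter> eigensp g T r}"

definition zhu_class :: "'v::complex_vs voa_data \<Rightarrow> ('v \<Rightarrow> 'v) \<Rightarrow> nat \<Rightarrow> 'v \<Rightarrow> 'v set"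
  where "zhu_class V g T a = {b. b - a \<in> zhu_O V g T}"

text \<open>A representative of $[a] *_g [b]$ for \<open>a\<close> of weight \<open>k\<close> in the \<open>r\<close>-th eigenspace;
  such \<open>a\<close> span \<open>V\<close>.\<close>

definition zhu_prod ::
  "'v::complex_vs voa_data \<Rightarrow> nat \<Rightarrow> nat \<Rightarrow> 'v \<Rightarrow> 'v \<Rightarrow> 'v"
  where "zhu_prod V k r a b =
    (if r = 0 then Sum_any (\<lambda>i::nat. (of_nat k gchoose i) *\<^sub>C mode V a (int i - 1) b) else 0)"

text \<open>Modules for the algebra of classes; only the values of the action on classes matter.
  The structure of the algebra is $[a]+[b]=[a+b]$, $c[a]=[ca]$, unit the class of the vacuum, and
  the product determined by \<^const>\<open>zhu_prod\<close>.\<close>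

definition zhu_left_module ::
  "'v::complex_vs voa_data \<Rightarrow> ('v \<Rightarrow> 'v) \<Rightarrow> nat \<Rightarrow> ('v set \<Rightarrow> 'u::complex_vs \<Rightarrow> 'u) \<Rightarrow> bool"
  where "zhu_left_module V g T A \<longleftrightarrow>
    (\<forall>a. clinear (A (zhu_class V g T a))) \<and>
    (\<forall>u. clinear (\<lambda>a. A (zhu_class V g T a) u)) \<and>
    (\<forall>u. A (zhu_class V g T (vac V)) u = u) \<and>
    (\<forall>k r a b u. r < T \<and> a \<in> grade V k \<inter> eigensp g T r \<longrightarrow>
      A (zhu_class V g T (zhu_prod V k r a b)) u =
      A (zhu_class V g T a) (A (zhu_class V g T b) u))"

definition zhu_right_module ::
  "'v::complex_vs voa_data \<Rightarrow> ('v \<Rightarrow> 'v) \<Rightarrow> nat \<Rightarrow> ('u::complex_vs \<Rightarrow> 'v set \<Rightarrow> 'u) \<Rightarrow> bool"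
  where "zhu_right_module V g T A \<longleftrightarrow>
    (\<forall>a. clinear (\<lambda>u. A u (zhu_class V g T a))) \<and>
    (\<forall>u. clinear (\<lambda>a. A u (zhu_class V g T a))) \<and>
    (\<forall>u. A u (zhu_class V g T (vac V)) = u) \<and>
    (\<forall>k r a b u. r < T \<and> a \<in> grade V k \<inter> eigensp g T r \<longrightarrow>
      A u (zhu_class V g T (zhu_prod V k r a b)) =
      A (A u (zhu_class V g T a)) (zhu_class V g T b))"

text \<open>A point of the punctured curve is given by its coordinate $s=z^{1/T}\neq 0$, so that
  $z=s^T$, $z^{r/T+m}=s^{r+Tm}$ and $dz=T s^{T-1}ds$. Functions are functions of \<open>s\<close>, and only
  their values away from \<open>0\<close> and the poles are meaningful.\<close>

definition config :: "nat \<Rightarrow> complex list \<Rightarrow> complex \<Rightarrow> bool"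
  where "config T ss t \<longleftrightarrow>
    t \<noteq> 0 \<and> (\<forall>s\<in>set ss. s \<noteq> 0) \<and> distinct (map (\<lambda>s. s ^ T) (ss @ [t]))"

definition d_dz :: "nat \<Rightarrow> (complex \<Rightarrow> complex) \<Rightarrow> complex \<Rightarrow> complex"
  where "d_dz T f s = deriv f s / (of_nat T * s ^ (T - 1))"

text \<open>The residue of $f\,dz$ at the point with coordinate \<open>s0\<close>.\<close>

definition res_dz :: "nat \<Rightarrow> (complex \<Rightarrow> complex) \<Rightarrow> complex \<Rightarrow> complex"
  where "res_dz T f s0 = residue (\<lambda>s. f s * (of_nat T * s ^ (T - 1))) s0"

text \<open>The coefficient of $(z-z_0)^n$ in the expansion of \<open>f\<close> at the point with coordinate \<open>s0\<close>.\<close>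

definition coeff_at :: "nat \<Rightarrow> (complex \<Rightarrow> complex) \<Rightarrow> complex \<Rightarrow> int \<Rightarrow> complex"
  where "coeff_at T f s0 n = res_dz T (\<lambda>s. f s * (s ^ T - s0 ^ T) powi (- n - 1)) s0"

text \<open>The coefficients of the integral power $z^n$ at \<open>0\<close> and at infinity.\<close>

definition coeff_zero :: "nat \<Rightarrow> (complex \<Rightarrow> complex) \<Rightarrow> int \<Rightarrow> complex"
  where "coeff_zero T f n = residue (\<lambda>s. f s * s powi (- (int T * n) - 1)) 0"

definition coeff_infinity :: "nat \<Rightarrow> (complex \<Rightarrow> complex) \<Rightarrow> int \<Rightarrow> complex"
  where "coeff_infinity T f n = residue (\<lambda>u. f (inverse u) * u powi (int T * n - 1)) 0"

text \<open>The algebra generated by $z^{\pm 1/T}$ and the $(z-z_0)^{-1}$, for the points in \<open>P\<close>.\<close>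

inductive_set curve_functions :: "nat \<Rightarrow> complex set \<Rightarrow> (complex \<Rightarrow> complex) set"
  for T :: nat and P :: "complex set" where
  cf_const: "(\<lambda>_. c) \<in> curve_functions T P"
| cf_coord: "(\<lambda>s. s) \<in> curve_functions T P"
| cf_inverse: "(\<lambda>s. inverse s) \<in> curve_functions T P"
| cf_pole: "p \<in> P \<Longrightarrow> (\<lambda>s. inverse (s ^ T - p ^ T)) \<in> curve_functions T P"
| cf_add: "f \<in> curve_functions T P \<Longrightarrow> f' \<in> curve_functions T P \<Longrightarrow>
    (\<lambda>s. f s + f' s) \<in> curve_functions T P"
| cf_mult: "f \<in> curve_functions T P \<Longrightarrow> f' \<in> curve_functions T P \<Longrightarrow>
    (\<lambda>s. f s * f' s) \<in> curve_functions T P"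

text \<open>The algebra generated by $z_i^{\pm1/T}$, $w^{\pm1/T}$, $(z_i-z_j)^{-1}$, $(z_i-w)^{-1}$ for
  \<open>k\<close> variables $z_i$, as functions of the coordinates $z_i^{1/T}$ and $w^{1/T}$.\<close>

inductive_set config_functions :: "nat \<Rightarrow> nat \<Rightarrow> (complex list \<Rightarrow> complex \<Rightarrow> complex) set"
  for T :: nat and k :: nat where
  gf_const: "(\<lambda>_ _. c) \<in> config_functions T k"
| gf_coord: "i < k \<Longrightarrow> (\<lambda>ss t. ss ! i) \<in> config_functions T k"
| gf_coord_inverse: "i < k \<Longrightarrow> (\<lambda>ss t. inverse (ss ! i)) \<in> config_functions T k"
| gf_last: "(\<lambda>ss t. t) \<in> config_functions T k"
| gf_last_inverse: "(\<lambda>ss t. inverse t) \<in> config_functions T k"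
| gf_diff: "i < k \<Longrightarrow> j < k \<Longrightarrow> i \<noteq> j \<Longrightarrow>
    (\<lambda>ss t. inverse ((ss ! i) ^ T - (ss ! j) ^ T)) \<in> config_functions T k"
| gf_diff_last: "i < k \<Longrightarrow> (\<lambda>ss t. inverse ((ss ! i) ^ T - t ^ T)) \<in> config_functions T k"
| gf_add: "f \<in> config_functions T k \<Longrightarrow> f' \<in> config_functions T k \<Longrightarrow>
    (\<lambda>ss t. f ss t + f' ss t) \<in> config_functions T k"
| gf_mult: "f \<in> config_functions T k \<Longrightarrow> f' \<in> config_functions T k \<Longrightarrow>
    (\<lambda>ss t. f ss t * f' ss t) \<in> config_functions T k"

text \<open>Linear functionals on tensor products are given as multilinear functionals.\<close>

definition trilinear ::
  "('u3::complex_vs \<Rightarrow> 'm::complex_vs \<Rightarrow> 'u2::complex_vs \<Rightarrow> complex) \<Rightarrow> bool"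
  where "trilinear \<phi> \<longleftrightarrow>
    (\<forall>v u2. clinear (\<lambda>u3. \<phi> u3 v u2)) \<and>
    (\<forall>u3 u2. clinear (\<lambda>v. \<phi> u3 v u2)) \<and>
    (\<forall>u3 v. clinear (\<lambda>u2. \<phi> u3 v u2))"

text \<open>The blocks for the datum at the point with coordinate \<open>t\<close>. The tests are against the
  spanning elements $a\otimes z^{r/T+m}(z-w)^{-n}dz$ of the constrained Lie algebra; the three
  summands are the actions on $U^3$, $M^1$ and $U^2$.\<close>

definition blocks ::
  "'v::complex_vs voa_data \<Rightarrow> ('v \<Rightarrow> 'v) \<Rightarrow> nat \<Rightarrow> ('v, 'm::complex_vs) module_data \<Rightarrow>
   ('u3::complex_vs \<Rightarrow> 'v set \<Rightarrow> 'u3) \<Rightarrow> ('v set \<Rightarrow> 'u2::complex_vs \<Rightarrow> 'u2) \<Rightarrow> complex \<Rightarrow>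
   ('u3 \<Rightarrow> 'm \<Rightarrow> 'u2 \<Rightarrow> complex) set"
  where "blocks V g T M R3 L2 t = {\<phi>. trilinear \<phi> \<and>
    (\<forall>r k m n. \<forall>a\<in>grade V k \<inter> eigensp g T r. \<forall>u3 v u2.
      r < T \<and>
      real r / real T + real_of_int m - real n \<le> real k - 1 \<and>
      real k - 1 \<le> real r / real T + real_of_int m \<longrightarrow>
      \<phi> (if real r / real T + real_of_int m - real n = real k - 1
         then - R3 u3 (zhu_class V g T a) else 0) v u2
      + \<phi> u3 (Sum_any (\<lambda>j::nat.
          (((of_nat r / of_nat T + of_int m) gchoose j) * t powi (int r + int T * (m - int j))) *\<^sub>C
          act M a (int j - int n) v)) u2
      + \<phi> u3 v (if real r / real T + real_of_int m = real k - 1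
         then ((- (t ^ T)) powi (- int n)) *\<^sub>C L2 (zhu_class V g T a) u2 else 0)
      = 0)}"

definition block_multilinear ::
  "nat \<Rightarrow> ('u3::complex_vs \<Rightarrow> 'v::complex_vs list \<Rightarrow> 'm::complex_vs \<Rightarrow> 'u2::complex_vs \<Rightarrow> complex) \<Rightarrow> bool"
  where "block_multilinear k \<psi> \<longleftrightarrow>
    (\<forall>as. trilinear (\<lambda>u3. \<psi> u3 as)) \<and>
    (\<forall>u3 as bs v u2. length as + length bs + 1 = k \<longrightarrow> clinear (\<lambda>a. \<psi> u3 (as @ a # bs) v u2)) \<and>
    (\<forall>u3 as v u2. length as \<noteq> k \<longrightarrow> \<psi> u3 as v u2 = 0)"

text \<open>$a\otimes f\,dz$ with \<open>a\<close> in the \<open>r\<close>-th eigenspace is invariant iff \<open>f\<close> lies in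
  $z^{r/T}$ times functions of \<open>z\<close>; decomposing \<open>V\<close> into eigenspaces and \<open>f\<close> according to
  exponents modulo \<open>T\<close> (which preserves the two order conditions) shows that such elements span
  the invariants.\<close>

definition constrained_functions ::
  "nat \<Rightarrow> complex set \<Rightarrow> nat \<Rightarrow> nat \<Rightarrow> (complex \<Rightarrow> complex) set"
  where "constrained_functions T P r k = {f \<in> curve_functions T P.
    (\<forall>s. s \<noteq> 0 \<and> (\<forall>p\<in>P. s ^ T \<noteq> p ^ T) \<longrightarrow>
      f (cis (2 * pi / real T) * s) = cis (2 * pi * real r / real T) * f s) \<and>
    f \<in> O[at 0](\<lambda>s. s powi (int T * (int k - 1))) \<and>
    f \<in> O[at_infinity](\<lambda>s. s powi (int T * (int k - 1)))}"

definition ext_blocks ::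
  "'v::complex_vs voa_data \<Rightarrow> ('v \<Rightarrow> 'v) \<Rightarrow> nat \<Rightarrow> ('v, 'm::complex_vs) module_data \<Rightarrow>
   ('u3::complex_vs \<Rightarrow> 'v set \<Rightarrow> 'u3) \<Rightarrow> ('v set \<Rightarrow> 'u2::complex_vs \<Rightarrow> 'u2) \<Rightarrow>
   complex list \<Rightarrow> complex \<Rightarrow> ('u3 \<Rightarrow> 'v list \<Rightarrow> 'm \<Rightarrow> 'u2 \<Rightarrow> complex) set"
  where "ext_blocks V g T M R3 L2 ss t = {\<psi>. block_multilinear (length ss) \<psi> \<and>
    (\<forall>r k. \<forall>a\<in>grade V k \<inter> eigensp g T r. \<forall>f\<in>constrained_functions T (insert t (set ss)) r k.
     \<forall>u3 as v u2. r < T \<and> length as = length ss \<longrightarrow>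
      \<psi> (- (coeff_infinity T f (int k - 1) *\<^sub>C R3 u3 (zhu_class V g T a))) as v u2
      + (\<Sum>i<length ss. \<psi> u3
          (as[i := Sum_any (\<lambda>n. coeff_at T f (ss ! i) n *\<^sub>C mode V a n (as ! i))]) v u2)
      + \<psi> u3 as (Sum_any (\<lambda>n. coeff_at T f t n *\<^sub>C act M a n v)) u2
      + \<psi> u3 as v (coeff_zero T f (int k - 1) *\<^sub>C L2 (zhu_class V g T a) u2)
      = 0)}"

text \<open>The functional $\varphi_q$. As $L_0=h_1+d$ on the degree \<open>d\<close> subspace, $w^{-L_0+h_1}$ is
  $w^{-d}$ there.\<close>

definition transport ::
  "nat \<Rightarrow> ('v, 'm::complex_vs) module_data \<Rightarrow> ('u3 \<Rightarrow> 'm \<Rightarrow> 'u2 \<Rightarrow> complex) \<Rightarrow> complex \<Rightarrow>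
   'u3 \<Rightarrow> 'm \<Rightarrow> 'u2 \<Rightarrow> complex"
  where "transport T M \<phi> t u3 v u2 =
    \<phi> u3 (Sum_any (\<lambda>d. ((t ^ T) powi (- int d)) *\<^sub>C component (mgrade M) v d)) u2"

text \<open>A system of correlation functions takes \<open>u3\<close>, the list of pairs $(a^i,p_i)$, the pair
  $(v,q)$ and \<open>u2\<close>, points being given by coordinates; off the configuration space the value is
  \<open>0\<close> by convention.\<close>

type_synonym ('v, 'm, 'u3, 'u2) correlation =
  "'u3 \<Rightarrow> ('v \<times> complex) list \<Rightarrow> 'm \<times> complex \<Rightarrow> 'u2 \<Rightarrow> complex"

definition S_map ::
  "'v::complex_vs voa_data \<Rightarrow> ('v \<Rightarrow> 'v) \<Rightarrow> nat \<Rightarrow> ('v, 'm::complex_vs) module_data \<Rightarrow>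
   ('u3::complex_vs \<Rightarrow> 'v set \<Rightarrow> 'u3) \<Rightarrow> ('v set \<Rightarrow> 'u2::complex_vs \<Rightarrow> 'u2) \<Rightarrow>
   ('u3 \<Rightarrow> 'm \<Rightarrow> 'u2 \<Rightarrow> complex) \<Rightarrow> ('v, 'm, 'u3, 'u2) correlation"
  where "S_map V g T M R3 L2 \<phi> u3 xs vq u2 =
    (let ss = map snd xs; v = fst vq; t = snd vq in
     if config T ss t then
       (THE \<psi>. \<psi> \<in> ext_blocks V g T M R3 L2 ss t \<and>
          (\<forall>u3 v u2. \<psi> u3 (replicate (length ss) (vac V)) v u2 = transport T M \<phi> t u3 v u2))
         u3 (map fst xs) v u2
     else 0)"

text \<open>$F_{n,i}(p,p')$ where \<open>K\<close> is the integer $Tn$ and \<open>s\<close>, \<open>s'\<close> are the coordinates of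
  \<open>p\<close>, \<open>p'\<close>.\<close>

definition F_fun :: "nat \<Rightarrow> int \<Rightarrow> nat \<Rightarrow> complex \<Rightarrow> complex \<Rightarrow> complex"
  where "F_fun T K i s s' = s powi (- K) / fact i *
    ((d_dz T ^^ i) (\<lambda>x. x powi K / (s ^ T - x ^ T))) s'"

text \<open>The part of the recursive formulas given by the insertions, for \<open>a\<close> at \<open>s\<close>.\<close>

definition recursion_sum ::
  "'v::complex_vs voa_data \<Rightarrow> nat \<Rightarrow> ('v, 'm::complex_vs) module_data \<Rightarrow>
   ('v, 'm, 'u3, 'u2) correlation \<Rightarrow> int \<Rightarrow>
   'v \<Rightarrow> complex \<Rightarrow> 'u3 \<Rightarrow> ('v \<times> complex) list \<Rightarrow> 'm \<Rightarrow> complex \<Rightarrow> 'u2 \<Rightarrow> complex"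
  where "recursion_sum V T M S K a s u3 xs v t u2 =
    (\<Sum>l<length xs. Sum_any (\<lambda>i::nat. F_fun T K i s (snd (xs ! l)) *
        S u3 (xs[l := (mode V a (int i) (fst (xs ! l)), snd (xs ! l))]) (v, t) u2))
    + Sum_any (\<lambda>i::nat. F_fun T K i s t * S u3 xs (act M a (int i) v, t) u2)"

definition cor_multilinear ::
  "nat \<Rightarrow> ('v::complex_vs, 'm::complex_vs, 'u3::complex_vs, 'u2::complex_vs) correlation \<Rightarrow> bool"
  where "cor_multilinear T S \<longleftrightarrow>
    (\<forall>xs t. trilinear (\<lambda>u3 v u2. S u3 xs (v, t) u2)) \<and>
    (\<forall>u3 xs ys s vq u2. clinear (\<lambda>a. S u3 (xs @ (a, s) # ys) vq u2)) \<and>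
    (\<forall>u3 xs v t u2. \<not> config T (map snd xs) t \<longrightarrow> S u3 xs (v, t) u2 = 0)"

definition cor_rational :: "nat \<Rightarrow> ('v, 'm, 'u3, 'u2) correlation \<Rightarrow> bool"
  where "cor_rational T S \<longleftrightarrow>
    (\<forall>u3 as v u2. \<exists>f\<in>config_functions T (length as). \<forall>ss t.
      length ss = length as \<and> config T ss t \<longrightarrow> S u3 (zip as ss) (v, t) u2 = f ss t)"

definition cor_monomial ::
  "nat \<Rightarrow> ('v, 'm::complex_vs) module_data \<Rightarrow> ('v, 'm, 'u3, 'u2) correlation \<Rightarrow> bool"
  where "cor_monomial T M S \<longleftrightarrow>
    (\<forall>d. \<forall>v\<in>mgrade M d. \<forall>u3 u2. \<exists>c. \<forall>t. t \<noteq> 0 \<longrightarrow>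
      S u3 [] (v, t) u2 = c * (t ^ T) powi (- int d))"

definition cor_local :: "('v, 'm, 'u3, 'u2) correlation \<Rightarrow> bool"
  where "cor_local S \<longleftrightarrow>
    (\<forall>u3 xs ys vq u2. mset xs = mset ys \<longrightarrow> S u3 xs vq u2 = S u3 ys vq u2)"

definition cor_homogeneous ::
  "('v::complex_vs \<Rightarrow> 'v) \<Rightarrow> nat \<Rightarrow> ('v, 'm, 'u3, 'u2) correlation \<Rightarrow> bool"
  where "cor_homogeneous g T S \<longleftrightarrow>
    (\<forall>r a u3 xs ys v t u2. r < T \<and> a \<in> eigensp g T r \<longrightarrow>
      (\<exists>P Q :: complex poly. \<forall>s. config T (map snd (xs @ (a, s) # ys)) t \<longrightarrow>
        poly Q (s ^ T) \<noteq> 0 \<and>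
        s ^ r * S u3 (xs @ (a, s) # ys) (v, t) u2 = poly P (s ^ T) / poly Q (s ^ T)))"

definition cor_vacuum ::
  "'v::complex_vs voa_data \<Rightarrow> nat \<Rightarrow> ('v, 'm, 'u3, 'u2) correlation \<Rightarrow> bool"
  where "cor_vacuum V T S \<longleftrightarrow>
    (\<forall>u3 xs ys s v t u2. config T (map snd (xs @ (vac V, s) # ys)) t \<longrightarrow>
      S u3 (xs @ (vac V, s) # ys) (v, t) u2 = S u3 (xs @ ys) (v, t) u2)"

text \<open>On \<open>v\<close>, $w^h\partial_w(w^{-h}S)$ is written as $\partial_wS-hw^{-1}S$, which does not involve
  a branch of $w^h$.\<close>

definition cor_L_minus_1 ::
  "'v::complex_vs voa_data \<Rightarrow> nat \<Rightarrow> ('v, 'm::complex_vs) module_data \<Rightarrow> complex \<Rightarrow>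
   ('v, 'm, 'u3, 'u2) correlation \<Rightarrow> bool"
  where "cor_L_minus_1 V T M h S \<longleftrightarrow>
    (\<forall>u3 xs ys a s v t u2. config T (map snd (xs @ (a, s) # ys)) t \<longrightarrow>
      S u3 (xs @ (Vir V (mode V) (-1) a, s) # ys) (v, t) u2 =
      d_dz T (\<lambda>x. S u3 (xs @ (a, x) # ys) (v, t) u2) s) \<and>
    (\<forall>u3 xs v t u2. config T (map snd xs) t \<longrightarrow>
      S u3 xs (Vir V (act M) (-1) v, t) u2 =
      d_dz T (\<lambda>x. S u3 xs (v, x) u2) t - h / t ^ T * S u3 xs (v, t) u2)"

definition cor_associative ::
  "'v::complex_vs voa_data \<Rightarrow> nat \<Rightarrow> ('v, 'm::complex_vs) module_data \<Rightarrow>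
   ('v, 'm, 'u3, 'u2) correlation \<Rightarrow> bool"
  where "cor_associative V T M S \<longleftrightarrow>
    (\<forall>u3 a xs v t u2 n. config T (map snd xs) t \<longrightarrow>
      res_dz T (\<lambda>s. S u3 ((a, s) # xs) (v, t) u2 * (s ^ T - t ^ T) powi n) t =
      S u3 xs (act M a n v, t) u2) \<and>
    (\<forall>u3 a b s2 xs v t u2 n. config T (s2 # map snd xs) t \<longrightarrow>
      res_dz T (\<lambda>s. S u3 ((a, s) # (b, s2) # xs) (v, t) u2 * (s ^ T - s2 ^ T) powi n) s2 =
      S u3 ((mode V a n b, s2) # xs) (v, t) u2)"

definition cor_recursive ::
  "'v::complex_vs voa_data \<Rightarrow> ('v \<Rightarrow> 'v) \<Rightarrow> nat \<Rightarrow> ('v, 'm::complex_vs) module_data \<Rightarrow>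
   ('u3 \<Rightarrow> 'v set \<Rightarrow> 'u3) \<Rightarrow> ('v set \<Rightarrow> 'u2 \<Rightarrow> 'u2) \<Rightarrow> ('v, 'm, 'u3, 'u2) correlation \<Rightarrow> bool"
  where "cor_recursive V g T M R3 L2 S \<longleftrightarrow>
    (\<forall>r k u3 s xs v t u2. \<forall>a\<in>grade V k \<inter> eigensp g T r. r < T \<and> config T (s # map snd xs) t \<longrightarrow>
      S u3 ((a, s) # xs) (v, t) u2 =
        (s ^ T) powi (- int k) * S (R3 u3 (zhu_class V g T a)) xs (v, t) u2
        + recursion_sum V T M S (int T * (int k - 1 + int (delta r)) + int r) a s u3 xs v t u2 \<and>
      S u3 ((a, s) # xs) (v, t) u2 =
        (s ^ T) powi (- int k) * S u3 xs (v, t) (L2 (zhu_class V g T a) u2)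
        + recursion_sum V T M S (int T * (int k - 1) + int r) a s u3 xs v t u2)"

definition Cor ::
  "'v::complex_vs voa_data \<Rightarrow> ('v \<Rightarrow> 'v) \<Rightarrow> nat \<Rightarrow> ('v, 'm::complex_vs) module_data \<Rightarrow>
   ('u3::complex_vs \<Rightarrow> 'v set \<Rightarrow> 'u3) \<Rightarrow> ('v set \<Rightarrow> 'u2::complex_vs \<Rightarrow> 'u2) \<Rightarrow> complex \<Rightarrow>
   ('v, 'm, 'u3, 'u2) correlation set"
  where "Cor V g T M R3 L2 h = {S. cor_multilinear T S \<and> cor_rational T S \<and>
    cor_monomial T M S \<and> cor_local S \<and> cor_homogeneous g T S \<and> cor_vacuum V T S \<and>
    cor_L_minus_1 V T M h S \<and> cor_associative V T M S \<and> cor_recursive V g T M R3 L2 S}"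

end

(* A system of correlation functions is determined by its values without insertions, through the
   left recursive formula. Conversely, starting from a block, one defines the functions by that
   formula and has to show that they do not depend on the order of the insertions. Write J(b, f) for
   the invariance condition under b (x) f dz. For the functions f = z^(K/T) / (z - z_p)^j with poles at
   the insertions, the vanishing of all J(b, f) with n insertions is equivalent, by the residue
   theorem, to associativity of the functions with n + 1 insertions at each point. Invariance then
   passes from n to n + 1 insertions: as a function of the new point, J(b, f) is determined by its
   expansion at the module point, which is computed by the Borcherds identity. Locality, the right
   recursive formula, the derivative property and invariance under all constrained test functions
   (by partial fractions) follow, and S_phi is identified with this system because a restricted
   conformal block is determined by its restriction to vacuum vectors. *)

theory Submission
  imports Defs
begin

unbundle no vec_syntax and Formal_Power_Series.fps_syntax and Formal_Laurent_Series.fps_syntax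

section \<open>Local coordinates on the curve\<close>

text \<open>What shapes the induction is a test function whose pole lies at the newly inserted
  point: there its action is no longer covered by the commutator formula. If a further insertion is
  present, it is exchanged with the new one, so that the pole sits at an old point; the exchange
  needs invariance one level lower as well, and therefore the induction carries two consecutive
  levels. A single insertion has nothing to be exchanged with. For it the Borcherds identity with l
  = -j is used, after the action on U^2 has been traded for an action on the module by the block
  condition with pole orders j + m. Kernels with the single exponent K = T(wt - 1) + r suffice:
  dividing a constrained test function by z^(K/T) makes it single-valued in z, and the two order
  conditions leave only poles at the insertions, plus a constant when r = 0. This constant, i.e. the
  test function z^(wt - 1), is exactly what separates the two recursive formulas. It also yields the
  derivative property at the module point, through the conformal vector tested against z, and this
  is where h = h1 + h2 - h3 comes from.\<close>

definition branch :: "nat \<Rightarrow> complex \<Rightarrow> complex \<Rightarrow> complex" where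
  "branch T p Z = p * (1 + Z / p ^ T) powr (1 / of_nat T)"

lemma branch_0 [simp]: "branch T p 0 = p"
  by (simp add: branch_def)

lemma one_plus_nonzero:
  assumes "p \<noteq> 0" "norm Z < norm (p ^ T)"
  shows "1 + Z / p ^ T \<noteq> (0::complex)" "Re (1 + Z / p ^ T) > 0"
proof -
  have "norm (Z / p ^ T) < 1"
    using assms by (simp add: norm_divide)
  then have "Re (Z / p ^ T) > -1"
    using abs_Re_le_cmod[of "Z / p ^ T"] by linarith
  then show "Re (1 + Z / p ^ T) > 0" by simp
  then show "1 + Z / p ^ T \<noteq> 0" by force
qed

text \<open>For |Z| < |p^T| the number 1 + Z/p^T has positive real part, so the principal power is
  holomorphic there. Thus \<open>branch T p\<close> is the sheet of z^(1/T) through p, as a function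
  of Z = z - z_p.\<close>

lemma branch_power:
  assumes "T > 0" "p \<noteq> 0" "norm Z < norm (p ^ T)"
  shows "branch T p Z ^ T = p ^ T + Z"
proof -
  have "((1 + Z / p ^ T) powr (1 / of_nat T)) ^ T = 1 + Z / p ^ T"
    using one_plus_nonzero[OF assms(2,3)] assms(1)
    by (simp add: powr_def exp_of_nat_mult[symmetric])
  then show ?thesis
    using assms by (simp add: branch_def power_mult_distrib field_simps)
qed

lemma branch_nonzero:
  assumes "p \<noteq> 0" "norm Z < norm (p ^ T)"
  shows "branch T p Z \<noteq> 0"
  using one_plus_nonzero[OF assms] assms by (simp add: branch_def)

lemma branch_holomorphic:
  assumes "p \<noteq> 0"
  shows "branch T p holomorphic_on ball 0 (norm (p ^ T))"
proof -
  have "1 + Z / p ^ T \<notin> \<real>\<^sub>\<le>\<^sub>0" if "Z \<in> ball 0 (norm (p ^ T))" for Z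
    using one_plus_nonzero(2)[OF assms, of Z T] that
    by (force simp: complex_nonpos_Reals_iff)
  then show ?thesis
    unfolding branch_def by (intro holomorphic_intros) (use assms in auto)
qed

lemma eventually_branch:
  fixes p :: complex
  assumes "p \<noteq> 0"
  shows "eventually (\<lambda>Z. norm Z < norm (p ^ T)) (nhds (0::complex))"
proof -
  have "eventually (\<lambda>Z. Z \<in> ball 0 (norm (p ^ T))) (nhds (0::complex))"
    by (rule eventually_nhds_in_open) (use assms power_not_zero[OF assms, of T] in auto)
  then show ?thesis by simp
qed

lemma eventually_branch_at:
  fixes p :: complex
  assumes "p \<noteq> 0"
  shows "eventually (\<lambda>Z. norm Z < norm (p ^ T) \<and> Z \<noteq> 0) (at (0::complex))"
  using eventually_branch[OF assms, of T]
  by (auto simp: eventually_at_filter elim!: eventually_mono)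

lemma eventually_power_avoids:
  fixes C :: "complex set"
  assumes "finite C" "T > 0" "p \<noteq> 0"
  shows "eventually (\<lambda>Z. branch T p Z \<noteq> 0 \<and> branch T p Z ^ T \<notin> C) (at 0)"
proof -
  let ?D = "(\<lambda>c. c - p ^ T) ` C - {0}"
  have "eventually (\<lambda>Z. Z \<in> - ?D - {0}) (at (0::complex))"
    by (rule eventually_at_in_open) (use assms(1) in \<open>blast intro: open_Compl finite_imp_closed\<close>)+
  with eventually_branch_at[OF assms(3), of T] show ?thesis
  proof eventually_elim
    case (elim Z)
    then show ?case
      using branch_power[of T p Z] branch_nonzero[of p Z T] assms
      by (auto simp: image_iff algebra_simps)
  qed
qed

text \<open>Whole fibres over the points of P are removed, because a pole in z at z_p is a pole at
  all T points of the curve above it.\<close>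

definition punctured :: "nat \<Rightarrow> complex set \<Rightarrow> complex set" where
  "punctured T P = {s. s \<noteq> 0 \<and> (\<forall>p\<in>P. s ^ T \<noteq> p ^ T)}"

lemma eventually_branch_punctured:
  assumes "finite P" "T > 0" "p \<noteq> 0"
  shows "eventually (\<lambda>Z. branch T p Z \<in> punctured T P) (at 0)"
  using eventually_power_avoids[of "(\<lambda>q. q ^ T) ` P" T p] assms
  by (auto simp: punctured_def elim!: eventually_mono)

lemma finite_power_eq:
  assumes "T > 0" shows "finite {s::complex. s ^ T = c}"
proof (cases "c = 0")
  case True then show ?thesis using assms by (simp add: power_0_left)
next
  case False
  then show ?thesis using assms card_nth_roots[of c T] by (metis card.infinite less_irrefl)
qed

lemma punctured_compl_finite:
  assumes "finite P" "T > 0" shows "finite (- punctured T P)"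
proof -
  have "- punctured T P \<subseteq> insert 0 (\<Union>p\<in>P. {s. s ^ T = p ^ T})"
    by (auto simp: punctured_def)
  then show ?thesis
    by (rule finite_subset) (use assms finite_power_eq in auto)
qed

lemma open_punctured: assumes "finite P" "T > 0" shows "open (punctured T P)"
  using finite_imp_closed[OF punctured_compl_finite[OF assms]] by (simp add: open_closed)

lemma connected_punctured: assumes "finite P" "T > 0" shows "connected (punctured T P)"
proof -
  have "connected (UNIV - (- punctured T P))"
    by (rule connected_open_diff_countable)
       (use punctured_compl_finite[OF assms] in \<open>auto simp: uncountable_infinite countable_finite\<close>)
  then show ?thesis by simp
qed

text \<open>The Laurent expansion at \<open>p\<close> in powers of $z-z_p$.\<close>

definition expands :: "nat \<Rightarrow> complex \<Rightarrow> (complex \<Rightarrow> complex) \<Rightarrow> complex fls \<Rightarrow> bool" where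
  "expands T p f L \<longleftrightarrow> (\<lambda>Z. f (branch T p Z)) has_laurent_expansion L"

lemma expands_unique: "expands T p f L \<Longrightarrow> expands T p f L' \<Longrightarrow> L = L'"
  unfolding expands_def by (rule has_laurent_expansion_unique)

lemma expands_cong_ev:
  assumes "eventually (\<lambda>Z. f (branch T p Z) = f' (branch T p Z)) (at 0)"
  shows "expands T p f L \<longleftrightarrow> expands T p f' L"
  unfolding expands_def by (rule has_laurent_expansion_cong[OF assms refl])

lemma expands_cong:
  assumes "finite P" "T > 0" "p \<noteq> 0" "\<And>s. s \<in> punctured T P \<Longrightarrow> f s = f' s"
  shows "expands T p f L \<longleftrightarrow> expands T p f' L"
  using eventually_branch_punctured[OF assms(1-3)] assms(4)
  by (intro expands_cong_ev) (auto elim: eventually_mono)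

lemma expands_const: "expands T p (\<lambda>_. c) (fls_const c)"
  and expands_add: "expands T p f L \<Longrightarrow> expands T p f' L' \<Longrightarrow> expands T p (\<lambda>s. f s + f' s) (L + L')"
  and expands_mult: "expands T p f L \<Longrightarrow> expands T p f' L' \<Longrightarrow> expands T p (\<lambda>s. f s * f' s) (L * L')"
  and expands_cmult: "expands T p f L \<Longrightarrow> expands T p (\<lambda>s. c * f s) (fls_const c * L)"
  and expands_inverse: "expands T p f L \<Longrightarrow> expands T p (\<lambda>s. inverse (f s)) (inverse L)"
  and expands_powi: "expands T p f L \<Longrightarrow> expands T p (\<lambda>s. f s powi n) (L powi n)"
  and expands_power: "expands T p f L \<Longrightarrow> expands T p (\<lambda>s. f s ^ k) (L ^ k)"
  unfolding expands_def by (auto intro!: laurent_expansion_intros)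

lemma expands_sum:
  "(\<And>i. i \<in> I \<Longrightarrow> expands T p (f i) (L i)) \<Longrightarrow> expands T p (\<lambda>s. \<Sum>i\<in>I. f i s) (\<Sum>i\<in>I. L i)"
  unfolding expands_def by (rule has_laurent_expansion_sum)

text \<open>The binomial series of (z_p + Z)^(K/T), on the sheet where z_p^(1/T) is p; the factor
  p^(K - Ti) is z_p^(K/T - i).\<close>

definition power_fps :: "nat \<Rightarrow> int \<Rightarrow> complex \<Rightarrow> complex fps" where
  "power_fps T K p = Abs_fps (\<lambda>i. ((of_int K / of_nat T) gchoose i) * p powi (K - int T * int i))"

lemma expands_coord:
  assumes "T > 0" "p \<noteq> 0"
  shows "expands T p (\<lambda>s. s powi K) (fps_to_fls (power_fps T K p))"
proof -
  let ?b = "of_int K / of_nat T :: complex"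
  have lin: "(\<lambda>Z. Z / p ^ T) has_fps_expansion (fps_const (inverse (p ^ T)) * fps_X)"
    unfolding divide_inverse_commute
    by (intro has_fps_expansion_cmult_left has_fps_expansion_fps_X)
  have "(\<lambda>Z. p powi K * ((\<lambda>x. (1 + x) powr ?b) \<circ> (\<lambda>Z. Z / p ^ T)) Z) has_fps_expansion
      (fps_const (p powi K) * fps_compose (fps_binomial ?b) (fps_const (inverse (p ^ T)) * fps_X))"
    using lin by (intro fps_expansion_intros has_fps_expansion_compose) auto
  moreover have "fps_const (p powi K) * fps_compose (fps_binomial ?b) (fps_const (inverse (p ^ T)) * fps_X)
      = power_fps T K p"
    using assms by (simp add: fps_eq_iff power_fps_def fps_compose_linear power_int_diff
        power_int_mult divide_inverse power_inverse)
  ultimately have *: "(\<lambda>Z. p powi K * (1 + Z / p ^ T) powr ?b) has_laurent_expansion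
      fps_to_fls (power_fps T K p)"
    by (intro has_laurent_expansion_fps) (simp add: o_def)
  have "eventually (\<lambda>Z. p powi K * (1 + Z / p ^ T) powr ?b = branch T p Z powi K) (at 0)"
    using eventually_branch_at[OF assms(2), of T]
  proof eventually_elim
    case (elim Z)
    then have nz: "1 + Z / p ^ T \<noteq> 0" using one_plus_nonzero assms by blast
    have "((1 + Z / p ^ T) powr (1 / of_nat T)) powi K = (1 + Z / p ^ T) powr ?b"
      using nz by (simp add: powr_def exp_power_int)
    then show ?case by (simp add: branch_def power_int_mult_distrib)
  qed
  with * show ?thesis
    unfolding expands_def by (subst (asm) has_laurent_expansion_cong[OF _ refl])
qed

lemma power_fps_0_nth: "power_fps T K p $ 0 = p powi K"
  by (simp add: power_fps_def)

lemma expands_difference: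
  assumes "T > 0" "p \<noteq> 0"
  shows "expands T p (\<lambda>s. s ^ T - c) (fls_const (p ^ T - c) + fls_X)"
proof -
  have "(\<lambda>Z. (p ^ T - c) + Z) has_laurent_expansion (fls_const (p ^ T - c) + fls_X)"
    by (intro laurent_expansion_intros)
  moreover have "eventually (\<lambda>Z. (p ^ T - c) + Z = branch T p Z ^ T - c) (at 0)"
    using eventually_branch_at[OF assms(2), of T]
    by eventually_elim (simp add: branch_power assms)
  ultimately show ?thesis
    unfolding expands_def by (subst (asm) has_laurent_expansion_cong[OF _ refl])
qed

lemma expands_pole_at:
  assumes "T > 0" "p \<noteq> 0" "q ^ T = p ^ T"
  shows "expands T p (\<lambda>s. inverse (s ^ T - q ^ T) ^ j) (fls_X_intpow (- int j))"
proof -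
  have "expands T p (\<lambda>s. inverse (s ^ T - q ^ T) ^ j) (inverse fls_X ^ j)"
    using expands_difference[OF assms(1,2), of "q ^ T"] assms(3)
    by (intro expands_power expands_inverse) simp
  then show ?thesis
    by (simp add: fls_inverse_X fls_X_inv_power_conv_shift_1 )
qed

text \<open>The expansion of (c + Z)^(-j) in powers of Z.\<close>

definition geom_fps :: "complex \<Rightarrow> nat \<Rightarrow> complex fps" where
  "geom_fps c j = Abs_fps (\<lambda>i. ((- of_nat j) gchoose i) * inverse c ^ (j + i))"

lemma expands_pole_away:
  assumes "T > 0" "p \<noteq> 0" "q ^ T \<noteq> p ^ T"
  shows "expands T p (\<lambda>s. inverse (s ^ T - q ^ T) ^ j) (fps_to_fls (geom_fps (p ^ T - q ^ T) j))"
proof -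
  let ?c = "p ^ T - q ^ T"
  have c: "?c \<noteq> 0" using assms by simp
  have "(\<lambda>Z. inverse ?c ^ j * ((\<lambda>x. (1 + x) powr (- of_nat j)) \<circ> (\<lambda>Z. inverse ?c * Z)) Z) has_fps_expansion
      (fps_const (inverse ?c ^ j) * fps_compose (fps_binomial (- of_nat j)) (fps_const (inverse ?c) * fps_X))"
    by (intro fps_expansion_intros has_fps_expansion_compose) auto
  moreover have "fps_const (inverse ?c ^ j) * fps_compose (fps_binomial (- of_nat j)) (fps_const (inverse ?c) * fps_X)
      = geom_fps ?c j"
    by (simp add: fps_eq_iff geom_fps_def fps_compose_linear power_add)
  ultimately have *: "(\<lambda>Z. inverse ?c ^ j * (1 + inverse ?c * Z) powr (- of_nat j)) has_laurent_expansion
      fps_to_fls (geom_fps ?c j)"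
    by (intro has_laurent_expansion_fps) (simp add: o_def)
  have "eventually (\<lambda>Z. branch T p Z ^ T \<notin> {q ^ T}) (at 0)"
    using eventually_power_avoids[of "{q ^ T}" T p] assms by (auto elim: eventually_mono)
  with eventually_branch_at[OF assms(2), of T]
  have "eventually (\<lambda>Z. inverse ?c ^ j * (1 + inverse ?c * Z) powr (- of_nat j)
      = inverse (branch T p Z ^ T - q ^ T) ^ j) (at 0)"
  proof eventually_elim
    case (elim Z)
    have e: "branch T p Z ^ T - q ^ T = ?c * (1 + inverse ?c * Z)"
      using elim c by (simp add: branch_power assms field_simps)
    with elim c have nz: "1 + inverse ?c * Z \<noteq> 0" by auto
    then have "(1 + inverse ?c * Z) powr (- of_nat j) = inverse (1 + inverse ?c * Z) ^ j"
      by (simp add: powr_minus powr_nat power_inverse)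
    then show ?case
      unfolding e by (simp add: power_mult_distrib)
  qed
  with * show ?thesis
    unfolding expands_def by (subst (asm) has_laurent_expansion_cong[OF _ refl])
qed

text \<open>Invariance of the residue under a change of coordinate. The polar part of L is peeled
  off one power at a time: for n > 0 the term G^(-n-1) G' is a derivative up to a scalar, so it has
  no residue, and for n = 0 it is the logarithmic derivative, whose residue is the order of the zero
  of G.\<close>

lemma fls_residue_compose_deriv:
  fixes G :: "complex fps"
  assumes "subdegree G = 1"
  shows "fls_residue (fls_compose_fps L G * fls_deriv (fps_to_fls G)) = fls_residue L"
proof -
  have G: "G $ 0 = 0" "G \<noteq> 0"
    using nth_less_subdegree_zero[of 0 G] assms by auto
  have "fls_residue (fls_compose_fps L G * fls_deriv (fps_to_fls G)) = fls_residue L"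
    if "fls_subdegree L \<ge> - int n" for n
    using that
  proof (induction n arbitrary: L)
    case 0
    then have "fps_to_fls (fls_regpart L) = L" by simp
    then obtain R where "L = fps_to_fls R" by (rule that[OF sym])
    then show ?case
      using G by (simp flip: fls_times_fps_to_fls add: fls_deriv_fps_to_fls)
  next
    case (Suc n)
    define c where "c = L $$ (- int (Suc n))"
    define X where "X = (fls_X_inv :: complex fls) ^ Suc n"
    have Xn: "X $$ i = (if i = - int (Suc n) then 1 else 0)" for i
      unfolding X_def fls_X_inv_power_conv_shift_1 by simp
    let ?L' = "L - fls_const c * X"
    have sub: "fls_subdegree ?L' \<ge> - int n"
    proof (cases "?L' = 0")
      case False
      then show ?thesis
      proof (rule fls_subdegree_geI)
        fix i assume "i < - int n"
        then have "i = - int (Suc n) \<or> i < - int (Suc n)" by auto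
        then show "?L' $$ i = 0"
          using Suc.prems by (auto simp: Xn c_def)
      qed
    qed simp
    have L: "L = ?L' + fls_const c * X" by simp
    let ?G = "fps_to_fls G"
    have XG: "fls_compose_fps X G = inverse ?G ^ Suc n"
      unfolding X_def fls_compose_fps_power[OF G(2,1)]
      unfolding fls_inverse_X[symmetric] fls_compose_fps_inverse[OF G(2,1)] by simp
    have "fls_residue (inverse ?G ^ Suc n * fls_deriv ?G) = (if n = 0 then 1 else 0)"
    proof (cases "n = 0")
      case True
      then show ?thesis
        using fls_residue_deriv_times_inverse_eq_subdegree(2)[of ?G] assms
        by (simp add: fls_subdegree_fls_to_fps)
    next
      case False
      have "fls_deriv (inverse ?G ^ n) = of_nat n * (inverse ?G ^ (n - 1)) * fls_deriv (inverse ?G)"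
        by (simp add: fls_deriv_power)
      also have "fls_deriv (inverse ?G) = - fls_deriv ?G * inverse ?G ^ 2"
        using fls_inverse_deriv[of ?G] by simp
      also have "of_nat n * (inverse ?G ^ (n - 1)) * (- fls_deriv ?G * inverse ?G ^ 2) =
          - (of_nat n * (inverse ?G ^ Suc n * fls_deriv ?G))"
        using False by (cases n) (simp_all add: power2_eq_square)
      finally have "fls_residue (of_nat n * (inverse ?G ^ Suc n * fls_deriv ?G)) = 0"
        using fls_residue_deriv[of "inverse ?G ^ n"]
        by (metis add.inverse_inverse fls_uminus_nth neg_equal_0_iff_equal fls_residue_def)
      then show ?thesis
        using False by (simp add: fls_of_nat)
    qed
    moreover have "fls_compose_fps L G = fls_compose_fps ?L' G + fls_const c * inverse ?G ^ Suc n"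
      unfolding XG[symmetric] using G
      by (simp add: fls_compose_fps_diff fls_compose_fps_mult)
    ultimately have "fls_residue (fls_compose_fps L G * fls_deriv ?G)
        = fls_residue ?L' + c * (if n = 0 then 1 else 0)"
      using Suc.IH[OF sub] by (simp add: distrib_right mult.assoc del: power_Suc)
    then show ?case by (simp add: Xn)
  qed
  from this[of "nat (- fls_subdegree L)"] show ?thesis by simp
qed

text \<open>The principal root of u^T is u itself, and not another root, as long as the argument of
  u = 1 + x/p is smaller than pi/T in absolute value.\<close>

lemma eventually_branch_inverse:
  assumes "T > 0" "p \<noteq> 0"
  shows "eventually (\<lambda>x. branch T p ((p + x) ^ T - p ^ T) = p + x) (nhds 0)"
proof -
  let ?u = "\<lambda>x. 1 + x / p"
  have "((\<lambda>x. Im (Ln (?u x))) \<longlongrightarrow> Im (Ln (?u 0))) (nhds 0)"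
    using filterlim_ident[of "nhds (0::complex)"]
    by (intro tendsto_intros) (use assms in auto)
  then have "eventually (\<lambda>x. dist (Im (Ln (?u x))) 0 < pi / of_nat T) (nhds 0)"
    using assms by (intro tendstoD) auto
  moreover have "eventually (\<lambda>x. x \<in> - {- p}) (nhds 0)"
    by (rule eventually_nhds_in_open) (use assms in auto)
  ultimately show ?thesis
  proof eventually_elim
    case (elim x)
    have nz: "?u x \<noteq> 0" using elim assms by (auto simp: field_simps add_eq_0_iff)
    have "\<bar>of_nat T * Im (Ln (?u x))\<bar> < pi"
      using elim assms by (simp add: abs_mult field_simps)
    then have "Ln (exp (of_nat T * Ln (?u x))) = of_nat T * Ln (?u x)"
      by (intro Ln_exp) (auto simp: abs_if split: if_splits)
    then have "Ln (?u x ^ T) = of_nat T * Ln (?u x)"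
      using nz by (simp add: exp_of_nat_mult)
    then have "(?u x ^ T) powr (1 / of_nat T) = ?u x"
      using nz assms by (simp add: powr_def)
    moreover have "1 + ((p + x) ^ T - p ^ T) / p ^ T = ?u x ^ T"
      using assms by (simp add: diff_divide_distrib flip: power_divide) (simp add: add_divide_distrib)
    ultimately show ?case
      using assms by (simp add: branch_def field_simps)
  qed
qed

text \<open>The residue is defined through the coordinate s of the curve and the series through Z =
  z - z_p. The change of coordinate x -> (p + x)^T - p^T has a simple zero at 0, so the formal
  substitution rule for residues applies.\<close>

lemma res_dz_expands:
  assumes "T > 0" "p \<noteq> 0" "expands T p f L"
  shows "res_dz T f p = fls_residue L"
proof -
  define g where "g x = (p + x) ^ T - p ^ T" for x
  have "g analytic_on {0}" unfolding g_def by (intro analytic_intros)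
  then obtain G where G: "g has_fps_expansion G"
    using analytic_at_imp_has_fps_expansion_0 by blast
  have G0: "G $ 0 = 0"
    using has_fps_expansion_imp_0_eq_fps_nth_0[OF G] by (simp add: g_def)
  have dg: "(g has_field_derivative of_nat T * (p + x) ^ (T - 1)) (at x)" for x
    unfolding g_def by (auto intro!: derivative_eq_intros)
  have "fps_nth G 1 = of_nat T * p ^ (T - 1)"
    using fps_nth_fps_expansion[OF G, of 1] DERIV_imp_deriv[OF dg[of 0]] by simp
  then have G1: "G $ 1 \<noteq> 0" using assms by simp
  then have sub: "subdegree G = 1" and Gnz: "G \<noteq> 0"
    using G0 by (auto intro!: subdegreeI)
  have Gl: "g has_laurent_expansion fps_to_fls G" by (rule has_laurent_expansion_fps[OF G])
  have "((\<lambda>Z. f (branch T p Z)) \<circ> g) has_laurent_expansion fls_compose_fps L G"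
    by (rule has_laurent_expansion_compose[OF assms(3)[unfolded expands_def] Gl G0 Gnz])
  moreover have "(\<lambda>x. of_nat T * (p + x) ^ (T - 1)) has_laurent_expansion fls_deriv (fps_to_fls G)"
    by (rule has_laurent_expansion_deriv'[OF Gl, of UNIV]) (use dg in auto)
  ultimately have "(\<lambda>x. ((\<lambda>Z. f (branch T p Z)) \<circ> g) x * (of_nat T * (p + x) ^ (T - 1)))
      has_laurent_expansion fls_compose_fps L G * fls_deriv (fps_to_fls G)"
    by (rule has_laurent_expansion_mult)
  moreover have "eventually (\<lambda>x. ((\<lambda>Z. f (branch T p Z)) \<circ> g) x * (of_nat T * (p + x) ^ (T - 1))
      = f (p + x) * (of_nat T * (p + x) ^ (T - 1))) (at 0)"
    using eventually_branch_inverse[OF assms(1,2)]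
    unfolding eventually_at_filter by (rule eventually_mono) (simp add: g_def)
  ultimately have "(\<lambda>x. f (p + x) * (of_nat T * (p + x) ^ (T - 1)))
      has_laurent_expansion fls_compose_fps L G * fls_deriv (fps_to_fls G)"
    by (subst (asm) has_laurent_expansion_cong[OF _ refl])
  then have "residue (\<lambda>s. f s * (of_nat T * s ^ (T - 1))) p = fls_residue L"
    using has_laurent_expansion_residue[of "\<lambda>s. f s * (of_nat T * s ^ (T - 1))" p]
      fls_residue_compose_deriv[OF sub, of L] by simp
  then show ?thesis by (simp add: res_dz_def)
qed

lemma res_dz_expands_shift:
  assumes "T > 0" "p \<noteq> 0" "expands T p f L" "q ^ T = p ^ T"
  shows "res_dz T (\<lambda>s. f s * (s ^ T - q ^ T) powi n) p = L $$ (- n - 1)"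
proof -
  have "expands T p (\<lambda>s. f s * (s ^ T - q ^ T) powi n) (L * fls_X powi n)"
    using expands_difference[OF assms(1,2), of "q ^ T"] assms(4)
    by (intro expands_mult expands_powi assms) simp
  from res_dz_expands[OF assms(1,2) this] show ?thesis
    by (simp add: fls_X_intpow_times_conv_shift minus_diff_commute)
qed

lemma coeff_at_expands:
  assumes "T > 0" "p \<noteq> 0" "expands T p f L"
  shows "coeff_at T f p n = L $$ n"
  unfolding coeff_at_def by (subst res_dz_expands_shift[OF assms refl]) simp

lemma d_dz_holomorphic:
  assumes "open S" "0 \<notin> S" "f holomorphic_on S" "T > 0"
  shows "d_dz T f holomorphic_on S"
proof -
  have "of_nat T * s ^ (T - 1) \<noteq> (0::complex)" if "s \<in> S" for s
    using assms that by auto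
  then show ?thesis
    unfolding d_dz_def by (intro holomorphic_intros holomorphic_deriv assms) auto
qed

lemma d_dz_iter_holomorphic:
  assumes "open S" "0 \<notin> S" "f holomorphic_on S" "T > 0"
  shows "(d_dz T ^^ i) f holomorphic_on S"
proof (induction i)
  case (Suc i)
  then show ?case using d_dz_holomorphic[OF assms(1,2) _ assms(4)] by simp
qed (simp add: assms)

lemma branch_has_derivative:
  assumes "T > 0" "p \<noteq> 0" "norm Z < norm (p ^ T)"
  shows "(branch T p has_field_derivative 1 / (of_nat T * branch T p Z ^ (T - 1))) (at Z)"
proof -
  let ?B = "ball 0 (norm (p ^ T)) :: complex set"
  have Z: "Z \<in> ?B" using assms by simp
  have d: "(branch T p has_field_derivative deriv (branch T p) Z) (at Z)"
    using branch_holomorphic[OF assms(2), of T] Z by (intro holomorphic_derivI[of _ ?B]) auto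
  then have "((\<lambda>Z. branch T p Z ^ T) has_field_derivative
      of_nat T * branch T p Z ^ (T - 1) * deriv (branch T p) Z) (at Z)"
    by (auto intro!: derivative_eq_intros)
  moreover have "((\<lambda>Z. branch T p Z ^ T) has_field_derivative 1) (at Z)"
  proof (rule has_field_derivative_transform_within_open[of "\<lambda>Z. p ^ T + Z" _ _ ?B])
    show "((\<lambda>Z. p ^ T + Z) has_field_derivative 1) (at Z)"
      by (auto intro!: derivative_eq_intros)
  qed (use Z branch_power[OF assms(1,2)] in auto)
  ultimately have e: "of_nat T * branch T p Z ^ (T - 1) * deriv (branch T p) Z = 1"
    by (rule DERIV_unique)
  then have "of_nat T * branch T p Z ^ (T - 1) \<noteq> 0" by (metis mult_zero_left zero_neq_one)
  with e have "deriv (branch T p) Z = 1 / (of_nat T * branch T p Z ^ (T - 1))"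
    by (metis nonzero_mult_div_cancel_left)
  with d show ?thesis by simp
qed

lemma d_dz_branch:
  assumes "T > 0" "p \<noteq> 0" "norm Z < norm (p ^ T)"
    and "open S" "f holomorphic_on S" "branch T p Z \<in> S"
  shows "((\<lambda>Z. f (branch T p Z)) has_field_derivative d_dz T f (branch T p Z)) (at Z)"
proof -
  have "(f has_field_derivative deriv f (branch T p Z)) (at (branch T p Z))"
    using assms by (intro holomorphic_derivI) auto
  from DERIV_chain2[OF this branch_has_derivative[OF assms(1-3)]]
  show ?thesis by (simp add: d_dz_def)
qed

lemma expands_d_dz:
  assumes "T > 0" "p \<noteq> 0" "finite P" "f holomorphic_on punctured T P" "expands T p f L"
  shows "expands T p (d_dz T f) (fls_deriv L)"
proof -
  have "eventually (\<lambda>Z. deriv (\<lambda>Z. f (branch T p Z)) Z = d_dz T f (branch T p Z)) (at 0)"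
    using eventually_branch_punctured[OF assms(3,1,2)] eventually_branch_at[OF assms(2), of T]
  proof eventually_elim
    case (elim Z)
    then show ?case
      using d_dz_branch[OF assms(1,2), of Z "punctured T P" f] open_punctured[OF assms(3,1)] assms(4)
      by (intro DERIV_imp_deriv) auto
  qed
  then show ?thesis
    using has_laurent_expansion_deriv[OF assms(5)[unfolded expands_def]]
    unfolding expands_def by (subst (asm) has_laurent_expansion_cong[OF _ refl])
qed

lemma zero_notin_punctured: "0 \<notin> punctured T P"
  by (simp add: punctured_def)

lemma d_dz_iter_holomorphic_punctured:
  assumes "T > 0" "finite P" "f holomorphic_on punctured T P"
  shows "(d_dz T ^^ i) f holomorphic_on punctured T P"
  using d_dz_iter_holomorphic[OF open_punctured[OF assms(2,1)] zero_notin_punctured assms(3,1)] .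

lemma expands_d_dz_iter:
  assumes "T > 0" "p \<noteq> 0" "finite P" "f holomorphic_on punctured T P" "expands T p f L"
  shows "expands T p ((d_dz T ^^ i) f) ((fls_deriv ^^ i) L)"
proof (induction i)
  case (Suc i)
  show ?case
    using expands_d_dz[OF assms(1-3) d_dz_iter_holomorphic_punctured[OF assms(1,3,4)] Suc] by simp
qed (simp add: assms)

definition taylor :: "nat \<Rightarrow> (complex \<Rightarrow> complex) \<Rightarrow> complex \<Rightarrow> complex fps" where
  "taylor T f p = Abs_fps (\<lambda>i. (d_dz T ^^ i) f p / fact i)"

text \<open>Composition with \<open>branch\<close> turns d/dz on the curve into the ordinary
  derivative in Z, so the iterates of \<open>d_dz\<close> at p are the Taylor data of the composite
  at 0.\<close>

lemma expands_taylor: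
  assumes "T > 0" "open S" "0 \<notin> S" "f holomorphic_on S" "p \<in> S"
  shows "expands T p f (fps_to_fls (taylor T f p))"
proof -
  have p: "p \<noteq> 0" using assms by auto
  let ?B = "ball 0 (norm (p ^ T)) :: complex set"
  define W where "W = ?B \<inter> branch T p -` S"
  have contB: "continuous_on ?B (branch T p)"
    using branch_holomorphic[OF p] holomorphic_on_imp_continuous_on by blast
  have W: "open W" unfolding W_def
    using continuous_open_preimage[OF contB] assms(2) by auto
  have W0: "0 \<in> W" using assms p by (simp add: W_def)
  have der: "((\<lambda>Z. (d_dz T ^^ i) f (branch T p Z)) has_field_derivative (d_dz T ^^ Suc i) f (branch T p Z)) (at Z)"
    if "Z \<in> W" for i Z
    using d_dz_branch[OF assms(1) p _ assms(2) d_dz_iter_holomorphic[OF assms(2,3,4,1), of i], of Z] that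
    by (auto simp: W_def)
  have "(\<lambda>Z. f (branch T p Z)) holomorphic_on W"
    using der[of _ 0] by (auto simp: holomorphic_on_def field_differentiable_def
        intro: has_field_derivative_at_within)
  then have "(\<lambda>Z. f (branch T p Z)) analytic_on {0}"
    using W W0 analytic_at by blast
  then obtain F where F: "(\<lambda>Z. f (branch T p Z)) has_fps_expansion F"
    using analytic_at_imp_has_fps_expansion_0 by blast
  have it: "\<forall>Z\<in>W. (deriv ^^ i) (\<lambda>Z. f (branch T p Z)) Z = (d_dz T ^^ i) f (branch T p Z)" for i
  proof (induction i)
    case (Suc i)
    show ?case
    proof
      fix Z assume Z: "Z \<in> W"
      have "eventually (\<lambda>x. x \<in> W) (nhds Z)" using W Z by (rule eventually_nhds_in_open)
      then have "eventually (\<lambda>x. (deriv ^^ i) (\<lambda>Z. f (branch T p Z)) x = (d_dz T ^^ i) f (branch T p x)) (nhds Z)"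
        by eventually_elim (use Suc in auto)
      then have "deriv ((deriv ^^ i) (\<lambda>Z. f (branch T p Z))) Z = deriv (\<lambda>x. (d_dz T ^^ i) f (branch T p x)) Z"
        by (intro deriv_cong_ev) auto
      also have "\<dots> = (d_dz T ^^ Suc i) f (branch T p Z)"
        using der[OF Z, of i] by (rule DERIV_imp_deriv)
      finally show "(deriv ^^ Suc i) (\<lambda>Z. f (branch T p Z)) Z = (d_dz T ^^ Suc i) f (branch T p Z)"
        by simp
    qed
  qed simp
  have "F = taylor T f p"
    using fps_nth_fps_expansion[OF F] it W0 by (simp add: fps_eq_iff taylor_def)
  then show ?thesis
    using has_laurent_expansion_fps[OF F] by (simp add: expands_def)
qed

text \<open>Identity theorem: the common series makes the functions agree on the image of a small
  punctured disc, which is open because \<open>branch\<close> is injective there, and the punctured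
  curve is connected. The point t may itself be a puncture, as the module point is in the
  applications.\<close>

lemma expands_determines:
  assumes "T > 0" "t \<noteq> 0" "finite P"
    and "f holomorphic_on punctured T P" "f' holomorphic_on punctured T P"
    and "expands T t f L" "expands T t f' L" "s \<in> punctured T P"
  shows "f s = f' s"
proof -
  let ?B = "ball 0 (norm (t ^ T)) :: complex set"
  have "eventually (\<lambda>Z. eval_fls L Z = f (branch T t Z)) (at 0)"
    "eventually (\<lambda>Z. eval_fls L Z = f' (branch T t Z)) (at 0)"
    using assms(6,7) by (auto simp: expands_def has_laurent_expansion_def)
  with eventually_branch_at[OF assms(2), of T] eventually_branch_punctured[OF assms(3,1,2)]
  have "eventually (\<lambda>Z. Z \<in> ?B \<and> branch T t Z \<in> punctured T P \<and>
      f (branch T t Z) = f' (branch T t Z)) (at 0)"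
    by eventually_elim auto
  then obtain N where N: "open N" "0 \<in> N"
    "\<And>Z. Z \<in> N - {0} \<Longrightarrow> Z \<in> ?B \<and> branch T t Z \<in> punctured T P \<and> f (branch T t Z) = f' (branch T t Z)"
    by (auto simp: eventually_at_filter eventually_nhds)
  have inj: "inj_on (branch T t) (N - {0})"
  proof (rule inj_on_inverseI[where g = "\<lambda>s. s ^ T - t ^ T"])
    fix Z assume "Z \<in> N - {0}"
    then show "branch T t Z ^ T - t ^ T = Z"
      using N(3)[of Z] branch_power[OF assms(1,2), of Z] by simp
  qed
  have hol: "branch T t holomorphic_on (N - {0})"
    by (rule holomorphic_on_subset[OF branch_holomorphic[OF assms(2), of T]]) (use N(3) in blast)
  have "open (branch T t ` (N - {0}))"
    by (rule open_mapping_thm3[OF hol _ inj]) (use N in auto)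
  moreover have "N - {0} \<noteq> {}"
    using N(1,2) by (metis insert_Diff not_open_singleton)
  ultimately show ?thesis
    by (intro analytic_continuation_open[of "branch T t ` (N - {0})" "punctured T P" f f' s])
       (use open_punctured[OF assms(3,1)] connected_punctured[OF assms(3,1)] assms N(3) in auto)
qed

lemma curve_functions_holomorphic:
  "f \<in> curve_functions T P \<Longrightarrow> f holomorphic_on punctured T P"
  by (induction rule: curve_functions.induct)
     (auto intro!: holomorphic_intros simp: punctured_def)

lemma curve_functions_expands:
  assumes "T > 0" "p \<noteq> 0" "f \<in> curve_functions T P"
  shows "\<exists>L. expands T p f L"
  using assms(3)
proof (induction rule: curve_functions.induct)
  case cf_coord
  then show ?case using expands_coord[OF assms(1,2), of 1] by auto
next
  case cf_inverse
  then show ?case using expands_coord[OF assms(1,2), of "-1"] by (auto simp: power_int_minus)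
next
  case (cf_pole q)
  then show ?case using expands_inverse[OF expands_difference[OF assms(1,2), of "q ^ T"]] by blast
qed (blast intro: expands_const expands_add expands_mult)+

definition expansion :: "nat \<Rightarrow> complex \<Rightarrow> (complex \<Rightarrow> complex) \<Rightarrow> complex fls" where
  "expansion T p f = (THE L. expands T p f L)"

lemma expansion_eq: "expands T p f L \<Longrightarrow> expansion T p f = L"
  unfolding expansion_def using expands_unique by blast

lemma expands_expansion:
  "T > 0 \<Longrightarrow> p \<noteq> 0 \<Longrightarrow> f \<in> curve_functions T P \<Longrightarrow> expands T p f (expansion T p f)"
  using curve_functions_expands expansion_eq by metis

section \<open>Linear algebra\<close>

lemma clinearI:
  assumes "\<And>x y. f (x + y) = f x + f y" "\<And>c x. f (c *\<^sub>C x) = c *\<^sub>C f x"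
  shows "clinear f"
  by (simp add: Vector_Spaces.linear_iff complex_vs.vector_space_axioms assms)

lemma clinearD:
  assumes "clinear f"
  shows clinear_add: "f (x + y) = f x + f y"
    and clinear_scale: "f (c *\<^sub>C x) = c *\<^sub>C f x"
  using assms by (simp_all add: Vector_Spaces.linear_iff)

lemma clinear_0: assumes "clinear f" shows "f 0 = 0"
  using clinear_add[OF assms, of 0 0] by simp

lemma clinear_minus: assumes "clinear f" shows "f (- x) = - f x"
  using clinear_add[OF assms, of x "- x"] clinear_0[OF assms] by (simp add: eq_neg_iff_add_eq_0 add.commute)

lemma clinear_diff: assumes "clinear f" shows "f (x - y) = f x - f y"
  using clinear_add[OF assms, of x "- y"] clinear_minus[OF assms, of y] by simp

lemma clinear_sum: assumes "clinear f" shows "f (\<Sum>i\<in>I. x i) = (\<Sum>i\<in>I. f (x i))"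
  by (induction I rule: infinite_finite_induct) (auto simp: clinear_0[OF assms] clinear_add[OF assms])

lemma Sum_any_superset:
  "finite I \<Longrightarrow> (\<And>i. i \<notin> I \<Longrightarrow> x i = 0) \<Longrightarrow> Sum_any x = (\<Sum>i\<in>I. x i)"
  by (rule Sum_any.expand_superset) auto

lemma clinear_Sum_any:
  assumes "clinear f" "finite {i. x i \<noteq> 0}"
  shows "f (Sum_any x) = Sum_any (\<lambda>i. f (x i))"
proof -
  have "Sum_any (\<lambda>i. f (x i)) = (\<Sum>i\<in>{i. x i \<noteq> 0}. f (x i))"
    by (rule Sum_any_superset) (use assms clinear_0[OF assms(1)] in auto)
  then show ?thesis
    by (simp add: Sum_any.expand_set clinear_sum[OF assms(1)])
qed

lemma clinear_compose: "clinear f \<Longrightarrow> clinear f' \<Longrightarrow> clinear (\<lambda>x. f (f' x))"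
  by (intro clinearI) (simp_all add: clinearD)

lemma clinear_plus: "clinear f \<Longrightarrow> clinear f' \<Longrightarrow> clinear (\<lambda>x. f x + f' x)"
  by (intro clinearI) (simp_all add: clinearD scaleC_add_right)

lemma clinear_const_scale: "clinear f \<Longrightarrow> clinear (\<lambda>x. c *\<^sub>C f x)"
  by (intro clinearI) (simp_all add: clinearD scaleC_add_right scaleC_scaleC mult.commute)

lemma clinear_cmult: "clinear f \<Longrightarrow> clinear (\<lambda>x. c * f x :: complex)"
  using clinear_const_scale[of f c] by (simp add: scaleC_complex_def)

lemma clinear_sum_fun: "(\<And>i. i \<in> I \<Longrightarrow> clinear (f i)) \<Longrightarrow> clinear (\<lambda>x. \<Sum>i\<in>I. f i x)"
proof (induction I rule: infinite_finite_induct)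
  case (insert i I)
  then show ?case by (simp add: clinear_plus)
qed (auto intro!: clinearI simp: complex_vs.scale_zero_right)

lemma clinear_zero: "clinear (\<lambda>_. 0)"
  by (auto intro!: clinearI simp: complex_vs.scale_zero_right)

lemma clinear_id: "clinear (\<lambda>x. x)"
  by (rule clinearI) auto

lemma sum_scaleC_right: "c *\<^sub>C (\<Sum>i\<in>I. x i) = (\<Sum>i\<in>I. c *\<^sub>C x i)"
  by (rule complex_vs.scale_sum_right)

section \<open>Modes smeared by Laurent series\<close>

text \<open>$\mathrm{Res}\,L(Z)\,Y(a,Z)w$.\<close>

definition smear :: "('v \<Rightarrow> int \<Rightarrow> 'm \<Rightarrow> 'm::complex_vs) \<Rightarrow> complex fls \<Rightarrow> 'v \<Rightarrow> 'm \<Rightarrow> 'm" where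
  "smear A L a w = Sum_any (\<lambda>n. (L $$ n) *\<^sub>C A a n w)"

text \<open>$\ell(Y(a,Z)w)$.\<close>

definition matrix_series :: "('v \<Rightarrow> int \<Rightarrow> 'm \<Rightarrow> 'm) \<Rightarrow> ('m \<Rightarrow> complex) \<Rightarrow> 'v \<Rightarrow> 'm \<Rightarrow> complex fls" where
  "matrix_series A l a w = Abs_fls (\<lambda>m. l (A a (- m - 1) w))"

locale wmod =
  fixes V :: "'v::complex_vs voa_data" and A :: "'v \<Rightarrow> int \<Rightarrow> 'm::complex_vs \<Rightarrow> 'm"
  assumes weak_module: "weak_module V A"
begin

lemma linear_right: "clinear (A a n)"
  and linear_left: "clinear (\<lambda>a. A a n w)"
  and vacuum: "A (vac V) n w = (if n = -1 then w else 0)"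
  using weak_module by (simp_all add: weak_module_def)

lemma truncation: obtains N where "\<And>n. n \<ge> N \<Longrightarrow> A a n w = 0"
  using weak_module by (fastforce simp: weak_module_def)

lemma borcherds:
  "Sum_any (\<lambda>i::nat. (of_int m gchoose i) *\<^sub>C A (mode V a (l + int i) b) (m + n - int i) w) =
   Sum_any (\<lambda>i::nat. ((-1) ^ i * (of_int l gchoose i)) *\<^sub>C
        (A a (m + l - int i) (A b (n + int i) w)
         - ((-1) powi l) *\<^sub>C A b (n + l - int i) (A a (m + int i) w)))"
  using weak_module by (simp add: weak_module_def)

lemma smear_sum:
  assumes "\<And>n. n < m \<Longrightarrow> L $$ n = 0" "\<And>n. n \<ge> N \<Longrightarrow> A a n w = 0"
  shows "smear A L a w = (\<Sum>n\<in>{m..<N}. (L $$ n) *\<^sub>C A a n w)"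
  unfolding smear_def
proof (rule Sum_any_superset)
  fix n assume "n \<notin> {m..<N}"
  then have "n < m \<or> n \<ge> N" by auto
  then show "(L $$ n) *\<^sub>C A a n w = 0"
    using assms by (auto simp: complex_vs.scale_zero_right complex_vs.scale_zero_left)
qed simp

lemma smear_support: "finite {n. L $$ n \<noteq> 0 \<and> A a n w \<noteq> 0}"
proof -
  obtain N where N: "\<And>n. n \<ge> N \<Longrightarrow> A a n w = 0" using truncation[of a w] by blast
  have "{n. L $$ n \<noteq> 0 \<and> A a n w \<noteq> 0} \<subseteq> {fls_subdegree L..<N}"
  proof
    fix n assume "n \<in> {n. L $$ n \<noteq> 0 \<and> A a n w \<noteq> 0}"
    then show "n \<in> {fls_subdegree L..<N}"
      using N[of n] fls_eq0_below_subdegree[of n L]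
      by (cases "n < fls_subdegree L"; cases "N \<le> n") auto
  qed
  then show ?thesis by (rule finite_subset) simp
qed

lemma smear_linear_right: "clinear (smear A L a)"
proof (rule clinearI)
  show "smear A L a (x + y) = smear A L a x + smear A L a y" for x y
    unfolding smear_def
    by (subst Sum_any.distrib[symmetric])
       (auto simp: smear_support clinear_add[OF linear_right] scaleC_add_right)
  show "smear A L a (c *\<^sub>C x) = c *\<^sub>C smear A L a x" for c x
    unfolding smear_def
    by (subst clinear_Sum_any[OF clinear_const_scale[OF clinear_id]])
       (auto simp: smear_support clinear_scale[OF linear_right] scaleC_scaleC mult.commute)
qed

lemma smear_linear_left: "clinear (\<lambda>a. smear A L a w)"
proof (rule clinearI)
  show "smear A L (x + y) w = smear A L x w + smear A L y w" for x y
    unfolding smear_def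
    by (subst Sum_any.distrib[symmetric])
       (auto simp: smear_support clinear_add[OF linear_left] scaleC_add_right)
  show "smear A L (c *\<^sub>C x) w = c *\<^sub>C smear A L x w" for c x
    unfolding smear_def
    by (subst clinear_Sum_any[OF clinear_const_scale[OF clinear_id]])
       (auto simp: smear_support clinear_scale[OF linear_left] scaleC_scaleC mult.commute)
qed

lemma matrix_series_nth:
  assumes "clinear l"
  shows "matrix_series A l a w $$ m = l (A a (- m - 1) w)"
proof -
  obtain N where N: "\<And>n. n \<ge> N \<Longrightarrow> A a n w = 0" using truncation[of a w] by blast
  show ?thesis
    unfolding matrix_series_def
    by (rule nth_Abs_fls_lower_bound[of "- N"]) (use N clinear_0[OF assms] in auto)
qed

text \<open>The cut-offs m and N are free, instead of the subdegrees of the factors, so that several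
  such products can be summed over one common range.\<close>

lemma times_matrix_series_nth:
  assumes "clinear l" "\<And>e. e < m \<Longrightarrow> L $$ e = 0" "\<And>e. e \<ge> N \<Longrightarrow> A a (e + n) w = 0"
  shows "(L * matrix_series A l a w) $$ (- n - 1) = (\<Sum>e\<in>{m..<N}. L $$ e * l (A a (e + n) w))"
proof -
  let ?W = "matrix_series A l a w"
  have W: "?W $$ (- n - 1 - e) = l (A a (e + n) w)" for e
    by (simp add: matrix_series_nth[OF assms(1)] algebra_simps)
  have "(L * ?W) $$ (- n - 1) = (\<Sum>e=fls_subdegree L..- n - 1 - fls_subdegree ?W. L $$ e * ?W $$ (- n - 1 - e))"
    by (rule fls_times_nth(2))
  also have "\<dots> = (\<Sum>e\<in>{fls_subdegree L..- n - 1 - fls_subdegree ?W} \<inter> {m..<N}. L $$ e * ?W $$ (- n - 1 - e))"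
  proof (rule sum.mono_neutral_right)
    show "\<forall>e\<in>{fls_subdegree L..- n - 1 - fls_subdegree ?W} -
        {fls_subdegree L..- n - 1 - fls_subdegree ?W} \<inter> {m..<N}. L $$ e * ?W $$ (- n - 1 - e) = 0"
    proof
      fix e assume "e \<in> {fls_subdegree L..- n - 1 - fls_subdegree ?W} -
        {fls_subdegree L..- n - 1 - fls_subdegree ?W} \<inter> {m..<N}"
      then have "e < m \<or> N \<le> e" by auto
      then show "L $$ e * ?W $$ (- n - 1 - e) = 0"
        using assms(2,3) clinear_0[OF assms(1)] by (auto simp: W)
    qed
  qed auto
  also have "\<dots> = (\<Sum>e\<in>{m..<N}. L $$ e * ?W $$ (- n - 1 - e))"
  proof (rule sum.mono_neutral_left)
    show "\<forall>e\<in>{m..<N} - {fls_subdegree L..- n - 1 - fls_subdegree ?W} \<inter> {m..<N}. L $$ e * ?W $$ (- n - 1 - e) = 0"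
    proof
      fix e assume "e \<in> {m..<N} - {fls_subdegree L..- n - 1 - fls_subdegree ?W} \<inter> {m..<N}"
      then have "e < fls_subdegree L \<or> - n - 1 - e < fls_subdegree ?W" by auto
      then show "L $$ e * ?W $$ (- n - 1 - e) = 0"
        using fls_eq0_below_subdegree by (metis mult_zero_left mult_zero_right)
    qed
  qed auto
  finally show ?thesis by (simp add: W)
qed

lemma smear_residue:
  assumes "clinear l"
  shows "l (smear A L a w) = (L * matrix_series A l a w) $$ (- 1)"
proof -
  obtain N where N: "\<And>n. n \<ge> N \<Longrightarrow> A a n w = 0" using truncation[of a w] by blast
  have *: "L $$ e = 0" if "e < fls_subdegree L" for e using that by simp
  show ?thesis
    using times_matrix_series_nth[OF assms *, where n = 0 and a = a and w = w and N = N] N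
    by (simp add: smear_sum[OF * N] clinear_sum[OF assms] clinear_scale[OF assms] scaleC_complex_def)
qed

lemma smear_fps:
  assumes "\<And>i. i \<ge> N \<Longrightarrow> A a (int i) w = 0"
  shows "smear A (fps_to_fls F) a w = (\<Sum>i<N. (F $ i) *\<^sub>C A a (int i) w)"
proof -
  have "smear A (fps_to_fls F) a w = (\<Sum>n\<in>int ` {..<N}. (fps_to_fls F $$ n) *\<^sub>C A a n w)"
    unfolding smear_def
  proof (rule Sum_any_superset)
    fix n assume "n \<notin> int ` {..<N}"
    then have "n < 0 \<or> (n \<ge> 0 \<and> nat n \<ge> N)" by (auto simp: image_iff) (metis nat_0_le lessThan_iff not_less)
    then show "(fps_to_fls F $$ n) *\<^sub>C A a n w = 0"
      using assms[of "nat n"] by (auto simp: complex_vs.scale_zero_right complex_vs.scale_zero_left)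
  qed simp
  then show ?thesis by (simp add: sum.reindex)
qed

text \<open>This is the Borcherds identity for l = 0, whose right side has only the term i =
  0.\<close>

lemma commutator:
  assumes "\<And>i. i \<ge> N \<Longrightarrow> mode V a (int i) b = 0"
  shows "A a m (A b n w) - A b n (A a m w) =
    (\<Sum>i<N. (of_int m gchoose i) *\<^sub>C A (mode V a (int i) b) (m + n - int i) w)"
proof -
  have "Sum_any (\<lambda>i::nat. (of_int m gchoose i) *\<^sub>C A (mode V a (0 + int i) b) (m + n - int i) w) =
    (\<Sum>i<N. (of_int m gchoose i) *\<^sub>C A (mode V a (int i) b) (m + n - int i) w)"
    by (subst Sum_any_superset[of "{..<N}"])
       (use assms clinear_0[OF linear_left] in \<open>auto simp: complex_vs.scale_zero_right not_less\<close>)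
  moreover have "Sum_any (\<lambda>i::nat. ((-1) ^ i * (of_int 0 gchoose i)) *\<^sub>C
        (A a (m + 0 - int i) (A b (n + int i) w)
         - ((-1) powi 0) *\<^sub>C A b (n + 0 - int i) (A a (m + int i) w))) = A a m (A b n w) - A b n (A a m w)"
    by (subst Sum_any_superset[of "{0}"])
       (auto simp: complex_vs.scale_zero_left gbinomial_0_left scaleC_one)
  ultimately show ?thesis using borcherds[of m a 0 b n w] by simp
qed

end

lemma fls_sum_nth: "(\<Sum>i\<in>I. L i :: complex fls) $$ n = (\<Sum>i\<in>I. L i $$ n)"
  by (induction I rule: infinite_finite_induct) auto

lemma
  assumes "voa V"
  shows voa_translation: "mode V (Vir V (mode V) (-1) a) n b = (- of_int n) *\<^sub>C mode V a (n - 1) b"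
    and voa_creation: "mode V a (-1) (vac V) = a" "n \<ge> 0 \<Longrightarrow> mode V a n (vac V) = 0"
    and voa_L0: "a \<in> grade V k \<Longrightarrow> Vir V (mode V) 0 a = of_nat k *\<^sub>C a"
    and voa_grading: "direct_sum_grading (grade V)"
    and voa_weak_module: "weak_module V (mode V)"
    and voa_vac: "vac V \<in> grade V 0" and voa_conf: "conf V \<in> grade V 2"
  using assms unfolding voa_def by blast+

definition hasse :: "nat \<Rightarrow> complex fls \<Rightarrow> complex fls" where
  "hasse i L = fls_const (inverse (fact i)) * (fls_deriv ^^ i) L"

lemma hasse_nth: "hasse i L $$ m = (of_int (m + int i) gchoose i) * L $$ (m + int i)"
proof -
  have "((fls_deriv ^^ i) L) $$ m = pochhammer (of_int m + 1) i * L $$ (m + int i)"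
  proof (induction i arbitrary: m)
    case (Suc i)
    then show ?case by (simp add: pochhammer_rec algebra_simps)
  qed simp
  then show ?thesis
    by (simp add: hasse_def gbinomial_pochhammer' field_simps)
qed

context wmod
begin

text \<open>The commutator formula summed against the coefficients of L. The product of L_e with the
  binomial coefficient (e over i) is the coefficient of the i-th divided derivative of L at exponent
  e - i; hence the commutator of Res L(Z) Y(b,Z) with Y(a,Z) is the sum of L^(i)/i! times Y(b_(i)a,
  Z).\<close>

lemma smear_commutator:
  assumes l: "clinear l" and N: "\<And>i. i \<ge> N \<Longrightarrow> mode V b (int i) a = 0"
  shows "(\<Sum>i<N. hasse i L * matrix_series A l (mode V b (int i) a) w) $$ (- n - 1) =
    l (smear A L b (A a n w)) - l (A a n (smear A L b w))"
proof -
  obtain J1 where J1: "\<And>j. j \<ge> J1 \<Longrightarrow> A b j (A a n w) = 0" using truncation by blast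
  obtain J2 where J2: "\<And>j. j \<ge> J2 \<Longrightarrow> A b j w = 0" using truncation by blast
  have "\<exists>J. \<forall>j\<ge>J. A (mode V b (int i) a) j w = 0" for i
    using truncation by metis
  then obtain J where J: "\<And>i j. j \<ge> J i \<Longrightarrow> A (mode V b (int i) a) j w = 0" by metis
  \<comment> \<open>A truncation bound valid for all i < N at once, after the shift by n - i in the
    commutator formula. With it, E becomes a common upper end of all the sums.\<close>
  define J3 where "J3 = Max (insert 0 (J ` {..<N})) + int N - n"
  have J3: "A (mode V b (int i) a) (e + n - int i) w = 0" if "i < N" "e \<ge> J3" for i e
  proof -
    have "J i \<le> Max (insert 0 (J ` {..<N}))" using that by (intro Max_ge) auto
    then have "J i \<le> e + n - int i" using that unfolding J3_def by linarith
    then show ?thesis by (rule J)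
  qed
  define E where "E = Max {J1, J2, J3}"
  have E: "J1 \<le> E" "J2 \<le> E" "J3 \<le> E" by (simp_all add: E_def)
  define m where "m = fls_subdegree L"
  have m: "\<And>e. e < m \<Longrightarrow> L $$ e = 0" by (simp add: m_def)
  have "(hasse i L * matrix_series A l (mode V b (int i) a) w) $$ (- n - 1) =
     (\<Sum>e\<in>{m..<E}. (of_int e gchoose i) * L $$ e * l (A (mode V b (int i) a) (e + n - int i) w))" if "i < N" for i
  proof -
    have "(hasse i L * matrix_series A l (mode V b (int i) a) w) $$ (- n - 1) =
      (\<Sum>e\<in>{m - int i..<E - int i}. hasse i L $$ e * l (A (mode V b (int i) a) (e + n) w))"
    proof (rule times_matrix_series_nth[OF l])
      show "hasse i L $$ e = 0" if "e < m - int i" for e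
        using that m by (simp add: hasse_nth)
      show "A (mode V b (int i) a) (e + n) w = 0" if "E - int i \<le> e" for e
        using J3[OF \<open>i < N\<close>, of "e + int i"] that E by simp
    qed
    also have "\<dots> = (\<Sum>e\<in>{m..<E}. hasse i L $$ (e - int i) * l (A (mode V b (int i) a) (e - int i + n) w))"
      by (rule sum.reindex_bij_witness[of _ "\<lambda>e. e - int i" "\<lambda>e. e + int i"]) auto
    finally show ?thesis by (simp add: hasse_nth algebra_simps)
  qed
  then have "(\<Sum>i<N. hasse i L * matrix_series A l (mode V b (int i) a) w) $$ (- n - 1) =
    (\<Sum>i<N. \<Sum>e\<in>{m..<E}. (of_int e gchoose i) * L $$ e * l (A (mode V b (int i) a) (e + n - int i) w))"
    by (simp add: fls_sum_nth)
  also have "\<dots> = (\<Sum>e\<in>{m..<E}. L $$ e * (\<Sum>i<N. (of_int e gchoose i) * l (A (mode V b (int i) a) (e + n - int i) w)))"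
    by (subst sum.swap) (simp add: sum_distrib_left mult_ac)
  also have "\<dots> = (\<Sum>e\<in>{m..<E}. L $$ e * (l (A b e (A a n w)) - l (A a n (A b e w))))"
    using commutator[OF N]
    by (simp flip: clinear_diff[OF l] add: clinear_sum[OF l] clinear_scale[OF l] scaleC_complex_def)
  also have "\<dots> = l (smear A L b (A a n w)) - l (A a n (smear A L b w))"
  proof -
    have "smear A L b (A a n w) = (\<Sum>e\<in>{m..<E}. (L $$ e) *\<^sub>C A b e (A a n w))"
      by (rule smear_sum[OF m]) (use J1 E in auto)
    moreover have "smear A L b w = (\<Sum>e\<in>{m..<E}. (L $$ e) *\<^sub>C A b e w)"
      by (rule smear_sum[OF m]) (use J2 E in auto)
    ultimately show ?thesis
      by (simp add: clinear_sum[OF linear_right] clinear_scale[OF linear_right] clinear_sum[OF l]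
          clinear_scale[OF l] scaleC_complex_def right_diff_distrib sum_subtractf)
  qed
  finally show ?thesis .
qed

text \<open>Since L_(-1)a is a_(-2) applied to the vacuum, the Borcherds identity with l = -2, m = 0
  and the vacuum as second vector applies. At most one term survives, as the vacuum acts only
  through its mode -1; the three ranges of n decide which one.\<close>

lemma translation:
  assumes "voa V"
  shows "A (Vir V (mode V) (-1) a) n w = (- of_int n) *\<^sub>C A a (n - 1) w"
proof -
  have voa: "mode V (Vir V (mode V) (-1) a) (-1) (vac V) = mode V a (-2) (vac V)"
    "mode V (Vir V (mode V) (-1) a) (-1) (vac V) = Vir V (mode V) (-1) a"
    using voa_translation[OF assms, of a "-1" "vac V"] voa_creation[OF assms] by (simp_all add: scaleC_one)
  have c: "(- 1) ^ i * ((- 2) gchoose i) = (of_nat i + 1 :: complex)" for i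
    using gbinomial_negated_upper[of "-2 :: complex" i]
    by (simp add: binomial_gbinomial[symmetric] add.commute flip: of_nat_Suc of_nat_add)
  have "A (Vir V (mode V) (-1) a) n w = Sum_any (\<lambda>i::nat. (of_int 0 gchoose i) *\<^sub>C
      A (mode V a (- 2 + int i) (vac V)) (0 + n - int i) w)"
    by (subst Sum_any_superset[of "{0}"])
       (use voa in \<open>auto simp: complex_vs.scale_zero_left gbinomial_0_left scaleC_one\<close>)
  also have "\<dots> = Sum_any (\<lambda>i::nat. ((-1) ^ i * ((- 2) gchoose i)) *\<^sub>C
      (A a (- 2 - int i) (A (vac V) (n + int i) w) - A (vac V) (n - 2 - int i) (A a (int i) w)))"
    unfolding borcherds by (simp add: scaleC_one)
  also have "\<dots> = (- of_int n) *\<^sub>C A a (n - 1) w"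
  proof (cases "n \<ge> 1")
    case True
    then have "Sum_any (\<lambda>i::nat. ((-1) ^ i * ((- 2) gchoose i)) *\<^sub>C
      (A a (- 2 - int i) (A (vac V) (n + int i) w) - A (vac V) (n - 2 - int i) (A a (int i) w))) =
      (\<Sum>i\<in>{nat (n - 1)}. ((-1) ^ i * ((- 2) gchoose i)) *\<^sub>C
      (A a (- 2 - int i) (A (vac V) (n + int i) w) - A (vac V) (n - 2 - int i) (A a (int i) w)))"
      by (intro Sum_any_superset) (auto simp: vacuum clinear_0[OF linear_right] complex_vs.scale_zero_right)
    then show ?thesis
      using True by (simp add: c vacuum clinear_0[OF linear_right] complex_vs.scale_minus_right)
  next
    case False
    show ?thesis
    proof (cases "n = 0")
      case True
      then show ?thesis
        by (subst Sum_any_superset[of "{}"])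
           (auto simp: vacuum clinear_0[OF linear_right] complex_vs.scale_zero_right)
    next
      case n: False
      with False have "n \<le> -1" by simp
      then have "Sum_any (\<lambda>i::nat. ((-1) ^ i * ((- 2) gchoose i)) *\<^sub>C
        (A a (- 2 - int i) (A (vac V) (n + int i) w) - A (vac V) (n - 2 - int i) (A a (int i) w))) =
        (\<Sum>i\<in>{nat (- n - 1)}. ((-1) ^ i * ((- 2) gchoose i)) *\<^sub>C
        (A a (- 2 - int i) (A (vac V) (n + int i) w) - A (vac V) (n - 2 - int i) (A a (int i) w)))"
        by (intro Sum_any_superset) (auto simp: vacuum clinear_0[OF linear_right] complex_vs.scale_zero_right)
      then show ?thesis
        using \<open>n \<le> -1\<close> by (simp add: c vacuum)
    qed
  qed
  finally show ?thesis .
qed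

text \<open>With m = 0 the commutator formula for the conformal vector retains only i = 0, and its
  zeroth mode on a is L_(-1)a.\<close>

lemma commutator_translation:
  assumes "voa V"
  shows "Vir V A (-1) (A a n w) = A a n (Vir V A (-1) w) - of_int n *\<^sub>C A a (n - 1) w"
proof -
  interpret VV: wmod V "mode V" using assms by unfold_locales (simp add: voa_def)
  obtain N0 where N0: "\<And>i. i \<ge> N0 \<Longrightarrow> mode V (conf V) i a = 0" using VV.truncation by blast
  define N where "N = Suc (nat N0)"
  have N: "mode V (conf V) (int i) a = 0" if "i \<ge> N" for i
    using N0[of "int i"] that by (simp add: N_def)
  have "(\<Sum>i<N. (of_int 0 gchoose i) *\<^sub>C A (mode V (conf V) (int i) a) (0 + n - int i) w)
      = A (mode V (conf V) 0 a) n w"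
    by (subst sum.mono_neutral_right[of _ "{0}"])
       (auto simp: N_def gbinomial_0_left complex_vs.scale_zero_left scaleC_one)
  with commutator[OF N, where m = 0 and n = n and w = w] have "A (conf V) 0 (A a n w) - A a n (A (conf V) 0 w) = A (mode V (conf V) 0 a) n w"
    by simp
  then show ?thesis
    using translation[OF assms, of a n w]
    by (simp add: Vir_def complex_vs.scale_minus_left algebra_simps)
qed

end

section \<open>Gradings\<close>

context
  fixes gr :: "nat \<Rightarrow> 'a::complex_vs set"
  assumes gr: "direct_sum_grading gr"
begin

lemma grading_subspace: "csubspace (gr n)"
  using gr by (simp add: direct_sum_grading_def)

lemma component_unique: assumes "is_decomposition gr x f" shows "component gr x = f"
  unfolding component_def using gr assms
  by (intro the1_equality) (auto simp: direct_sum_grading_def)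

lemma component_decomposition: "is_decomposition gr x (component gr x)"
  using gr component_unique unfolding direct_sum_grading_def by metis

lemma component_in: "component gr x n \<in> gr n"
  and component_finite: "finite {n. component gr x n \<noteq> 0}"
  and component_Sum_any: "x = Sum_any (component gr x)"
  using component_decomposition[of x] by (simp_all add: is_decomposition_def)

lemma component_homogeneous:
  assumes "x \<in> gr n" shows "component gr x = (\<lambda>m. if m = n then x else 0)"
proof (rule component_unique)
  have "x = Sum_any (\<lambda>m. if m = n then x else 0)"
    by (subst Sum_any_superset[of "{n}"]) auto
  then show "is_decomposition gr x (\<lambda>m. if m = n then x else 0)"
    using assms grading_subspace
    by (auto simp: is_decomposition_def complex_vs.subspace_0)
qed

lemma component_linear: "clinear (\<lambda>x. component gr x n)"
proof (rule clinearI)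
  fix x y
  have "component gr (x + y) = (\<lambda>n. component gr x n + component gr y n)"
  proof (rule component_unique)
    have "x + y = Sum_any (\<lambda>n. component gr x n + component gr y n)"
      by (subst Sum_any.distrib) (auto simp: component_finite component_Sum_any[symmetric])
    moreover have "finite {n. component gr x n + component gr y n \<noteq> 0}"
      by (rule finite_subset[OF _ finite_UnI[OF component_finite[of x] component_finite[of y]]]) auto
    ultimately show "is_decomposition gr (x + y) (\<lambda>n. component gr x n + component gr y n)"
      using complex_vs.subspace_add[OF grading_subspace] component_in
      by (auto simp: is_decomposition_def)
  qed
  then show "component gr (x + y) n = component gr x n + component gr y n" by simp
next
  fix c x
  have "component gr (c *\<^sub>C x) = (\<lambda>n. c *\<^sub>C component gr x n)"
  proof (rule component_unique)
    have "c *\<^sub>C x = Sum_any (\<lambda>n. c *\<^sub>C component gr x n)"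
      by (subst clinear_Sum_any[OF clinear_const_scale[OF clinear_id], symmetric])
         (auto simp: component_finite component_Sum_any[symmetric])
    moreover have "finite {n. c *\<^sub>C component gr x n \<noteq> 0}"
      by (rule finite_subset[OF _ component_finite[of x]]) (auto simp: complex_vs.scale_zero_right)
    ultimately show "is_decomposition gr (c *\<^sub>C x) (\<lambda>n. c *\<^sub>C component gr x n)"
      using complex_vs.subspace_scale[OF grading_subspace] component_in
      by (auto simp: is_decomposition_def)
  qed
  then show "component gr (c *\<^sub>C x) n = c *\<^sub>C component gr x n" by simp
qed

lemma graded_induct:
  assumes "\<And>n x. x \<in> gr n \<Longrightarrow> Q x" "\<And>x y. Q x \<Longrightarrow> Q y \<Longrightarrow> Q (x + y)"
  shows "Q x"
proof -
  have Q0: "Q 0" using assms(1)[of 0 0] complex_vs.subspace_0[OF grading_subspace] by blast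
  have "Q (\<Sum>n\<in>I. component gr x n)" if "finite I" for I
    using that by induction (auto simp: Q0 intro: assms component_in)
  then have "Q (Sum_any (component gr x))"
    using component_finite by (simp add: Sum_any.expand_set)
  then show ?thesis by (simp flip: component_Sum_any)
qed

end

section \<open>Eigenspace decomposition\<close>

text \<open>Fourier average over the cyclic group generated by g, which is the projection onto an
  eigenspace once g^T = 1.\<close>

definition eigenproj :: "('v::complex_vs \<Rightarrow> 'v) \<Rightarrow> nat \<Rightarrow> nat \<Rightarrow> 'v \<Rightarrow> 'v" where
  "eigenproj g T r a = (\<Sum>j<T. (cis (- (2 * pi * real (r * j) / real T)) / of_nat T) *\<^sub>C (g ^^ j) a)"

lemma sum_roots_of_unity:
  assumes "T > 0" "w ^ T = 1" "w \<noteq> (1::complex)"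
  shows "(\<Sum>j<T. w ^ j) = 0"
  using geometric_sum[OF assms(3), of T] assms by simp

lemma cis_full_turn: "cis (2 * pi * real r / real T * real T) = 1" if "T > 0"
  using that cis_multiple_2pi[of "real r"] by (simp add: mult_ac)

lemma root_unity_eq_1:
  assumes "T > 0" "cis (2 * pi * (real r - real r') / real T) = 1" "r < T" "r' < T"
  shows "r = r'"
proof -
  have "cos (2 * pi * (real r - real r') / real T) = 1"
    using assms(2) by (metis Re_complex_of_real cis.sel(1) of_real_1)
  then obtain n :: int where "2 * pi * (real r - real r') / real T = n * 2 * pi"
    by (auto simp: cos_one_2pi_int)
  then have "(2 * pi) * ((real r - real r') / real T) = (2 * pi) * of_int n"
    by (simp add: mult_ac)
  then have "(real r - real r') / real T = of_int n" by (subst (asm) mult_left_cancel) auto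
  then have "real r - real r' = of_int n * real T"
    using assms(1) by (simp add: divide_eq_eq)
  then have "real_of_int (int r - int r') = real_of_int (n * int T)" by simp
  then have e: "int r - int r' = n * int T" by (simp only: of_int_eq_iff)
  have "\<bar>n * int T\<bar> < int T" using assms by (simp flip: e)
  then have "n = 0" using assms(1) by (simp add: abs_mult)
  then show ?thesis using e by simp
qed

context
  fixes V :: "'v::complex_vs voa_data" and g :: "'v \<Rightarrow> 'v" and T :: nat
  assumes voa: "voa V" and aut: "voa_automorphism V g" and T: "T > 0" and gT: "g ^^ T = id"
begin

lemma g_linear: "clinear g"
  using aut by (simp add: voa_automorphism_def)

lemma g_iter_linear: "clinear (g ^^ j)"
  by (induction j) (auto intro: clinearI clinear_compose[OF g_linear, unfolded o_def] simp: o_def)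

lemma eigenproj_linear: "clinear (eigenproj g T r)"
  unfolding eigenproj_def by (intro clinear_sum_fun clinear_const_scale g_iter_linear)

lemma eigenproj_in: "eigenproj g T r a \<in> eigensp g T r"
proof -
  define z where "z j = cis (- (2 * pi * real (r * j) / real T))" for j :: nat
  have z: "z j = cis (2 * pi * real r / real T) * z (Suc j)" for j
    by (simp add: z_def cis_mult ring_distribs add_divide_distrib)
  define h where "h j = (z j / of_nat T) *\<^sub>C (g ^^ j) a" for j
  have hT: "h T = h 0"
  proof -
    have "z T = cnj (cis (2 * pi * real r / real T * real T))"
      using T by (simp add: z_def cis_cnj mult_ac)
    then have "z T = 1" using cis_full_turn[OF T, of r] by simp
    then show ?thesis using gT by (simp add: h_def z_def)
  qed
  have e: "eigenproj g T r a = (\<Sum>j<T. h j)"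
    by (simp add: eigenproj_def h_def z_def)
  have "g (h j) = cis (2 * pi * real r / real T) *\<^sub>C h (Suc j)" for j
    unfolding h_def clinear_scale[OF g_linear] scaleC_scaleC by (subst z[of j]) simp
  then have "g (eigenproj g T r a) = (\<Sum>j<T. cis (2 * pi * real r / real T) *\<^sub>C h (Suc j))"
    by (simp add: e clinear_sum[OF g_linear])
  also have "(\<Sum>j<T. cis (2 * pi * real r / real T) *\<^sub>C h (Suc j)) =
      cis (2 * pi * real r / real T) *\<^sub>C (\<Sum>j<T. h (Suc j))"
    by (simp add: sum_scaleC_right)
  also have "(\<Sum>j<T. h (Suc j)) = (\<Sum>j<T. h j)"
    using sum.lessThan_Suc_shift[of h T] sum.lessThan_Suc[of h T] hT by (simp add: add.commute)
  finally show ?thesis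
    by (simp add: eigensp_def e)
qed

lemma g_iter_eigen: "a \<in> eigensp g T r \<Longrightarrow> (g ^^ j) a = cis (2 * pi * real (r * j) / real T) *\<^sub>C a"
proof (induction j)
  case (Suc j)
  then have "(g ^^ Suc j) a = cis (2 * pi * real (r * j) / real T) *\<^sub>C cis (2 * pi * real r / real T) *\<^sub>C a"
    by (simp add: clinear_scale[OF g_linear] eigensp_def)
  then show ?case by (simp add: scaleC_scaleC cis_mult ring_distribs add_divide_distrib add.commute)
qed (simp add: scaleC_one)

lemma eigenproj_eigen:
  assumes "a \<in> eigensp g T r'" "r < T" "r' < T"
  shows "eigenproj g T r a = (if r = r' then a else 0)"
proof -
  define w where "w = cis (2 * pi * (real r' - real r) / real T)"
  have *: "cis (- (2 * pi * real (r * j) / real T)) * cis (2 * pi * real (r' * j) / real T) = w ^ j" for j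
    by (simp add: w_def cis_mult Complex.DeMoivre algebra_simps diff_divide_distrib)
  have "eigenproj g T r a = (\<Sum>j<T. (w ^ j / of_nat T) *\<^sub>C a)"
    unfolding eigenproj_def
    by (intro sum.cong refl) (simp add: g_iter_eigen[OF assms(1)] scaleC_scaleC * [symmetric])
  also have "\<dots> = ((\<Sum>j<T. w ^ j) / of_nat T) *\<^sub>C a"
    by (simp add: complex_vs.scale_sum_left sum_divide_distrib)
  finally have e: "eigenproj g T r a = ((\<Sum>j<T. w ^ j) / of_nat T) *\<^sub>C a" .
  show ?thesis
  proof (cases "r = r'")
    case True
    then show ?thesis using e T by (simp add: w_def scaleC_one)
  next
    case False
    then have "w \<noteq> 1" using root_unity_eq_1[OF T _ assms(3,2)] by (auto simp: w_def)
    moreover have "w ^ T = 1"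
    proof -
      have "w ^ T = cis (2 * pi * (real_of_int (int r' - int r)))"
        using T by (simp add: w_def Complex.DeMoivre)
      then show ?thesis using cis_multiple_2pi[of "real_of_int (int r' - int r)"] by simp
    qed
    ultimately have "(\<Sum>j<T. w ^ j) = 0" using sum_roots_of_unity T by blast
    then show ?thesis using False e by (simp add: complex_vs.scale_zero_left)
  qed
qed

lemma eigenproj_sum: "(\<Sum>r<T. eigenproj g T r a) = a"
proof -
  have "(\<Sum>r<T. eigenproj g T r a) =
      (\<Sum>j<T. (\<Sum>r<T. cis (- (2 * pi * real (r * j) / real T)) / of_nat T) *\<^sub>C (g ^^ j) a)"
    unfolding eigenproj_def by (subst sum.swap) (simp add: complex_vs.scale_sum_left)
  also have "\<dots> = (\<Sum>j\<in>{0}. (\<Sum>r<T. cis (- (2 * pi * real (r * j) / real T)) / of_nat T) *\<^sub>C (g ^^ j) a)"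
  proof (rule sum.mono_neutral_right)
    show "\<forall>j\<in>{..<T} - {0}. (\<Sum>r<T. cis (- (2 * pi * real (r * j) / real T)) / of_nat T) *\<^sub>C (g ^^ j) a = 0"
    proof
      fix j assume j: "j \<in> {..<T} - {0}"
      define w where "w = cis (2 * pi * (real 0 - real j) / real T)"
      have "cis (- (2 * pi * real (r * j) / real T)) = w ^ r" for r
        by (simp add: w_def Complex.DeMoivre mult_ac)
      moreover have "w \<noteq> 1" using root_unity_eq_1[OF T, of 0 j] j by (auto simp: w_def)
      moreover have "w ^ T = 1"
      proof -
        have "w ^ T = cis (2 * pi * (real_of_int (- int j)))"
          using T by (simp add: w_def Complex.DeMoivre)
        then show ?thesis using cis_multiple_2pi[of "real_of_int (- int j)"] by simp
      qed
      ultimately have "(\<Sum>r<T. cis (- (2 * pi * real (r * j) / real T))) = 0"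
        using sum_roots_of_unity[OF T] by simp
      then show "(\<Sum>r<T. cis (- (2 * pi * real (r * j) / real T)) / of_nat T) *\<^sub>C (g ^^ j) a = 0"
        by (simp flip: sum_divide_distrib add: complex_vs.scale_zero_left)
    qed
  qed (use T in auto)
  also have "\<dots> = a" using T by (simp add: scaleC_one)
  finally show ?thesis .
qed

text \<open>The space V_k is the full k-eigenspace of L_0: on the component of degree d the operator
  is d, so the components with d different from k vanish. This serves to show that g preserves
  weights, which is not part of the notion of automorphism but follows because g fixes the conformal
  vector.\<close>

lemma L0_eigen_in_grade:
  assumes "Vir V (mode V) 0 x = of_nat k *\<^sub>C x"
  shows "x \<in> grade V k"
proof -
  note gr = voa_grading[OF voa]
  interpret wmod V "mode V" by unfold_locales (rule voa_weak_module[OF voa])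
  let ?c = "component (grade V) x"
  have L0: "clinear (Vir V (mode V) 0)"
    using linear_right[of "conf V" 1] by (simp add: Vir_def[abs_def])
  have "component (grade V) (Vir V (mode V) 0 x) = (\<lambda>d. of_nat d *\<^sub>C ?c d)"
  proof (rule component_unique[OF gr])
    have "Vir V (mode V) 0 x = Sum_any (\<lambda>d. Vir V (mode V) 0 (?c d))"
      by (subst clinear_Sum_any[OF L0, symmetric])
         (simp_all add: component_finite[OF gr] component_Sum_any[OF gr, symmetric])
    then have "Vir V (mode V) 0 x = Sum_any (\<lambda>d. of_nat d *\<^sub>C ?c d)"
      using voa_L0[OF voa component_in[OF gr]] by simp
    moreover have "finite {d. of_nat d *\<^sub>C ?c d \<noteq> 0}"
      by (rule finite_subset[OF _ component_finite[OF gr, of x]]) (auto simp: complex_vs.scale_zero_right)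
    ultimately show "is_decomposition (grade V) (Vir V (mode V) 0 x) (\<lambda>d. of_nat d *\<^sub>C ?c d)"
      using complex_vs.subspace_scale[OF grading_subspace[OF gr] component_in[OF gr]]
      by (auto simp: is_decomposition_def)
  qed
  moreover have "component (grade V) (Vir V (mode V) 0 x) d = of_nat k *\<^sub>C ?c d" for d
    unfolding assms by (rule clinear_scale[OF component_linear[OF gr]])
  ultimately have e: "of_nat k *\<^sub>C ?c d = of_nat d *\<^sub>C ?c d" for d by metis
  have z: "?c d = 0" if "d \<noteq> k" for d
  proof -
    have "(of_nat k - of_nat d) *\<^sub>C ?c d = 0"
      using e[of d] by (simp add: complex_vs.scale_left_diff_distrib)
    then show ?thesis using that by simp
  qed
  have "x = Sum_any ?c" by (rule component_Sum_any[OF gr])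
  also have "\<dots> = ?c k" by (subst Sum_any_superset[of "{k}"]) (use z in auto)
  finally show ?thesis using component_in[OF gr, of x k] by simp
qed

lemma g_grade: assumes "a \<in> grade V k" shows "g a \<in> grade V k"
proof (rule L0_eigen_in_grade)
  have "Vir V (mode V) 0 (g a) = g (Vir V (mode V) 0 a)"
    using aut by (simp add: Vir_def voa_automorphism_def)
  then show "Vir V (mode V) 0 (g a) = of_nat k *\<^sub>C g a"
    using voa_L0[OF voa assms] clinear_scale[OF g_linear] by simp
qed

lemma eigenproj_grade: assumes "a \<in> grade V k" shows "eigenproj g T r a \<in> grade V k"
proof -
  have "(g ^^ j) a \<in> grade V k" for j
    by (induction j) (auto simp: assms g_grade)
  then show ?thesis
    unfolding eigenproj_def
    using grading_subspace[OF voa_grading[OF voa]]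
    by (intro complex_vs.subspace_sum complex_vs.subspace_scale) auto
qed

text \<open>The recursive formulas are stated only for vectors homogeneous for both the weight and
  g, and such vectors span V. The sums are taken over nonempty index sets, so additivity is
  enough.\<close>

lemma homogeneous_induct:
  assumes "\<And>k r a. r < T \<Longrightarrow> a \<in> grade V k \<inter> eigensp g T r \<Longrightarrow> Q a"
    and "\<And>a b. Q a \<Longrightarrow> Q b \<Longrightarrow> Q (a + b)"
  shows "Q a"
proof (rule graded_induct[OF voa_grading[OF voa]])
  fix k a assume a: "a \<in> grade V k"
  have "Q (\<Sum>r\<in>I. eigenproj g T r a)" if "finite I" "I \<subseteq> {..<T}" "I \<noteq> {}" for I
    using that(1,3,2)
  proof (induction I rule: finite_ne_induct)
    case (insert r I)
    then show ?case
      using assms(1)[of r "eigenproj g T r a" k] assms(2) eigenproj_grade[OF a] eigenproj_in by auto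
  qed (use assms(1)[of _ _ k] eigenproj_grade[OF a] eigenproj_in in auto)
  from this[of "{..<T}"] show "Q a" using T by (auto simp: eigenproj_sum)
qed (rule assms(2))

end

section \<open>The residue theorem for a function with prescribed principal parts\<close>

text \<open>The test function z^(K/T) / (z - z_p)^j.\<close>

definition kernel :: "nat \<Rightarrow> int \<Rightarrow> complex \<Rightarrow> nat \<Rightarrow> complex \<Rightarrow> complex" where
  "kernel T K p j = (\<lambda>x. x powi K * inverse (x ^ T - p ^ T) ^ j)"

text \<open>As a function of x this is F_(K/T,0), with its first point at s and its second at x: a
  Cauchy kernel twisted by z^(K/T).\<close>

definition cauchy_kernel :: "nat \<Rightarrow> int \<Rightarrow> complex \<Rightarrow> complex \<Rightarrow> complex" where
  "cauchy_kernel T K s = (\<lambda>x. - (s powi (- K)) * kernel T K s 1 x)"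

lemma expands_kernel_away:
  assumes "T > 0" "q \<noteq> 0" "p ^ T \<noteq> q ^ T"
  shows "expands T q (kernel T K p j) (fps_to_fls (power_fps T K q * geom_fps (q ^ T - p ^ T) j))"
  unfolding kernel_def fls_times_fps_to_fls
  by (intro expands_mult expands_coord expands_pole_away assms)

lemma expands_kernel_at:
  assumes "T > 0" "q \<noteq> 0" "p ^ T = q ^ T"
  shows "expands T q (kernel T K p j) (fps_to_fls (power_fps T K q) * fls_X_intpow (- int j))"
  unfolding kernel_def by (intro expands_mult expands_coord expands_pole_at assms)

lemma expands_cauchy_kernel:
  assumes "T > 0" "q \<noteq> 0" "s ^ T \<noteq> q ^ T"
  shows "expands T q (cauchy_kernel T K s)
    (fls_const (- (s powi (- K))) * fps_to_fls (power_fps T K q * geom_fps (q ^ T - s ^ T) 1))"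
  unfolding cauchy_kernel_def by (intro expands_cmult expands_kernel_away assms)

text \<open>Up to sign both sides are (j+m-1 over m). The identity compares the coefficient of index
  m of (z - z_p)^(-j) at z_q with the coefficient of index j-1 of (z - z_q)^(-m-1) at z_p. It is the
  residue theorem for a product of two such poles, and the only form in which that theorem is
  needed.\<close>

lemma gbinomial_negated_swap:
  assumes "j \<ge> 1"
  shows "(- 1) ^ (j + m) * ((- of_nat j) gchoose m) = - ((- of_nat m - 1 :: complex) gchoose (j - 1))"
proof -
  obtain i where i: "j = Suc i" using assms by (cases j) auto
  have "((- of_nat j) gchoose m) = (- 1) ^ m * (of_nat (i + m) gchoose m :: complex)"
    using gbinomial_minus[of "of_nat j" m] by (simp add: i algebra_simps)
  moreover have "((- of_nat m - 1 :: complex) gchoose i) = (- 1) ^ i * (of_nat (i + m) gchoose i)"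
  proof -
    have "(- of_nat m - 1 :: complex) = - (of_nat m + 1)" by simp
    moreover have "(of_nat m + 1 + of_nat i - 1 :: complex) = of_nat (i + m)" by simp
    ultimately show ?thesis using gbinomial_minus[of "of_nat m + 1 :: complex" i] by metis
  qed
  moreover have "(of_nat (i + m) gchoose m :: complex) = of_nat (i + m) gchoose i"
    using binomial_symmetric[of m "i + m"] unfolding binomial_gbinomial[symmetric] by simp
  ultimately show ?thesis
    by (simp add: i power_add algebra_simps flip: power_mult_distrib)
qed

lemma fps_times_fls_residue:
  fixes B :: "complex fls"
  assumes "\<And>m. m \<ge> M \<Longrightarrow> B $$ (- int m - 1) = 0"
  shows "(fps_to_fls F * B) $$ (- 1) = (\<Sum>m<M. F $ m * B $$ (- int m - 1))"
proof -
  have below: "B $$ n = 0" if "n < - int M" for n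
    using assms[of "nat (- n - 1)"] that by simp
  have "(fps_to_fls F * B) $$ (- 1) =
    (\<Sum>i=fls_subdegree (fps_to_fls F)..- 1 - fls_subdegree B. fps_to_fls F $$ i * B $$ (- 1 - i))"
    by (rule fls_times_nth(2))
  also have "\<dots> = (\<Sum>i\<in>int ` {..<M} \<inter> {fls_subdegree (fps_to_fls F)..- 1 - fls_subdegree B}.
      fps_to_fls F $$ i * B $$ (- 1 - i))"
  proof (rule sum.mono_neutral_right)
    show "\<forall>i\<in>{fls_subdegree (fps_to_fls F)..- 1 - fls_subdegree B} - int ` {..<M} \<inter>
        {fls_subdegree (fps_to_fls F)..- 1 - fls_subdegree B}. fps_to_fls F $$ i * B $$ (- 1 - i) = 0"
    proof
      fix i assume "i \<in> {fls_subdegree (fps_to_fls F)..- 1 - fls_subdegree B} - int ` {..<M} \<inter>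
        {fls_subdegree (fps_to_fls F)..- 1 - fls_subdegree B}"
      then have "i \<notin> int ` {..<M}" by auto
      then have "i < 0 \<or> i \<ge> int M" by (metis image_eqI lessThan_iff nat_0_le nat_less_iff not_less)
      then show "fps_to_fls F $$ i * B $$ (- 1 - i) = 0" using below by auto
    qed
  qed auto
  also have "\<dots> = (\<Sum>i\<in>int ` {..<M}. fps_to_fls F $$ i * B $$ (- 1 - i))"
  proof (rule sum.mono_neutral_left)
    show "\<forall>i\<in>int ` {..<M} - int ` {..<M} \<inter> {fls_subdegree (fps_to_fls F)..- 1 - fls_subdegree B}.
      fps_to_fls F $$ i * B $$ (- 1 - i) = 0"
    proof
      fix i assume "i \<in> int ` {..<M} - int ` {..<M} \<inter> {fls_subdegree (fps_to_fls F)..- 1 - fls_subdegree B}"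
      then have "i < fls_subdegree (fps_to_fls F) \<or> - 1 - i < fls_subdegree B" by auto
      then show "fps_to_fls F $$ i * B $$ (- 1 - i) = 0"
        using fls_eq0_below_subdegree by (metis mult_zero_left mult_zero_right)
    qed
  qed auto
  also have "\<dots> = (\<Sum>m<M. F $ m * B $$ (- int m - 1))"
    by (simp add: sum.reindex minus_diff_commute)
  finally show ?thesis .
qed

text \<open>If the principal parts of \<open>G\<close> at the points \<open>q i\<close> are those of the series \<open>W i\<close>, then
  \<open>G\<close> has the full expansion \<open>W i0\<close> at \<open>q i0\<close> iff the residues of \<open>G\<close> times the kernels
  with poles at \<open>q i0\<close> sum to zero.\<close>

lemma expands_iff_residue_sums:
  fixes q :: "'i \<Rightarrow> complex" and W :: "'i \<Rightarrow> complex fls"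
  assumes T: "T > 0" and I: "finite I" and q0: "\<And>i. i \<in> I \<Longrightarrow> q i \<noteq> 0"
    and inj: "inj_on (\<lambda>i. q i ^ T) I" and i0: "i0 \<in> I"
  shows "expands T (q i0) (\<lambda>s. \<beta> * (s powi (- K) * inverse (s ^ T))
        + (\<Sum>i\<in>I. (expansion T (q i) (cauchy_kernel T K s) * W i) $$ (- 1))) (W i0)
    \<longleftrightarrow> (\<forall>j\<ge>1. (\<Sum>i\<in>I. (expansion T (q i) (kernel T K (q i0) j) * W i) $$ (- 1))
        + \<beta> * (- (q i0 ^ T)) powi (- int j) = 0)"
proof -
  let ?p = "q i0"
  \<comment> \<open>Multiplication by z^(K/T) makes everything rational in z: \<open>B i\<close> is
    the series of z^(K/T) W_i at the point q_i.\<close>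
  define A where "A i = power_fps T K (q i)" for i
  define B where "B i = fps_to_fls (A i) * W i" for i
  define z where "z i = q i ^ T" for i
  have p: "?p \<noteq> 0" using q0 i0 by blast
  have zne: "z i \<noteq> z i0" if "i \<in> I - {i0}" for i
    using inj i0 that by (auto simp: z_def inj_on_def)
  have "\<exists>N. \<forall>m\<ge>N. B i $$ (- int m - 1) = 0" for i
    by (rule exI[of _ "nat (- fls_subdegree (B i))"]) auto
  then obtain N where N: "\<And>i m. m \<ge> N i \<Longrightarrow> B i $$ (- int m - 1) = 0" by metis
  define M where "M = Max (insert 0 (N ` I))"
  have M: "B i $$ (- int m - 1) = 0" if "i \<in> I" "m \<ge> M" for i m
    using that I N[of i m] Max_ge[of "insert 0 (N ` I)" "N i"] by (auto simp: M_def)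
  \<comment> \<open>The partial fraction in z with the principal parts of the \<open>B i\<close> and
    residue beta at 0. The pole at 0 is written with \<open>0 ^ T\<close> in order to have the same
    shape as the other poles.\<close>
  define R where "R s = \<beta> * inverse (s ^ T - 0 ^ T) ^ 1
      + (\<Sum>i\<in>I. \<Sum>m<M. B i $$ (- int m - 1) * inverse (s ^ T - q i ^ T) ^ Suc m)" for s
  define G where "G s = \<beta> * (s powi (- K) * inverse (s ^ T))
        + (\<Sum>i\<in>I. (expansion T (q i) (cauchy_kernel T K s) * W i) $$ (- 1))" for s
  have geom_nth: "geom_fps c j $ i = ((- of_nat j) gchoose i) * inverse c ^ (j + i)" for c j i
    by (simp add: geom_fps_def)
  have geom1: "geom_fps (- c) 1 $ m = - (inverse c ^ Suc m)" for c m
  proof -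
    have "((- 1) gchoose m) = (- 1 :: complex) ^ m"
      using gbinomial_minus[of "1 :: complex" m] by (simp flip: binomial_gbinomial)
    moreover have "inverse (- c) ^ (1 + m) = (- 1) ^ Suc m * inverse c ^ Suc m"
      by (metis inverse_minus_eq plus_1_eq_Suc power_minus)
    ultimately show ?thesis
      by (simp add: geom_fps_def del: power_Suc) (simp flip: power_mult_distrib)
  qed
  have GR: "G s = s powi (- K) * R s" if s: "s \<in> punctured T (q ` I)" for s
  proof -
    have "(expansion T (q i) (cauchy_kernel T K s) * W i) $$ (- 1) =
       s powi (- K) * (\<Sum>m<M. B i $$ (- int m - 1) * inverse (s ^ T - q i ^ T) ^ Suc m)" if i: "i \<in> I" for i
    proof -
      have ne: "s ^ T \<noteq> q i ^ T" using s i by (auto simp: punctured_def)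
      let ?g = "geom_fps (- (s ^ T - q i ^ T)) 1"
      have "expansion T (q i) (cauchy_kernel T K s) * W i = fls_const (- (s powi (- K))) * (fps_to_fls ?g * B i)"
        by (subst expansion_eq[OF expands_cauchy_kernel[OF T q0[OF i] ne]])
           (simp add: B_def A_def fls_times_fps_to_fls mult_ac)
      also have "\<dots> $$ (- 1) = - (s powi (- K)) * (\<Sum>m<M. ?g $ m * B i $$ (- int m - 1))"
        using fps_times_fls_residue[of M "B i" ?g] M[OF i] by simp
      finally show ?thesis
        by (simp only: geom1) (simp add: sum_negf sum_distrib_left mult_ac)
    qed
    moreover have "(0::complex) ^ T = 0" using T by simp
    ultimately show ?thesis
      by (simp add: G_def R_def distrib_left sum_distrib_left mult_ac)
  qed
  define LR where "LR = fls_const \<beta> * fps_to_fls (geom_fps (?p ^ T - 0 ^ T) 1)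
      + (\<Sum>i\<in>I. \<Sum>m<M. fls_const (B i $$ (- int m - 1)) *
          (if i = i0 then fls_X_intpow (- int (Suc m)) else fps_to_fls (geom_fps (?p ^ T - q i ^ T) (Suc m))))"
  have R: "expands T ?p R LR"
    unfolding R_def LR_def
  proof (intro expands_add expands_cmult expands_sum)
    show "expands T ?p (\<lambda>s. inverse (s ^ T - 0 ^ T) ^ 1) (fps_to_fls (geom_fps (?p ^ T - 0 ^ T) 1))"
      by (rule expands_pole_away) (use T p in \<open>auto simp: power_0_left\<close>)
    fix i m assume "i \<in> I"
    then show "expands T ?p (\<lambda>s. inverse (s ^ T - q i ^ T) ^ Suc m)
      (if i = i0 then fls_X_intpow (- int (Suc m)) else fps_to_fls (geom_fps (?p ^ T - q i ^ T) (Suc m)))"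
      using expands_pole_at[OF T p, of "q i" "Suc m"] expands_pole_away[OF T p, of "q i" "Suc m"] zne[of i]
      by (auto simp: z_def simp del: power_Suc)
  qed
  have G: "expands T ?p G (fps_to_fls (power_fps T (- K) ?p) * LR)"
    using expands_mult[OF expands_coord[OF T p, of "- K"] R]
    by (subst expands_cong[of "q ` I", OF _ T p GR]) (use I in auto)
  have inv: "fps_to_fls (power_fps T (- K) ?p) * fps_to_fls (A i0) = 1"
  proof -
    have "expands T ?p (\<lambda>s. s powi (- K) * s powi K) (fps_to_fls (power_fps T (- K) ?p) * fps_to_fls (A i0))"
      unfolding A_def by (intro expands_mult expands_coord T p)
    moreover have "expands T ?p (\<lambda>s. s powi (- K) * s powi K) (fls_const 1)"
    proof (subst expands_cong[of "{}" T ?p _ "\<lambda>_. 1"])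
      show "s powi - K * s powi K = 1" if "s \<in> punctured T {}" for s
        using that by (simp add: punctured_def power_int_minus)
      show "expands T ?p (\<lambda>_. 1) (fls_const 1)" by (rule expands_const)
    qed (use T p in auto)
    ultimately show ?thesis using expands_unique by fastforce
  qed
  define D where "D j = (\<Sum>i\<in>I. (expansion T (q i) (kernel T K ?p j) * W i) $$ (- 1))
        + \<beta> * (- (?p ^ T)) powi (- int j)" for j
  \<comment> \<open>The polar parts at p agree by construction, so only the coefficients of Z^(j-1)
    with j at least 1 remain to be compared.\<close>
  have neg: "LR $$ n = B i0 $$ n" if "n < 0" for n
  proof -
    have "LR $$ n = (\<Sum>i\<in>I. \<Sum>m<M. if i = i0 \<and> n = - int (Suc m) then B i0 $$ n else 0)"
      unfolding LR_def using that
      by (simp add: fls_sum_nth) (intro sum.cong refl, auto simp: minus_diff_commute)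
    also have "\<dots> = (\<Sum>i\<in>{i0}. \<Sum>m<M. if i = i0 \<and> n = - int (Suc m) then B i0 $$ n else 0)"
      using i0 I by (intro sum.mono_neutral_right) auto
    also have "\<dots> = B i0 $$ n"
    proof -
      define k where "k = nat (- n - 1)"
      have n: "n = - int (Suc k)" using that by (simp add: k_def)
      have "(\<Sum>m<M. if k = m then B i0 $$ n else 0) = B i0 $$ n"
        using M[OF i0, of k] by (simp add: n minus_diff_commute not_less)
      then show ?thesis by (simp add: n)
    qed
    finally show ?thesis .
  qed
  \<comment> \<open>The coefficient of Z^(j-1) in \<open>B i0\<close> is its own contribution to the
    residue sum of order j. The other points contribute with opposite sign by the binomial symmetry,
    and beta/z yields the term at 0.\<close>
  have pos: "LR $$ (int j - 1) - B i0 $$ (int j - 1) = - D j" if j: "j \<ge> 1" for j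
  proof -
    have jn: "nat (int j - 1) = j - 1" using j by simp
    have "LR $$ (int j - 1) = \<beta> * geom_fps (?p ^ T) 1 $ (j - 1)
        + (\<Sum>i\<in>I. \<Sum>m<M. if i = i0 then 0 else B i $$ (- int m - 1) * geom_fps (?p ^ T - q i ^ T) (Suc m) $ (j - 1))"
      unfolding LR_def using j T
      by (simp add: fls_sum_nth jn power_0_left) (intro sum.cong refl, auto simp: jn)
    also have "(\<Sum>i\<in>I. \<Sum>m<M. if i = i0 then 0 else B i $$ (- int m - 1) * geom_fps (?p ^ T - q i ^ T) (Suc m) $ (j - 1))
       = (\<Sum>i\<in>I-{i0}. \<Sum>m<M. B i $$ (- int m - 1) * geom_fps (?p ^ T - q i ^ T) (Suc m) $ (j - 1))"
      using I by (intro sum.mono_neutral_cong_right) auto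
    also have "\<dots> = (\<Sum>i\<in>I-{i0}. - (expansion T (q i) (kernel T K ?p j) * W i) $$ (- 1))"
    proof (intro sum.cong refl)
      fix i assume i: "i \<in> I - {i0}"
      then have ne: "?p ^ T \<noteq> q i ^ T" and qi: "q i \<noteq> 0" using zne[of i] q0 by (auto simp: z_def)
      have "(expansion T (q i) (kernel T K ?p j) * W i) = fps_to_fls (geom_fps (q i ^ T - ?p ^ T) j) * B i"
        by (subst expansion_eq[OF expands_kernel_away[OF T qi ne]])
           (simp add: B_def A_def fls_times_fps_to_fls mult_ac)
      then have "(expansion T (q i) (kernel T K ?p j) * W i) $$ (- 1)
          = (\<Sum>m<M. geom_fps (q i ^ T - ?p ^ T) j $ m * B i $$ (- int m - 1))"
        using fps_times_fls_residue[of M "B i"] M i by auto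
      moreover have "geom_fps (q i ^ T - ?p ^ T) j $ m = - geom_fps (?p ^ T - q i ^ T) (Suc m) $ (j - 1)" for m
      proof -
        let ?c = "inverse (?p ^ T - q i ^ T)"
        have c: "inverse (q i ^ T - ?p ^ T) = - ?c"
          by (metis inverse_minus_eq minus_diff_eq)
        have "geom_fps (q i ^ T - ?p ^ T) j $ m = ((- 1) ^ (j + m) * ((- of_nat j) gchoose m)) * ?c ^ (j + m)"
          unfolding geom_fps_def c by (simp add: power_minus[of ?c] mult_ac)
        also have "\<dots> = - (((- of_nat m - 1) gchoose (j - 1)) * ?c ^ (j + m))"
          by (simp add: gbinomial_negated_swap[OF j])
        also have "j + m = Suc m + (j - 1)" using j by simp
        also have "(- of_nat m - 1 :: complex) = - of_nat (Suc m)" by simp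
        finally show ?thesis by (simp only: geom_nth fps_neg_nth)
      qed
      ultimately show "(\<Sum>m<M. B i $$ (- int m - 1) * geom_fps (?p ^ T - q i ^ T) (Suc m) $ (j - 1))
         = - (expansion T (q i) (kernel T K ?p j) * W i) $$ (- 1)"
        by (simp add: sum_negf mult_ac)
    qed
    finally have L: "LR $$ (int j - 1) = \<beta> * geom_fps (?p ^ T) 1 $ (j - 1)
        - (\<Sum>i\<in>I-{i0}. (expansion T (q i) (kernel T K ?p j) * W i) $$ (- 1))"
      by (simp add: sum_negf)
    have "expansion T ?p (kernel T K ?p j) * W i0 = fls_X_intpow (- int j) * B i0"
      by (subst expansion_eq[OF expands_kernel_at[OF T p refl]]) (simp add: B_def A_def mult_ac)
    then have Bj: "(expansion T ?p (kernel T K ?p j) * W i0) $$ (- 1) = B i0 $$ (int j - 1)"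
      by (simp add: fls_shifted_times_simps)
    have "geom_fps (?p ^ T) 1 $ (j - 1) = - ((- (?p ^ T)) powi (- int j))"
      using geom1[of "- (?p ^ T)" "j - 1"] j
      by (simp add: power_int_minus flip: power_inverse inverse_minus_eq)
    then show ?thesis
      using L Bj sum.remove[OF I i0, of "\<lambda>i. (expansion T (q i) (kernel T K ?p j) * W i) $$ (- 1)"]
      by (simp add: D_def)
  qed
  have "expands T ?p G (W i0) \<longleftrightarrow> W i0 = fps_to_fls (power_fps T (- K) ?p) * LR"
  proof
    assume "expands T ?p G (W i0)"
    then show "W i0 = fps_to_fls (power_fps T (- K) ?p) * LR" by (rule expands_unique[OF _ G])
  next
    assume "W i0 = fps_to_fls (power_fps T (- K) ?p) * LR"
    then show "expands T ?p G (W i0)" using G by (simp only:)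
  qed
  also have "\<dots> \<longleftrightarrow> B i0 = LR"
  proof
    assume "W i0 = fps_to_fls (power_fps T (- K) ?p) * LR"
    then have "B i0 = (fps_to_fls (power_fps T (- K) ?p) * fps_to_fls (A i0)) * LR"
      unfolding B_def by (simp add: mult_ac)
    then show "B i0 = LR" by (simp add: inv)
  next
    assume "B i0 = LR"
    then have "fps_to_fls (power_fps T (- K) ?p) * LR = (fps_to_fls (power_fps T (- K) ?p) * fps_to_fls (A i0)) * W i0"
      unfolding B_def by (simp add: mult_ac)
    then show "W i0 = fps_to_fls (power_fps T (- K) ?p) * LR" by (simp add: inv)
  qed
  also have "\<dots> \<longleftrightarrow> (\<forall>j\<ge>1. D j = 0)"
  proof
    assume "B i0 = LR"
    then show "\<forall>j\<ge>1. D j = 0" using pos by simp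
  next
    assume D: "\<forall>j\<ge>1. D j = 0"
    show "B i0 = LR"
    proof (rule fls_eqI)
      fix n show "B i0 $$ n = LR $$ n"
      proof (cases "n < 0")
        case False
        then have "n = int (nat (n + 1)) - 1" by simp
        then show ?thesis using pos[of "nat (n + 1)"] D False by simp
      qed (simp add: neg)
    qed
  qed
  finally show ?thesis by (simp add: G_def[abs_def] D_def)
qed

section \<open>Systems of multilinear functions with a left recursion\<close>

lemma powi_in_curve_functions: "(\<lambda>x. x powi K) \<in> curve_functions T P"
proof -
  have pow: "f \<in> curve_functions T P \<Longrightarrow> (\<lambda>x. f x ^ n) \<in> curve_functions T P" for f n
    by (induction n) (auto intro: curve_functions.intros)
  show ?thesis
    using pow[OF cf_coord, of "nat K"] pow[OF cf_inverse, of "nat (- K)"]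
    by (cases "K \<ge> 0") (simp_all add: power_int_def)
qed

lemma power_in_curve_functions: "f \<in> curve_functions T P \<Longrightarrow> (\<lambda>x. f x ^ n) \<in> curve_functions T P"
  by (induction n) (auto intro: curve_functions.intros)

lemma kernel_in_curve_functions: "p \<in> P \<Longrightarrow> kernel T K p j \<in> curve_functions T P"
  unfolding kernel_def
  by (intro cf_mult powi_in_curve_functions power_in_curve_functions cf_pole)

lemma cauchy_kernel_in_curve_functions: "s \<in> P \<Longrightarrow> cauchy_kernel T K s \<in> curve_functions T P"
  unfolding cauchy_kernel_def by (intro cf_mult cf_const kernel_in_curve_functions)

lemma cauchy_kernel_eq: "cauchy_kernel T K s x = s powi (- K) * (x powi K / (s ^ T - x ^ T))"
proof -
  have "inverse (x ^ T - s ^ T) = - inverse (s ^ T - x ^ T)"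
    by (metis inverse_minus_eq minus_diff_eq)
  then show ?thesis by (simp add: cauchy_kernel_def kernel_def divide_inverse)
qed

text \<open>The numbers F_(n,i) are by definition the Taylor coefficients of the Cauchy kernel in
  its second point. This is what turns a recursive formula into an invariance expression with the
  Cauchy kernel as test function.\<close>

lemma expands_cauchy_F_fun:
  assumes "T > 0" "p \<noteq> 0" "s ^ T \<noteq> p ^ T"
  shows "expands T p (cauchy_kernel T K s) (fps_to_fls (Abs_fps (\<lambda>i. F_fun T K i s p)))"
proof -
  let ?f = "\<lambda>x. x powi K / (s ^ T - x ^ T)"
  have fin: "finite {s}" by simp
  have "?f holomorphic_on punctured T {s}"
    by (intro holomorphic_intros) (auto simp: punctured_def)
  moreover have "p \<in> punctured T {s}" using assms by (auto simp: punctured_def)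
  ultimately have "expands T p ?f (fps_to_fls (taylor T ?f p))"
    using expands_taylor[OF assms(1) open_punctured[OF fin assms(1)] zero_notin_punctured] by blast
  then have "expands T p (\<lambda>x. s powi (- K) * ?f x) (fls_const (s powi (- K)) * fps_to_fls (taylor T ?f p))"
    by (rule expands_cmult)
  moreover have "fls_const (s powi (- K)) * fps_to_fls (taylor T ?f p) =
      fps_to_fls (fps_const (s powi (- K)) * taylor T ?f p)"
    by (simp add: fls_times_fps_to_fls)
  moreover have "fps_const (s powi (- K)) * taylor T ?f p = Abs_fps (\<lambda>i. F_fun T K i s p)"
    by (simp add: fps_eq_iff taylor_def F_fun_def)
  ultimately show ?thesis by (simp add: cauchy_kernel_eq[abs_def])
qed

text \<open>Obtained by comparing two expansions of the Cauchy kernel. Holomorphy and rationality in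
  s can be read off from this form, but not from iterated derivatives in the other variable.\<close>

lemma F_fun_explicit:
  assumes "T > 0" "p \<noteq> 0" "s ^ T \<noteq> p ^ T"
  shows "F_fun T K i s p = - (s powi (- K)) *
    (\<Sum>m\<le>i. power_fps T K p $ m * (((- 1) gchoose (i - m)) * inverse (p ^ T - s ^ T) ^ (1 + (i - m))))"
proof -
  have "fps_to_fls (Abs_fps (\<lambda>i. F_fun T K i s p)) =
      fls_const (- (s powi (- K))) * fps_to_fls (power_fps T K p * geom_fps (p ^ T - s ^ T) 1)"
    by (rule expands_unique[OF expands_cauchy_F_fun[OF assms] expands_cauchy_kernel[OF assms]])
  from arg_cong[OF this, of "\<lambda>L. L $$ int i"]
  show ?thesis by (simp add: fps_mult_nth geom_fps_def atLeast0AtMost)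
qed

lemma F_fun_holomorphic:
  assumes "T > 0" "p \<noteq> 0" "p \<in> P"
  shows "(\<lambda>s. F_fun T K i s p) holomorphic_on punctured T P"
proof -
  have "(\<lambda>s. - (s powi (- K)) *
    (\<Sum>m\<le>i. power_fps T K p $ m * (((- 1) gchoose (i - m)) * inverse (p ^ T - s ^ T) ^ (1 + (i - m)))))
    holomorphic_on punctured T P"
    by (intro holomorphic_intros) (use assms(3) in \<open>auto simp: punctured_def\<close>)
  then show ?thesis
  proof (rule holomorphic_transform)
    show "- (s powi (- K)) * (\<Sum>m\<le>i. power_fps T K p $ m *
      (((- 1) gchoose (i - m)) * inverse (p ^ T - s ^ T) ^ (1 + (i - m)))) = F_fun T K i s p"
      if "s \<in> punctured T P" for s
      using that assms by (intro F_fun_explicit[symmetric]) (auto simp: punctured_def)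
  qed
qed

lemma config_Cons:
  "config T (s # ss) t \<longleftrightarrow> config T ss t \<and> s \<in> punctured T (insert t (set ss))"
  by (auto simp: config_def punctured_def image_iff)

lemma config_nonzero: "config T ss t \<Longrightarrow> t \<noteq> 0" "config T ss t \<Longrightarrow> s \<in> set ss \<Longrightarrow> s \<noteq> 0"
  by (auto simp: config_def)

locale twisted_datum =
  fixes V :: "'v::complex_vs voa_data" and g :: "'v \<Rightarrow> 'v" and T :: nat
    and M :: "('v, 'm::complex_vs) module_data"
    and U2 :: "'v set \<Rightarrow> 'u2::complex_vs \<Rightarrow> 'u2"
    and U3 :: "'u3::complex_vs \<Rightarrow> 'v set \<Rightarrow> 'u3"
    and h1 h2 h3 h :: complex
  assumes voa: "voa V" and aut: "voa_automorphism V g" and T: "T > 0" and gT: "g ^^ T = id"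
    and adm: "admissible_module V M" and conformal_weight: "has_conformal_weight V M h1"
    and left_module: "zhu_left_module V g T U2"
    and h2: "\<And>u. U2 (zhu_class V g T (conf V)) u = h2 *\<^sub>C u"
    and right_module: "zhu_right_module V g T U3"
    and h3: "\<And>u. U3 u (zhu_class V g T (conf V)) = h3 *\<^sub>C u"
    and h: "h = h1 + h2 - h3"
begin

abbreviation cls :: "'v \<Rightarrow> 'v set" where "cls a \<equiv> zhu_class V g T a"

sublocale VV: wmod V "mode V" by unfold_locales (rule voa_weak_module[OF voa])
sublocale MM: wmod V "act M" using adm by unfold_locales (simp add: admissible_module_def)

lemmas hom_induct = homogeneous_induct[OF voa aut T gT]

lemma mgrading: "direct_sum_grading (mgrade M)"
  using adm by (simp add: admissible_module_def)

lemma U2_linear: "clinear (U2 (cls a))" "clinear (\<lambda>a. U2 (cls a) u)"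
  and U3_linear: "clinear (\<lambda>u. U3 u (cls a))" "clinear (\<lambda>a. U3 w (cls a))"
  using left_module right_module by (simp_all add: zhu_left_module_def zhu_right_module_def)

text \<open>For nonzero r one has \<open>delta r = 0\<close>; with b the vacuum, the creation
  property leaves only i = 0 in the spanning element of O_g(V), and this term is a itself.\<close>

lemma zhu_class_twisted:
  assumes "r < T" "r \<noteq> 0" "a \<in> grade V k \<inter> eigensp g T r"
  shows "cls a = cls 0"
proof -
  have e: "Sum_any (\<lambda>i::nat. ((of_nat k - 1 + of_nat (delta r) + of_nat r / of_nat T) gchoose i) *\<^sub>C
        mode V a (int i - 1 - int (delta r)) (vac V)) = a"
    using voa_creation[OF voa] assms(2)
    by (subst Sum_any_superset[of "{0}"])
       (auto simp: delta_def complex_vs.scale_zero_right scaleC_one)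
  have "a \<in> zhu_O V g T"
    unfolding zhu_O_def
    by (rule complex_vs.span_base, rule CollectI, intro exI conjI, rule e[symmetric]) (rule assms)+
  then have "b - a \<in> zhu_O V g T \<longleftrightarrow> b \<in> zhu_O V g T" for b
    unfolding zhu_O_def
    using complex_vs.span_diff[of b _ a] complex_vs.span_add[of "b - a" _ a] by auto
  then show ?thesis by (simp add: zhu_class_def)
qed

lemma twisted_acts_zero:
  assumes "r < T" "r \<noteq> 0" "a \<in> grade V k \<inter> eigensp g T r"
  shows "U2 (cls a) u = 0" "U3 w (cls a) = 0"
  using clinear_0[OF U2_linear(2)] clinear_0[OF U3_linear(2)] zhu_class_twisted[OF assms] by auto

end

section \<open>The invariance functional of a multilinear system\<close>

locale multilinear_system = twisted_datum V g T M U2 U3 h1 h2 h3 h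
  for V :: "'v::complex_vs voa_data" and g :: "'v \<Rightarrow> 'v" and T :: nat
    and M :: "('v, 'm::complex_vs) module_data"
    and U2 :: "'v set \<Rightarrow> 'u2::complex_vs \<Rightarrow> 'u2"
    and U3 :: "'u3::complex_vs \<Rightarrow> 'v set \<Rightarrow> 'u3"
    and h1 h2 h3 h :: complex +
  fixes S :: "('v, 'm, 'u3, 'u2) correlation"
  assumes multilinear: "cor_multilinear T S"
begin

lemma S_linear: "clinear (\<lambda>u3. S u3 xs (v, t) u2)" "clinear (\<lambda>v. S u3 xs (v, t) u2)"
    "clinear (\<lambda>u2. S u3 xs (v, t) u2)"
  and S_linear_mid: "clinear (\<lambda>a. S u3 (xs @ (a, s) # ys) vq u2)"
  and S_off: "\<not> config T (map snd xs) t \<Longrightarrow> S u3 xs (v, t) u2 = 0"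
  using multilinear unfolding cor_multilinear_def trilinear_def by blast+

lemma S_linear_first: "clinear (\<lambda>a. S u3 ((a, s) # ys) vq u2)"
  using S_linear_mid[of u3 "[]"] by simp

lemma S_linear_entry: "l < length xs \<Longrightarrow> clinear (\<lambda>a. S u3 (xs[l := (a, s)]) vq u2)"
  using S_linear_mid[of u3 "take l xs" s "drop (Suc l) xs" vq u2]
  by (simp add: upd_conv_take_nth_drop)

text \<open>The invariance condition for $b\otimes f\,dz$; \<open>\<alpha>\<close> and \<open>\<beta>\<close> are the coefficients of the
  actions on $U^3$ and $U^2$.\<close>

definition J :: "'v \<Rightarrow> (complex \<Rightarrow> complex) \<Rightarrow> complex \<Rightarrow> complex \<Rightarrow> 'u3 \<Rightarrow> ('v \<times> complex) list \<Rightarrow> 'm \<Rightarrow> complex \<Rightarrow> 'u2 \<Rightarrow> complex" where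
  "J b f \<alpha> \<beta> u3 xs v t u2 = \<alpha> * S (U3 u3 (cls b)) xs (v, t) u2
    + (\<Sum>l<length xs. S u3 (xs[l := (smear (mode V) (expansion T (snd (xs ! l)) f) b (fst (xs ! l)), snd (xs ! l))]) (v, t) u2)
    + S u3 xs (smear (act M) (expansion T t f) b v, t) u2
    + \<beta> * S u3 xs (v, t) (U2 (cls b) u2)"

text \<open>Collects the values of S with all modes of b applied at slot i. The index
  \<open>length xs\<close> stands for the module point, in accordance with the list
  \<open>pts\<close>.\<close>

definition slot_series :: "'v \<Rightarrow> 'u3 \<Rightarrow> ('v \<times> complex) list \<Rightarrow> 'm \<Rightarrow> complex \<Rightarrow> 'u2 \<Rightarrow> nat \<Rightarrow> complex fls" where
  "slot_series b u3 xs v t u2 i =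
    (if i < length xs then matrix_series (mode V) (\<lambda>c. S u3 (xs[i := (c, snd (xs ! i))]) (v, t) u2) b (fst (xs ! i))
     else matrix_series (act M) (\<lambda>w. S u3 xs (w, t) u2) b v)"

abbreviation pts :: "('v \<times> complex) list \<Rightarrow> complex \<Rightarrow> complex list" where
  "pts xs t \<equiv> map snd xs @ [t]"

lemma slot_series_nth:
  "slot_series b u3 xs v t u2 i $$ m =
    (if i < length xs then S u3 (xs[i := (mode V b (- m - 1) (fst (xs ! i)), snd (xs ! i))]) (v, t) u2
     else S u3 xs (act M b (- m - 1) v, t) u2)"
  unfolding slot_series_def
  using VV.matrix_series_nth[OF S_linear_entry] MM.matrix_series_nth[OF S_linear(2)] by auto

lemma slot_series_add:
  "slot_series (a + b) u3 xs v t u2 i = slot_series a u3 xs v t u2 i + slot_series b u3 xs v t u2 i"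
  by (rule fls_eqI)
     (simp add: slot_series_nth clinear_add[OF VV.linear_left] clinear_add[OF MM.linear_left]
        clinear_add[OF S_linear_entry] clinear_add[OF S_linear(2)])

text \<open>Insertions and module point are put on the same footing, as residues at the points of
  \<open>pts\<close>; the residue criterion is applied in this form.\<close>

lemma J_slots:
  "J b f \<alpha> \<beta> u3 xs v t u2 = \<alpha> * S (U3 u3 (cls b)) xs (v, t) u2
    + (\<Sum>i\<le>length xs. (expansion T (pts xs t ! i) f * slot_series b u3 xs v t u2 i) $$ (- 1))
    + \<beta> * S u3 xs (v, t) (U2 (cls b) u2)"
proof -
  have "S u3 xs (smear (act M) (expansion T t f) b v, t) u2 =
    (expansion T (pts xs t ! length xs) f * slot_series b u3 xs v t u2 (length xs)) $$ (- 1)"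
    using MM.smear_residue[OF S_linear(2)] by (simp add: slot_series_def nth_append)
  moreover have "S u3 (xs[l := (smear (mode V) (expansion T (snd (xs ! l)) f) b (fst (xs ! l)), snd (xs ! l))]) (v, t) u2 =
    (expansion T (pts xs t ! l) f * slot_series b u3 xs v t u2 l) $$ (- 1)" if "l < length xs" for l
    using VV.smear_residue[OF S_linear_entry[OF that]] that by (simp add: slot_series_def nth_append)
  ultimately show ?thesis
    by (simp add: J_def flip: lessThan_Suc_atMost)
qed

lemma J_linear_v: "clinear (\<lambda>v. J b f \<alpha> \<beta> u3 xs v t u2)"
  unfolding J_def
  by (intro clinear_plus clinear_sum_fun clinear_cmult S_linear
       clinear_compose[OF S_linear(2) MM.smear_linear_right])

lemma J_linear_b: "clinear (\<lambda>b. J b f \<alpha> \<beta> u3 xs v t u2)"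
proof -
  have 1: "clinear (\<lambda>b. S (U3 u3 (cls b)) xs (v, t) u2)"
    by (rule clinear_compose[OF S_linear(1) U3_linear(2)])
  have 2: "clinear (\<lambda>b. S u3 xs (v, t) (U2 (cls b) u2))"
    by (rule clinear_compose[OF S_linear(3) U2_linear(2)])
  have 3: "clinear (\<lambda>b. S u3 xs (smear (act M) L b v, t) u2)" for L
    by (rule clinear_compose[OF S_linear(2) MM.smear_linear_left])
  have 4: "clinear (\<lambda>b. S u3 (xs[l := (smear (mode V) L b w, s)]) (v, t) u2)" if "l < length xs" for l L w s
    by (rule clinear_compose[OF S_linear_entry[OF that] VV.smear_linear_left])
  show ?thesis
    unfolding J_def
    by (intro clinear_plus clinear_sum_fun clinear_cmult 1 2 3 4) simp
qed

text \<open>Additivity of J in the test function requires genuine expansions at all points, since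
  \<open>expansion\<close> is a definite description.\<close>

definition expandable :: "(complex \<Rightarrow> complex) \<Rightarrow> bool" where
  "expandable f \<longleftrightarrow> (\<forall>p. p \<noteq> 0 \<longrightarrow> (\<exists>L. expands T p f L))"

lemma expandable_curve: "f \<in> curve_functions T P \<Longrightarrow> expandable f"
  using curve_functions_expands[OF T] by (auto simp: expandable_def)

lemma expandableD: "expandable f \<Longrightarrow> p \<noteq> 0 \<Longrightarrow> expands T p f (expansion T p f)"
  using expansion_eq unfolding expandable_def by metis

lemma expansion_add: "expandable f \<Longrightarrow> expandable f' \<Longrightarrow> p \<noteq> 0 \<Longrightarrow>
    expansion T p (\<lambda>x. f x + f' x) = expansion T p f + expansion T p f'"
  by (intro expansion_eq expands_add expandableD)

lemma expansion_cmult: "expandable f \<Longrightarrow> p \<noteq> 0 \<Longrightarrow>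
    expansion T p (\<lambda>x. c * f x) = fls_const c * expansion T p f"
  by (intro expansion_eq expands_cmult expandableD)

lemma pts_nonzero: "config T (map snd xs) t \<Longrightarrow> i \<le> length xs \<Longrightarrow> pts xs t ! i \<noteq> 0"
  by (auto simp: nth_append config_def)

lemma J_add:
  assumes "expandable f" "expandable f'" "config T (map snd xs) t"
  shows "J b (\<lambda>x. f x + f' x) (\<alpha> + \<alpha>') (\<beta> + \<beta>') u3 xs v t u2 =
    J b f \<alpha> \<beta> u3 xs v t u2 + J b f' \<alpha>' \<beta>' u3 xs v t u2"
  unfolding J_slots using pts_nonzero[OF assms(3)]
  by (simp add: expansion_add[OF assms(1,2)] algebra_simps sum.distrib)

lemma J_cmult:
  assumes "expandable f" "config T (map snd xs) t"
  shows "J b (\<lambda>x. c * f x) (c * \<alpha>) (c * \<beta>) u3 xs v t u2 = c * J b f \<alpha> \<beta> u3 xs v t u2"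
  unfolding J_slots using pts_nonzero[OF assms(2)]
  by (simp add: expansion_cmult[OF assms(1)] algebra_simps sum_distrib_left)

lemma J_cong:
  assumes "finite P" "\<And>x. x \<in> punctured T P \<Longrightarrow> f x = f' x" "config T (map snd xs) t"
  shows "J b f \<alpha> \<beta> u3 xs v t u2 = J b f' \<alpha> \<beta> u3 xs v t u2"
proof -
  have "expands T p f L \<longleftrightarrow> expands T p f' L" if "p \<noteq> 0" for p L
    by (rule expands_cong[OF assms(1) T that assms(2)])
  then have "expansion T p f = expansion T p f'" if "p \<noteq> 0" for p
    using that by (simp add: expansion_def)
  then show ?thesis unfolding J_slots using pts_nonzero[OF assms(3)] by simp
qed

lemma J_coeffs: "J b f \<alpha> \<beta> u3 xs v t u2 = J b f 0 0 u3 xs v t u2 +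
   \<alpha> * S (U3 u3 (cls b)) xs (v, t) u2 + \<beta> * S u3 xs (v, t) (U2 (cls b) u2)"
  by (simp add: J_def)

lemma mode_bound: "\<exists>N. \<forall>i\<ge>N. mode V a (int i) b = 0"
proof -
  obtain N where N: "\<And>n. n \<ge> N \<Longrightarrow> mode V a n b = 0" using VV.truncation by blast
  show ?thesis by (rule exI[of _ "nat N"]) (use N in \<open>auto simp: nat_le_iff\<close>)
qed

lemma act_bound: "\<exists>N. \<forall>i\<ge>N. act M a (int i) v = 0"
proof -
  obtain N where N: "\<And>n. n \<ge> N \<Longrightarrow> act M a n v = 0" using MM.truncation by blast
  show ?thesis by (rule exI[of _ "nat N"]) (use N in \<open>auto simp: nat_le_iff\<close>)
qed

lemma common_bound:
  "\<exists>N. (\<forall>i\<ge>N. act M a (int i) v = 0) \<and> (\<forall>b\<in>set bs. \<forall>i\<ge>N. mode V a (int i) b = 0)"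
proof -
  have "\<exists>N. \<forall>b\<in>set bs. \<forall>i\<ge>N. mode V a (int i) b = 0"
  proof (induction bs)
    case (Cons b bs)
    then obtain N where N: "\<forall>b\<in>set bs. \<forall>i\<ge>N. mode V a (int i) b = 0" by blast
    obtain N' where N': "\<forall>i\<ge>N'. mode V a (int i) b = 0" using mode_bound by blast
    show ?case by (rule exI[of _ "max N N'"]) (use N N' in auto)
  qed simp
  then obtain N where N: "\<forall>b\<in>set bs. \<forall>i\<ge>N. mode V a (int i) b = 0" by blast
  obtain N' where N': "\<forall>i\<ge>N'. act M a (int i) v = 0" using act_bound by blast
  show ?thesis by (rule exI[of _ "max N N'"]) (use N N' in auto)
qed

lemma recursion_sum_finite:
  assumes "\<forall>i\<ge>N. act M a (int i) v = 0" "\<forall>b\<in>fst ` set xs. \<forall>i\<ge>N. mode V a (int i) b = 0"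
  shows "recursion_sum V T M S K a s u3 xs v t u2 =
    (\<Sum>l<length xs. \<Sum>i<N. F_fun T K i s (snd (xs ! l)) *
        S u3 (xs[l := (mode V a (int i) (fst (xs ! l)), snd (xs ! l))]) (v, t) u2)
    + (\<Sum>i<N. F_fun T K i s t * S u3 xs (act M a (int i) v, t) u2)"
  unfolding recursion_sum_def
proof (intro arg_cong2[where f = "(+)"] sum.cong refl)
  fix l assume l: "l \<in> {..<length xs}"
  then have "fst (xs ! l) \<in> fst ` set xs" by auto
  with assms(2) show "Sum_any (\<lambda>i. F_fun T K i s (snd (xs ! l)) *
        S u3 (xs[l := (mode V a (int i) (fst (xs ! l)), snd (xs ! l))]) (v, t) u2) =
    (\<Sum>i<N. F_fun T K i s (snd (xs ! l)) *
        S u3 (xs[l := (mode V a (int i) (fst (xs ! l)), snd (xs ! l))]) (v, t) u2)"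
    by (intro Sum_any_superset) (use l clinear_0[OF S_linear_entry] in auto)
next
  show "Sum_any (\<lambda>i. F_fun T K i s t * S u3 xs (act M a (int i) v, t) u2) =
    (\<Sum>i<N. F_fun T K i s t * S u3 xs (act M a (int i) v, t) u2)"
    by (intro Sum_any_superset) (use assms(1) clinear_0[OF S_linear(2)] in auto)
qed

text \<open>The Cauchy kernel is regular at all insertions of the tail and at the module point, so
  smearing with it involves only the modes with i at least 0, with the coefficients F_(n,i).\<close>

lemma recursion_sum_eq_J:
  assumes "config T (s # map snd xs) t"
  shows "recursion_sum V T M S K a s u3 xs v t u2 = J a (cauchy_kernel T K s) 0 0 u3 xs v t u2"
proof -
  obtain N where N: "\<forall>i\<ge>N. act M a (int i) v = 0" "\<forall>b\<in>fst ` set xs. \<forall>i\<ge>N. mode V a (int i) b = 0"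
    using common_bound[of a v "map fst xs"] by auto
  have s: "config T (map snd xs) t" "s \<in> punctured T (insert t (snd ` set xs))"
    using assms by (simp_all add: config_Cons)
  have ex: "expansion T p (cauchy_kernel T K s) = fps_to_fls (Abs_fps (\<lambda>i. F_fun T K i s p))"
    if "p \<in> insert t (snd ` set xs)" for p
    by (rule expansion_eq[OF expands_cauchy_F_fun[OF T]])
       (use that s config_nonzero[OF s(1)] in \<open>auto simp: punctured_def\<close>)
  have "S u3 (xs[l := (smear (mode V) (expansion T (snd (xs ! l)) (cauchy_kernel T K s)) a (fst (xs ! l)), snd (xs ! l))]) (v, t) u2
     = (\<Sum>i<N. F_fun T K i s (snd (xs ! l)) *
        S u3 (xs[l := (mode V a (int i) (fst (xs ! l)), snd (xs ! l))]) (v, t) u2)" if l: "l < length xs" for l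
  proof -
    have "smear (mode V) (expansion T (snd (xs ! l)) (cauchy_kernel T K s)) a (fst (xs ! l)) =
      (\<Sum>i<N. F_fun T K i s (snd (xs ! l)) *\<^sub>C mode V a (int i) (fst (xs ! l)))"
      using l N by (subst ex, simp, subst VV.smear_fps[of N]) auto
    then show ?thesis
      by (simp add: clinear_sum[OF S_linear_entry[OF l]] clinear_scale[OF S_linear_entry[OF l]] scaleC_complex_def)
  qed
  moreover have "S u3 xs (smear (act M) (expansion T t (cauchy_kernel T K s)) a v, t) u2
     = (\<Sum>i<N. F_fun T K i s t * S u3 xs (act M a (int i) v, t) u2)"
  proof -
    have "smear (act M) (expansion T t (cauchy_kernel T K s)) a v = (\<Sum>i<N. F_fun T K i s t *\<^sub>C act M a (int i) v)"
      using N by (subst ex, simp, subst MM.smear_fps[of N]) auto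
    then show ?thesis
      by (simp add: clinear_sum[OF S_linear(2)] clinear_scale[OF S_linear(2)] scaleC_complex_def)
  qed
  ultimately show ?thesis
    unfolding recursion_sum_finite[OF N] J_def by simp
qed

end

context multilinear_system
begin

text \<open>The test function is z^(wt b - 1 + r/T) / (z - z_p)^j. For r = 0 its coefficient of
  z^(wt b - 1) is (-z_p)^(-j) at 0, and at infinity it is 1 if j = 0 and 0 otherwise, with the sign
  of the right action on U^3. For other r the class of b acts by zero, so that the same formula can
  be used.\<close>

definition block_sum :: "'v \<Rightarrow> nat \<Rightarrow> nat \<Rightarrow> complex \<Rightarrow> nat \<Rightarrow> 'u3 \<Rightarrow> ('v \<times> complex) list \<Rightarrow> 'm \<Rightarrow> complex \<Rightarrow> 'u2 \<Rightarrow> complex" where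
  "block_sum b k r p j = J b (kernel T (int T * (int k - 1) + int r) p j)
     (if j = 0 then -1 else 0) ((- (p ^ T)) powi (- int j))"

text \<open>The condition \<open>j \<ge> 1 \<or> r = 0\<close> is the order condition at infinity:
  for j = 0 the test function grows like z^(wt b - 1 + r/T), which is admissible only for r =
  0.\<close>

definition invariant :: "nat \<Rightarrow> bool" where
  "invariant n \<longleftrightarrow> (\<forall>xs k r b p j u3 v t u2. length xs = n \<and> config T (map snd xs) t \<and> r < T \<and>
     b \<in> grade V k \<inter> eigensp g T r \<and> p \<in> set (pts xs t) \<and> (j \<ge> 1 \<or> r = 0) \<longrightarrow>
     block_sum b k r p j u3 xs v t u2 = 0)"

lemma invariantD:
  assumes "invariant (length xs)" "config T (map snd xs) t" "r < T" "b \<in> grade V k \<inter> eigensp g T r"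
    "p \<in> set (pts xs t)" "j \<ge> 1 \<or> r = 0"
  shows "block_sum b k r p j u3 xs v t u2 = 0"
  using assms unfolding invariant_def by blast

lemma pts_inj: "config T (map snd xs) t \<Longrightarrow> inj_on (\<lambda>i. (pts xs t ! i) ^ T) {..length xs}"
proof -
  assume "config T (map snd xs) t"
  then have d: "distinct (map (\<lambda>s. s ^ T) (pts xs t))" by (simp add: config_def)
  have "(pts xs t ! i) ^ T = map (\<lambda>s. s ^ T) (pts xs t) ! i" if "i \<le> length xs" for i
    using that by (subst nth_map) auto
  moreover have "inj_on (\<lambda>i. map (\<lambda>s. s ^ T) (pts xs t) ! i) {..length xs}"
    using d by (auto simp: inj_on_def nth_eq_iff_index_eq)
  ultimately show ?thesis by (simp add: inj_on_def)
qed

lemma snd_update: "l < length xs \<Longrightarrow> map snd (xs[l := (c, snd (xs ! l))]) = map snd xs"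
  by (metis list_update_id map_update nth_map snd_conv)

lemma matrix_series_S_nth:
  assumes "clinear l" shows "matrix_series (act M) l a v $$ (- n - 1) = l (act M a n v)"
  using MM.matrix_series_nth[OF assms, of a v "- n - 1"] by simp

lemma fls_eqI_residue: "(\<And>n. L $$ (- n - 1) = L' $$ (- n - 1)) \<Longrightarrow> L = (L' :: complex fls)"
proof (rule fls_eqI)
  fix m assume "\<And>n. L $$ (- n - 1) = L' $$ (- n - 1)"
  from this[of "- m - 1"] show "L $$ m = L' $$ m" by simp
qed

text \<open>The poles of f lie over P, so f is regular at the first insertion s. Its action there
  uses only modes with i at least 0, and the coefficients are divided derivatives of f at s, hence
  holomorphic functions of s.\<close>

lemma J_first:
  assumes "finite P" "f \<in> curve_functions T P" "s \<in> punctured T P"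
    and N: "\<And>i. i \<ge> N \<Longrightarrow> mode V b (int i) a = 0"
  shows "J b f \<alpha> \<beta> u3 ((a, s) # xs) v t u2 =
    \<alpha> * S (U3 u3 (cls b)) ((a, s) # xs) (v, t) u2
    + ((\<Sum>i<N. (inverse (fact i) * (d_dz T ^^ i) f s) * S u3 ((mode V b (int i) a, s) # xs) (v, t) u2)
    + ((\<Sum>l<length xs. S u3 ((a, s) # xs[l := (smear (mode V) (expansion T (snd (xs ! l)) f) b (fst (xs ! l)), snd (xs ! l))]) (v, t) u2)
    + (S u3 ((a, s) # xs) (smear (act M) (expansion T t f) b v, t) u2
    + \<beta> * S u3 ((a, s) # xs) (v, t) (U2 (cls b) u2))))"
proof -
  have "expansion T s f = fps_to_fls (taylor T f s)"
    by (rule expansion_eq[OF expands_taylor[OF T open_punctured[OF assms(1) T] zero_notin_punctured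
        curve_functions_holomorphic[OF assms(2)] assms(3)]])
  then have "smear (mode V) (expansion T s f) b a = (\<Sum>i<N. (inverse (fact i) * (d_dz T ^^ i) f s) *\<^sub>C mode V b (int i) a)"
    by (simp add: VV.smear_fps[OF N] taylor_def divide_inverse mult.commute)
  then have "S u3 ((smear (mode V) (expansion T s f) b a, s) # xs) (v, t) u2 =
     (\<Sum>i<N. (inverse (fact i) * (d_dz T ^^ i) f s) * S u3 ((mode V b (int i) a, s) # xs) (v, t) u2)"
    by (simp add: clinear_sum[OF S_linear_first] clinear_scale[OF S_linear_first] scaleC_complex_def)
  then show ?thesis
    unfolding J_def by (simp add: sum.lessThan_Suc_shift del: sum.lessThan_Suc)
qed

end

section \<open>Associativity, exchange of insertions and propagation of invariance\<close>

locale recursive_system = multilinear_system V g T M U2 U3 h1 h2 h3 h S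
  for V :: "'v::complex_vs voa_data" and g :: "'v \<Rightarrow> 'v" and T :: nat
    and M :: "('v, 'm::complex_vs) module_data"
    and U2 :: "'v set \<Rightarrow> 'u2::complex_vs \<Rightarrow> 'u2"
    and U3 :: "'u3::complex_vs \<Rightarrow> 'v set \<Rightarrow> 'u3"
    and h1 h2 h3 h :: complex
    and S :: "('v, 'm, 'u3, 'u2) correlation" +
  assumes recursion: "\<And>r k a u3 s xs v t u2. r < T \<Longrightarrow> a \<in> grade V k \<inter> eigensp g T r \<Longrightarrow>
      config T (s # map snd xs) t \<Longrightarrow>
      S u3 ((a, s) # xs) (v, t) u2 = (s ^ T) powi (- int k) * S u3 xs (v, t) (U2 (cls a) u2)
        + recursion_sum V T M S (int T * (int k - 1) + int r) a s u3 xs v t u2"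
begin

lemma recursion_J:
  assumes "r < T" "a \<in> grade V k \<inter> eigensp g T r" "config T (s # map snd xs) t"
  shows "S u3 ((a, s) # xs) (v, t) u2 =
    J a (cauchy_kernel T (int T * (int k - 1) + int r) s) 0 ((s ^ T) powi (- int k)) u3 xs v t u2"
  unfolding recursion[OF assms] recursion_sum_eq_J[OF assms(3)]
  by (subst (2) J_coeffs) simp

lemma first_holomorphic:
  assumes "config T (map snd xs) t"
  shows "(\<lambda>s. S u3 ((a, s) # xs) (v, t) u2) holomorphic_on punctured T (insert t (snd ` set xs))"
proof (induction a rule: hom_induct)
  case (1 k r a)
  obtain N where N: "\<forall>i\<ge>N. act M a (int i) v = 0" "\<forall>b\<in>fst ` set xs. \<forall>i\<ge>N. mode V a (int i) b = 0"
    using common_bound[of a v "map fst xs"] by auto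
  let ?P = "punctured T (insert t (snd ` set xs))"
  let ?K = "int T * (int k - 1) + int r"
  have "(\<lambda>s. (s ^ T) powi (- int k) * S u3 xs (v, t) (U2 (cls a) u2) +
    ((\<Sum>l<length xs. \<Sum>i<N. F_fun T ?K i s (snd (xs ! l)) *
        S u3 (xs[l := (mode V a (int i) (fst (xs ! l)), snd (xs ! l))]) (v, t) u2)
    + (\<Sum>i<N. F_fun T ?K i s t * S u3 xs (act M a (int i) v, t) u2))) holomorphic_on ?P"
  proof -
    have F: "(\<lambda>s. F_fun T ?K i s p) holomorphic_on ?P" if "p \<in> insert t (snd ` set xs)" for i p
      by (rule F_fun_holomorphic[OF T _ that]) (use that config_nonzero[OF assms] in auto)
    show ?thesis
      by (intro holomorphic_intros F) (auto simp: punctured_def)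
  qed
  then show ?case
  proof (rule holomorphic_transform)
    fix s assume "s \<in> ?P"
    then have "config T (s # map snd xs) t" using assms by (simp add: config_Cons)
    from recursion[OF 1 this]
    show "(s ^ T) powi (- int k) * S u3 xs (v, t) (U2 (cls a) u2) +
    ((\<Sum>l<length xs. \<Sum>i<N. F_fun T ?K i s (snd (xs ! l)) *
        S u3 (xs[l := (mode V a (int i) (fst (xs ! l)), snd (xs ! l))]) (v, t) u2)
    + (\<Sum>i<N. F_fun T ?K i s t * S u3 xs (act M a (int i) v, t) u2)) = S u3 ((a, s) # xs) (v, t) u2"
      by (simp add: recursion_sum_finite[OF N])
  qed
next
  case (2 a b)
  then show ?case by (simp add: clinear_add[OF S_linear_first] holomorphic_on_add)
qed

text \<open>By the recursion, S as a function of the first point is exactly the function of the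
  residue criterion, with the slot series as prescribed expansions and beta the value with [a]
  acting on U^2.\<close>

lemma associativity_iff:
  assumes a: "r < T" "a \<in> grade V k \<inter> eigensp g T r"
    and cf: "config T (map snd xs) t" and i: "i \<le> length xs"
  shows "expands T (pts xs t ! i) (\<lambda>s. S u3 ((a, s) # xs) (v, t) u2) (slot_series a u3 xs v t u2 i) \<longleftrightarrow>
    (\<forall>j\<ge>1. block_sum a k r (pts xs t ! i) j u3 xs v t u2 = 0)"
proof -
  let ?K = "int T * (int k - 1) + int r"
  let ?P = "insert t (snd ` set xs)"
  define \<beta> where "\<beta> = S u3 xs (v, t) (U2 (cls a) u2)"
  have \<beta>0: "\<beta> = 0" if "r \<noteq> 0"
    using twisted_acts_zero(1)[OF a(1) that a(2)] clinear_0[OF S_linear(3)] by (simp add: \<beta>_def)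
  define q where "q i = pts xs t ! i" for i
  define W where "W = slot_series a u3 xs v t u2"
  have q0: "q i \<noteq> 0" if "i \<in> {..length xs}" for i
    using pts_nonzero[OF cf] that by (simp add: q_def)
  have inj: "inj_on (\<lambda>i. q i ^ T) {..length xs}" unfolding q_def by (rule pts_inj[OF cf])
  have i': "i \<in> {..length xs}" using i by simp
  have "S u3 ((a, s) # xs) (v, t) u2 = \<beta> * (s powi (- ?K) * inverse (s ^ T))
        + (\<Sum>i\<in>{..length xs}. (expansion T (q i) (cauchy_kernel T ?K s) * W i) $$ (- 1))"
    if s: "s \<in> punctured T ?P" for s
  proof -
    have s0: "s \<noteq> 0" using s by (simp add: punctured_def)
    \<comment> \<open>For r = 0 the factor z^(-wt a) equals z^(-K/T) / z, the shape required by the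
      criterion; for other r the number beta vanishes.\<close>
    have "(s ^ T) powi (- int k) * \<beta> = \<beta> * (s powi (- ?K) * inverse (s ^ T))"
    proof (cases "r = 0")
      case True
      have "(s ^ T) powi (- int k) = s powi (- ?K) * inverse (s ^ T)"
      proof -
        have "(s ^ T) powi (- int k) = s powi (int T * (- int k))"
          using power_int_mult[of s "int T" "- int k"] by simp
        also have "int T * (- int k) = - ?K + - int T" using True by (simp add: algebra_simps)
        also have "s powi (- ?K + - int T) = s powi (- ?K) * inverse (s ^ T)"
          using s0 by (subst power_int_add) (simp_all add: power_int_minus)
        finally show ?thesis .
      qed
      then show ?thesis by simp
    qed (simp add: \<beta>0)
    moreover have "config T (s # map snd xs) t" using cf s by (simp add: config_Cons)
    ultimately show ?thesis
      using recursion_J[OF a, of s xs t u3 v u2] by (simp add: J_slots q_def W_def \<beta>_def)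
  qed
  then have "expands T (q i) (\<lambda>s. S u3 ((a, s) # xs) (v, t) u2) (W i) \<longleftrightarrow>
    expands T (q i) (\<lambda>s. \<beta> * (s powi (- ?K) * inverse (s ^ T))
        + (\<Sum>i\<in>{..length xs}. (expansion T (q i) (cauchy_kernel T ?K s) * W i) $$ (- 1))) (W i)"
    using q0[OF i'] T by (intro expands_cong[of ?P]) auto
  also have "\<dots> \<longleftrightarrow> (\<forall>j\<ge>1. (\<Sum>i'\<le>length xs. (expansion T (q i') (kernel T ?K (q i) j) * W i') $$ (- 1))
        + \<beta> * (- (q i ^ T)) powi (- int j) = 0)"
    by (rule expands_iff_residue_sums[OF T finite_atMost q0 inj i'])
  also have "\<dots> \<longleftrightarrow> (\<forall>j\<ge>1. block_sum a k r (pts xs t ! i) j u3 xs v t u2 = 0)"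
    by (simp add: block_sum_def J_slots q_def W_def \<beta>_def mult.commute)
  finally show ?thesis by (simp add: q_def W_def)
qed

theorem associativity:
  assumes inv: "invariant (length xs)" and cf: "config T (map snd xs) t" and i: "i \<le> length xs"
  shows "expands T (pts xs t ! i) (\<lambda>s. S u3 ((a, s) # xs) (v, t) u2) (slot_series a u3 xs v t u2 i)"
proof (induction a rule: hom_induct)
  case (1 k r a)
  have "pts xs t ! i \<in> set (pts xs t)" by (rule nth_mem) (use i in auto)
  from invariantD[OF inv cf 1 this] show ?case by (simp add: associativity_iff[OF 1 cf i])
next
  case (2 a b)
  then show ?case
    by (simp add: clinear_add[OF S_linear_first] slot_series_add expands_add)
qed

lemma associativity_t:
  assumes "invariant (length xs)" "config T (map snd xs) t"
  shows "expands T t (\<lambda>s. S u3 ((a, s) # xs) (v, t) u2) (matrix_series (act M) (\<lambda>w. S u3 xs (w, t) u2) a v)"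
  using associativity[OF assms, of "length xs"] by (simp add: slot_series_def nth_append)

lemma J_first_holomorphic:
  assumes "finite P" "f \<in> curve_functions T P" "config T (map snd xs) t" "insert t (snd ` set xs) \<subseteq> P"
  shows "(\<lambda>s. J b f \<alpha> \<beta> u3 ((a, s) # xs) v t u2) holomorphic_on punctured T P"
proof -
  obtain N where N: "\<And>i. i \<ge> N \<Longrightarrow> mode V b (int i) a = 0" using mode_bound by blast
  have hol: "(\<lambda>s. S u3 ((a, s) # xs') (v, t) u2) holomorphic_on punctured T P"
    if "map snd xs' = map snd xs" for u3 a xs' v u2
  proof (rule holomorphic_on_subset[OF first_holomorphic])
    have "snd ` set xs' = snd ` set xs" using that by (metis list.set_map)
    then show "punctured T P \<subseteq> punctured T (insert t (snd ` set xs'))"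
      using assms(4) by (auto simp: punctured_def)
  qed (use that assms in simp)
  have hd: "(d_dz T ^^ i) f holomorphic_on punctured T P" for i
    by (rule d_dz_iter_holomorphic_punctured[OF T assms(1) curve_functions_holomorphic[OF assms(2)]])
  have "(\<lambda>s. \<alpha> * S (U3 u3 (cls b)) ((a, s) # xs) (v, t) u2
    + ((\<Sum>i<N. (inverse (fact i) * (d_dz T ^^ i) f s) * S u3 ((mode V b (int i) a, s) # xs) (v, t) u2)
    + ((\<Sum>l<length xs. S u3 ((a, s) # xs[l := (smear (mode V) (expansion T (snd (xs ! l)) f) b (fst (xs ! l)), snd (xs ! l))]) (v, t) u2)
    + (S u3 ((a, s) # xs) (smear (act M) (expansion T t f) b v, t) u2
    + \<beta> * S u3 ((a, s) # xs) (v, t) (U2 (cls b) u2))))) holomorphic_on punctured T P"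
    by (intro holomorphic_on_add holomorphic_on_mult holomorphic_on_sum holomorphic_on_const hol hd)
       (simp_all add: snd_update)
  then show ?thesis
    by (rule holomorphic_transform) (rule J_first[OF assms(1,2) _ N, symmetric])
qed

text \<open>Near the module point, associativity replaces every value of S by a matrix series of
  Y(a,Z)v. The term where f acts at s becomes the commutator of the smeared b with Y(a,Z); together
  with b acting on v it gives b acting on Y(a,Z)v. So J with the insertion a expands into J of the
  modes a_(n)v without it.\<close>

lemma J_first_expands:
  assumes P: "finite P" and f: "f \<in> curve_functions T P"
    and inv: "invariant (length xs)" and cf: "config T (map snd xs) t"
  shows "expands T t (\<lambda>s. J b f \<alpha> \<beta> u3 ((a, s) # xs) v t u2)
    (matrix_series (act M) (\<lambda>w. J b f \<alpha> \<beta> u3 xs w t u2) a v)"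
proof -
  have t: "t \<noteq> 0" using config_nonzero(1)[OF cf] .
  obtain N where N: "\<And>i. i \<ge> N \<Longrightarrow> mode V b (int i) a = 0" using mode_bound by blast
  define L where "L = expansion T t f"
  have L: "expands T t f L" unfolding L_def by (rule expands_expansion[OF T t f])
  define ms where "ms u3 xs u2 a v = matrix_series (act M) (\<lambda>w. S u3 xs (w, t) u2) a v" for u3 xs u2 a v
  have ex: "expands T t (\<lambda>s. S u3 ((a, s) # xs') (v, t) u2) (ms u3 xs' u2 a v)"
    if "map snd xs' = map snd xs" for u3 xs' u2 a v
    unfolding ms_def using associativity_t[of xs' t] that inv cf by (metis length_map)
  have ms_nth: "ms u3 xs u2 a v $$ (- n - 1) = S u3 xs (act M a n v, t) u2" for u3 xs u2 a v n
    unfolding ms_def by (rule matrix_series_S_nth[OF S_linear(2)])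
  let ?xs = "\<lambda>l. xs[l := (smear (mode V) (expansion T (snd (xs ! l)) f) b (fst (xs ! l)), snd (xs ! l))]"
  let ?R = "fls_const \<alpha> * ms (U3 u3 (cls b)) xs u2 a v
    + ((\<Sum>i<N. hasse i L * ms u3 xs u2 (mode V b (int i) a) v)
    + ((\<Sum>l<length xs. ms u3 (?xs l) u2 a v)
    + (ms u3 xs u2 a (smear (act M) L b v) + fls_const \<beta> * ms u3 xs (U2 (cls b) u2) a v)))"
  have "expands T t (\<lambda>s. \<alpha> * S (U3 u3 (cls b)) ((a, s) # xs) (v, t) u2
    + ((\<Sum>i<N. (inverse (fact i) * (d_dz T ^^ i) f s) * S u3 ((mode V b (int i) a, s) # xs) (v, t) u2)
    + ((\<Sum>l<length xs. S u3 ((a, s) # ?xs l) (v, t) u2)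
    + (S u3 ((a, s) # xs) (smear (act M) L b v, t) u2
    + \<beta> * S u3 ((a, s) # xs) (v, t) (U2 (cls b) u2))))) ?R"
    unfolding hasse_def
    by (intro expands_add expands_cmult expands_sum expands_mult ex
        expands_d_dz_iter[OF T t P curve_functions_holomorphic[OF f] L]) (simp_all add: snd_update)
  then have "expands T t (\<lambda>s. J b f \<alpha> \<beta> u3 ((a, s) # xs) v t u2) ?R"
    by (subst expands_cong[OF P T t J_first[OF P f _ N]]) (simp_all add: L_def)
  moreover have "?R = matrix_series (act M) (\<lambda>w. J b f \<alpha> \<beta> u3 xs w t u2) a v"
  proof (rule fls_eqI_residue)
    fix n
    have "(\<Sum>i<N. hasse i L * ms u3 xs u2 (mode V b (int i) a) v) $$ (- n - 1) =
      S u3 xs (smear (act M) L b (act M a n v), t) u2 - S u3 xs (act M a n (smear (act M) L b v), t) u2"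
      unfolding ms_def by (rule MM.smear_commutator[OF S_linear(2) N])
    then show "?R $$ (- n - 1) = matrix_series (act M) (\<lambda>w. J b f \<alpha> \<beta> u3 xs w t u2) a v $$ (- n - 1)"
      by (subst matrix_series_S_nth[OF J_linear_v]) (simp add: J_def ms_nth fls_sum_nth L_def)
  qed
  ultimately show ?thesis by simp
qed

text \<open>By the recursion the left side is J with the Cauchy kernel at s'. As functions of s both
  sides expand at t with the same coefficients, namely S with the insertion at s' and modes of a
  applied to the module vector. The expansion of the left side uses invariance for the tail, that of
  the right side for the tail with one insertion more.\<close>

theorem swap_first:
  assumes inv: "invariant (length xs)" "invariant (Suc (length xs))"
    and cf: "config T (s' # s # map snd xs) t"
  shows "S u3 ((b, s') # (a, s) # xs) (v, t) u2 = S u3 ((a, s) # (b, s') # xs) (v, t) u2"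
proof (induction b rule: hom_induct)
  case (1 k r b)
  let ?f = "cauchy_kernel T (int T * (int k - 1) + int r) s'" and ?\<beta> = "(s' ^ T) powi (- int k)"
  let ?P = "insert s' (insert t (snd ` set xs))"
  have cfxs: "config T (map snd xs) t" using cf by (simp add: config_Cons)
  have cf': "config T (s' # map snd xs) t"
    using cf by (auto simp: config_Cons punctured_def)
  have sP: "s \<in> punctured T ?P"
    using cf by (auto simp: config_Cons punctured_def)
  have conf: "config T (s' # map snd ((a, x) # xs)) t" if "x \<in> punctured T ?P" for x
    using that cf' by (auto simp: config_Cons punctured_def)
  have f: "?f \<in> curve_functions T ?P" by (rule cauchy_kernel_in_curve_functions) simp
  have fin: "finite ?P" by simp
  have t: "t \<noteq> 0" using config_nonzero(1)[OF cf] .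
  have "J b ?f 0 ?\<beta> u3 ((a, s) # xs) v t u2 = S u3 ((a, s) # (b, s') # xs) (v, t) u2"
  proof (rule expands_determines[OF T t fin _ _ _ _ sP])
    show "(\<lambda>s. J b ?f 0 ?\<beta> u3 ((a, s) # xs) v t u2) holomorphic_on punctured T ?P"
      by (rule J_first_holomorphic[OF fin f cfxs]) auto
    show "(\<lambda>s. S u3 ((a, s) # (b, s') # xs) (v, t) u2) holomorphic_on punctured T ?P"
      using first_holomorphic[of "(b, s') # xs" t] cf' by (simp add: insert_commute)
    show "expands T t (\<lambda>s. J b ?f 0 ?\<beta> u3 ((a, s) # xs) v t u2)
        (matrix_series (act M) (\<lambda>w. J b ?f 0 ?\<beta> u3 xs w t u2) a v)"
      by (rule J_first_expands[OF fin f inv(1) cfxs])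
    have "J b ?f 0 ?\<beta> u3 xs w t u2 = S u3 ((b, s') # xs) (w, t) u2" for w
      by (rule recursion_J[OF 1 cf', symmetric])
    then show "expands T t (\<lambda>s. S u3 ((a, s) # (b, s') # xs) (v, t) u2)
        (matrix_series (act M) (\<lambda>w. J b ?f 0 ?\<beta> u3 xs w t u2) a v)"
      using associativity_t[of "(b, s') # xs" t u3 a v u2] inv(2) cf' by simp
  qed
  then show ?case
    using recursion_J[OF 1 conf[OF sP], of u3 v u2] by simp
next
  case (2 b b')
  then show ?case
    using clinear_add[OF S_linear_first] clinear_add[OF S_linear_mid[of u3 "[(a, s)]"]] by simp
qed

lemma J_swap_first:
  assumes inv: "invariant (length xs)" "invariant (Suc (length xs))"
    and cf: "config T (s' # s # map snd xs) t"
  shows "J b f \<alpha> \<beta> u3 ((a, s) # (c, s') # xs) v t u2 = J b f \<alpha> \<beta> u3 ((c, s') # (a, s) # xs) v t u2"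
proof -
  have sw: "S u3 ((c, s') # (a, s) # xs') (v, t) u2 = S u3 ((a, s) # (c, s') # xs') (v, t) u2"
    if "map snd xs' = map snd xs" for u3 c a xs' v u2
    using swap_first[of xs' s' s t] that inv cf by (metis length_map)
  show ?thesis
    unfolding J_def by (simp add: sum.lessThan_Suc_shift sw snd_update del: sum.lessThan_Suc)
qed

text \<open>The test function has no pole at s, so the block sum is holomorphic in s away from the
  remaining points, and the coefficients of its expansion at t are block sums with one insertion
  less, which vanish.\<close>

lemma invariant_step_away:
  assumes inv: "invariant (length xs)" and cf: "config T (s # map snd xs) t"
    and b: "r < T" "b \<in> grade V k \<inter> eigensp g T r" and p: "p \<in> set (pts xs t)" and j: "j \<ge> 1 \<or> r = 0"
  shows "block_sum b k r p j u3 ((a, s) # xs) v t u2 = 0"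
proof -
  let ?P = "insert t (snd ` set xs)"
  have cfxs: "config T (map snd xs) t" and s: "s \<in> punctured T ?P"
    using cf by (simp_all add: config_Cons)
  have t: "t \<noteq> 0" using config_nonzero(1)[OF cf] .
  have fin: "finite ?P" by simp
  have f: "kernel T (int T * (int k - 1) + int r) p j \<in> curve_functions T ?P"
    by (rule kernel_in_curve_functions) (use p in auto)
  have z: "(\<lambda>w. block_sum b k r p j u3 xs w t u2) = (\<lambda>_. 0)"
    using invariantD[OF inv cfxs b p j] by blast
  show ?thesis
  proof (rule expands_determines[OF T t fin _ _ _ _ s])
    show "(\<lambda>s. block_sum b k r p j u3 ((a, s) # xs) v t u2) holomorphic_on punctured T ?P"
      unfolding block_sum_def by (rule J_first_holomorphic[OF fin f cfxs]) auto
    show "(\<lambda>_. 0) holomorphic_on punctured T ?P" by simp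
    have "expands T t (\<lambda>s. block_sum b k r p j u3 ((a, s) # xs) v t u2)
        (matrix_series (act M) (\<lambda>w. block_sum b k r p j u3 xs w t u2) a v)"
      unfolding block_sum_def by (rule J_first_expands[OF fin f inv cfxs])
    moreover have "matrix_series (act M) (\<lambda>_. 0) a v = fls_const 0"
      by (rule fls_eqI_residue) (simp add: matrix_series_S_nth[OF clinear_zero])
    ultimately show "expands T t (\<lambda>s. block_sum b k r p j u3 ((a, s) # xs) v t u2) (fls_const 0)"
      by (simp add: z)
    show "expands T t (\<lambda>_. 0) (fls_const 0)" by (rule expands_const)
  qed
qed

end

section \<open>A single insertion with the pole of the test function at it\<close>

context recursive_system
begin

text \<open>The coefficients of z^(K/T) at a moving point y must be expanded in y near t, hence they
  are needed as iterated derivatives of one function.\<close>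

lemma power_fps_nth_derivative:
  assumes "y \<noteq> 0"
  shows "power_fps T K y $ i = inverse (fact i) * (d_dz T ^^ i) (\<lambda>x. x powi K) y"
proof -
  have "fps_to_fls (power_fps T K y) = fps_to_fls (taylor T (\<lambda>x. x powi K) y)"
  proof (rule expands_unique[OF expands_coord[OF T assms]])
    show "expands T y (\<lambda>x. x powi K) (fps_to_fls (taylor T (\<lambda>x. x powi K) y))"
      by (rule expands_taylor[OF T, of "- {0}"])
         (use assms in \<open>auto intro!: holomorphic_intros\<close>)
  qed
  then show ?thesis by (simp add: taylor_def divide_inverse mult.commute)
qed

text \<open>Here associativity at the inserted point is not available yet; the identity is checked
  on expansions at \<open>t\<close>, where it becomes the Borcherds identity for the module.\<close>

lemma invariant_step_base:
  assumes inv: "invariant 0" and y: "config T [y] t"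
    and b: "r < T" "b \<in> grade V k \<inter> eigensp g T r" and j: "j \<ge> 1"
  shows "block_sum b k r y j u3 [(a, y)] v t u2 = 0"
proof -
  define K where "K = int T * (int k - 1) + int r"
  define A where "A = power_fps T K t"
  let ?P = "{t}"
  have t: "t \<noteq> 0" and yP: "y \<in> punctured T ?P"
    using y by (auto simp: config_def punctured_def)
  have cf0: "config T (map snd []) t" using t by (simp add: config_def)
  have fin: "finite ?P" by simp
  define l where "l w = S u3 [] (w, t) u2" for w
  have l: "clinear l" unfolding l_def by (rule S_linear(2))
  obtain N1 where N1: "\<And>i. i \<ge> N1 \<Longrightarrow> mode V b (int i - int j) a = 0"
  proof -
    obtain N where N: "\<And>n. n \<ge> N \<Longrightarrow> mode V b n a = 0" using VV.truncation[of b a] by blast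
    show ?thesis by (rule that[of "nat (N + int j)"]) (use N in \<open>auto simp: nat_le_iff\<close>)
  qed
  obtain N2 where N2: "\<And>i. i \<ge> N2 \<Longrightarrow> act M b (int i) v = 0" using act_bound by blast
  have ex: "expands T t (\<lambda>y. S u3 [(a, y)] (v, t) u2) (matrix_series (act M) (\<lambda>w. S u3 [] (w, t) u2) a v)" for u3 a v u2
    using associativity_t[of "[]" t] inv cf0 by simp
  have hol: "(\<lambda>y. S u3 [(a, y)] (v, t) u2) holomorphic_on punctured T ?P" for u3 a v u2
    using first_holomorphic[of "[]" t] cf0 by simp
  have ms: "matrix_series (act M) (\<lambda>w. S u3 [] (w, t) u2) a v $$ (- n - 1) = S u3 [] (act M a n v, t) u2" for u3 a v u2 n
    by (rule matrix_series_S_nth[OF S_linear(2)])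
  \<comment> \<open>The contributions of the insertion, of the module and of U^2, as functions of y.
    As the pole moves with y, the second one has poles at y = t and the third one a pole at y =
    0.\<close>
  define t1 where "t1 y = (\<Sum>i<N1. (inverse (fact i) * (d_dz T ^^ i) (\<lambda>x. x powi K) y) *
      S u3 [(mode V b (int i - int j) a, y)] (v, t) u2)" for y
  define t2 where "t2 y = (\<Sum>i<N2. (\<Sum>m\<le>i. (A $ (i - m) * ((- of_nat j) gchoose m) * (- 1) ^ (j + m)) *
      inverse (y ^ T - t ^ T) ^ (j + m)) * S u3 [(a, y)] (act M b (int i) v, t) u2)" for y
  define t3 where "t3 y = (((- 1) ^ j * inverse (y ^ T - 0 ^ T) ^ j) * S u3 [(a, y)] (v, t) (U2 (cls b) u2))" for y
  have split: "block_sum b k r y j u3 [(a, y)] v t u2 = t1 y + (t2 y + t3 y)" if y: "y \<in> punctured T ?P" for y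
  proof -
    have y0: "y \<noteq> 0" and yt: "y ^ T \<noteq> t ^ T" using y by (auto simp: punctured_def)
    have "smear (mode V) (expansion T y (kernel T K y j)) b a =
       (\<Sum>i<N1. (power_fps T K y $ i) *\<^sub>C mode V b (int i - int j) a)"
    proof -
      have nth: "expansion T y (kernel T K y j) $$ n = fps_to_fls (power_fps T K y) $$ (n + int j)" for n
        by (subst expansion_eq[OF expands_kernel_at[OF T y0 refl]]) (simp add: fls_shifted_times_simps)
      have "smear (mode V) (expansion T y (kernel T K y j)) b a =
        (\<Sum>n\<in>(\<lambda>i. int i - int j) ` {..<N1}. (expansion T y (kernel T K y j) $$ n) *\<^sub>C mode V b n a)"
        unfolding smear_def
      proof (rule Sum_any_superset)
        fix n assume n: "n \<notin> (\<lambda>i. int i - int j) ` {..<N1}"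
        show "(expansion T y (kernel T K y j) $$ n) *\<^sub>C mode V b n a = 0"
        proof (cases "n + int j < 0")
          case True
          then show ?thesis by (simp add: nth complex_vs.scale_zero_left)
        next
          case False
          then have "n = int (nat (n + int j)) - int j" by simp
          with n have "nat (n + int j) \<ge> N1" by (metis image_eqI lessThan_iff not_less)
          from N1[OF this] show ?thesis using False by (simp add: complex_vs.scale_zero_right)
        qed
      qed simp
      also have "\<dots> = (\<Sum>i<N1. (expansion T y (kernel T K y j) $$ (int i - int j)) *\<^sub>C mode V b (int i - int j) a)"
        by (subst sum.reindex) (auto simp: inj_on_def)
      finally show ?thesis by (simp add: nth)
    qed
    then have 1: "S u3 [(smear (mode V) (expansion T y (kernel T K y j)) b a, y)] (v, t) u2 = t1 y"
      unfolding t1_def power_fps_nth_derivative[OF y0]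
      by (simp add: clinear_sum[OF S_linear_first] clinear_scale[OF S_linear_first] scaleC_complex_def)
    have ytn: "inverse (t ^ T - y ^ T) = - inverse (y ^ T - t ^ T)"
      by (metis inverse_minus_eq minus_diff_eq)
    have "smear (act M) (expansion T t (kernel T K y j)) b v =
       (\<Sum>i<N2. ((A * geom_fps (t ^ T - y ^ T) j) $ i) *\<^sub>C act M b (int i) v)"
      unfolding A_def
      by (subst expansion_eq[OF expands_kernel_away[OF T t yt]], rule MM.smear_fps) (rule N2)
    moreover have "(A * geom_fps (t ^ T - y ^ T) j) $ i = (\<Sum>m\<le>i. (A $ (i - m) * ((- of_nat j) gchoose m) * (- 1) ^ (j + m)) *
      inverse (y ^ T - t ^ T) ^ (j + m))" for i
    proof -
      have "(A * geom_fps (t ^ T - y ^ T) j) $ i = (\<Sum>m=0..i. geom_fps (t ^ T - y ^ T) j $ m * A $ (i - m))"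
        unfolding mult.commute[of A] by (rule fps_mult_nth)
      then show ?thesis
        unfolding atLeast0AtMost geom_fps_def ytn
        by (simp add: power_minus[of "inverse (y ^ T - t ^ T)"] mult_ac)
    qed
    ultimately have 2: "S u3 [(a, y)] (smear (act M) (expansion T t (kernel T K y j)) b v, t) u2 = t2 y"
      unfolding t2_def
      by (simp add: clinear_sum[OF S_linear(2)] clinear_scale[OF S_linear(2)] scaleC_complex_def)
    have "(- (y ^ T)) powi (- int j) = (- 1) ^ j * inverse (y ^ T - 0 ^ T) ^ j"
    proof -
      have "(- (y ^ T)) powi (- int j) = inverse (- (y ^ T)) ^ j"
        by (simp only: power_int_minus power_int_of_nat power_inverse)
      also have "\<dots> = (- 1) ^ j * inverse (y ^ T) ^ j"
        by (metis inverse_minus_eq power_minus)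
      finally show ?thesis using T by (simp only: power_0_left) simp
    qed
    then have 3: "(- (y ^ T)) powi (- int j) * S u3 [(a, y)] (v, t) (U2 (cls b) u2) = t3 y"
      by (simp add: t3_def)
    show ?thesis
      using 1 2 3 j by (simp add: block_sum_def J_def K_def)
  qed
  let ?ms = "\<lambda>c w. matrix_series (act M) l c w"
  define L1 where "L1 = (\<Sum>i<N1. hasse i (fps_to_fls A) * ?ms (mode V b (int i - int j) a) v)"
  define L2 where "L2 = (\<Sum>i<N2. (\<Sum>m\<le>i. fls_const (A $ (i - m) * ((- of_nat j) gchoose m) * (- 1) ^ (j + m)) *
      fls_X_intpow (- int (j + m))) * ?ms a (act M b (int i) v))"
  define L3 where "L3 = (fls_const ((- 1) ^ j) * fps_to_fls (geom_fps (t ^ T - 0 ^ T) j)) *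
      matrix_series (act M) (\<lambda>w. S u3 [] (w, t) (U2 (cls b) u2)) a v"
  have powhol: "(\<lambda>x. x powi K) holomorphic_on punctured T ?P"
    by (intro holomorphic_intros) (auto simp: punctured_def)
  have hd: "(d_dz T ^^ i) (\<lambda>x. x powi K) holomorphic_on punctured T ?P" for i
    by (rule d_dz_iter_holomorphic_punctured[OF T fin powhol])
  have E1: "expands T t t1 L1"
    unfolding t1_def L1_def hasse_def A_def l_def
    by (intro expands_sum expands_mult expands_cmult ex expands_d_dz_iter[OF T t fin powhol] expands_coord T t)
  have E2: "expands T t t2 L2"
    unfolding t2_def L2_def l_def
    by (intro expands_sum expands_mult expands_cmult ex expands_pole_at T t refl)
  have E3: "expands T t t3 L3"
    unfolding t3_def L3_def
    by (intro expands_mult expands_cmult ex expands_pole_away T t) (use T t in \<open>auto simp: power_0_left\<close>)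
  have H: "(\<lambda>y. t1 y + (t2 y + t3 y)) holomorphic_on punctured T ?P"
  proof -
    have i1: "(\<lambda>y. inverse (y ^ T - t ^ T)) holomorphic_on punctured T ?P"
      "(\<lambda>y. inverse (y ^ T - 0 ^ T)) holomorphic_on punctured T ?P"
      using T by (auto intro!: holomorphic_intros simp: punctured_def power_0_left)
    show ?thesis
      unfolding t1_def t2_def t3_def
      by (intro holomorphic_on_add holomorphic_on_mult holomorphic_on_sum holomorphic_on_const
          holomorphic_on_power i1 hol hd)
  qed
  \<comment> \<open>For every exponent e in the series A of z^(K/T) at t, the three contributions
    are the three sums of the Borcherds identity for b and a with parameters l = -j, m = e and n;
    this is \<open>B\<close> below.\<close>
  have L0: "L1 + (L2 + L3) = 0"
  proof (rule fls_eqI_residue)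
    fix n
    obtain M0 where M0: "\<And>q. q \<ge> M0 \<Longrightarrow> act M a q v = 0" using MM.truncation[of a v] by blast
    define M' where "M' = max N2 (nat (M0 - n))"
    have Ma: "act M a (n + int m) v = 0" if "m \<ge> M'" for m
      using that by (intro M0) (auto simp: M'_def)
    have "\<exists>Q. \<forall>q\<ge>Q. act M b q (act M a (n + int m) v) = 0" for m
      using MM.truncation[of b "act M a (n + int m) v"] by metis
    then obtain Q where Q: "\<And>m q. q \<ge> Q m \<Longrightarrow> act M b q (act M a (n + int m) v) = 0" by metis
    have "\<exists>R. \<forall>q\<ge>R. act M (mode V b (int i - int j) a) q v = 0" for i
      using MM.truncation[of "mode V b (int i - int j) a" v] by metis
    then obtain R where R: "\<And>i q. q \<ge> R i \<Longrightarrow> act M (mode V b (int i - int j) a) q v = 0" by metis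
    define Q0 where "Q0 = Max (insert 0 (Q ` {..<M'}))"
    define R0 where "R0 = Max (insert 0 (R ` {..<N1}))"
    \<comment> \<open>Beyond E all the modes concerned vanish, for all m < M' and i < N1
      simultaneously, so the exponent e can run over one range in all three sums.\<close>
    define E where "E = max N2 (max (nat (Q0 + int j + int M')) (nat (R0 - n + int N1)))"
    have EQ: "act M b (int e - int j - int m) (act M a (n + int m) v) = 0" if "e \<ge> E" "m < M'" for e m
    proof (rule Q)
      have "Q m \<le> Q0" unfolding Q0_def by (rule Max_ge) (use that in auto)
      moreover have "Q0 + int j + int M' \<le> int e" using that(1) unfolding E_def by linarith
      ultimately show "Q m \<le> int e - int j - int m" using that(2) by linarith
    qed
    have ER: "act M (mode V b (int i - int j) a) (int e + n - int i) v = 0" if "e \<ge> E" "i < N1" for e i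
    proof (rule R)
      have "R i \<le> R0" unfolding R0_def by (rule Max_ge) (use that in auto)
      moreover have "R0 - n + int N1 \<le> int e" using that(1) unfolding E_def by linarith
      ultimately show "R i \<le> int e + n - int i" using that(2) by linarith
    qed
    let ?c = "\<lambda>m. (- 1) ^ m * ((- of_nat j) gchoose m) :: complex"
    have c1: "L1 $$ (- n - 1) = (\<Sum>e<E. A $ e * (\<Sum>i<N1. (of_nat e gchoose i) *
        l (act M (mode V b (int i - int j) a) (int e + n - int i) v)))"
    proof -
      have "(hasse i (fps_to_fls A) * ?ms (mode V b (int i - int j) a) v) $$ (- n - 1) =
        (\<Sum>e<E. (of_nat e gchoose i) * A $ e * l (act M (mode V b (int i - int j) a) (int e + n - int i) v))"
        if i: "i < N1" for i
      proof -
        have "(hasse i (fps_to_fls A) * ?ms (mode V b (int i - int j) a) v) $$ (- n - 1) =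
          (\<Sum>e\<in>{- int i..<int E - int i}. hasse i (fps_to_fls A) $$ e * l (act M (mode V b (int i - int j) a) (e + n) v))"
        proof (rule MM.times_matrix_series_nth[OF l])
          show "hasse i (fps_to_fls A) $$ e = 0" if "e < - int i" for e
            using that by (simp add: hasse_nth)
          show "act M (mode V b (int i - int j) a) (e + n) v = 0" if e: "int E - int i \<le> e" for e
            using ER[of "nat (e + int i)" i] e i by simp
        qed
        also have "\<dots> = (\<Sum>e<E. hasse i (fps_to_fls A) $$ (int e - int i) * l (act M (mode V b (int i - int j) a) (int e - int i + n) v))"
          by (rule sum.reindex_bij_witness[of _ "\<lambda>e. int e - int i" "\<lambda>e. nat (e + int i)"]) auto
        finally show ?thesis by (simp add: hasse_nth algebra_simps)
      qed
      then have "L1 $$ (- n - 1) = (\<Sum>i<N1. \<Sum>e<E. (of_nat e gchoose i) * A $ e *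
          l (act M (mode V b (int i - int j) a) (int e + n - int i) v))"
        unfolding L1_def by (simp add: fls_sum_nth)
      then show ?thesis
        by (subst (asm) sum.swap) (simp add: sum_distrib_left mult_ac)
    qed
    have c2: "L2 $$ (- n - 1) = (\<Sum>e<E. A $ e * (\<Sum>m<M'. (?c m * (- 1) ^ j) *
        l (act M a (n - int j - int m) (act M b (int e + int m) v))))"
    proof -
      \<comment> \<open>The mode index i is split as e + m, with e the exponent taken from z^(K/T)
        and m the one taken from the pole; the sum over m up to i thereby becomes a sum over a
        triangle of pairs.\<close>
      define G where "G e m = A $ e * ((?c m * (- 1) ^ j) * l (act M a (n - int j - int m) (act M b (int e + int m) v)))" for e m
      have msn: "(fls_X_intpow (- int (j + m)) * ?ms a w) $$ (- n - 1) = l (act M a (n - int j - int m) w)" for m w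
        using matrix_series_S_nth[OF l, of a w "n - int j - int m"]
        by (simp add: fls_shifted_times_simps algebra_simps)
      have "L2 $$ (- n - 1) = (\<Sum>i<N2. \<Sum>m\<le>i. (A $ (i - m) * ((- of_nat j) gchoose m) * (- 1) ^ (j + m)) *
         l (act M a (n - int j - int m) (act M b (int i) v)))"
        unfolding L2_def fls_sum_nth sum_distrib_right mult.assoc[of "fls_const _"] 
        by (intro sum.cong refl) (simp only: fls_mult_const_nth msn)
      also have "\<dots> = (\<Sum>i<N2. \<Sum>m\<le>i. G (i - m) m)"
        by (intro sum.cong refl) (simp add: G_def power_add mult_ac flip: of_nat_add)
      also have "\<dots> = (\<Sum>i<N2. \<Sum>e\<le>i. G e (i - e))"
      proof (rule sum.cong[OF refl])
        show "(\<Sum>m\<le>i. G (i - m) m) = (\<Sum>e\<le>i. G e (i - e))" for i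
          by (rule sum.reindex_bij_witness[of _ "\<lambda>e. i - e" "\<lambda>e. i - e"]) auto
      qed
      also have "\<dots> = (\<Sum>(e, m)\<in>{(e, m). e + m < N2}. G e m)"
        by (rule sum.triangle_reindex[symmetric])
      also have "\<dots> = (\<Sum>(e, m)\<in>{..<E} \<times> {..<M'}. G e m)"
      proof (rule sum.mono_neutral_left)
        show "\<forall>p\<in>{..<E} \<times> {..<M'} - {(e, m). e + m < N2}. (case p of (e, m) \<Rightarrow> G e m) = 0"
        proof
          fix p assume "p \<in> {..<E} \<times> {..<M'} - {(e, m). e + m < N2}"
          then obtain e m where p: "p = (e, m)" "\<not> e + m < N2" by (cases p) auto
          then have "act M b (int e + int m) v = 0" using N2[of "e + m"] by simp
          then show "(case p of (e, m) \<Rightarrow> G e m) = 0"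
            by (simp add: p G_def clinear_0[OF MM.linear_right] clinear_0[OF l])
        qed
      qed (auto simp: E_def M'_def)
      also have "\<dots> = (\<Sum>e<E. \<Sum>m<M'. G e m)" by (simp add: sum.cartesian_product)
      finally show ?thesis by (simp add: G_def sum_distrib_left)
    qed
    have c3: "L3 $$ (- n - 1) = - (\<Sum>e<E. A $ e * (\<Sum>m<M'. ?c m *
        l (act M b (int e - int j - int m) (act M a (n + int m) v))))"
    proof -
      \<comment> \<open>Invariance without insertions, for the pole of order j + m at t, trades the
        action of b on U^2 for an action on the module. This produces the products in which b acts
        after a.\<close>
      have blk: "inverse (- (t ^ T)) ^ (j + m) * S u3 [] (x, t) (U2 (cls b) u2) =
          - l (smear (act M) (expansion T t (kernel T K t (j + m))) b x)" for m x
      proof -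
        have pw: "(- (t ^ T)) powi (- int (j + m)) = inverse (- (t ^ T)) ^ (j + m)"
          by (simp only: power_int_minus power_int_of_nat power_inverse)
        have "block_sum b k r t (j + m) u3 [] x t u2 = 0"
          using invariantD[of "[]" t r b k t "j + m" u3 x u2] inv cf0 b j by simp
        then show ?thesis
          using j unfolding block_sum_def J_def pw by (simp add: K_def l_def add_eq_0_iff)
      qed
      have sm: "l (smear (act M) (expansion T t (kernel T K t (j + m))) b (act M a (n + int m) v)) =
         (\<Sum>e<E. A $ e * l (act M b (int e - int j - int m) (act M a (n + int m) v)))" if m: "m < M'" for m
      proof -
        have nth: "expansion T t (kernel T K t (j + m)) $$ q = fps_to_fls A $$ (q + int (j + m))" for q
          unfolding A_def
          by (subst expansion_eq[OF expands_kernel_at[OF T t refl]]) (simp add: fls_shifted_times_simps add.commute)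
        have "smear (act M) (expansion T t (kernel T K t (j + m))) b (act M a (n + int m) v) =
          (\<Sum>q\<in>{- int (j + m)..<int E - int (j + m)}. (expansion T t (kernel T K t (j + m)) $$ q) *\<^sub>C
            act M b q (act M a (n + int m) v))"
        proof (rule MM.smear_sum)
          show "expansion T t (kernel T K t (j + m)) $$ q = 0" if "q < - int (j + m)" for q
            using that by (simp add: nth)
          show "act M b q (act M a (n + int m) v) = 0" if q: "int E - int (j + m) \<le> q" for q
            using EQ[of "nat (q + int (j + m))" m] q m by simp
        qed
        also have "\<dots> = (\<Sum>e<E. (A $ e) *\<^sub>C act M b (int e - int j - int m) (act M a (n + int m) v))"
          by (rule sum.reindex_bij_witness[of _ "\<lambda>e. int e - int (j + m)" "\<lambda>q. nat (q + int (j + m))"])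
             (auto simp: nth algebra_simps)
        finally show ?thesis by (simp add: clinear_sum[OF l] clinear_scale[OF l] scaleC_complex_def)
      qed
      have "L3 $$ (- n - 1) = (- 1) ^ j * (\<Sum>q\<in>{0..<int M'}. fps_to_fls (geom_fps (t ^ T - 0 ^ T) j) $$ q *
          S u3 [] (act M a (q + n) v, t) (U2 (cls b) u2))"
        unfolding L3_def mult.assoc fls_mult_const_nth
      proof (subst MM.times_matrix_series_nth[OF S_linear(2), of 0 _ "int M'"])
        show "act M a (e + n) v = 0" if "int M' \<le> e" for e
          using Ma[of "nat e"] that by (simp add: add.commute)
      qed simp_all
      also have "(\<Sum>q\<in>{0..<int M'}. fps_to_fls (geom_fps (t ^ T - 0 ^ T) j) $$ q *
          S u3 [] (act M a (q + n) v, t) (U2 (cls b) u2)) =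
          (\<Sum>m<M'. geom_fps (t ^ T - 0 ^ T) j $ m * S u3 [] (act M a (n + int m) v, t) (U2 (cls b) u2))"
        by (rule sum.reindex_bij_witness[of _ int nat]) (auto simp: add.commute)
      also have "(- 1) ^ j * \<dots> = (\<Sum>m<M'. ?c m * (inverse (- (t ^ T)) ^ (j + m) * S u3 [] (act M a (n + int m) v, t) (U2 (cls b) u2)))"
      proof -
        have "(- 1) ^ j * geom_fps (t ^ T - 0 ^ T) j $ m = ?c m * inverse (- (t ^ T)) ^ (j + m)" for m
        proof -
          have "inverse (- (t ^ T)) ^ (j + m) = (- 1) ^ (j + m) * inverse (t ^ T) ^ (j + m)"
            by (metis inverse_minus_eq power_minus)
          then have "?c m * inverse (- (t ^ T)) ^ (j + m) =
            ((- 1) ^ m * (- 1) ^ m) * ((- 1) ^ j * (((- of_nat j) gchoose m) * inverse (t ^ T) ^ (j + m)))"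
            by (simp only: power_add mult_ac)
          moreover have "(- 1 :: complex) ^ m * (- 1) ^ m = 1"
            by (simp flip: power_mult_distrib)
          moreover have "t ^ T - 0 ^ T = t ^ T" using T by (simp add: power_0_left)
          ultimately show ?thesis
            by (simp only: geom_fps_def) simp
        qed
        then show ?thesis by (simp add: sum_distrib_left flip: mult.assoc)
      qed
      also have "\<dots> = - (\<Sum>m<M'. ?c m * (\<Sum>e<E. A $ e * l (act M b (int e - int j - int m) (act M a (n + int m) v))))"
        unfolding blk by (simp add: sm sum_negf)
      also have "(\<Sum>m<M'. ?c m * (\<Sum>e<E. A $ e * l (act M b (int e - int j - int m) (act M a (n + int m) v)))) =
        (\<Sum>e<E. A $ e * (\<Sum>m<M'. ?c m * l (act M b (int e - int j - int m) (act M a (n + int m) v))))"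
        unfolding sum_distrib_left by (subst sum.swap) (simp add: mult_ac)
      finally show ?thesis .
    qed
    have B: "(\<Sum>i<N1. (of_nat e gchoose i) * l (act M (mode V b (int i - int j) a) (int e + n - int i) v)) =
      (\<Sum>m<M'. ?c m * l (act M b (int e - int j - int m) (act M a (n + int m) v)))
      - (\<Sum>m<M'. (?c m * (- 1) ^ j) * l (act M a (n - int j - int m) (act M b (int e + int m) v)))" for e
    proof -
      have 1: "Sum_any (\<lambda>i::nat. (of_int (int e) gchoose i) *\<^sub>C act M (mode V b (- int j + int i) a) (int e + n - int i) v)
        = (\<Sum>i<N1. (of_int (int e) gchoose i) *\<^sub>C act M (mode V b (- int j + int i) a) (int e + n - int i) v)"
        by (rule Sum_any_superset)
           (use N1 in \<open>auto simp: not_less clinear_0[OF MM.linear_left] complex_vs.scale_zero_right add.commute\<close>)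
      let ?h = "\<lambda>m::nat. ((-1) ^ m * (of_int (- int j) gchoose m)) *\<^sub>C
        (act M b (int e + - int j - int m) (act M a (n + int m) v)
         - ((-1) powi (- int j)) *\<^sub>C act M a (n + - int j - int m) (act M b (int e + int m) v))"
      have 2: "Sum_any ?h = (\<Sum>m<M'. ?h m)"
      proof (rule Sum_any_superset)
        fix m assume "m \<notin> {..<M'}"
        then have m: "m \<ge> M'" by simp
        have "act M b (int e + int m) v = 0" using N2[of "e + m"] m by (simp add: M'_def)
        then show "?h m = 0"
          using Ma[OF m] by (simp add: clinear_0[OF MM.linear_right] complex_vs.scale_zero_right)
      qed simp
      have p: "(- 1 :: complex) powi (- int j) = (- 1) ^ j"
        by (simp add: power_int_minus power_inverse[symmetric])
      have "l (\<Sum>i<N1. (of_int (int e) gchoose i) *\<^sub>C act M (mode V b (- int j + int i) a) (int e + n - int i) v)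
        = l (\<Sum>m<M'. ?h m)"
        using MM.borcherds[of "int e" b "- int j" a n v] 1 2 by simp
      then show ?thesis
        unfolding p
        by (simp add: clinear_sum[OF l] clinear_scale[OF l] clinear_diff[OF l] scaleC_complex_def
            right_diff_distrib sum_subtractf mult_ac)
    qed
    have "(L1 + (L2 + L3)) $$ (- n - 1) = (\<Sum>e<E. A $ e * (\<Sum>i<N1. (of_nat e gchoose i) *
        l (act M (mode V b (int i - int j) a) (int e + n - int i) v)))
      + ((\<Sum>e<E. A $ e * (\<Sum>m<M'. (?c m * (- 1) ^ j) *
        l (act M a (n - int j - int m) (act M b (int e + int m) v))))
      - (\<Sum>e<E. A $ e * (\<Sum>m<M'. ?c m *
        l (act M b (int e - int j - int m) (act M a (n + int m) v)))))"
      unfolding fls_plus_nth c1 c2 c3 by simp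
    also have "\<dots> = 0"
      unfolding B by (simp add: right_diff_distrib sum_subtractf)
    finally show "(L1 + (L2 + L3)) $$ (- n - 1) = 0 $$ (- n - 1)" by simp
  qed
  have "t1 y + (t2 y + t3 y) = 0"
  proof (rule expands_determines[OF T t fin H _ _ _ yP])
    show "(\<lambda>_. 0) holomorphic_on punctured T ?P" by simp
    show "expands T t (\<lambda>y. t1 y + (t2 y + t3 y)) 0"
      unfolding L0[symmetric] by (intro expands_add E1 E2 E3)
    show "expands T t (\<lambda>_. 0) 0" using expands_const[of T t 0] by simp
  qed
  then show ?thesis by (simp add: split[OF yP])
qed

end

lemma mset_eq_config: "mset ss = mset ss' \<Longrightarrow> config T ss t \<longleftrightarrow> config T ss' t"
proof -
  assume m: "mset ss = mset ss'"
  then have "mset (map (\<lambda>s. s ^ T) (ss @ [t])) = mset (map (\<lambda>s. s ^ T) (ss' @ [t]))" by simp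
  then have "distinct (map (\<lambda>s. s ^ T) (ss @ [t])) = distinct (map (\<lambda>s. s ^ T) (ss' @ [t]))"
    by (rule mset_eq_imp_distinct_iff)
  then show ?thesis using mset_eq_setD[OF m] by (simp add: config_def)
qed

text \<open>A relation rather than an equation for \<open>d_dz\<close>: the sum and product rules
  need the derivative to exist, which the total function \<open>deriv\<close> does not
  record.\<close>

definition has_dz :: "nat \<Rightarrow> (complex \<Rightarrow> complex) \<Rightarrow> complex \<Rightarrow> complex \<Rightarrow> bool" where
  "has_dz T f D t \<longleftrightarrow> (f has_field_derivative D * (of_nat T * t ^ (T - 1))) (at t)"

lemma has_dz_d_dz:
  assumes "has_dz T f D t" "T > 0" "t \<noteq> 0"
  shows "d_dz T f t = D"
  using DERIV_imp_deriv[OF assms(1)[unfolded has_dz_def]] assms(2,3) by (simp add: d_dz_def)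

lemma has_dz_holomorphic:
  assumes "f holomorphic_on X" "open X" "t \<in> X" "T > 0" "t \<noteq> 0"
  shows "has_dz T f (d_dz T f t) t"
  using holomorphic_derivI[OF assms(1,2,3)] assms(4,5) by (simp add: has_dz_def d_dz_def)

lemma has_dz_const: "has_dz T (\<lambda>_. c) 0 t"
  and has_dz_add: "has_dz T f D t \<Longrightarrow> has_dz T f' D' t \<Longrightarrow> has_dz T (\<lambda>x. f x + f' x) (D + D') t"
  and has_dz_cmult: "has_dz T f D t \<Longrightarrow> has_dz T (\<lambda>x. c * f x) (c * D) t"
  and has_dz_mult: "has_dz T f D t \<Longrightarrow> has_dz T f' D' t \<Longrightarrow>
    has_dz T (\<lambda>x. f x * f' x) (D * f' t + f t * D') t"
  unfolding has_dz_def by (auto intro!: derivative_eq_intros simp: algebra_simps)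

lemma has_dz_sum: "(\<And>i. i \<in> I \<Longrightarrow> has_dz T (f i) (D i) t) \<Longrightarrow> has_dz T (\<lambda>x. \<Sum>i\<in>I. f i x) (\<Sum>i\<in>I. D i) t"
proof (induction I rule: infinite_finite_induct)
  case (insert i I)
  then show ?case using has_dz_add[of T "f i" "D i" t "\<lambda>x. \<Sum>i\<in>I. f i x"] by simp
qed (simp_all add: has_dz_const)

lemma has_dz_cong:
  assumes "has_dz T f D t" "open X" "t \<in> X" "\<And>x. x \<in> X \<Longrightarrow> f x = f' x"
  shows "has_dz T f' D t"
  using assms unfolding has_dz_def by (auto intro: has_field_derivative_transform_within_open)

text \<open>The F_(n,i) are divided derivatives in the second point, so a further derivative raises
  i and produces the factor i + 1.\<close>

lemma has_dz_F_fun: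
  assumes "T > 0" "t \<noteq> 0" "s ^ T \<noteq> t ^ T"
  shows "has_dz T (\<lambda>x. F_fun T K i s x) (of_nat (Suc i) * F_fun T K (Suc i) s t) t"
proof -
  let ?f = "\<lambda>x. x powi K / (s ^ T - x ^ T)"
  have "?f holomorphic_on punctured T {s}"
    by (intro holomorphic_intros) (auto simp: punctured_def)
  then have "(d_dz T ^^ i) ?f holomorphic_on punctured T {s}"
    by (intro d_dz_iter_holomorphic_punctured assms) auto
  then have "has_dz T ((d_dz T ^^ i) ?f) (d_dz T ((d_dz T ^^ i) ?f) t) t"
    by (rule has_dz_holomorphic) (use assms open_punctured[of "{s}" T] in \<open>auto simp: punctured_def\<close>)
  then have "has_dz T (\<lambda>x. s powi (- K) / fact i * (d_dz T ^^ i) ?f x)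
      (s powi (- K) / fact i * (d_dz T ^^ Suc i) ?f t) t"
    by (intro has_dz_cmult) simp
  moreover have "s powi (- K) / fact i * (d_dz T ^^ Suc i) ?f t = of_nat (Suc i) * F_fun T K (Suc i) s t"
    by (simp add: F_fun_def field_simps del: of_nat_Suc)
  ultimately show ?thesis by (simp add: F_fun_def[abs_def])
qed

text \<open>Agreement is required only on configurations, because elsewhere S is zero by convention
  while the formulas take arbitrary values.\<close>

definition regular_on_configs :: "nat \<Rightarrow> nat \<Rightarrow> (complex list \<Rightarrow> complex \<Rightarrow> complex) \<Rightarrow> bool" where
  "regular_on_configs T n G \<longleftrightarrow>
     (\<exists>f\<in>config_functions T n. \<forall>ss t. length ss = n \<and> config T ss t \<longrightarrow> G ss t = f ss t)"

lemma regular_const: "regular_on_configs T n (\<lambda>_ _. c)"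
  unfolding regular_on_configs_def using gf_const by (intro bexI[of _ "\<lambda>_ _. c"]) auto

lemma regular_add:
  "regular_on_configs T n G \<Longrightarrow> regular_on_configs T n G' \<Longrightarrow> regular_on_configs T n (\<lambda>ss t. G ss t + G' ss t)"
  unfolding regular_on_configs_def
  by (elim bexE, rule_tac x = "\<lambda>ss t. f ss t + fa ss t" in bexI) (auto intro: gf_add)

lemma regular_mult:
  "regular_on_configs T n G \<Longrightarrow> regular_on_configs T n G' \<Longrightarrow> regular_on_configs T n (\<lambda>ss t. G ss t * G' ss t)"
  unfolding regular_on_configs_def
  by (elim bexE, rule_tac x = "\<lambda>ss t. f ss t * fa ss t" in bexI) (auto intro: gf_mult)

lemma regular_sum:
  "(\<And>i. i \<in> I \<Longrightarrow> regular_on_configs T n (G i)) \<Longrightarrow> regular_on_configs T n (\<lambda>ss t. \<Sum>i\<in>I. G i ss t)"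
  by (induction I rule: infinite_finite_induct) (auto intro: regular_add regular_const)

lemma regular_power: "regular_on_configs T n G \<Longrightarrow> regular_on_configs T n (\<lambda>ss t. G ss t ^ k)"
  by (induction k) (auto intro: regular_mult regular_const)

lemma regular_powi:
  "regular_on_configs T n G \<Longrightarrow> regular_on_configs T n (\<lambda>ss t. inverse (G ss t)) \<Longrightarrow>
   regular_on_configs T n (\<lambda>ss t. G ss t powi K)"
  by (cases "K \<ge> 0") (auto simp: power_int_def intro: regular_power)

lemma regular_in: "f \<in> config_functions T n \<Longrightarrow> regular_on_configs T n f"
  unfolding regular_on_configs_def by blast

lemma regular_cong:
  assumes "regular_on_configs T n G" "\<And>ss t. length ss = n \<Longrightarrow> config T ss t \<Longrightarrow> G' ss t = G ss t"
  shows "regular_on_configs T n G'"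
  using assms unfolding regular_on_configs_def by (metis (no_types, lifting))

lemma regular_tl:
  assumes "regular_on_configs T n G"
  shows "regular_on_configs T (Suc n) (\<lambda>ss t. G (tl ss) t)"
proof -
  have "f \<in> config_functions T n \<Longrightarrow> \<exists>f'\<in>config_functions T (Suc n). \<forall>s ss t. f' (s # ss) t = f ss t" for f
  proof (induction rule: config_functions.induct)
    case (gf_const c) then show ?case by (intro bexI[of _ "\<lambda>_ _. c"]) (auto intro: config_functions.intros)
  next
    case (gf_coord i) then show ?case
      by (intro bexI[of _ "\<lambda>ss t. ss ! Suc i"]) (auto intro!: config_functions.intros)
  next
    case (gf_coord_inverse i) then show ?case
      by (intro bexI[of _ "\<lambda>ss t. inverse (ss ! Suc i)"]) (auto intro!: config_functions.intros)
  next
    case gf_last then show ?case by (intro bexI[of _ "\<lambda>ss t. t"]) (auto intro: config_functions.intros)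
  next
    case gf_last_inverse then show ?case
      by (intro bexI[of _ "\<lambda>ss t. inverse t"]) (auto intro: config_functions.intros)
  next
    case (gf_diff i j) then show ?case
      by (intro bexI[of _ "\<lambda>ss t. inverse ((ss ! Suc i) ^ T - (ss ! Suc j) ^ T)"]) (auto intro!: config_functions.intros)
  next
    case (gf_diff_last i) then show ?case
      by (intro bexI[of _ "\<lambda>ss t. inverse ((ss ! Suc i) ^ T - t ^ T)"]) (auto intro!: config_functions.intros)
  next
    case (gf_add f1 f2)
    then obtain g1 g2 where "g1 \<in> config_functions T (Suc n)" "\<forall>s ss t. g1 (s # ss) t = f1 ss t"
      "g2 \<in> config_functions T (Suc n)" "\<forall>s ss t. g2 (s # ss) t = f2 ss t" by blast
    then show ?case by (intro bexI[of _ "\<lambda>ss t. g1 ss t + g2 ss t"]) (auto intro: config_functions.intros)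
  next
    case (gf_mult f1 f2)
    then obtain g1 g2 where "g1 \<in> config_functions T (Suc n)" "\<forall>s ss t. g1 (s # ss) t = f1 ss t"
      "g2 \<in> config_functions T (Suc n)" "\<forall>s ss t. g2 (s # ss) t = f2 ss t" by blast
    then show ?case by (intro bexI[of _ "\<lambda>ss t. g1 ss t * g2 ss t"]) (auto intro: config_functions.intros)
  qed
  moreover obtain f where "f \<in> config_functions T n" "\<forall>ss t. length ss = n \<and> config T ss t \<longrightarrow> G ss t = f ss t"
    using assms unfolding regular_on_configs_def by blast
  ultimately obtain f' where f': "f' \<in> config_functions T (Suc n)"
    "\<And>s ss t. length ss = n \<Longrightarrow> config T ss t \<Longrightarrow> f' (s # ss) t = G ss t" by metis
  have "G (tl ss) t = f' ss t" if "length ss = Suc n" "config T ss t" for ss t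
    using that f'(2) by (cases ss) (auto simp: config_Cons)
  with f'(1) show ?thesis unfolding regular_on_configs_def by blast
qed

lemma regular_coords:
  assumes "i < n" shows "regular_on_configs T n (\<lambda>ss t. (ss ! i) powi K)"
  by (intro regular_powi regular_in gf_coord gf_coord_inverse assms)

lemma regular_last: "regular_on_configs T n (\<lambda>ss t. t powi K)"
  by (intro regular_powi regular_in gf_last gf_last_inverse)

lemma regular_F_fun:
  assumes "T > 0" "l < n"
  shows "regular_on_configs T (Suc n) (\<lambda>ss t. F_fun T K i (ss ! 0) (ss ! Suc l))"
proof (rule regular_cong)
  show "regular_on_configs T (Suc n) (\<lambda>ss t. ((- 1) * ((ss ! 0) powi (- K))) *
    (\<Sum>m\<le>i. (((of_int K / of_nat T) gchoose m) * ((ss ! Suc l) powi (K - int T * int m))) *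
      (((- 1) gchoose (i - m)) * inverse ((ss ! Suc l) ^ T - (ss ! 0) ^ T) ^ (1 + (i - m)))))"
    using assms(2)
    by (intro regular_mult regular_sum regular_power regular_const regular_coords regular_in[OF gf_diff]) auto
  fix ss t assume ss: "length ss = Suc n" "config T ss t"
  have "Suc l < length ss" using ss assms by simp
  then have "(ss ! 0) ^ T \<noteq> (ss ! Suc l) ^ T"
    using ss(2) nth_eq_iff_index_eq[of "map (\<lambda>s. s ^ T) (ss @ [t])" 0 "Suc l"] ss(1)
    by (auto simp: config_def nth_append)
  moreover have "ss ! Suc l \<noteq> 0" using ss assms by (auto simp: config_def)
  ultimately show "F_fun T K i (ss ! 0) (ss ! Suc l) = ((- 1) * ((ss ! 0) powi (- K))) *
    (\<Sum>m\<le>i. (((of_int K / of_nat T) gchoose m) * ((ss ! Suc l) powi (K - int T * int m))) *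
      (((- 1) gchoose (i - m)) * inverse ((ss ! Suc l) ^ T - (ss ! 0) ^ T) ^ (1 + (i - m))))"
    by (subst F_fun_explicit[OF assms(1)]) (simp_all add: power_fps_def)
qed

lemma regular_F_fun_last:
  assumes "T > 0"
  shows "regular_on_configs T (Suc n) (\<lambda>ss t. F_fun T K i (ss ! 0) t)"
proof (rule regular_cong)
  show "regular_on_configs T (Suc n) (\<lambda>ss t. ((- 1) * ((ss ! 0) powi (- K))) *
    (\<Sum>m\<le>i. (((of_int K / of_nat T) gchoose m) * (t powi (K - int T * int m))) *
      (((- 1) gchoose (i - m)) * ((- 1) * inverse ((ss ! 0) ^ T - t ^ T)) ^ (1 + (i - m)))))"
    by (intro regular_mult regular_sum regular_power regular_const regular_coords regular_last regular_in[OF gf_diff_last]) auto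
  fix ss t assume ss: "length ss = Suc n" "config T ss t"
  then obtain s ss' where s: "ss = s # ss'" by (cases ss) auto
  have ne: "s ^ T \<noteq> t ^ T" and t: "t \<noteq> 0"
    using ss by (auto simp: s config_def)
  have "inverse (t ^ T - s ^ T) = (- 1) * inverse (s ^ T - t ^ T)"
    by (metis inverse_minus_eq minus_diff_eq mult_minus1)
  then show "F_fun T K i (ss ! 0) t = ((- 1) * ((ss ! 0) powi (- K))) *
    (\<Sum>m\<le>i. (((of_int K / of_nat T) gchoose m) * (t powi (K - int T * int m))) *
      (((- 1) gchoose (i - m)) * ((- 1) * inverse ((ss ! 0) ^ T - t ^ T)) ^ (1 + (i - m))))"
    by (subst F_fun_explicit[OF assms t]) (simp_all add: s power_fps_def ne)
qed

definition rational_in_z :: "nat \<Rightarrow> complex set \<Rightarrow> (complex \<Rightarrow> complex) \<Rightarrow> bool" where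
  "rational_in_z T X G \<longleftrightarrow> (\<exists>P Q :: complex poly. \<forall>s\<in>X. poly Q (s ^ T) \<noteq> 0 \<and> G s = poly P (s ^ T) / poly Q (s ^ T))"

lemma rational_const: "rational_in_z T X (\<lambda>_. c)"
  unfolding rational_in_z_def by (intro exI[of _ "[:c:]"] exI[of _ 1]) simp

lemma rational_z: "rational_in_z T X (\<lambda>s. s ^ T)"
  unfolding rational_in_z_def by (intro exI[of _ "[:0, 1:]"] exI[of _ 1]) simp

lemma rational_pole: "(\<And>s. s \<in> X \<Longrightarrow> c \<noteq> s ^ T) \<Longrightarrow> rational_in_z T X (\<lambda>s. inverse (c - s ^ T))"
  unfolding rational_in_z_def by (intro exI[of _ 1] exI[of _ "[:c, -1:]"]) (auto simp: divide_inverse)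

lemma rational_add:
  assumes "rational_in_z T X G" "rational_in_z T X G'"
  shows "rational_in_z T X (\<lambda>s. G s + G' s)"
proof -
  obtain P Q P' Q' where "\<forall>s\<in>X. poly Q (s ^ T) \<noteq> 0 \<and> G s = poly P (s ^ T) / poly Q (s ^ T)"
    "\<forall>s\<in>X. poly Q' (s ^ T) \<noteq> 0 \<and> G' s = poly P' (s ^ T) / poly Q' (s ^ T)"
    using assms unfolding rational_in_z_def by blast
  then show ?thesis unfolding rational_in_z_def
    by (intro exI[of _ "P * Q' + P' * Q"] exI[of _ "Q * Q'"]) (auto simp: field_simps)
qed

lemma rational_mult:
  assumes "rational_in_z T X G" "rational_in_z T X G'"
  shows "rational_in_z T X (\<lambda>s. G s * G' s)"
proof -
  obtain P Q P' Q' where "\<forall>s\<in>X. poly Q (s ^ T) \<noteq> 0 \<and> G s = poly P (s ^ T) / poly Q (s ^ T)"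
    "\<forall>s\<in>X. poly Q' (s ^ T) \<noteq> 0 \<and> G' s = poly P' (s ^ T) / poly Q' (s ^ T)"
    using assms unfolding rational_in_z_def by blast
  then show ?thesis unfolding rational_in_z_def
    by (intro exI[of _ "P * P'"] exI[of _ "Q * Q'"]) auto
qed

lemma rational_sum: "(\<And>i. i \<in> I \<Longrightarrow> rational_in_z T X (G i)) \<Longrightarrow> rational_in_z T X (\<lambda>s. \<Sum>i\<in>I. G i s)"
  by (induction I rule: infinite_finite_induct) (auto intro: rational_add rational_const)

lemma rational_power: "rational_in_z T X G \<Longrightarrow> rational_in_z T X (\<lambda>s. G s ^ n)"
  by (induction n) (auto intro: rational_mult rational_const)

lemma rational_z_powi:
  assumes "\<And>s. s \<in> X \<Longrightarrow> s \<noteq> 0"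
  shows "rational_in_z T X (\<lambda>s. (s ^ T) powi n)"
proof (cases "n \<ge> 0")
  case False
  have "rational_in_z T X (\<lambda>s. ((- 1) * inverse (0 - s ^ T)) ^ nat (- n))"
    by (intro rational_power rational_mult rational_const rational_pole) (use assms in auto)
  then show ?thesis using False by (simp add: power_int_def)
qed (simp add: power_int_def rational_power rational_z)

lemma rational_cong:
  assumes "rational_in_z T X G" "\<And>s. s \<in> X \<Longrightarrow> G' s = G s"
  shows "rational_in_z T X G'"
  using assms unfolding rational_in_z_def by metis

text \<open>With K = Tq + r the factor s^r cancels the fractional part of s^(-K) and leaves the
  integral power z^(-q); in s, everything else in the explicit formula depends on z alone.\<close>

lemma rational_F_fun:
  assumes "T > 0" "p \<noteq> 0" "\<And>s. s \<in> X \<Longrightarrow> s \<noteq> 0 \<and> s ^ T \<noteq> p ^ T" "K = int T * q + int r"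
  shows "rational_in_z T X (\<lambda>s. s ^ r * F_fun T K i s p)"
proof (rule rational_cong)
  show "rational_in_z T X (\<lambda>s. ((- 1) * (s ^ T) powi (- q)) *
    (\<Sum>m\<le>i. power_fps T K p $ m * (((- 1) gchoose (i - m)) * inverse (p ^ T - s ^ T) ^ (1 + (i - m)))))"
    by (intro rational_mult rational_sum rational_power rational_const rational_z_powi rational_pole)
       (metis assms(3))+
  fix s assume s: "s \<in> X"
  have "s ^ r * s powi (- K) = s powi (int r + (- K))"
    using assms(3)[OF s] by (subst power_int_add) auto
  also have "int r + (- K) = int T * (- q)" by (simp add: assms(4))
  also have "s powi (int T * (- q)) = (s ^ T) powi (- q)" by (simp only: power_int_mult power_int_of_nat)
  finally have "s ^ r * s powi (- K) = (s ^ T) powi (- q)" .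
  then show "s ^ r * F_fun T K i s p = ((- 1) * (s ^ T) powi (- q)) *
    (\<Sum>m\<le>i. power_fps T K p $ m * (((- 1) gchoose (i - m)) * inverse (p ^ T - s ^ T) ^ (1 + (i - m))))"
    by (subst F_fun_explicit[OF assms(1,2)]) (use assms(3)[OF s] in \<open>simp_all flip: mult.assoc\<close>)
qed

text \<open>From z'/(z - z') = z/(z - z') - 1: raising the exponent by one full power of z changes
  the Cauchy kernel by a multiple of z^(K/T), the kernel of pole order 0.\<close>

lemma cauchy_kernel_shift:
  assumes x: "x \<in> punctured T {s}" and s0: "s \<noteq> 0"
  shows "cauchy_kernel T (K + int T) s x = cauchy_kernel T K s x + (- (s powi (- (K + int T)))) * kernel T K t 0 x"
proof -
  have x0: "x \<noteq> 0" and ne: "s ^ T - x ^ T \<noteq> 0" using x by (auto simp: punctured_def)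
  define c where "c = s powi (- (K + int T))"
  have "x powi (K + int T) = x powi K * x ^ T" using x0 by (simp add: power_int_add)
  moreover have sc: "s powi (- K) = c * s ^ T"
  proof -
    have "c * s ^ T = s powi (- (K + int T)) * s powi (int T)" by (simp add: c_def)
    also have "\<dots> = s powi (- (K + int T) + int T)" using s0 by (subst power_int_add) auto
    finally show ?thesis by simp
  qed
  moreover define X where "X = x powi K"
  moreover define Y where "Y = X / (s ^ T - x ^ T)"
  moreover define Y' where "Y' = X * x ^ T / (s ^ T - x ^ T)"
  ultimately have 1: "cauchy_kernel T (K + int T) s x = c * Y'"
    by (simp add: cauchy_kernel_eq c_def)
  have 2: "cauchy_kernel T K s x = c * s ^ T * Y"
    by (simp add: cauchy_kernel_eq sc X_def Y_def)
  have 3: "Y' = s ^ T * Y - X"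
    unfolding Y_def Y'_def using ne by (simp add: divide_simps) (simp add: algebra_simps)
  show ?thesis unfolding 1 2 3 c_def[symmetric] by (simp add: kernel_def X_def algebra_simps)
qed

text \<open>The left and the right recursive formula differ by the invariance under
  $a\otimes z^{\mathrm{wt}\,a-1}dz$.\<close>

lemma (in recursive_system) right_recursion_defect:
  assumes a: "a \<in> grade V k \<inter> eigensp g T 0" and cf: "config T (s # map snd xs) t"
  shows "S u3 ((a, s) # xs) (v, t) u2 = (s ^ T) powi (- int k) * S (U3 u3 (cls a)) xs (v, t) u2
     + recursion_sum V T M S (int T * int k) a s u3 xs v t u2
     + (s ^ T) powi (- int k) * block_sum a k 0 t 0 u3 xs v t u2"
proof -
  let ?K = "int T * (int k - 1)"
  have cfx: "config T (map snd xs) t" and s0: "s \<noteq> 0" using cf by (auto simp: config_Cons punctured_def)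
  define c where "c = (s ^ T) powi (- int k)"
  have K: "?K + int T = int T * int k" by (simp add: algebra_simps)
  have c: "s powi (- (?K + int T)) = c"
    using power_int_mult[of s "int T" "- int k"] by (simp add: c_def K)
  let ?f = "cauchy_kernel T ?K s" and ?e = "kernel T ?K t 0"
  have exf: "expandable ?f" by (rule expandable_curve[OF cauchy_kernel_in_curve_functions[of s "{s}"]]) simp
  have exe: "expandable ?e" by (rule expandable_curve[OF kernel_in_curve_functions[of t "{t}"]]) simp
  have exe': "expandable (\<lambda>x. (- c) * ?e x)"
    by (rule expandable_curve[of _ "{t}"], intro cf_mult cf_const kernel_in_curve_functions) simp
  \<comment> \<open>The two scalars are left unevaluated so that they split together with the test
    function.\<close>
  have "J a (cauchy_kernel T (?K + int T) s) (0 + (- c) * (- 1)) (c + (- c) * 1) u3 xs v t u2 =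
      J a (\<lambda>x. ?f x + (- c) * ?e x) (0 + (- c) * (- 1)) (c + (- c) * 1) u3 xs v t u2"
  proof (rule J_cong[of "{s}", OF _ _ cfx])
    fix x assume "x \<in> punctured T {s}"
    then show "cauchy_kernel T (?K + int T) s x = ?f x + (- c) * ?e x"
      by (simp only: cauchy_kernel_shift[OF _ s0, of x T ?K t] c)
  qed simp
  also have "\<dots> = J a ?f 0 c u3 xs v t u2 - c * J a ?e (- 1) 1 u3 xs v t u2"
    by (simp only: J_add[OF exf exe' cfx] J_cmult[OF exe cfx]) simp
  finally have "J a ?f 0 c u3 xs v t u2 =
      J a (cauchy_kernel T (?K + int T) s) c 0 u3 xs v t u2 + c * J a ?e (- 1) 1 u3 xs v t u2" by simp
  moreover have "S u3 ((a, s) # xs) (v, t) u2 = J a ?f 0 c u3 xs v t u2"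
    using recursion_J[OF T a cf, of u3 v u2] by (simp add: c_def)
  moreover have "J a (cauchy_kernel T (?K + int T) s) c 0 u3 xs v t u2 =
      c * S (U3 u3 (cls a)) xs (v, t) u2 + recursion_sum V T M S (?K + int T) a s u3 xs v t u2"
    by (subst J_coeffs) (simp add: recursion_sum_eq_J[OF cf])
  ultimately show ?thesis by (simp add: c_def block_sum_def K)
qed

section \<open>Invariance for any number of insertions and its consequences\<close>

locale block_system = recursive_system V g T M U2 U3 h1 h2 h3 h S
  for V :: "'v::complex_vs voa_data" and g :: "'v \<Rightarrow> 'v" and T :: nat
    and M :: "('v, 'm::complex_vs) module_data"
    and U2 :: "'v set \<Rightarrow> 'u2::complex_vs \<Rightarrow> 'u2"
    and U3 :: "'u3::complex_vs \<Rightarrow> 'v set \<Rightarrow> 'u3"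
    and h1 h2 h3 h :: complex
    and S :: "('v, 'm, 'u3, 'u2) correlation" +
  assumes invariant_0: "invariant 0" and monomial: "cor_monomial T M S"
begin

text \<open>The second hypothesis supplies invariance one level further down, which the exchange of
  the first two insertions needs.\<close>

lemma invariant_step:
  assumes inv: "invariant n" and inv': "\<And>n'. n = Suc n' \<Longrightarrow> invariant n'"
  shows "invariant (Suc n)"
  unfolding invariant_def
proof (intro allI impI, elim conjE)
  fix xs :: "('v \<times> complex) list" and k r j :: nat and b p u3 v t u2
  assume len: "length xs = Suc n" and cf: "config T (map snd xs) t" and r: "r < T"
    and b: "b \<in> grade V k \<inter> eigensp g T r" and p: "p \<in> set (pts xs t)" and j: "j \<ge> 1 \<or> r = 0"
  obtain a s xs' where xs: "xs = (a, s) # xs'" and len': "length xs' = n"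
    using len by (cases xs) auto
  have inv: "invariant (length xs')" using inv len' by simp
  have cf': "config T (s # map snd xs') t" using cf xs by simp
  have away: "block_sum b k r q j u3 ((a, s) # xs') v t u2 = 0" if "q \<in> set (pts xs' t)" for q
    by (rule invariant_step_away[OF inv cf' r b that j])
  show "block_sum b k r p j u3 xs v t u2 = 0"
  proof (cases "p \<in> set (pts xs' t)")
    case True
    then show ?thesis using away xs by simp
  next
    case False
    then have ps: "p = s" using p xs by auto
    show ?thesis
    proof (cases "j = 0")
      case True
      \<comment> \<open>A kernel of order 0 has no pole, so its nominal pole may be moved to
        t.\<close>
      have "block_sum b k r p j u3 xs v t u2 = block_sum b k r t j u3 xs v t u2"
        using True by (simp add: block_sum_def kernel_def)
      then show ?thesis using away[of t] xs by simp
    next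
      case False
      show ?thesis
      proof (cases xs')
        case Nil
        then show ?thesis
          using invariant_step_base[of s t r b k j u3 a v u2] inv cf' r b False xs ps by simp
      next
        case (Cons y ys)
        obtain c s2 where y: "y = (c, s2)" by (cases y)
        have invs: "invariant (length ys)" "invariant (Suc (length ys))"
          using inv' inv len' Cons by simp_all
        have cf2: "config T (s2 # s # map snd ys) t"
          using cf' mset_eq_config[of "s2 # s # map snd ys" "s # s2 # map snd ys"] Cons y by simp
        \<comment> \<open>After the exchange the new point is s2 and the pole s belongs to the old
          points.\<close>
        have "block_sum b k r p j u3 xs v t u2 = block_sum b k r p j u3 ((c, s2) # (a, s) # ys) v t u2"
          unfolding block_sum_def xs Cons y by (rule J_swap_first[OF invs cf2])
        also have "\<dots> = 0"
          using invariant_step_away[of "(a, s) # ys" s2 t r b k p j u3 c v u2] invs cf2 r b j ps by simp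
        finally show ?thesis .
      qed
    qed
  qed
qed

theorem invariant: "invariant n"
proof -
  have "invariant n \<and> (\<forall>n'. n = Suc n' \<longrightarrow> invariant n')"
    by (induction n) (auto simp: invariant_0 intro: invariant_step)
  then show ?thesis ..
qed

text \<open>The expansion at t in the position of the head involves only values with the tails, so
  equality for the tails passes to the longer lists.\<close>

lemma same_head:
  assumes "mset xs = mset ys" "\<And>v. S u3 xs (v, t) u2 = S u3 ys (v, t) u2"
  shows "S u3 (x # xs) (v, t) u2 = S u3 (x # ys) (v, t) u2"
proof -
  obtain a s where x: "x = (a, s)" by (cases x)
  have ms: "mset (map snd xs) = mset (map snd ys)" using assms(1) by simp
  have set: "snd ` set xs = snd ` set ys" using mset_eq_setD[OF assms(1)] by simp
  show ?thesis
  proof (cases "config T (s # map snd xs) t")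
    case True
    then have cf: "config T (map snd xs) t" "s \<in> punctured T (insert t (snd ` set xs))"
      by (simp_all add: config_Cons)
    have cfy: "config T (map snd ys) t" using cf(1) mset_eq_config[OF ms] by simp
    have t: "t \<noteq> 0" using config_nonzero(1)[OF True] .
    show ?thesis unfolding x
    proof (rule expands_determines[OF T t _ first_holomorphic[OF cf(1)] _
          associativity_t[OF invariant cf(1)] _ cf(2)])
      show "(\<lambda>s. S u3 ((a, s) # ys) (v, t) u2) holomorphic_on punctured T (insert t (snd ` set xs))"
        using first_holomorphic[OF cfy] by (simp add: set)
      show "expands T t (\<lambda>s. S u3 ((a, s) # ys) (v, t) u2) (matrix_series (act M) (\<lambda>w. S u3 xs (w, t) u2) a v)"
        using associativity_t[OF invariant cfy] by (simp add: assms(2))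
    qed simp
  next
    case False
    then have "\<not> config T (s # map snd ys) t"
      using mset_eq_config[of "s # map snd xs" "s # map snd ys"] ms by simp
    then show ?thesis using False by (simp add: x S_off)
  qed
qed

lemma swap: "S u3 (x # y # xs) (v, t) u2 = S u3 (y # x # xs) (v, t) u2"
proof -
  obtain b s' a s where x: "x = (b, s')" "y = (a, s)" by (cases x, cases y)
  show ?thesis
  proof (cases "config T (s' # s # map snd xs) t")
    case True
    then show ?thesis using swap_first[OF invariant invariant True] x by simp
  next
    case False
    moreover from False have "\<not> config T (s # s' # map snd xs) t"
      using mset_eq_config[of "s # s' # map snd xs" "s' # s # map snd xs"] by simp
    ultimately show ?thesis by (simp add: x S_off)
  qed
qed

text \<open>If the heads differ, the head y of the second list occurs in the tail of the first. It
  is brought to second place by the induction hypothesis, exchanged with x, and the remaining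
  rearrangement takes place behind the common head y.\<close>

lemma locality: "mset xs = mset ys \<Longrightarrow> S u3 xs (v, t) u2 = S u3 ys (v, t) u2"
proof (induction "length xs" arbitrary: xs ys v rule: less_induct)
  case less
  show ?case
  proof (cases xs)
    case Nil
    then show ?thesis using less by simp
  next
    case (Cons x xs')
    then obtain y ys' where ys: "ys = y # ys'" using less(2) by (cases ys) auto
    show ?thesis
    proof (cases "x = y")
      case True
      then have m: "mset xs' = mset ys'" using less(2) Cons ys by simp
      show ?thesis unfolding Cons ys True
        by (rule same_head[OF m]) (rule less(1)[OF _ m], simp add: Cons)
    next
      case False
      have e: "add_mset x (mset xs') = add_mset y (mset ys')" using less(2) Cons ys by simp
      then have "y \<in># mset xs'" using False by (metis insert_noteq_member)
      then obtain zs where zs: "mset xs' = add_mset y (mset zs)"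
        by (metis ex_mset insert_DiffM)
      have m1: "mset xs' = mset (y # zs)" using zs by simp
      have m2: "mset (x # zs) = mset ys'" using e zs by (simp add: add_mset_commute)
      have len: "length xs' < length xs" "length (x # zs) < length xs"
        using Cons arg_cong[OF zs, of size] by auto
      have "S u3 xs (v, t) u2 = S u3 (x # y # zs) (v, t) u2"
        unfolding Cons by (rule same_head[OF m1 less(1)[OF len(1) m1]])
      also have "\<dots> = S u3 (y # x # zs) (v, t) u2" by (rule swap)
      also have "\<dots> = S u3 ys (v, t) u2"
        unfolding ys by (rule same_head[OF m2 less(1)[OF len(2) m2]])
      finally show ?thesis .
    qed
  qed
qed

lemma move_to_front: "S u3 (xs @ x # ys) (v, t) u2 = S u3 (x # xs @ ys) (v, t) u2"
  by (rule locality) simp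

lemma config_move: "config T (map snd (xs @ (a, s) # ys)) t \<longleftrightarrow> config T (s # map snd (xs @ ys)) t"
  by (rule mset_eq_config) simp

text \<open>For nonzero r the exponents coincide and both boundary terms vanish; for r = 0 the
  defect is the block sum of pole order 0, which is zero by invariance.\<close>

lemma right_recursion:
  assumes a: "r < T" "a \<in> grade V k \<inter> eigensp g T r" and cf: "config T (s # map snd xs) t"
  shows "S u3 ((a, s) # xs) (v, t) u2 = (s ^ T) powi (- int k) * S (U3 u3 (cls a)) xs (v, t) u2
     + recursion_sum V T M S (int T * (int k - 1 + int (delta r)) + int r) a s u3 xs v t u2"
proof (cases "r = 0")
  case False
  then show ?thesis
    using recursion[OF a cf] twisted_acts_zero[OF a(1) False a(2)] clinear_0[OF S_linear(1)] clinear_0[OF S_linear(3)]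
    by (simp add: delta_def)
next
  case True
  have cfx: "config T (map snd xs) t" using cf by (simp add: config_Cons)
  have "block_sum a k 0 t 0 u3 xs v t u2 = 0"
    using invariantD[OF invariant cfx a, of t 0 u3 v u2] True by simp
  then show ?thesis
    using right_recursion_defect[OF _ cf, of a k u3 v u2] a True by (simp add: delta_def algebra_simps)
qed

lemma vac_homogeneous: "vac V \<in> grade V 0 \<inter> eigensp g T 0"
  using voa_vac[OF voa] aut by (simp add: voa_automorphism_def eigensp_def scaleC_one)

lemma conf_homogeneous: "conf V \<in> grade V 2 \<inter> eigensp g T 0"
  using voa_conf[OF voa] aut by (simp add: voa_automorphism_def eigensp_def scaleC_one)

lemma vacuum_first:
  assumes "config T (s # map snd xs) t"
  shows "S u3 ((vac V, s) # xs) (v, t) u2 = S u3 xs (v, t) u2"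
proof -
  have "recursion_sum V T M S K (vac V) s u3 xs v t u2 = 0" for K
    by (subst recursion_sum_finite[of 0]) (simp_all add: MM.vacuum VV.vacuum)
  moreover have "U2 (cls (vac V)) u2 = u2" using left_module by (simp add: zhu_left_module_def)
  ultimately show ?thesis using recursion[OF T vac_homogeneous assms, of u3 v u2] by simp
qed

text \<open>Both sides are holomorphic in s and are compared at the module point, where the claim
  reduces to Y(L_(-1)a, Z) being the derivative of Y(a,Z).\<close>

lemma translation_first:
  assumes "config T (s # map snd xs) t"
  shows "S u3 ((Vir V (mode V) (-1) a, s) # xs) (v, t) u2 = d_dz T (\<lambda>x. S u3 ((a, x) # xs) (v, t) u2) s"
proof -
  let ?P = "insert t (snd ` set xs)"
  have cf: "config T (map snd xs) t" "s \<in> punctured T ?P" using assms by (simp_all add: config_Cons)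
  have t: "t \<noteq> 0" using config_nonzero(1)[OF assms] .
  have fin: "finite ?P" by simp
  let ?l = "\<lambda>w. S u3 xs (w, t) u2"
  show ?thesis
  proof (rule expands_determines[OF T t fin first_holomorphic[OF cf(1)] _ associativity_t[OF invariant cf(1)] _ cf(2)])
    show "d_dz T (\<lambda>x. S u3 ((a, x) # xs) (v, t) u2) holomorphic_on punctured T ?P"
      using d_dz_iter_holomorphic_punctured[OF T fin first_holomorphic[OF cf(1)], of 1] by simp
    have "expands T t (d_dz T (\<lambda>x. S u3 ((a, x) # xs) (v, t) u2)) (fls_deriv (matrix_series (act M) ?l a v))"
      by (rule expands_d_dz[OF T t fin first_holomorphic[OF cf(1)] associativity_t[OF invariant cf(1)]])
    moreover have "fls_deriv (matrix_series (act M) ?l a v) = matrix_series (act M) ?l (Vir V (mode V) (-1) a) v"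
    proof (rule fls_eqI_residue)
      fix n
      show "fls_deriv (matrix_series (act M) ?l a v) $$ (- n - 1) = matrix_series (act M) ?l (Vir V (mode V) (-1) a) v $$ (- n - 1)"
        using matrix_series_S_nth[OF S_linear(2), of u3 xs t u2 a v "n - 1"]
        by (simp add: matrix_series_S_nth[OF S_linear(2)] MM.translation[OF voa] clinear_minus[OF S_linear(2)]
            clinear_scale[OF S_linear(2)] scaleC_complex_def)
    qed
    ultimately show "expands T t (d_dz T (\<lambda>x. S u3 ((a, x) # xs) (v, t) u2))
        (matrix_series (act M) ?l (Vir V (mode V) (-1) a) v)" by simp
  qed
qed

end

section \<open>Rationality, the derivative at the module point, and membership in the space of
  correlation functions\<close>

context block_system
begin

lemma regular_S: "length as = n \<Longrightarrow> regular_on_configs T n (\<lambda>ss t. S u3 (zip as ss) (v, t) u2)"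
proof (induction n arbitrary: as u3 v u2)
  case 0
  show ?case
  proof (induction v rule: graded_induct[where gr = "mgrade M"])
    show "direct_sum_grading (mgrade M)" using adm by (simp add: admissible_module_def)
  next
    fix d v assume "v \<in> mgrade M d"
    then obtain c where c: "\<And>t. t \<noteq> 0 \<Longrightarrow> S u3 [] (v, t) u2 = c * (t ^ T) powi (- int d)"
      using monomial unfolding cor_monomial_def by blast
    have "regular_on_configs T 0 (\<lambda>ss t. c * (t powi (int T * (- int d))))"
      by (intro regular_mult regular_const regular_last)
    then show "regular_on_configs T 0 (\<lambda>ss t. S u3 (zip as ss) (v, t) u2)"
    proof (rule regular_cong)
      fix ss t assume "config T ss t"
      then have "t \<noteq> 0" by (rule config_nonzero(1))
      then show "S u3 (zip as ss) (v, t) u2 = c * (t powi (int T * (- int d)))"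
        using c[of t] 0 by (simp only: power_int_mult power_int_of_nat) simp
    qed
  next
    fix v w
    assume "regular_on_configs T 0 (\<lambda>ss t. S u3 (zip as ss) (v, t) u2)"
      "regular_on_configs T 0 (\<lambda>ss t. S u3 (zip as ss) (w, t) u2)"
    then show "regular_on_configs T 0 (\<lambda>ss t. S u3 (zip as ss) (v + w, t) u2)"
      by (simp add: clinear_add[OF S_linear(2)] regular_add)
  qed
next
  case (Suc n)
  obtain a0 as' where as: "as = a0 # as'" and len: "length as' = n"
    using Suc.prems by (cases as) auto
  have IH: "regular_on_configs T (Suc n) (\<lambda>ss t. S u3 (zip bs (tl ss)) (v, t) u2)"
    if "length bs = n" for u3 bs v u2
    by (rule regular_tl) (rule Suc.IH[OF that])
  have "regular_on_configs T (Suc n) (\<lambda>ss t. S u3 (zip (a # as') ss) (v, t) u2)" for a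
  proof (induction a rule: hom_induct)
    case (1 k r a)
    let ?K = "int T * (int k - 1) + int r"
    obtain N where N: "\<forall>i\<ge>N. act M a (int i) v = 0" "\<forall>b\<in>set as'. \<forall>i\<ge>N. mode V a (int i) b = 0"
      using common_bound[of a v as'] by auto
    have "regular_on_configs T (Suc n) (\<lambda>ss t. (ss ! 0) powi (int T * (- int k)) * S u3 (zip as' (tl ss)) (v, t) (U2 (cls a) u2)
      + ((\<Sum>l<n. \<Sum>i<N. F_fun T ?K i (ss ! 0) (ss ! Suc l) * S u3 (zip (as'[l := mode V a (int i) (as' ! l)]) (tl ss)) (v, t) u2)
      + (\<Sum>i<N. F_fun T ?K i (ss ! 0) t * S u3 (zip as' (tl ss)) (act M a (int i) v, t) u2)))"
      by (intro regular_add regular_mult regular_sum IH regular_coords regular_F_fun regular_F_fun_last T)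
         (use len in auto)
    then show ?case
    proof (rule regular_cong)
      fix ss t assume ss: "length ss = Suc n" "config T ss t"
      obtain s ss' where s: "ss = s # ss'" and len': "length ss' = n" using ss(1) by (cases ss) auto
      have snd: "map snd (zip as' ss') = ss'" and fst: "fst ` set (zip as' ss') = set as'"
        using len len' by (auto simp flip: list.set_map)
      have cf: "config T (s # map snd (zip as' ss')) t" using ss(2) s snd by simp
      have up: "(zip as' ss')[l := (c, snd (zip as' ss' ! l))] = zip (as'[l := c]) ss'" if "l < n" for l c
      proof (rule nth_equalityI)
        show "(zip as' ss')[l := (c, snd (zip as' ss' ! l))] ! i = zip (as'[l := c]) ss' ! i"
          if "i < length ((zip as' ss')[l := (c, snd (zip as' ss' ! l))])" for i
          using that \<open>l < n\<close> len len' by (cases "i = l") auto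
      qed (use len len' in auto)
      have zl: "zip as' ss' ! l = (as' ! l, ss' ! l)" "length (zip as' ss') = n" if "l < n" for l
        using that len len' by auto
      have N': "\<forall>b\<in>fst ` set (zip as' ss'). \<forall>i\<ge>N. mode V a (int i) b = 0" using N(2) fst by simp
      show "S u3 (zip (a # as') ss) (v, t) u2 = (ss ! 0) powi (int T * (- int k)) * S u3 (zip as' (tl ss)) (v, t) (U2 (cls a) u2)
      + ((\<Sum>l<n. \<Sum>i<N. F_fun T ?K i (ss ! 0) (ss ! Suc l) * S u3 (zip (as'[l := mode V a (int i) (as' ! l)]) (tl ss)) (v, t) u2)
      + (\<Sum>i<N. F_fun T ?K i (ss ! 0) t * S u3 (zip as' (tl ss)) (act M a (int i) v, t) u2))"
      proof -
        have "recursion_sum V T M S ?K a s u3 (zip as' ss') v t u2 =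
          (\<Sum>l<n. \<Sum>i<N. F_fun T ?K i s (ss' ! l) * S u3 (zip (as'[l := mode V a (int i) (as' ! l)]) ss') (v, t) u2)
          + (\<Sum>i<N. F_fun T ?K i s t * S u3 (zip as' ss') (act M a (int i) v, t) u2)"
          unfolding recursion_sum_finite[OF N(1) N']
        proof (intro arg_cong2[where f = "(+)"] sum.cong refl)
          show "{..<length (zip as' ss')} = {..<n}" using len len' by simp
          fix l i assume "l \<in> {..<n}"
          then have l: "l < n" by simp
          show "F_fun T ?K i s (snd (zip as' ss' ! l)) *
              S u3 ((zip as' ss')[l := (mode V a (int i) (fst (zip as' ss' ! l)), snd (zip as' ss' ! l))]) (v, t) u2 =
            F_fun T ?K i s (ss' ! l) * S u3 (zip (as'[l := mode V a (int i) (as' ! l)]) ss') (v, t) u2"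
            by (subst up[OF l]) (simp add: zl(1)[OF l])
        qed
        then show ?thesis
          using recursion[OF 1 cf, of u3 v u2] power_int_mult[of s "int T" "- int k"] by (simp add: s)
      qed
    qed
  next
    case (2 a b)
    show ?case
    proof (rule regular_cong[OF regular_add[OF 2]])
      fix ss :: "complex list" and t assume "length ss = Suc n"
      then obtain s ss' where "ss = s # ss'" by (cases ss) auto
      then show "S u3 (zip ((a + b) # as') ss) (v, t) u2 = S u3 (zip (a # as') ss) (v, t) u2 + S u3 (zip (b # as') ss) (v, t) u2"
        by (simp add: clinear_add[OF S_linear_first])
    qed
  qed
  then show ?case unfolding as .
qed

lemma rational_S_first:
  assumes r: "r < T" and a: "a \<in> eigensp g T r" and cf: "config T (map snd xs) t"
  shows "rational_in_z T (punctured T (insert t (snd ` set xs))) (\<lambda>s. s ^ r * S u3 ((a, s) # xs) (v, t) u2)"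
proof -
  let ?X = "punctured T (insert t (snd ` set xs))"
  have hom: "rational_in_z T ?X (\<lambda>s. s ^ r * S u3 ((a, s) # xs) (v, t) u2)"
    if a: "a \<in> grade V k \<inter> eigensp g T r" for a k
  proof -
    let ?K = "int T * (int k - 1) + int r"
    define \<beta> where "\<beta> = S u3 xs (v, t) (U2 (cls a) u2)"
    have \<beta>: "s ^ r * \<beta> = \<beta>" for s
      using twisted_acts_zero(1)[OF r _ a] clinear_0[OF S_linear(3)] by (cases "r = 0") (simp_all add: \<beta>_def)
    obtain N where N: "\<forall>i\<ge>N. act M a (int i) v = 0" "\<forall>b\<in>fst ` set xs. \<forall>i\<ge>N. mode V a (int i) b = 0"
      using common_bound[of a v "map fst xs"] by auto
    have F: "rational_in_z T ?X (\<lambda>s. s ^ r * F_fun T ?K i s p)" if "p \<in> insert t (snd ` set xs)" for i p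
      by (rule rational_F_fun[OF T _ _ refl]) (use that config_nonzero[OF cf] in \<open>auto simp: punctured_def\<close>)
    have "rational_in_z T ?X (\<lambda>s. (s ^ T) powi (- int k) * \<beta> +
      ((\<Sum>l<length xs. \<Sum>i<N. (s ^ r * F_fun T ?K i s (snd (xs ! l))) *
        S u3 (xs[l := (mode V a (int i) (fst (xs ! l)), snd (xs ! l))]) (v, t) u2)
      + (\<Sum>i<N. (s ^ r * F_fun T ?K i s t) * S u3 xs (act M a (int i) v, t) u2)))"
      by (intro rational_add rational_sum rational_mult rational_const rational_z_powi F)
         (auto simp: punctured_def)
    then show ?thesis
    proof (rule rational_cong)
      fix s assume "s \<in> ?X"
      then have "config T (s # map snd xs) t" using cf by (simp add: config_Cons)
      from recursion[OF r a this, of u3 v u2]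
      have "s ^ r * S u3 ((a, s) # xs) (v, t) u2 = (s ^ T) powi (- int k) * (s ^ r * \<beta>) +
        s ^ r * recursion_sum V T M S ?K a s u3 xs v t u2"
        by (simp add: \<beta>_def algebra_simps)
      then show "s ^ r * S u3 ((a, s) # xs) (v, t) u2 = (s ^ T) powi (- int k) * \<beta> +
      ((\<Sum>l<length xs. \<Sum>i<N. (s ^ r * F_fun T ?K i s (snd (xs ! l))) *
        S u3 (xs[l := (mode V a (int i) (fst (xs ! l)), snd (xs ! l))]) (v, t) u2)
      + (\<Sum>i<N. (s ^ r * F_fun T ?K i s t) * S u3 xs (act M a (int i) v, t) u2))"
        unfolding \<beta> recursion_sum_finite[OF N] by (simp add: distrib_left sum_distrib_left mult.assoc)
    qed
  qed
  \<comment> \<open>A vector of V^r need not be homogeneous for the weight. Applying the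
    eigenprojection to its graded components decomposes it into vectors to which the homogeneous
    case applies.\<close>
  note gr = voa_grading[OF voa]
  define I where "I = {k. component (grade V) a k \<noteq> 0}"
  have "a = eigenproj g T r (\<Sum>k\<in>I. component (grade V) a k)"
    using eigenproj_eigen[OF voa aut T gT a r r] component_Sum_any[OF gr, of a]
    by (simp add: I_def Sum_any.expand_set)
  also have "\<dots> = (\<Sum>k\<in>I. eigenproj g T r (component (grade V) a k))"
    by (rule clinear_sum[OF eigenproj_linear[OF voa aut T gT]])
  finally have dec: "a = (\<Sum>k\<in>I. eigenproj g T r (component (grade V) a k))" .
  have "rational_in_z T ?X (\<lambda>s. \<Sum>k\<in>I. s ^ r * S u3 ((eigenproj g T r (component (grade V) a k), s) # xs) (v, t) u2)"
  proof (rule rational_sum)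
    show "rational_in_z T ?X (\<lambda>s. s ^ r * S u3 ((eigenproj g T r (component (grade V) a k), s) # xs) (v, t) u2)" for k
      by (rule hom[of _ k]) (use eigenproj_grade[OF voa aut T gT component_in[OF gr]] eigenproj_in[OF voa aut T gT] in blast)
  qed
  then show ?thesis
    by (subst dec) (simp add: clinear_sum[OF S_linear_first] sum_distrib_left)
qed

text \<open>Invariance under the conformal vector tested against z. On the module z = w + Z acts by
  w L_(-1) + L_0, with L_0 = h1 + d in degree d, while U^2 and U^3 contribute h2 and -h3. Hence w
  S(L_(-1)v) = -(h + d) S(v), and S(v) is a multiple of w^(-d).\<close>

lemma translation_v_base:
  assumes t: "t \<noteq> 0"
  shows "has_dz T (\<lambda>x. S u3 [] (v, x) u2)
    (S u3 [] (Vir V (act M) (-1) v, t) u2 + h / t ^ T * S u3 [] (v, t) u2) t"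
proof (induction v rule: graded_induct[OF mgrading])
  case (1 d v)
  then obtain c where c: "\<And>t. t \<noteq> 0 \<Longrightarrow> S u3 [] (v, t) u2 = c * (t ^ T) powi (- int d)"
    using monomial unfolding cor_monomial_def by blast
  have scalar: "- c * s + (a + (b + d) * s) + e * s = 0 \<Longrightarrow> a = - (b + e - c + d) * s" for a b c d e s :: complex
    by algebra
  have scalar2: "z * a = - (c + d) * s \<Longrightarrow> z \<noteq> 0 \<Longrightarrow> a + c / z * s = - d / z * s" for z a c d s :: complex
    by (simp add: divide_simps) algebra
  let ?w = "conf V" and ?L = "expansion T t (kernel T (int T) t 0)"
  have cf0: "config T (map snd []) t" using t by (simp add: config_def)
  have L: "?L = fls_const (t ^ T) + fls_X"
  proof (rule expansion_eq)
    have "expands T t (\<lambda>s. s ^ T - 0) (fls_const (t ^ T - 0) + fls_X)"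
      by (rule expands_difference[OF T t])
    then show "expands T t (kernel T (int T) t 0) (fls_const (t ^ T) + fls_X)"
      by (simp add: kernel_def)
  qed
  have "smear (act M) ?L ?w v = (\<Sum>n\<in>{0, 1}. (?L $$ n) *\<^sub>C act M ?w n v)"
    unfolding smear_def by (rule Sum_any_superset) (auto simp: L complex_vs.scale_zero_left)
  also have "\<dots> = t ^ T *\<^sub>C Vir V (act M) (-1) v + Vir V (act M) 0 v"
    by (simp add: L Vir_def scaleC_one)
  also have "Vir V (act M) 0 v = (h1 + of_nat d) *\<^sub>C v"
    using conformal_weight 1 by (simp add: has_conformal_weight_def)
  finally have sm: "smear (act M) ?L ?w v = t ^ T *\<^sub>C Vir V (act M) (-1) v + (h1 + of_nat d) *\<^sub>C v" .
  have "block_sum ?w 2 0 t 0 u3 [] v t u2 = 0"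
    using invariantD[of "[]" t 0 ?w 2 t 0 u3 v u2] invariant_0 cf0 T conf_homogeneous by simp
  then have "- h3 * S u3 [] (v, t) u2 + (t ^ T * S u3 [] (Vir V (act M) (-1) v, t) u2 + (h1 + of_nat d) * S u3 [] (v, t) u2)
     + h2 * S u3 [] (v, t) u2 = 0"
    by (simp add: block_sum_def J_def sm h2 h3 clinear_scale[OF S_linear(1)] clinear_scale[OF S_linear(2)]
        clinear_scale[OF S_linear(3)] clinear_add[OF S_linear(2)] scaleC_complex_def)
  then have "t ^ T * S u3 [] (Vir V (act M) (-1) v, t) u2 = - (h + of_nat d) * S u3 [] (v, t) u2"
    unfolding h by (rule scalar)
  then have e: "S u3 [] (Vir V (act M) (-1) v, t) u2 + h / t ^ T * S u3 [] (v, t) u2 =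
      - of_nat d / t ^ T * S u3 [] (v, t) u2"
    using scalar2[of "t ^ T"] t by simp
  have "has_dz T (\<lambda>x. c * (x ^ T) powi (- int d)) (- of_nat d / t ^ T * (c * (t ^ T) powi (- int d))) t"
  proof -
    have *: "((\<lambda>x. c * (x ^ T) powi (- int d)) has_field_derivative
        c * (of_int (- int d) * (t ^ T) powi (- int d - 1) * (of_nat T * t ^ (T - 1)))) (at t)"
      using t by (auto intro!: derivative_eq_intros)
    have "(t ^ T) powi (- int d - 1) = (t ^ T) powi (- int d) / t ^ T"
      using t by (simp add: power_int_diff)
    then show ?thesis using * unfolding has_dz_def by (simp add: mult_ac)
  qed
  then have "has_dz T (\<lambda>x. S u3 [] (v, x) u2) (- of_nat d / t ^ T * S u3 [] (v, t) u2) t"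
    unfolding c[OF t] by (rule has_dz_cong[of _ _ _ _ "- {0}"]) (use t c in auto)
  then show ?case by (simp only: e)
next
  case (2 v w)
  have "clinear (Vir V (act M) (-1))"
    using MM.linear_right[of "conf V" 0] by (simp add: Vir_def[abs_def])
  then show ?case
    using has_dz_add[OF 2] by (simp add: clinear_add[OF S_linear(2)] clinear_add algebra_simps)
qed

text \<open>The left recursion is differentiated in the module point. The new terms (i + 1)
  F_(n,i+1) are absorbed, after a shift of i, by the commutator of L_(-1) with a_(i).\<close>

lemma translation_v:
  assumes "config T (map snd xs) t"
  shows "has_dz T (\<lambda>x. S u3 xs (v, x) u2)
    (S u3 xs (Vir V (act M) (-1) v, t) u2 + h / t ^ T * S u3 xs (v, t) u2) t"
  using assms
proof (induction "length xs" arbitrary: xs u3 v u2)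
  case 0
  then show ?case using translation_v_base[of t u3 v u2] config_nonzero(1)[OF 0(2)] by simp
next
  case (Suc n)
  obtain a0 s ys where xs: "xs = (a0, s) # ys" and len: "length ys = n"
    using Suc(2) by (cases xs) auto
  have cf: "config T (s # map snd ys) t" using Suc(3) xs by simp
  have cfy: "config T (map snd ys) t" using cf by (simp add: config_Cons)
  have t: "t \<noteq> 0" by (rule config_nonzero(1)[OF cf])
  let ?D = "\<lambda>u3 xs v u2. S u3 xs (Vir V (act M) (-1) v, t) u2 + h / t ^ T * S u3 xs (v, t) u2"
  have IH: "has_dz T (\<lambda>x. S u3 zs (v, x) u2) (?D u3 zs v u2) t" if "map snd zs = map snd ys" for zs u3 v u2
    using Suc(1)[of zs] that cfy len by (metis length_map)
  let ?X = "punctured T (set (s # map snd ys))"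
  have Xopen: "open ?X" using open_punctured[OF _ T] by blast
  have X: "t \<in> ?X" using cf by (auto simp: config_def punctured_def)
  have cfX: "config T (s # map snd ys) x" if "x \<in> ?X" for x
    using that cf by (auto simp: config_def punctured_def)
  have "has_dz T (\<lambda>x. S u3 ((a, s) # ys) (v, x) u2) (?D u3 ((a, s) # ys) v u2) t" for a
  proof (induction a rule: hom_induct)
    case (1 k r a)
    let ?K = "int T * (int k - 1) + int r"
    obtain N1 where N1: "\<forall>i\<ge>N1. act M a (int i) v = 0" "\<forall>b\<in>fst ` set ys. \<forall>i\<ge>N1. mode V a (int i) b = 0"
      using common_bound[of a v "map fst ys"] by auto
    obtain N2 where N2: "\<forall>i\<ge>N2. act M a (int i) (Vir V (act M) (-1) v) = 0"
      using act_bound by blast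
    \<comment> \<open>The successor makes the mode N - 1 vanish on v as well, so that the shifted
      sum has the same range.\<close>
    define N where "N = Suc (max N1 N2)"
    have N: "\<forall>i\<ge>N. act M a (int i) v = 0" "\<forall>b\<in>fst ` set ys. \<forall>i\<ge>N. mode V a (int i) b = 0"
      "\<forall>i\<ge>N. act M a (int i) (Vir V (act M) (-1) v) = 0" and last: "act M a (int (N - 1)) v = 0"
      using N1 N2 by (auto simp: N_def)
    let ?G = "\<lambda>v x. (s ^ T) powi (- int k) * S u3 ys (v, x) (U2 (cls a) u2) +
      ((\<Sum>l<length ys. \<Sum>i<N. F_fun T ?K i s (snd (ys ! l)) *
        S u3 (ys[l := (mode V a (int i) (fst (ys ! l)), snd (ys ! l))]) (v, x) u2)
      + (\<Sum>i<N. F_fun T ?K i s x * S u3 ys (act M a (int i) v, x) u2))"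
    have G: "S u3 ((a, s) # ys) (v, x) u2 = ?G v x" if "x \<in> ?X" for x
      using recursion[OF 1 cfX[OF that]] recursion_sum_finite[OF N(1,2)] by simp
    have GL: "S u3 ((a, s) # ys) (Vir V (act M) (-1) v, t) u2 = (s ^ T) powi (- int k) * S u3 ys (Vir V (act M) (-1) v, t) (U2 (cls a) u2) +
      ((\<Sum>l<length ys. \<Sum>i<N. F_fun T ?K i s (snd (ys ! l)) *
        S u3 (ys[l := (mode V a (int i) (fst (ys ! l)), snd (ys ! l))]) (Vir V (act M) (-1) v, t) u2)
      + (\<Sum>i<N. F_fun T ?K i s t * S u3 ys (act M a (int i) (Vir V (act M) (-1) v), t) u2))"
      using recursion[OF 1 cfX[OF X]] recursion_sum_finite[OF N(3,2)] by simp
    have st: "s ^ T \<noteq> t ^ T" using X by (auto simp: punctured_def)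
    have der: "has_dz T (\<lambda>x. ?G v x) ((s ^ T) powi (- int k) * ?D u3 ys v (U2 (cls a) u2) +
      ((\<Sum>l<length ys. \<Sum>i<N. F_fun T ?K i s (snd (ys ! l)) *
        ?D u3 (ys[l := (mode V a (int i) (fst (ys ! l)), snd (ys ! l))]) v u2)
      + (\<Sum>i<N. of_nat (Suc i) * F_fun T ?K (Suc i) s t * S u3 ys (act M a (int i) v, t) u2 +
          F_fun T ?K i s t * ?D u3 ys (act M a (int i) v) u2))) t"
      by (intro has_dz_add has_dz_cmult has_dz_sum has_dz_mult IH has_dz_F_fun T t st)
         (simp_all add: snd_update)
    have eq: "(\<Sum>i<N. of_nat (Suc i) * F_fun T ?K (Suc i) s t * S u3 ys (act M a (int i) v, t) u2 +
          F_fun T ?K i s t * ?D u3 ys (act M a (int i) v) u2) =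
       (\<Sum>i<N. F_fun T ?K i s t * S u3 ys (act M a (int i) (Vir V (act M) (-1) v), t) u2)
       + h / t ^ T * (\<Sum>i<N. F_fun T ?K i s t * S u3 ys (act M a (int i) v, t) u2)"
    proof -
      \<comment> \<open>The sequence \<tau> is \<sigma> shifted by one index. Its value at 0 belongs
        to the mode -1, but occurs only with the factor i = 0.\<close>
      define \<sigma> where "\<sigma> i = S u3 ys (act M a (int i) v, t) u2" for i
      define \<tau> where "\<tau> i = S u3 ys (act M a (int i - 1) v, t) u2" for i :: nat
      have comm: "S u3 ys (Vir V (act M) (-1) (act M a (int i) v), t) u2 =
          S u3 ys (act M a (int i) (Vir V (act M) (-1) v), t) u2 - of_nat i * \<tau> i" for i
        unfolding MM.commutator_translation[OF voa]
        by (simp add: clinear_diff[OF S_linear(2)] clinear_scale[OF S_linear(2)] scaleC_complex_def \<tau>_def)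
      have shift: "(\<Sum>i<N. of_nat i * F_fun T ?K i s t * \<tau> i) = (\<Sum>i<N. of_nat (Suc i) * F_fun T ?K (Suc i) s t * \<sigma> i)"
      proof -
        have N': "N = Suc (N - 1)" by (simp add: N_def)
        have "\<sigma> (N - 1) = 0" using last clinear_0[OF S_linear(2)] by (simp add: \<sigma>_def)
        then have "(\<Sum>i<N. of_nat (Suc i) * F_fun T ?K (Suc i) s t * \<sigma> i) =
           (\<Sum>i<N - 1. of_nat (Suc i) * F_fun T ?K (Suc i) s t * \<sigma> i)"
          by (subst N') (simp only: sum.lessThan_Suc, simp)
        moreover have "(\<Sum>i<N. of_nat i * F_fun T ?K i s t * \<tau> i) =
           (\<Sum>i<N - 1. of_nat (Suc i) * F_fun T ?K (Suc i) s t * \<tau> (Suc i))"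
          by (subst N') (simp only: sum.lessThan_Suc_shift, simp)
        ultimately show ?thesis by (simp add: \<sigma>_def \<tau>_def)
      qed
      show ?thesis
        using shift unfolding comm \<sigma>_def[symmetric]
        by (simp add: sum.distrib sum_subtractf sum_distrib_left algebra_simps)
    qed
    have "?D u3 ((a, s) # ys) v u2 = (s ^ T) powi (- int k) * ?D u3 ys v (U2 (cls a) u2) +
      ((\<Sum>l<length ys. \<Sum>i<N. F_fun T ?K i s (snd (ys ! l)) *
        ?D u3 (ys[l := (mode V a (int i) (fst (ys ! l)), snd (ys ! l))]) v u2)
      + ((\<Sum>i<N. F_fun T ?K i s t * S u3 ys (act M a (int i) (Vir V (act M) (-1) v), t) u2)
       + h / t ^ T * (\<Sum>i<N. F_fun T ?K i s t * S u3 ys (act M a (int i) v, t) u2)))"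
      unfolding G[OF X] GL by (simp add: algebra_simps sum.distrib sum_distrib_left)
    then have "has_dz T (\<lambda>x. ?G v x) (?D u3 ((a, s) # ys) v u2) t"
      using der unfolding eq by (simp only:)
    then show ?case
      by (rule has_dz_cong[OF _ Xopen X]) (simp only: G)
  next
    case (2 a b)
    show ?case
      using has_dz_add[OF 2] by (simp add: clinear_add[OF S_linear_first] algebra_simps)
  qed
  then show ?case unfolding xs .
qed

theorem in_Cor: "S \<in> Cor V g T M U3 U2 h"
proof -
  have "cor_rational T S"
    unfolding cor_rational_def
  proof (intro allI)
    fix u3 as v u2
    show "\<exists>f\<in>config_functions T (length as). \<forall>ss t. length ss = length as \<and> config T ss t \<longrightarrow> S u3 (zip as ss) (v, t) u2 = f ss t"
      using regular_S[OF refl, of as u3 v u2] unfolding regular_on_configs_def .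
  qed
  moreover have "cor_local S"
    unfolding cor_local_def using locality by (metis surj_pair)
  moreover have "cor_homogeneous g T S"
    unfolding cor_homogeneous_def
  proof (intro allI impI, elim conjE)
    fix r u3 v t u2 and a :: 'v and xs ys :: "('v \<times> complex) list"
    assume r: "r < T" "a \<in> eigensp g T r"
    show "\<exists>P Q :: complex poly. \<forall>s. config T (map snd (xs @ (a, s) # ys)) t \<longrightarrow>
        poly Q (s ^ T) \<noteq> 0 \<and> s ^ r * S u3 (xs @ (a, s) # ys) (v, t) u2 = poly P (s ^ T) / poly Q (s ^ T)"
    proof (cases "config T (map snd (xs @ ys)) t")
      case True
      from rational_S_first[OF r True, of u3 v u2] obtain P Q :: "complex poly" where
        "\<forall>s\<in>punctured T (insert t (snd ` set (xs @ ys))). poly Q (s ^ T) \<noteq> 0 \<and>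
          s ^ r * S u3 ((a, s) # xs @ ys) (v, t) u2 = poly P (s ^ T) / poly Q (s ^ T)"
        unfolding rational_in_z_def by blast
      then have "\<forall>s. config T (s # map snd (xs @ ys)) t \<longrightarrow> poly Q (s ^ T) \<noteq> 0 \<and>
          s ^ r * S u3 ((a, s) # xs @ ys) (v, t) u2 = poly P (s ^ T) / poly Q (s ^ T)"
        unfolding config_Cons set_map by blast
      then show ?thesis unfolding config_move move_to_front by blast
    next
      case False
      then show ?thesis unfolding config_move by (simp only: config_Cons) simp
    qed
  qed
  moreover have "cor_vacuum V T S"
    unfolding cor_vacuum_def by (auto simp only: config_move move_to_front intro!: vacuum_first)
  moreover have "cor_L_minus_1 V T M h S"
    unfolding cor_L_minus_1_def
  proof (intro conjI allI impI)
    fix u3 s v t u2 and a :: 'v and xs ys :: "('v \<times> complex) list" assume "config T (map snd (xs @ (a, s) # ys)) t"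
    then show "S u3 (xs @ (Vir V (mode V) (-1) a, s) # ys) (v, t) u2 =
      d_dz T (\<lambda>x. S u3 (xs @ (a, x) # ys) (v, t) u2) s"
      unfolding move_to_front by (intro translation_first) (simp only: config_move)
  next
    fix u3 v t u2 and xs :: "('v \<times> complex) list" assume cf: "config T (map snd xs) t"
    show "S u3 xs (Vir V (act M) (-1) v, t) u2 = d_dz T (\<lambda>x. S u3 xs (v, x) u2) t - h / t ^ T * S u3 xs (v, t) u2"
      using has_dz_d_dz[OF translation_v[OF cf] T config_nonzero(1)[OF cf]] by simp
  qed
  moreover have "cor_associative V T M S"
    unfolding cor_associative_def
  proof (intro conjI allI impI)
    fix u3 a v t u2 n and xs :: "('v \<times> complex) list" assume cf: "config T (map snd xs) t"
    show "res_dz T (\<lambda>s. S u3 ((a, s) # xs) (v, t) u2 * (s ^ T - t ^ T) powi n) t = S u3 xs (act M a n v, t) u2"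
      using res_dz_expands_shift[OF T config_nonzero(1)[OF cf] associativity_t[OF invariant cf] refl, of u3 a v u2 n]
      by (simp add: matrix_series_S_nth[OF S_linear(2)])
  next
    fix u3 a b s2 v t u2 n and xs :: "('v \<times> complex) list" assume cf: "config T (s2 # map snd xs) t"
    have ex: "expands T s2 (\<lambda>s. S u3 ((a, s) # (b, s2) # xs) (v, t) u2) (slot_series a u3 ((b, s2) # xs) v t u2 0)"
      using associativity[OF invariant, of "(b, s2) # xs" t 0 u3 a v u2] cf by simp
    have "s2 \<noteq> 0" using config_nonzero(2)[OF cf] by simp
    from res_dz_expands_shift[OF T this ex refl, of n]
    show "res_dz T (\<lambda>s. S u3 ((a, s) # (b, s2) # xs) (v, t) u2 * (s ^ T - s2 ^ T) powi n) s2 =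
      S u3 ((mode V a n b, s2) # xs) (v, t) u2"
      by (simp add: slot_series_nth)
  qed
  moreover have "cor_recursive V g T M U3 U2 S"
    unfolding cor_recursive_def using recursion right_recursion by blast
  ultimately show ?thesis
    using multilinear monomial by (simp add: Cor_def)
qed

end

section \<open>Partial fractions of the test functions\<close>

inductive_set partial_fractions :: "complex set \<Rightarrow> (complex \<Rightarrow> complex) set" for A :: "complex set" where
  pf_poly: "poly q \<in> partial_fractions A"
| pf_pole: "a \<in> A \<Longrightarrow> (\<lambda>z. inverse (z - a) ^ Suc j) \<in> partial_fractions A"
| pf_add: "h \<in> partial_fractions A \<Longrightarrow> h' \<in> partial_fractions A \<Longrightarrow> (\<lambda>z. h z + h' z) \<in> partial_fractions A"
| pf_scale: "h \<in> partial_fractions A \<Longrightarrow> (\<lambda>z. c * h z) \<in> partial_fractions A"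

text \<open>Partial fractions without a polynomial part, hence tending to 0 at infinity.\<close>

inductive_set polar_functions :: "complex set \<Rightarrow> (complex \<Rightarrow> complex) set" for A :: "complex set" where
  po_zero: "(\<lambda>z. 0) \<in> polar_functions A"
| po_pole: "a \<in> A \<Longrightarrow> (\<lambda>z. inverse (z - a) ^ Suc j) \<in> polar_functions A"
| po_add: "h \<in> polar_functions A \<Longrightarrow> h' \<in> polar_functions A \<Longrightarrow> (\<lambda>z. h z + h' z) \<in> polar_functions A"
| po_scale: "h \<in> polar_functions A \<Longrightarrow> (\<lambda>z. c * h z) \<in> polar_functions A"

lemma pole_times_pole:
  assumes "a \<in> A" "b \<in> A"
  shows "\<exists>h\<in>partial_fractions A. \<forall>z. z \<notin> A \<longrightarrow> h z = inverse (z - b) ^ Suc j * inverse (z - a)"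
proof (cases "a = b")
  case True
  then show ?thesis
    using pf_pole[OF assms(2), of "Suc j"] by (intro bexI[of _ "\<lambda>z. inverse (z - b) ^ Suc (Suc j)"]) auto
next
  case False
  have id: "inverse (z - b) * inverse (z - a) = inverse (b - a) * (inverse (z - b) - inverse (z - a))"
    if "z \<notin> A" for z
  proof -
    have "z - a \<noteq> 0" "z - b \<noteq> 0" "b - a \<noteq> 0" using that assms False by auto
    then show ?thesis by (simp add: field_simps)
  qed
  show ?thesis
  proof (induction j)
    case 0
    have "(\<lambda>z. inverse (b - a) * (inverse (z - b) ^ Suc 0 + (- 1) * inverse (z - a) ^ Suc 0)) \<in> partial_fractions A"
      by (intro pf_scale pf_add pf_pole assms)
    then show ?case by (rule bexI[rotated]) (use id in auto)
  next
    case (Suc j)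
    then obtain h where h: "h \<in> partial_fractions A"
      "\<And>z. z \<notin> A \<Longrightarrow> h z = inverse (z - b) ^ Suc j * inverse (z - a)" by blast
    have "(\<lambda>z. inverse (b - a) * (inverse (z - b) ^ Suc (Suc j) + (- 1) * h z)) \<in> partial_fractions A"
      by (intro pf_scale pf_add pf_pole assms h)
    then show ?case
    proof (rule bexI[rotated], intro allI impI)
      fix z assume z: "z \<notin> A"
      have "inverse (z - b) ^ Suc (Suc j) * inverse (z - a) = inverse (z - b) ^ Suc j * (inverse (z - b) * inverse (z - a))"
        by (simp add: mult_ac)
      then show "inverse (b - a) * (inverse (z - b) ^ Suc (Suc j) + (- 1) * h z) = inverse (z - b) ^ Suc (Suc j) * inverse (z - a)"
        unfolding id[OF z] h(2)[OF z] by (simp add: algebra_simps)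
    qed
  qed
qed

text \<open>On polynomials this is division with remainder by z - a; on a pole at another point b it
  rests on the identity for 1/((z - a)(z - b)).\<close>

lemma partial_fractions_divide:
  assumes "h \<in> partial_fractions A" "a \<in> A"
  shows "\<exists>h'\<in>partial_fractions A. \<forall>z. z \<notin> A \<longrightarrow> h' z = h z * inverse (z - a)"
  using assms(1)
proof (induction rule: partial_fractions.induct)
  case (pf_poly q)
  have "(\<lambda>z. poly (synthetic_div q a) z + poly q a * inverse (z - a) ^ Suc 0) \<in> partial_fractions A"
    by (intro pf_add pf_scale partial_fractions.pf_poly pf_pole assms)
  then show ?case
  proof (rule bexI[rotated], intro allI impI)
    fix z assume "z \<notin> A"
    then have "z - a \<noteq> 0" using assms by auto
    moreover have "poly q z = (z - a) * poly (synthetic_div q a) z + poly q a"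
      by (subst (1) synthetic_div_correct'[of a q, symmetric]) (simp add: algebra_simps)
    ultimately show "poly (synthetic_div q a) z + poly q a * inverse (z - a) ^ Suc 0 = poly q z * inverse (z - a)"
      by (simp add: field_simps)
  qed
next
  case (pf_pole b j)
  then show ?case by (rule pole_times_pole[OF assms(2)])
next
  case (pf_add h1 h2)
  then obtain k1 k2 where "k1 \<in> partial_fractions A" "\<forall>z. z \<notin> A \<longrightarrow> k1 z = h1 z * inverse (z - a)"
    "k2 \<in> partial_fractions A" "\<forall>z. z \<notin> A \<longrightarrow> k2 z = h2 z * inverse (z - a)" by blast
  then show ?case
    by (intro bexI[of _ "\<lambda>z. k1 z + k2 z"]) (auto simp: algebra_simps intro: partial_fractions.pf_add)
next
  case (pf_scale h1 c)
  then obtain k1 where "k1 \<in> partial_fractions A" "\<forall>z. z \<notin> A \<longrightarrow> k1 z = h1 z * inverse (z - a)" by blast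
  then show ?case
    by (intro bexI[of _ "\<lambda>z. c * k1 z"]) (auto simp: algebra_simps intro: partial_fractions.pf_scale)
qed

lemma partial_fractions_divide_power:
  assumes "h \<in> partial_fractions A" "a \<in> A"
  shows "\<exists>h'\<in>partial_fractions A. \<forall>z. z \<notin> A \<longrightarrow> h' z = h z * inverse (z - a) ^ n"
proof (induction n)
  case 0
  then show ?case using assms by (intro bexI[of _ h]) auto
next
  case (Suc n)
  then obtain h1 where h1: "h1 \<in> partial_fractions A" "\<forall>z. z \<notin> A \<longrightarrow> h1 z = h z * inverse (z - a) ^ n" by blast
  from partial_fractions_divide[OF h1(1) assms(2)] h1(2) show ?case by (auto simp: mult_ac)
qed

lemma partial_fractions_divide_prod:
  assumes "finite I" "h \<in> partial_fractions A" "\<And>i. i \<in> I \<Longrightarrow> c i \<in> A"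
  shows "\<exists>h'\<in>partial_fractions A. \<forall>z. z \<notin> A \<longrightarrow> h' z = h z * (\<Prod>i\<in>I. inverse (z - c i) ^ n)"
  using assms(1,3)
proof (induction I)
  case empty
  then show ?case using assms by (intro bexI[of _ h]) auto
next
  case (insert i I)
  then obtain h1 where h1: "h1 \<in> partial_fractions A" "\<forall>z. z \<notin> A \<longrightarrow> h1 z = h z * (\<Prod>i\<in>I. inverse (z - c i) ^ n)" by auto
  from partial_fractions_divide_power[OF h1(1), of "c i" n] h1(2) insert show ?case by (auto simp: mult_ac)
qed

text \<open>The poles at 0 are collected in a polynomial d in 1/z without constant term, so that the
  behaviour at infinity and at 0 controls q and d separately.\<close>

lemma partial_fractions_structure:
  assumes "h \<in> partial_fractions A"
  shows "\<exists>q d k. k \<in> polar_functions (A - {0}) \<and> poly d 0 = 0 \<and> h = (\<lambda>z. poly q z + poly d (inverse z) + k z)"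
  using assms
proof (induction rule: partial_fractions.induct)
  case (pf_poly q)
  show ?case by (rule exI[of _ q], rule exI[of _ 0], rule exI[of _ "\<lambda>_. 0"]) (auto intro: po_zero)
next
  case (pf_pole a j)
  show ?case
  proof (cases "a = 0")
    case True
    show ?thesis
      by (rule exI[of _ 0], rule exI[of _ "monom 1 (Suc j)"], rule exI[of _ "\<lambda>_. 0"])
         (auto simp: True poly_monom intro: po_zero)
  next
    case False
    show ?thesis
      by (rule exI[of _ 0], rule exI[of _ 0], rule exI[of _ "\<lambda>z. inverse (z - a) ^ Suc j"])
         (use False pf_pole in \<open>auto intro: po_pole simp del: power_Suc\<close>)
  qed
next
  case (pf_add h1 h2)
  then obtain q1 d1 k1 q2 d2 k2 where *:
    "k1 \<in> polar_functions (A - {0})" "poly d1 0 = 0" "h1 = (\<lambda>z. poly q1 z + poly d1 (inverse z) + k1 z)"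
    "k2 \<in> polar_functions (A - {0})" "poly d2 0 = 0" "h2 = (\<lambda>z. poly q2 z + poly d2 (inverse z) + k2 z)" by blast
  show ?case
    by (rule exI[of _ "q1 + q2"], rule exI[of _ "d1 + d2"], rule exI[of _ "\<lambda>z. k1 z + k2 z"])
       (use * in \<open>auto intro: po_add\<close>)
next
  case (pf_scale h1 c)
  then obtain q1 d1 k1 where *:
    "k1 \<in> polar_functions (A - {0})" "poly d1 0 = 0" "h1 = (\<lambda>z. poly q1 z + poly d1 (inverse z) + k1 z)" by blast
  show ?case
    by (rule exI[of _ "smult c q1"], rule exI[of _ "smult c d1"], rule exI[of _ "\<lambda>z. c * k1 z"])
       (use * in \<open>auto intro: po_scale simp: algebra_simps\<close>)
qed

lemma polar_tendsto_0: "k \<in> polar_functions A \<Longrightarrow> (k \<longlongrightarrow> 0) at_infinity"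
proof (induction rule: polar_functions.induct)
  case (po_pole a j)
  have "((\<lambda>z. inverse (z - a)) \<longlongrightarrow> 0) at_infinity"
  proof (rule filterlim_compose[OF tendsto_inverse_0])
    show "filterlim (\<lambda>z::complex. z - a) at_infinity at_infinity"
    proof -
      have "(\<lambda>z. z - a) = poly [:- a, 1:]" by (auto simp: fun_eq_iff)
      then show ?thesis using filterlim_poly_at_infinity[of "[:- a, 1:]"] by simp
    qed
  qed
  from tendsto_power[OF this, of "Suc j"] show ?case by simp
next
  case (po_add h h') then show ?case using tendsto_add[OF po_add.IH] by simp
next
  case (po_scale h c) then show ?case using tendsto_mult_left[OF po_scale.IH, of c] by simp
qed simp

lemma polar_tendsto_at_0:
  assumes "0 \<notin> A"
  shows "k \<in> polar_functions A \<Longrightarrow> (k \<longlongrightarrow> k 0) (at 0)"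
proof (induction rule: polar_functions.induct)
  case (po_pole a j)
  then have "a \<noteq> 0" using assms by auto
  then show ?case by (intro tendsto_intros) auto
next
  case (po_add h h') then show ?case by (intro tendsto_add)
next
  case (po_scale h c) then show ?case by (intro tendsto_mult_left)
qed simp

text \<open>Writing p = c + z p', the bound with r < T forces p'(y^T) to tend to 0, hence p' = 0. It
  is applied with y = s and exponent 0 at infinity, and with y = 1/s at the branch point 0.\<close>

lemma polynomial_slow_growth:
  assumes T: "r < (T::nat)"
    and b: "eventually (\<lambda>y. norm (poly p (y ^ T)) \<le> C * norm y ^ r + C) (at_infinity :: complex filter)"
  shows "\<exists>c. p = [:c:]"
proof -
  obtain c p' where p: "p = pCons c p'" by (cases p)
  have "((\<lambda>y::complex. poly p' (y ^ T)) \<longlongrightarrow> 0) at_infinity"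
  proof (rule Lim_null_comparison)
    have inf: "eventually (\<lambda>y::complex. norm y \<ge> 1) at_infinity"
      unfolding eventually_at_infinity by blast
    show "eventually (\<lambda>y. norm (poly p' (y ^ T)) \<le> (2 * \<bar>C\<bar> + norm c) * inverse (norm y)) at_infinity"
      using b inf
    proof eventually_elim
      case (elim y)
      have y: "norm y > 0" using elim(2) by linarith
      have "norm (y ^ T * poly p' (y ^ T)) \<le> norm (poly p (y ^ T)) + norm c"
        using norm_triangle_ineq4[of "poly p (y ^ T)" c] by (simp add: p)
      also have "\<dots> \<le> C * norm y ^ r + C + norm c" using elim(1) by simp
      also have "\<dots> \<le> (2 * \<bar>C\<bar> + norm c) * norm y ^ (T - 1)"
      proof -
        have 1: "norm y ^ r \<le> norm y ^ (T - 1)" by (rule power_increasing) (use T elim(2) in auto)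
        have 2: "1 \<le> norm y ^ (T - 1)" using elim(2) by (rule one_le_power)
        have "C * norm y ^ r \<le> \<bar>C\<bar> * norm y ^ (T - 1)"
          using 1 by (meson abs_ge_self abs_ge_zero dual_order.trans mult_mono norm_ge_zero zero_le_power)
        moreover have "C \<le> \<bar>C\<bar> * norm y ^ (T - 1)"
          using mult_left_mono[OF 2, of "\<bar>C\<bar>"] by linarith
        moreover have "norm c \<le> norm c * norm y ^ (T - 1)"
          using mult_left_mono[OF 2, of "norm c"] by simp
        ultimately show ?thesis by (simp add: algebra_simps)
      qed
      finally have "norm y ^ T * norm (poly p' (y ^ T)) \<le> (2 * \<bar>C\<bar> + norm c) * norm y ^ (T - 1)"
        by (simp add: norm_mult norm_power)
      moreover have "norm y ^ T = norm y ^ (T - 1) * norm y"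
        using T by (cases T) (simp_all add: mult_ac)
      ultimately have "norm y ^ (T - 1) * (norm y * norm (poly p' (y ^ T))) \<le> norm y ^ (T - 1) * (2 * \<bar>C\<bar> + norm c)"
        by (simp add: mult_ac)
      then have "norm y * norm (poly p' (y ^ T)) \<le> 2 * \<bar>C\<bar> + norm c"
        using y by (simp add: mult_le_cancel_left_pos)
      then show ?case using y by (simp add: field_simps)
    qed
    have "((\<lambda>y::complex. inverse (norm y)) \<longlongrightarrow> 0) at_infinity"
      using tendsto_inverse_0_at_top[OF filterlim_norm_at_top] by blast
    then show "((\<lambda>y::complex. (2 * \<bar>C\<bar> + norm c) * inverse (norm y)) \<longlongrightarrow> 0) at_infinity"
      by (rule tendsto_mult_right_zero)
  qed
  moreover have pw: "filterlim (\<lambda>y::complex. y ^ T) at_infinity at_infinity"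
    by (rule filterlim_power_at_infinity) (use T in simp)
  ultimately have lim: "((\<lambda>y::complex. poly p' (y ^ T)) \<longlongrightarrow> 0) at_infinity" by blast
  have "degree p' = 0"
  proof (rule ccontr)
    assume "degree p' \<noteq> 0"
    then have "filterlim (\<lambda>y::complex. poly p' (y ^ T)) at_infinity at_infinity"
      using filterlim_compose[OF filterlim_poly_at_infinity[of p'] pw] by simp
    from not_tendsto_and_filterlim_at_infinity[OF trivial_limit_at_infinity lim this] show False .
  qed
  then obtain c' where "p' = [:c':]" by (rule degree_eq_zeroE)
  with lim have "((\<lambda>y::complex. c') \<longlongrightarrow> 0) at_infinity" by simp
  then have "c' = 0" by (simp only: tendsto_const_iff[OF trivial_limit_at_infinity])
  then show ?thesis using p \<open>p' = [:c':]\<close> by auto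
qed

lemma curve_functions_rational:
  assumes "finite P" "f \<in> curve_functions T P"
  shows "\<exists>N M n. \<forall>s\<in>punctured T P. f s * s ^ M * (\<Prod>p\<in>P. s ^ T - p ^ T) ^ n = poly N s"
  using assms(2)
proof (induction rule: curve_functions.induct)
  case (cf_const c)
  show ?case by (rule exI[of _ "[:c:]"], rule exI[of _ 0], rule exI[of _ 0]) simp
next
  case cf_coord
  show ?case by (rule exI[of _ "[:0, 1:]"], rule exI[of _ 0], rule exI[of _ 0]) simp
next
  case cf_inverse
  show ?case by (rule exI[of _ 1], rule exI[of _ 1], rule exI[of _ 0]) (simp add: punctured_def)
next
  case (cf_pole p)
  show ?case
  proof (rule exI[of _ "\<Prod>q\<in>P-{p}. monom 1 T - [:q ^ T:]"], rule exI[of _ 0], rule exI[of _ 1], intro ballI)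
    fix s assume "s \<in> punctured T P"
    then have "s ^ T - p ^ T \<noteq> 0" using cf_pole by (auto simp: punctured_def)
    then show "inverse (s ^ T - p ^ T) * s ^ 0 * (\<Prod>p\<in>P. s ^ T - p ^ T) ^ 1 = poly (\<Prod>q\<in>P-{p}. monom 1 T - [:q ^ T:]) s"
      using prod.remove[OF assms(1) cf_pole, of "\<lambda>p. s ^ T - p ^ T"]
      by (simp add: poly_prod poly_monom)
  qed
next
  case (cf_add f1 f2)
  then obtain N1 M1 n1 N2 M2 n2 where
    1: "\<forall>s\<in>punctured T P. f1 s * s ^ M1 * (\<Prod>p\<in>P. s ^ T - p ^ T) ^ n1 = poly N1 s" and
    2: "\<forall>s\<in>punctured T P. f2 s * s ^ M2 * (\<Prod>p\<in>P. s ^ T - p ^ T) ^ n2 = poly N2 s" by blast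
  let ?D = "\<Prod>p\<in>P. monom 1 T - [:p ^ T:] :: complex poly"
  have D: "poly ?D s = (\<Prod>p\<in>P. s ^ T - p ^ T)" for s by (simp add: poly_prod poly_monom)
  show ?case
  proof (rule exI[of _ "N1 * monom 1 M2 * ?D ^ n2 + N2 * monom 1 M1 * ?D ^ n1"],
      rule exI[of _ "M1 + M2"], rule exI[of _ "n1 + n2"], intro ballI)
    fix s assume s: "s \<in> punctured T P"
    have "(f1 s + f2 s) * s ^ (M1 + M2) * (\<Prod>p\<in>P. s ^ T - p ^ T) ^ (n1 + n2) =
      (f1 s * s ^ M1 * (\<Prod>p\<in>P. s ^ T - p ^ T) ^ n1) * s ^ M2 * (\<Prod>p\<in>P. s ^ T - p ^ T) ^ n2 +
      (f2 s * s ^ M2 * (\<Prod>p\<in>P. s ^ T - p ^ T) ^ n2) * s ^ M1 * (\<Prod>p\<in>P. s ^ T - p ^ T) ^ n1"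
      by (simp add: power_add algebra_simps)
    also have "\<dots> = poly (N1 * monom 1 M2 * ?D ^ n2 + N2 * monom 1 M1 * ?D ^ n1) s"
      using 1 2 s by (simp add: poly_monom poly_power D del: poly_prod)
    finally show "(f1 s + f2 s) * s ^ (M1 + M2) * (\<Prod>p\<in>P. s ^ T - p ^ T) ^ (n1 + n2) =
      poly (N1 * monom 1 M2 * ?D ^ n2 + N2 * monom 1 M1 * ?D ^ n1) s" .
  qed
next
  case (cf_mult f1 f2)
  then obtain N1 M1 n1 N2 M2 n2 where
    1: "\<forall>s\<in>punctured T P. f1 s * s ^ M1 * (\<Prod>p\<in>P. s ^ T - p ^ T) ^ n1 = poly N1 s" and
    2: "\<forall>s\<in>punctured T P. f2 s * s ^ M2 * (\<Prod>p\<in>P. s ^ T - p ^ T) ^ n2 = poly N2 s" by blast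
  show ?case
  proof (rule exI[of _ "N1 * N2"], rule exI[of _ "M1 + M2"], rule exI[of _ "n1 + n2"], intro ballI)
    fix s assume s: "s \<in> punctured T P"
    have "f1 s * f2 s * s ^ (M1 + M2) * (\<Prod>p\<in>P. s ^ T - p ^ T) ^ (n1 + n2) =
      (f1 s * s ^ M1 * (\<Prod>p\<in>P. s ^ T - p ^ T) ^ n1) * (f2 s * s ^ M2 * (\<Prod>p\<in>P. s ^ T - p ^ T) ^ n2)"
      by (simp add: power_add mult_ac)
    then show "f1 s * f2 s * s ^ (M1 + M2) * (\<Prod>p\<in>P. s ^ T - p ^ T) ^ (n1 + n2) = poly (N1 * N2) s"
      using 1 2 s by simp
  qed
qed

lemma zeta_power_T: "T > 0 \<Longrightarrow> cis (2 * pi / real T) ^ T = 1"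
  by (simp add: Complex.DeMoivre)

lemma punctured_rotate:
  assumes "T > 0" "s \<in> punctured T P"
  shows "cis (2 * pi / real T) * s \<in> punctured T P"
  using assms zeta_power_T[OF assms(1)] by (auto simp: punctured_def power_mult_distrib)

text \<open>Averaging over the T rotations annihilates the coefficients whose index is not divisible
  by T.\<close>

lemma rotation_invariant_polynomial:
  assumes T: "T > 0"
    and inv: "\<And>s. s \<in> punctured T P \<Longrightarrow> poly N (cis (2 * pi / real T) * s) = poly N s"
  shows "\<exists>Q. \<forall>s\<in>punctured T P. poly N s = poly Q (s ^ T)"
proof -
  let ?z = "cis (2 * pi / real T)"
  have it: "poly N (?z ^ l * s) = poly N s \<and> ?z ^ l * s \<in> punctured T P" if "s \<in> punctured T P" for s l
  proof (induction l)
    case (Suc l)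
    then show ?case
      using inv[of "?z ^ l * s"] punctured_rotate[OF T, of "?z ^ l * s" P] by (simp add: mult.assoc)
  qed (use that in simp)
  have sums: "(\<Sum>l<T. (?z ^ i) ^ l) = (if T dvd i then of_nat T else 0)" for i
  proof (cases "T dvd i")
    case True
    then have "?z ^ i = 1" using zeta_power_T[OF T] by (auto elim!: dvdE simp: power_mult)
    then show ?thesis using True by simp
  next
    case False
    have "?z ^ i = ?z ^ (T * (i div T) + i mod T)" by simp
    also have "\<dots> = ?z ^ (i mod T)" unfolding power_add power_mult zeta_power_T[OF T] by simp
    also have "\<dots> = cis (2 * pi * (real (i mod T) - real 0) / real T)" by (simp add: Complex.DeMoivre mult_ac)
    finally have e: "?z ^ i = cis (2 * pi * (real (i mod T) - real 0) / real T)" .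
    have "i mod T \<noteq> 0" using False by (simp only: dvd_eq_mod_eq_0 not_False_eq_True)
    then have "?z ^ i \<noteq> 1"
      unfolding e using root_unity_eq_1[OF T, of "i mod T" 0] T by (metis mod_less_divisor)
    moreover have "(?z ^ i) ^ T = 1"
      by (simp only: power_mult[symmetric] mult.commute[of i]) (simp only: power_mult zeta_power_T[OF T] power_one)
    ultimately have "(\<Sum>l<T. (?z ^ i) ^ l) = 0" using sum_roots_of_unity[OF T] by blast
    then show ?thesis using False by simp
  qed
  define Q where "Q = (\<Sum>i\<in>{i. i \<le> degree N \<and> T dvd i}. monom (coeff N i) (i div T))"
  have "poly N s = poly Q (s ^ T)" if s: "s \<in> punctured T P" for s
  proof -
    have "of_nat T * poly N s = (\<Sum>l<T. poly N (?z ^ l * s))" using it[OF s] by simp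
    also have "\<dots> = (\<Sum>l<T. \<Sum>i\<le>degree N. coeff N i * s ^ i * (?z ^ i) ^ l)"
    proof -
      have "(?z ^ l) ^ i = (?z ^ i) ^ l" for l i by (simp only: power_mult[symmetric] mult.commute)
      then show ?thesis by (simp only: poly_altdef power_mult_distrib mult_ac)
    qed
    also have "\<dots> = (\<Sum>i\<le>degree N. coeff N i * s ^ i * (\<Sum>l<T. (?z ^ i) ^ l))"
      by (subst sum.swap) (simp add: sum_distrib_left)
    also have "\<dots> = (\<Sum>i\<in>{i. i \<le> degree N \<and> T dvd i}. coeff N i * s ^ i * of_nat T)"
      unfolding sums by (rule sum.mono_neutral_cong_right) auto
    also have "\<dots> = of_nat T * poly Q (s ^ T)"
      unfolding Q_def poly_sum poly_monom sum_distrib_left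
      by (intro sum.cong refl) (auto simp: power_mult[symmetric])
    finally show ?thesis using T by simp
  qed
  then show ?thesis by blast
qed

lemma eventually_punctured_0:
  assumes "finite P" "T > 0" shows "eventually (\<lambda>s. s \<in> punctured T P) (at 0)"
proof -
  have "open (- (- punctured T P - {0}))"
    using punctured_compl_finite[OF assms] by (intro open_Compl finite_imp_closed) auto
  then have "eventually (\<lambda>s. s \<in> - (- punctured T P - {0}) - {0}) (at 0)" by (rule eventually_at_in_open) simp
  then show ?thesis by (auto elim: eventually_mono)
qed

lemma eventually_punctured_infinity:
  assumes "finite P" "T > 0" shows "eventually (\<lambda>s. s \<in> punctured T P) at_infinity"
proof -
  obtain B where B: "\<And>s. s \<in> - punctured T P \<Longrightarrow> norm s \<le> B"
    using finite_imp_bounded[OF punctured_compl_finite[OF assms]] unfolding bounded_iff by blast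
  have "norm s \<ge> B + 1 \<Longrightarrow> s \<in> punctured T P" for s using B[of s] by force
  then show ?thesis unfolding eventually_at_infinity by blast
qed

text \<open>The quotient of f by z^(K/T) is invariant under rotation of s, hence a rational function
  of z. It is at most of order |s|^(-r) at 0 and at infinity. As r < T, this excludes a pole in z at
  0 and leaves at most a constant at infinity, which vanishes when r is positive.\<close>

lemma constrained_decomposition:
  assumes T: "T > 0" and P: "finite P" "0 \<notin> P" and r: "r < T" and f: "f \<in> constrained_functions T P r k"
  shows "\<exists>c h. h \<in> polar_functions ((\<lambda>p. p ^ T) ` P) \<and> (r \<noteq> 0 \<longrightarrow> c = 0) \<and>
    (\<forall>s\<in>punctured T P. f s = s powi (int T * (int k - 1) + int r) * (c + h (s ^ T)))"
proof -
  let ?z = "cis (2 * pi / real T)"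
  let ?K = "int T * (int k - 1) + int r"
  let ?A = "insert 0 ((\<lambda>p. p ^ T) ` P)"
  have fc: "f \<in> curve_functions T P"
    and rot: "\<And>s. s \<in> punctured T P \<Longrightarrow> f (?z * s) = cis (2 * pi * real r / real T) * f s"
    and O0: "f \<in> O[at 0](\<lambda>s. s powi (int T * (int k - 1)))"
    and Oi: "f \<in> O[at_infinity](\<lambda>s. s powi (int T * (int k - 1)))"
    using f by (auto simp: constrained_functions_def punctured_def)
  obtain N M n where N: "\<And>s. s \<in> punctured T P \<Longrightarrow> f s * s ^ M * (\<Prod>p\<in>P. s ^ T - p ^ T) ^ n = poly N s"
    using curve_functions_rational[OF P(1) fc] by blast
  define gg where "gg s = f s * s powi (- ?K)" for s
  \<comment> \<open>The exponents are arranged so that Tm = K + M + e with e nonnegative; then the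
    quotient times z^m and the cleared poles is the polynomial N times s^e.\<close>
  define m where "m = nat \<bar>?K\<bar> + M"
  define e where "e = nat (int T * int m - ?K - int M)"
  have "1 * int m \<le> int T * int m" using T by (intro mult_right_mono) auto
  moreover have "int m = \<bar>?K\<bar> + int M" by (simp add: m_def)
  ultimately have "int T * int m - ?K - int M \<ge> 0" by linarith
  then have e: "int e = int T * int m - ?K - int M" unfolding e_def by simp
  have gN: "gg s * (s ^ T) ^ m * (\<Prod>p\<in>P. s ^ T - p ^ T) ^ n = poly (N * monom 1 e) s" if s: "s \<in> punctured T P" for s
  proof -
    have s0: "s \<noteq> 0" using s by (simp add: punctured_def)
    have "s powi (- ?K) * (s ^ T) ^ m = s powi (- ?K + int T * int m)"
      using s0 by (simp add: power_int_add power_int_mult)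
    also have "- ?K + int T * int m = int M + int e" using e by simp
    also have "s powi (int M + int e) = s ^ M * s ^ e" using s0 by (simp add: power_int_add)
    finally have "gg s * (s ^ T) ^ m = f s * s ^ M * s ^ e" by (simp add: gg_def mult_ac)
    then show ?thesis using N[OF s] by (simp add: poly_monom mult_ac)
  qed
  have grot: "gg (?z * s) = gg s" if s: "s \<in> punctured T P" for s
  proof -
    have "?z powi (- ?K) = ?z powi (int T * (- (int k - 1))) * ?z powi (- int r)"
      by (subst power_int_add[symmetric]) (simp_all add: algebra_simps)
    also have "?z powi (int T * (- (int k - 1))) = 1"
      by (simp only: power_int_mult power_int_of_nat zeta_power_T[OF T]) simp
    also have "?z powi (- int r) = inverse (cis (2 * pi * real r / real T))"
      by (simp only: power_int_minus power_int_of_nat Complex.DeMoivre) (simp add: mult_ac)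
    finally have "?z powi (- ?K) = inverse (cis (2 * pi * real r / real T))" by simp
    then have 1: "?z powi (- ?K) * cis (2 * pi * real r / real T) = 1"
      by (metis cis_neq_zero left_inverse)
    have "gg (?z * s) = (?z powi (- ?K) * cis (2 * pi * real r / real T)) * gg s"
      unfolding gg_def rot[OF s] power_int_mult_distrib by (simp only: mult_ac)
    then show ?thesis unfolding 1 by simp
  qed
  obtain Q where Q: "\<And>s. s \<in> punctured T P \<Longrightarrow> poly (N * monom 1 e) s = poly Q (s ^ T)"
  proof -
    have "poly (N * monom 1 e) (?z * s) = poly (N * monom 1 e) s" if s: "s \<in> punctured T P" for s
      using gN[OF s] gN[OF punctured_rotate[OF T s]] grot[OF s] zeta_power_T[OF T]
      by (simp add: power_mult_distrib)
    then show ?thesis using rotation_invariant_polynomial[OF T] that by metis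
  qed
  obtain h1 where h1: "h1 \<in> partial_fractions ?A" "\<And>z. z \<notin> ?A \<Longrightarrow> h1 z = poly Q z * inverse (z - 0) ^ m"
    using partial_fractions_divide_power[OF pf_poly, of 0 ?A Q m] by blast
  obtain h2 where h2: "h2 \<in> partial_fractions ?A"
    "\<And>z. z \<notin> ?A \<Longrightarrow> h2 z = h1 z * (\<Prod>p\<in>P. inverse (z - p ^ T) ^ n)"
    using partial_fractions_divide_prod[OF P(1) h1(1), of "\<lambda>p. p ^ T" n] by blast
  have gh: "gg s = h2 (s ^ T)" if s: "s \<in> punctured T P" for s
  proof -
    have A: "s ^ T \<notin> ?A" and s0: "s \<noteq> 0" using s T by (auto simp: punctured_def)
    have nz: "(\<Prod>p\<in>P. s ^ T - p ^ T) \<noteq> 0" using A P(1) by auto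
    have "(\<Prod>p\<in>P. inverse (s ^ T - p ^ T) ^ n) = inverse ((\<Prod>p\<in>P. s ^ T - p ^ T) ^ n)"
      by (simp add: prod_inversef[symmetric] power_inverse prod_power_distrib)
    then have "h2 (s ^ T) = gg s * ((s ^ T) ^ m * inverse ((s ^ T) ^ m)) *
        ((\<Prod>p\<in>P. s ^ T - p ^ T) ^ n * inverse ((\<Prod>p\<in>P. s ^ T - p ^ T) ^ n))"
      using h1(2)[OF A] h2(2)[OF A] gN[OF s] Q[OF s] by (simp add: power_inverse mult_ac)
    then show ?thesis using nz s0 by simp
  qed
  obtain q d h where h: "h \<in> polar_functions (?A - {0})" and d0: "poly d 0 = 0"
    and h2e: "h2 = (\<lambda>z. poly q z + poly d (inverse z) + h z)"
    using partial_fractions_structure[OF h2(1)] by blast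
  have A0: "0 \<notin> (\<lambda>p. p ^ T) ` P" using P(2) T by auto
  then have h': "h \<in> polar_functions ((\<lambda>p. p ^ T) ` P)" using h by simp
  have ev0: "eventually (\<lambda>s. s \<in> punctured T P) (at 0)"
    by (rule eventually_punctured_0[OF P(1) T])
  have evi: "eventually (\<lambda>s. s \<in> punctured T P) at_infinity"
    by (rule eventually_punctured_infinity[OF P(1) T])
  \<comment> \<open>The comparison function in the order conditions is s^(K - r), so division by s^K
    leaves |s|^(-r).\<close>
  have norm_g: "norm (gg s) \<le> c * inverse (norm s) ^ r"
    if "norm (f s) \<le> c * norm (s powi (int T * (int k - 1)))" "s \<noteq> 0" for s c
  proof -
    have "norm (gg s) \<le> c * norm (s powi (int T * (int k - 1))) * norm (s powi (- ?K))"
      unfolding gg_def norm_mult by (rule mult_right_mono[OF that(1)]) simp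
    also have "\<dots> = c * norm (s powi (int T * (int k - 1)) * s powi (- ?K))" by (simp add: norm_mult)
    also have "s powi (int T * (int k - 1)) * s powi (- ?K) = s powi (int T * (int k - 1) + - ?K)"
      using that(2) by (subst power_int_add) auto
    also have "int T * (int k - 1) + - ?K = - int r" by simp
    also have "norm (s powi (- int r)) = inverse (norm s) ^ r"
      by (simp add: norm_inverse norm_power power_int_minus power_inverse)
    finally show ?thesis .
  qed
  have zT: "filterlim (\<lambda>s::complex. s ^ T) at_infinity at_infinity"
    by (rule filterlim_power_at_infinity) (use T in simp)
  have lim_inf: "((\<lambda>s::complex. poly d (inverse (s ^ T)) + h (s ^ T)) \<longlongrightarrow> 0) at_infinity"
  proof -
    have "((\<lambda>s::complex. inverse (s ^ T)) \<longlongrightarrow> 0) at_infinity"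
      by (rule filterlim_compose[OF tendsto_inverse_0 zT])
    then have "((\<lambda>s::complex. poly d (inverse (s ^ T))) \<longlongrightarrow> poly d 0) at_infinity" by (rule tendsto_poly)
    from tendsto_add[OF this filterlim_compose[OF polar_tendsto_0[OF h] zT]] d0 show ?thesis by simp
  qed
  obtain ci where "ci > 0" and ci: "eventually (\<lambda>s. norm (f s) \<le> ci * norm (s powi (int T * (int k - 1)))) at_infinity"
    using landau_o.bigE[OF Oi] by blast
  have ev_nz: "eventually (\<lambda>s::complex. norm s \<ge> 1) at_infinity" unfolding eventually_at_infinity by blast
  have g_inf: "eventually (\<lambda>s. norm (gg s) \<le> ci * inverse (norm s) ^ r) at_infinity"
    using ci ev_nz by eventually_elim (auto intro: norm_g)
  obtain c where q: "q = [:c:]"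
  proof -
    have "eventually (\<lambda>s. norm (poly q (s ^ T)) \<le> (ci + 1) * norm s ^ 0 + (ci + 1)) at_infinity"
      using g_inf ev_nz evi tendstoD[OF lim_inf zero_less_one]
    proof eventually_elim
      case (elim s)
      have "inverse (norm s) ^ r \<le> 1" using elim(2) by (simp add: power_le_one inverse_le_1_iff)
      then have "norm (gg s) \<le> ci"
        using order_trans[OF elim(1) mult_left_mono[of "inverse (norm s) ^ r" 1 ci]] \<open>ci > 0\<close> by simp
      moreover have "poly q (s ^ T) = gg s - (poly d (inverse (s ^ T)) + h (s ^ T))"
        using gh[OF elim(3)] by (simp add: h2e)
      then have "norm (poly q (s ^ T)) \<le> norm (gg s) + norm (poly d (inverse (s ^ T)) + h (s ^ T))"
        by (simp only: norm_triangle_ineq4)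
      ultimately show ?case using elim(4) \<open>ci > 0\<close> by simp
    qed
    from polynomial_slow_growth[OF T this] that show ?thesis by blast
  qed
  \<comment> \<open>In the variable y = 1/s the part at 0 is a polynomial in y^T of growth at most
    |y|^r, hence constant, and it has no constant term.\<close>
  have d: "d = 0"
  proof -
    have "((\<lambda>s::complex. poly q (s ^ T) + h (s ^ T)) \<longlongrightarrow> c + h 0) (at 0)"
    proof -
      have "filterlim (\<lambda>s::complex. s ^ T) (at 0) (at 0)"
      proof -
        have "((\<lambda>s::complex. s ^ T) \<longlongrightarrow> 0 ^ T) (at 0)" by (intro tendsto_intros)
        then show ?thesis using T
          by (auto simp: filterlim_at power_0_left eventually_at_filter)
      qed
      from filterlim_compose[OF polar_tendsto_at_0[OF A0 h'] this]
      have "((\<lambda>s::complex. h (s ^ T)) \<longlongrightarrow> h 0) (at 0)" .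
      from tendsto_add[OF tendsto_const[of c] this] show ?thesis by (simp add: q)
    qed
    from tendstoD[OF this zero_less_one]
    have bd: "eventually (\<lambda>s::complex. norm (poly q (s ^ T) + h (s ^ T)) \<le> norm (c + h 0) + 1) (at 0)"
    proof eventually_elim
      case (elim s)
      then show ?case
        using norm_triangle_ineq2[of "poly q (s ^ T) + h (s ^ T)" "c + h 0"] by (simp add: dist_norm)
    qed
    obtain c0 where "c0 > 0" and c0: "eventually (\<lambda>s. norm (f s) \<le> c0 * norm (s powi (int T * (int k - 1)))) (at 0)"
      using landau_o.bigE[OF O0] by blast
    define C where "C = c0 + norm (c + h 0) + 1"
    have "eventually (\<lambda>s. norm (poly d (inverse s ^ T)) \<le> C * norm (inverse s) ^ r + C) (at 0)"
      using c0 bd ev0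
    proof eventually_elim
      case (elim s)
      have s0: "s \<noteq> 0" using elim(3) by (simp add: punctured_def)
      have "norm (gg s) \<le> c0 * inverse (norm s) ^ r" by (rule norm_g[OF elim(1) s0])
      moreover have "poly d (inverse s ^ T) = gg s - (poly q (s ^ T) + h (s ^ T))"
        using gh[OF elim(3)] by (simp add: h2e power_inverse)
      then have "norm (poly d (inverse s ^ T)) \<le> norm (gg s) + norm (poly q (s ^ T) + h (s ^ T))"
        by (simp only: norm_triangle_ineq4)
      moreover have "c0 * inverse (norm s) ^ r \<le> C * inverse (norm s) ^ r"
        by (rule mult_right_mono) (auto simp: C_def)
      ultimately show ?case using elim(2) \<open>c0 > 0\<close> by (simp add: norm_inverse C_def)
    qed
    then have "eventually (\<lambda>y. norm (poly d (y ^ T)) \<le> C * norm y ^ r + C) at_infinity"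
      unfolding at_to_infinity eventually_filtermap by simp
    from polynomial_slow_growth[OF r this] d0 show ?thesis by auto
  qed
  have "c = 0" if "r \<noteq> 0"
  proof -
    have "((\<lambda>s. gg s) \<longlongrightarrow> 0) at_infinity"
    proof (rule Lim_null_comparison[OF g_inf])
      have "((\<lambda>s::complex. inverse (norm s)) \<longlongrightarrow> 0) at_infinity"
        using tendsto_inverse_0_at_top[OF filterlim_norm_at_top] by blast
      from tendsto_power[OF this, of r] that have "((\<lambda>s::complex. inverse (norm s) ^ r) \<longlongrightarrow> 0) at_infinity"
        by (simp add: power_0_left)
      then show "((\<lambda>s::complex. ci * inverse (norm s) ^ r) \<longlongrightarrow> 0) at_infinity" by (rule tendsto_mult_right_zero)
    qed
    moreover have "eventually (\<lambda>s. gg s = c + h (s ^ T)) at_infinity"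
      using evi by eventually_elim (simp add: gh h2e q d)
    ultimately have "((\<lambda>s. c + h (s ^ T)) \<longlongrightarrow> 0) at_infinity" by (rule Lim_transform_eventually)
    moreover have "((\<lambda>s::complex. c + h (s ^ T)) \<longlongrightarrow> c + 0) at_infinity"
      by (intro tendsto_intros filterlim_compose[OF polar_tendsto_0[OF h] zT])
    ultimately have "0 = c + 0" by (rule tendsto_unique[OF trivial_limit_at_infinity])
    then show ?thesis by simp
  qed
  moreover have "f s = s powi ?K * (c + h (s ^ T))" if s: "s \<in> punctured T P" for s
  proof -
    have "s \<noteq> 0" using s by (simp add: punctured_def)
    then have "s powi ?K * s powi (- ?K) = 1" by (subst power_int_add[symmetric]) simp_all
    then have "f s = s powi ?K * gg s" by (simp add: gg_def mult.left_commute[of _ "f s"])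
    then show ?thesis using gh[OF s] by (simp add: h2e q d)
  qed
  ultimately show ?thesis using h' by blast
qed

text \<open>Linear combinations of the kernels with the one exponent K exhaust the constrained
  functions. The point t supplies the zero function as a multiple of a kernel, and the constant term
  as the kernel of order 0.\<close>

lemma constrained_induct [consumes 5, case_names kernel add scale cong]:
  assumes T: "T > 0" and P: "finite P" "0 \<notin> P" and r: "r < T" and f: "f \<in> constrained_functions T P r k"
    and t: "t \<in> P"
    and ker: "\<And>p j. p \<in> P \<Longrightarrow> j \<ge> 1 \<or> r = 0 \<Longrightarrow> Q (kernel T (int T * (int k - 1) + int r) p j)"
    and add: "\<And>f f'. Q f \<Longrightarrow> Q f' \<Longrightarrow> Q (\<lambda>s. f s + f' s)"
    and scale: "\<And>f c. Q f \<Longrightarrow> Q (\<lambda>s. c * f s)"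
    and cong: "\<And>f f'. Q f \<Longrightarrow> f' \<in> curve_functions T P \<Longrightarrow> (\<And>s. s \<in> punctured T P \<Longrightarrow> f' s = f s) \<Longrightarrow> Q f'"
  shows "Q f"
proof -
  let ?K = "int T * (int k - 1) + int r"
  obtain c h where h: "h \<in> polar_functions ((\<lambda>p. p ^ T) ` P)" and c: "r \<noteq> 0 \<longrightarrow> c = 0"
    and fe: "\<And>s. s \<in> punctured T P \<Longrightarrow> f s = s powi ?K * (c + h (s ^ T))"
    using constrained_decomposition[OF T P r f] by blast
  have Qz: "Q (\<lambda>s. 0 * kernel T ?K t 1 s)" by (rule scale[OF ker[OF t]]) simp
  have Qh: "Q (\<lambda>s. s powi ?K * h (s ^ T))"
    using h
  proof (induction rule: polar_functions.induct)
    case po_zero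
    then show ?case using Qz by simp
  next
    case (po_pole a j)
    then obtain p where p: "p \<in> P" "a = p ^ T" by blast
    then show ?case using ker[OF p(1), of "Suc j"] by (simp add: kernel_def)
  next
    case (po_add h h')
    then show ?case using add[OF po_add.IH] by (simp add: distrib_left)
  next
    case (po_scale h c)
    then show ?case using scale[OF po_scale.IH, of c] by (simp add: mult_ac)
  qed
  have "Q (\<lambda>s. c * (if r = 0 then kernel T ?K t 0 s else 0 * kernel T ?K t 1 s))"
    using scale[of _ c] ker[OF t, of 0] Qz by (cases "r = 0") auto
  from add[OF this Qh] show ?thesis
  proof (rule cong)
    show "f \<in> curve_functions T P" using f by (simp add: constrained_functions_def)
    fix s assume "s \<in> punctured T P"
    then show "f s = c * (if r = 0 then kernel T ?K t 0 s else 0 * kernel T ?K t 1 s) + s powi ?K * h (s ^ T)"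
      using c by (simp add: fe kernel_def algebra_simps)
  qed
qed

section \<open>Expansions at the branch points\<close>

lemma curve_functions_expands_zero:
  assumes "f \<in> curve_functions T P"
  shows "\<exists>L. f has_laurent_expansion L"
  using assms
proof (induction rule: curve_functions.induct)
  case cf_coord
  show ?case by (rule exI, rule has_laurent_expansion_fps_X)
next
  case cf_inverse
  show ?case by (rule exI, rule has_laurent_expansion_inverse, rule has_laurent_expansion_fps_X)
next
  case (cf_pole p)
  show ?case
    by (rule exI, rule has_laurent_expansion_inverse[OF has_laurent_expansion_diff[OF
        has_laurent_expansion_power[OF has_laurent_expansion_fps_X] has_laurent_expansion_const]])
qed (blast intro: laurent_expansion_intros)+

lemma curve_functions_expands_infinity:
  assumes "f \<in> curve_functions T P"
  shows "\<exists>L. (\<lambda>u. f (inverse u)) has_laurent_expansion L"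
  using assms
proof (induction rule: curve_functions.induct)
  case cf_coord
  show ?case by (rule exI, rule has_laurent_expansion_inverse, rule has_laurent_expansion_fps_X)
next
  case cf_inverse
  show ?case by simp (rule exI, rule has_laurent_expansion_fps_X)
next
  case (cf_pole p)
  show ?case
    by (rule exI, rule has_laurent_expansion_inverse[OF has_laurent_expansion_diff[OF has_laurent_expansion_power[OF
        has_laurent_expansion_inverse[OF has_laurent_expansion_fps_X]] has_laurent_expansion_const]])
next
  case (cf_add f f')
  then obtain L L' where "(\<lambda>u. f (inverse u)) has_laurent_expansion L" "(\<lambda>u. f' (inverse u)) has_laurent_expansion L'" by blast
  from has_laurent_expansion_add[OF this] show ?case by blast
next
  case (cf_mult f f')
  then obtain L L' where "(\<lambda>u. f (inverse u)) has_laurent_expansion L" "(\<lambda>u. f' (inverse u)) has_laurent_expansion L'" by blast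
  from has_laurent_expansion_mult[OF this] show ?case by blast
qed (blast intro: laurent_expansion_intros)

lemma fls_X_powi_times_nth: "(fls_X powi a * L) $$ b = (L :: complex fls) $$ (b - a)"
  by (simp add: fls_X_power_int fls_X_intpow_times_conv_shift)

lemma residue_powi_expansion:
  assumes "f has_laurent_expansion L"
  shows "residue (\<lambda>s. f s * s powi n) 0 = L $$ (- n - 1)"
proof -
  have "(\<lambda>s. f s * s powi n) has_laurent_expansion fls_X powi n * L"
    by (subst mult.commute, intro has_laurent_expansion_mult assms has_laurent_expansion_power_int has_laurent_expansion_fps_X)
  from has_laurent_expansion_residue_0[OF this]
  moreover have "- 1 - n = - n - 1" by simp
  ultimately show ?thesis by (simp only: fls_residue_def fls_X_powi_times_nth)
qed

lemma coeff_zero_eq: "f has_laurent_expansion L \<Longrightarrow> coeff_zero T f n = L $$ (int T * n)"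
  unfolding coeff_zero_def by (subst residue_powi_expansion) simp_all

lemma coeff_infinity_eq:
  "(\<lambda>u. f (inverse u)) has_laurent_expansion L \<Longrightarrow> coeff_infinity T f n = L $$ (- (int T * n))"
  unfolding coeff_infinity_def
  using residue_powi_expansion[of "\<lambda>u. f (inverse u)" L "int T * n - 1"] by simp

lemma coeff_zero_add:
  "f \<in> curve_functions T P \<Longrightarrow> f' \<in> curve_functions T P \<Longrightarrow>
   coeff_zero T (\<lambda>s. f s + f' s) n = coeff_zero T f n + coeff_zero T f' n"
  using curve_functions_expands_zero coeff_zero_eq has_laurent_expansion_add
  by (metis (no_types, lifting) fls_plus_nth)

lemma coeff_infinity_add:
  assumes "f \<in> curve_functions T P" "f' \<in> curve_functions T P"
  shows "coeff_infinity T (\<lambda>s. f s + f' s) n = coeff_infinity T f n + coeff_infinity T f' n"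
proof -
  obtain L L' where "(\<lambda>u. f (inverse u)) has_laurent_expansion L" "(\<lambda>u. f' (inverse u)) has_laurent_expansion L'"
    using assms curve_functions_expands_infinity by blast
  then show ?thesis
    using coeff_infinity_eq[of "\<lambda>s. f s + f' s" "L + L'"] has_laurent_expansion_add coeff_infinity_eq by fastforce
qed

lemma coeff_zero_cmult:
  assumes "f \<in> curve_functions T P"
  shows "coeff_zero T (\<lambda>s. c * f s) n = c * coeff_zero T f n"
proof -
  obtain L where L: "f has_laurent_expansion L"
    using assms curve_functions_expands_zero by blast
  from has_laurent_expansion_mult[OF has_laurent_expansion_const this, of c]
  show ?thesis using L by (simp add: coeff_zero_eq)
qed

lemma coeff_infinity_cmult:
  assumes "f \<in> curve_functions T P"
  shows "coeff_infinity T (\<lambda>s. c * f s) n = c * coeff_infinity T f n"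
proof -
  obtain L where L: "(\<lambda>u. f (inverse u)) has_laurent_expansion L"
    using assms curve_functions_expands_infinity by blast
  from has_laurent_expansion_mult[OF has_laurent_expansion_const this, of c]
  show ?thesis using L by (simp add: coeff_infinity_eq)
qed

lemma coeff_zero_cong:
  assumes "finite P" "T > 0" "\<And>s. s \<in> punctured T P \<Longrightarrow> f' s = f s"
  shows "coeff_zero T f' n = coeff_zero T f n"
  unfolding coeff_zero_def
  by (rule residue_cong[OF _ refl]) (use eventually_punctured_0[OF assms(1,2)] assms(3) in \<open>auto elim: eventually_mono\<close>)

lemma coeff_infinity_cong:
  assumes "finite P" "T > 0" "\<And>s. s \<in> punctured T P \<Longrightarrow> f' s = f s"
  shows "coeff_infinity T f' n = coeff_infinity T f n"
proof -
  have "eventually (\<lambda>u. inverse u \<in> punctured T P) (at 0)"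
    using eventually_punctured_infinity[OF assms(1,2)] unfolding at_to_infinity eventually_filtermap by simp
  then show ?thesis
    unfolding coeff_infinity_def
    by (intro residue_cong[OF _ refl]) (use assms(3) in \<open>auto elim: eventually_mono\<close>)
qed

text \<open>$z^{r/T+m}/(z-w)^n$, with $K=r+Tm$.\<close>

lemma kernel_constrained:
  assumes T: "T > 0" and r: "r < T" and w: "w \<in> P" "w \<noteq> 0" and K: "K = int r + int T * m"
    and bounds: "K - int T * int n \<le> int T * (int k - 1)" "int T * (int k - 1) \<le> K"
  shows "kernel T K w n \<in> constrained_functions T P r k"
  unfolding constrained_functions_def
proof (intro CollectI conjI allI impI)
  let ?B = "int T * (int k - 1)"
  let ?z = "cis (2 * pi / real T)"
  show "kernel T K w n \<in> curve_functions T P" by (rule kernel_in_curve_functions[OF w(1)])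
  fix s
  have "?z powi K = cis (2 * pi * real r / real T)"
  proof -
    have "?z powi K = ?z powi (int r) * ?z powi (int T * m)" unfolding K by (simp add: power_int_add)
    also have "?z powi (int T * m) = 1"
      by (simp only: power_int_mult power_int_of_nat zeta_power_T[OF T]) simp
    also have "?z powi (int r) = cis (2 * pi * real r / real T)"
      by (simp only: power_int_of_nat Complex.DeMoivre) (simp add: mult_ac)
    finally show ?thesis by simp
  qed
  then show "kernel T K w n (?z * s) = cis (2 * pi * real r / real T) * kernel T K w n s"
    by (simp add: kernel_def power_int_mult_distrib power_mult_distrib zeta_power_T[OF T])
next
  let ?B = "int T * (int k - 1)"
  have lim: "((\<lambda>s. inverse (s ^ T - w ^ T) ^ n) \<longlongrightarrow> inverse (0 ^ T - w ^ T) ^ n) (at 0)"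
    by (intro tendsto_intros) (use T w in \<open>auto simp: power_0_left\<close>)
  from tendstoD[OF this zero_less_one]
  have bd: "eventually (\<lambda>s. norm (inverse (s ^ T - w ^ T) ^ n) \<le> norm (inverse (0 ^ T - w ^ T) ^ n) + 1) (at 0)"
  proof eventually_elim
    case (elim s)
    then show ?case
      using norm_triangle_ineq2[of "inverse (s ^ T - w ^ T) ^ n" "inverse (0 ^ T - w ^ T) ^ n"] unfolding dist_norm by linarith
  qed
  have "eventually (\<lambda>s::complex. s \<in> ball 0 1 - {0}) (at 0)" by (rule eventually_at_in_open) auto
  then have "eventually (\<lambda>s::complex. s \<noteq> 0 \<and> norm s \<le> 1) (at 0)" by eventually_elim auto
  with bd have "eventually (\<lambda>s. norm (kernel T K w n s) \<le> (norm (inverse (0 ^ T - w ^ T) ^ n) + 1) * norm (s powi ?B)) (at 0)"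
  proof eventually_elim
    case (elim s)
    have "norm s powi K \<le> norm s powi ?B"
      by (rule power_int_decreasing) (use elim bounds in auto)
    then show ?case
      using elim unfolding kernel_def norm_mult
      by (subst mult.commute, intro mult_mono) (auto simp: norm_power_int)
  qed
  then show "kernel T K w n \<in> O[at 0](\<lambda>s. s powi ?B)" by (rule bigoI)
next
  let ?B = "int T * (int k - 1)"
  \<comment> \<open>For |s| at least 1 and at least 2|w^T| one has |w^T| at most |s^T|/2, which
    bounds |s^T - w^T| from below by |s^T|/2.\<close>
  define N where "N = max 1 (2 * norm (w ^ T))"
  have "eventually (\<lambda>s::complex. norm s \<ge> N) at_infinity" unfolding eventually_at_infinity by blast
  then have "eventually (\<lambda>s. norm (kernel T K w n s) \<le> 2 ^ n * norm (s powi ?B)) at_infinity"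
  proof eventually_elim
    case (elim s)
    then have s: "norm s \<ge> 1" "norm s \<ge> 2 * norm (w ^ T)" by (simp_all add: N_def)
    then have s0: "s \<noteq> 0" by auto
    have "norm s ^ 1 \<le> norm s ^ T" by (rule power_increasing) (use T s in auto)
    then have ge: "norm (w ^ T) \<le> norm (s ^ T) / 2" using s by (simp add: norm_power)
    have "norm (s ^ T) - norm (w ^ T) \<le> norm (s ^ T - w ^ T)" by (rule norm_triangle_ineq2)
    then have "norm (s ^ T) / 2 \<le> norm (s ^ T - w ^ T)" using ge by linarith
    moreover have "norm (s ^ T) > 0" using s0 by simp
    ultimately have "inverse (norm (s ^ T - w ^ T)) \<le> inverse (norm (s ^ T) / 2)"
      by (intro le_imp_inverse_le) auto
    then have "norm (inverse (s ^ T - w ^ T)) \<le> 2 * inverse (norm s ^ T)"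
      by (simp only: divide_inverse norm_inverse norm_power inverse_mult_distrib inverse_inverse_eq mult.commute)
    then have "norm (inverse (s ^ T - w ^ T)) ^ n \<le> (2 * inverse (norm s ^ T)) ^ n"
      by (rule power_mono) simp
    then have "norm (inverse (s ^ T - w ^ T) ^ n) \<le> (2 * inverse (norm s ^ T)) ^ n"
      by (simp only: norm_power)
    then have "norm (kernel T K w n s) \<le> norm s powi K * (2 * inverse (norm s ^ T)) ^ n"
      unfolding kernel_def norm_mult norm_power_int by (rule mult_left_mono) simp
    also have "\<dots> = 2 ^ n * norm s powi (K - int T * int n)"
    proof -
      have "norm s powi (K - int T * int n) = norm s powi K * norm s powi (int T * (- int n))"
        using s0 by (subst power_int_add[symmetric]) auto
      also have "norm s powi (int T * (- int n)) = inverse (norm s ^ T) ^ n"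
        by (simp only: power_int_mult power_int_of_nat power_int_minus power_inverse)
      finally show ?thesis by (simp add: power_mult_distrib mult_ac)
    qed
    also have "\<dots> \<le> 2 ^ n * norm s powi ?B"
      by (intro mult_left_mono power_int_increasing) (use s bounds in auto)
    finally show ?case by (simp add: norm_power_int)
  qed
  then show "kernel T K w n \<in> O[at_infinity](\<lambda>s. s powi ?B)" by (rule bigoI)
qed

text \<open>The exponent n does not exceed the order m of the kernel at 0, so only the value of (z -
  w)^(-j) at 0 can contribute.\<close>

lemma coeff_zero_kernel:
  assumes T: "T > 0" and w: "w \<noteq> 0" and m: "n \<le> m"
  shows "coeff_zero T (kernel T (int T * m) w j) n = (if m = n then (- (w ^ T)) powi (- int j) else 0)"
proof -
  have "(\<lambda>s. inverse (s ^ T - w ^ T) ^ j) has_fps_expansion inverse (fps_X ^ T - fps_const (w ^ T)) ^ j"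
    by (intro fps_expansion_intros) (use T w in auto)
  from has_laurent_expansion_mult[OF has_laurent_expansion_power_int[OF has_laurent_expansion_fps_X]
      has_laurent_expansion_fps[OF this], of "int T * m"]
  have "kernel T (int T * m) w j has_laurent_expansion
    fls_X powi (int T * m) * fps_to_fls (inverse (fps_X ^ T - fps_const (w ^ T)) ^ j)"
    unfolding kernel_def .
  note coeff_zero_eq[OF this, of T n]
  also have "(fls_X powi (int T * m) * fps_to_fls (inverse (fps_X ^ T - fps_const (w ^ T)) ^ j)) $$ (int T * n) =
     fps_to_fls (inverse (fps_X ^ T - fps_const (w ^ T)) ^ j) $$ (int T * (n - m))"
    by (simp only: fls_X_powi_times_nth) (simp add: algebra_simps)
  also have "\<dots> = (if m = n then (- (w ^ T)) powi (- int j) else 0)"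
  proof (cases "m = n")
    case True
    have "(inverse (fps_X ^ T - fps_const (w ^ T)) ^ j) $ 0 = inverse (- (w ^ T)) ^ j"
      using T by (simp add: fps_power_zeroth power_0_left)
    then show ?thesis using True by (simp add: power_int_minus power_inverse[symmetric])
  next
    case False
    then have "int T * (n - m) < 0" using T m by (simp add: mult_less_0_iff)
    then show ?thesis using False by simp
  qed
  finally show ?thesis .
qed

text \<open>In u = 1/s the kernel is u^(-T(m-j)) times a power series with constant term 1, and the
  hypothesis places n at or above the leading exponent m - j.\<close>

lemma coeff_infinity_kernel:
  assumes T: "T > 0" and m: "m - int j \<le> n"
  shows "coeff_infinity T (kernel T (int T * m) w j) n = (if m - int j = n then 1 else 0)"
proof -
  let ?F = "inverse (1 - fps_const (w ^ T) * fps_X ^ T) ^ j"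
  have "(\<lambda>u. inverse (1 - w ^ T * u ^ T) ^ j) has_fps_expansion ?F"
    by (intro fps_expansion_intros) (use T in auto)
  from has_laurent_expansion_mult[OF has_laurent_expansion_power_int[OF has_laurent_expansion_fps_X]
      has_laurent_expansion_fps[OF this], of "- (int T * (m - int j))"]
  have "(\<lambda>u. u powi (- (int T * (m - int j))) * inverse (1 - w ^ T * u ^ T) ^ j) has_laurent_expansion
    fls_X powi (- (int T * (m - int j))) * fps_to_fls ?F" .
  moreover have "kernel T (int T * m) w j (inverse u) = u powi (- (int T * (m - int j))) * inverse (1 - w ^ T * u ^ T) ^ j"
    if u: "u \<noteq> 0" for u
  proof -
    have "inverse (inverse u ^ T - w ^ T) = u ^ T * inverse (1 - w ^ T * u ^ T)"
    proof -
      have "u ^ T * (inverse u ^ T - w ^ T) = 1 - w ^ T * u ^ T"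
        using u by (simp add: algebra_simps power_inverse)
      then have "inverse (1 - w ^ T * u ^ T) = inverse (u ^ T) * inverse (inverse u ^ T - w ^ T)"
        by (metis inverse_mult_distrib)
      then show ?thesis using u by simp
    qed
    then have "kernel T (int T * m) w j (inverse u) = inverse u powi (int T * m) * (u ^ T) ^ j * inverse (1 - w ^ T * u ^ T) ^ j"
      by (simp add: kernel_def power_mult_distrib)
    also have "inverse u powi (int T * m) * (u ^ T) ^ j = u powi (- (int T * (m - int j)))"
    proof -
      have "u powi (- (int T * (m - int j))) = u powi (- (int T * m)) * u powi (int T * int j)"
        using u by (subst power_int_add[symmetric]) (auto simp: algebra_simps)
      also have "u powi (int T * int j) = (u ^ T) ^ j" by (simp only: power_int_mult power_int_of_nat)
      finally show ?thesis by (simp add: power_int_minus power_int_inverse)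
    qed
    finally show ?thesis .
  qed
  then have "eventually (\<lambda>u. kernel T (int T * m) w j (inverse u) =
      u powi (- (int T * (m - int j))) * inverse (1 - w ^ T * u ^ T) ^ j) (at 0)"
    by (simp add: eventually_at_filter)
  ultimately have "(\<lambda>u. kernel T (int T * m) w j (inverse u)) has_laurent_expansion
      fls_X powi (- (int T * (m - int j))) * fps_to_fls ?F"
    by (subst has_laurent_expansion_cong[OF _ refl])
  note coeff_infinity_eq[OF this, of T n]
  also have "(fls_X powi (- (int T * (m - int j))) * fps_to_fls ?F) $$ (- (int T * n)) =
     fps_to_fls ?F $$ (int T * (m - int j - n))"
    by (simp only: fls_X_powi_times_nth) (simp add: algebra_simps)
  also have "\<dots> = (if m - int j = n then 1 else 0)"
  proof (cases "m - int j = n")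
    case True
    then show ?thesis using T by (simp add: fps_power_zeroth power_0_left)
  next
    case False
    then have "int T * (m - int j - n) < 0" using T m by (simp add: mult_less_0_iff)
    then show ?thesis using False by simp
  qed
  finally show ?thesis .
qed

section \<open>Invariance under all constrained test functions\<close>

context multilinear_system
begin

lemma J_no_coeffs:
  assumes "r < T" "r \<noteq> 0" "a \<in> grade V k \<inter> eigensp g T r"
  shows "J a f \<alpha> \<beta> u3 xs v t u2 = J a f \<alpha>' \<beta>' u3 xs v t u2"
  using twisted_acts_zero[OF assms] clinear_0[OF S_linear(1)] clinear_0[OF S_linear(3)]
  by (simp add: J_def)

text \<open>The functional J and the coefficients at 0 and infinity are linear in the test function
  and depend only on its values on the punctured curve. So the claim reduces to kernels, for which
  it is a vanishing block sum.\<close>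

lemma J_constrained:
  assumes inv: "invariant (length xs)" and cf: "config T (map snd xs) t"
    and a: "r < T" "a \<in> grade V k \<inter> eigensp g T r"
    and f: "f \<in> constrained_functions T (insert t (snd ` set xs)) r k"
  shows "J a f (- coeff_infinity T f (int k - 1)) (coeff_zero T f (int k - 1)) u3 xs v t u2 = 0"
proof -
  let ?P = "insert t (snd ` set xs)"
  let ?n = "int k - 1"
  let ?K = "int T * (int k - 1) + int r"
  define Q where "Q f \<longleftrightarrow> f \<in> curve_functions T ?P \<and>
    J a f (- coeff_infinity T f ?n) (coeff_zero T f ?n) u3 xs v t u2 = 0" for f
  have P: "finite ?P" "0 \<notin> ?P" using config_nonzero[OF cf] by auto
  from T P a(1) f have "Q f"
  proof (induction rule: constrained_induct)
    show "t \<in> ?P" by simp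
  next
    fix p and j :: nat assume p: "p \<in> ?P" and j: "1 \<le> j \<or> r = 0"
    have "block_sum a k r p j u3 xs v t u2 = 0"
      using invariantD[OF inv cf a, of p] p j by simp
    moreover have "J a (kernel T ?K p j) (- coeff_infinity T (kernel T ?K p j) ?n) (coeff_zero T (kernel T ?K p j) ?n) u3 xs v t u2
      = block_sum a k r p j u3 xs v t u2"
    proof (cases "r = 0")
      case True
      have "p \<noteq> 0" using p P by auto
      from coeff_zero_kernel[OF T this order_refl, of "int k - 1" j] coeff_infinity_kernel[OF T, of "int k - 1" j "int k - 1" p]
      show ?thesis using True by (simp add: block_sum_def)
    next
      case False
      then show ?thesis unfolding block_sum_def by (rule J_no_coeffs[OF a(1) _ a(2)])
    qed
    ultimately show "Q (kernel T ?K p j)"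
      using p by (simp add: Q_def kernel_in_curve_functions)
  next
    fix f f' assume Q: "Q f" "Q f'"
    then have c: "f \<in> curve_functions T ?P" "f' \<in> curve_functions T ?P" by (simp_all add: Q_def)
    from Q show "Q (\<lambda>s. f s + f' s)"
      using J_add[OF expandable_curve[OF c(1)] expandable_curve[OF c(2)] cf, of a "- coeff_infinity T f ?n"
          "- coeff_infinity T f' ?n" "coeff_zero T f ?n" "coeff_zero T f' ?n" u3 v u2] cf_add[OF c]
      by (simp add: Q_def coeff_zero_add[OF c] coeff_infinity_add[OF c])
  next
    fix f c assume Q: "Q f"
    then have f: "f \<in> curve_functions T ?P" by (simp add: Q_def)
    from Q show "Q (\<lambda>s. c * f s)"
      using J_cmult[OF expandable_curve[OF f] cf, of a c "- coeff_infinity T f ?n" "coeff_zero T f ?n" u3 v u2]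
        cf_mult[OF cf_const f]
      by (simp add: Q_def coeff_zero_cmult[OF f] coeff_infinity_cmult[OF f])
  next
    fix f f' assume Q: "Q f" and f': "f' \<in> curve_functions T ?P" and eq: "\<And>s. s \<in> punctured T ?P \<Longrightarrow> f' s = f s"
    show "Q f'"
      using Q f' J_cong[OF P(1) eq cf] coeff_zero_cong[OF P(1) T eq] coeff_infinity_cong[OF P(1) T eq]
      by (simp add: Q_def)
  qed
  then show ?thesis by (simp add: Q_def)
qed

lemma J_linear_u3: "clinear (\<lambda>u3. J b f \<alpha> \<beta> u3 xs v t u2)"
  unfolding J_def
  by (intro clinear_plus clinear_sum_fun clinear_cmult S_linear clinear_compose[OF S_linear(1) U3_linear(1)])

lemma J_linear_u2: "clinear (\<lambda>u2. J b f \<alpha> \<beta> u3 xs v t u2)"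
  unfolding J_def
  by (intro clinear_plus clinear_sum_fun clinear_cmult S_linear clinear_compose[OF S_linear(3) U2_linear(1)])

lemma J_linear_entry: "clinear (\<lambda>c. J b f \<alpha> \<beta> u3 (xs @ (c, s) # ys) v t u2)"
proof -
  have "clinear (\<lambda>c. S u3 ((xs @ (c, s) # ys)[l :=
      (smear (mode V) (expansion T (snd ((xs @ (c, s) # ys) ! l)) f) b (fst ((xs @ (c, s) # ys) ! l)),
       snd ((xs @ (c, s) # ys) ! l))]) (v, t) u2)" for l
  proof -
    consider "l < length xs" | "l = length xs" | "l > length xs" by linarith
    then show ?thesis
    proof cases
      case 1
      then show ?thesis by (simp add: nth_append list_update_append S_linear_mid)
    next
      case 2
      then show ?thesis
        using clinear_compose[OF S_linear_mid VV.smear_linear_right] by simp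
    next
      case 3
      then obtain i where "l = length xs + Suc i" using less_imp_Suc_add by auto
      then show ?thesis by (simp add: nth_append list_update_append S_linear_mid)
    qed
  qed
  then show ?thesis
    unfolding J_def length_append list.size
    by (intro clinear_plus clinear_sum_fun clinear_cmult S_linear_mid)
qed

end

lemma clinear_Sum_any_fun:
  assumes "\<And>k. clinear (f k)" "\<And>x. finite {k. f k x \<noteq> 0}"
  shows "clinear (\<lambda>x. Sum_any (\<lambda>k. f k x))"
proof (rule clinearI)
  show "Sum_any (\<lambda>k. f k (x + y)) = Sum_any (\<lambda>k. f k x) + Sum_any (\<lambda>k. f k y)" for x y
    by (subst Sum_any.distrib[symmetric]) (simp_all add: assms clinear_add[OF assms(1)])
  show "Sum_any (\<lambda>k. f k (c *\<^sub>C x)) = c *\<^sub>C Sum_any (\<lambda>k. f k x)" for c x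
    by (subst clinear_Sum_any[OF clinear_const_scale[OF clinear_id]]) (simp_all add: assms clinear_scale[OF assms(1)])
qed

section \<open>The correlation functions of a functional\<close>

context twisted_datum
begin

definition left_recursion ::
    "('v, 'm, 'u3, 'u2) correlation \<Rightarrow> nat \<Rightarrow> nat \<Rightarrow> 'v \<Rightarrow> complex \<Rightarrow> 'u3 \<Rightarrow> ('v \<times> complex) list \<Rightarrow> 'm \<times> complex \<Rightarrow> 'u2 \<Rightarrow> complex" where
  "left_recursion C r k a s u3 xs vq u2 = (s ^ T) powi (- int k) * C u3 xs vq (U2 (cls a) u2) +
     recursion_sum V T M C (int T * (int k - 1) + int r) a s u3 xs (fst vq) (snd vq) u2"

text \<open>The recursion runs over the number of insertions, because the recursive formula changes
  the vectors in the tail but keeps its length. The first vector is split into its components in V_k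
  and V^r, as the exponent of the formula depends on both.\<close>

primrec correlation_of_length ::
    "('u3 \<Rightarrow> 'm \<Rightarrow> 'u2 \<Rightarrow> complex) \<Rightarrow> nat \<Rightarrow> ('v, 'm, 'u3, 'u2) correlation" where
  "correlation_of_length \<phi> 0 = (\<lambda>u3 xs vq u2.
     if xs = [] \<and> snd vq \<noteq> 0 then transport T M \<phi> (snd vq) u3 (fst vq) u2 else 0)"
| "correlation_of_length \<phi> (Suc n) = (\<lambda>u3 xs vq u2.
     if length xs = Suc n \<and> config T (map snd xs) (snd vq)
     then \<Sum>r<T. Sum_any (\<lambda>k. left_recursion (correlation_of_length \<phi> n) r k
       (eigenproj g T r (component (grade V) (fst (hd xs)) k)) (snd (hd xs)) u3 (tl xs) vq u2)
     else 0)"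

definition correlation_of ::
    "('u3 \<Rightarrow> 'm \<Rightarrow> 'u2 \<Rightarrow> complex) \<Rightarrow> ('v, 'm, 'u3, 'u2) correlation" where
  "correlation_of \<phi> u3 xs vq u2 = correlation_of_length \<phi> (length xs) u3 xs vq u2"

lemma twisted_datum: "twisted_datum V g T M U2 U3 h1 h2 h3 h" ..

lemma left_recursion_J:
  assumes C: "cor_multilinear T C" and cf: "config T (s # map snd xs) t"
  shows "left_recursion C r k a s u3 xs (v, t) u2 =
    multilinear_system.J V g T M U2 U3 C a (cauchy_kernel T (int T * (int k - 1) + int r) s)
      0 ((s ^ T) powi (- int k)) u3 xs v t u2"
proof -
  interpret multilinear_system V g T M U2 U3 h1 h2 h3 h C
    by (rule multilinear_system.intro[OF twisted_datum]) (rule multilinear_system_axioms.intro[OF C])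
  show ?thesis
    unfolding left_recursion_def fst_conv snd_conv recursion_sum_eq_J[OF cf] by (subst (2) J_coeffs) simp
qed

lemma transport_linear: "clinear (\<lambda>v. Sum_any (\<lambda>d. ((t ^ T) powi (- int d)) *\<^sub>C component (mgrade M) v d))"
proof (rule clinear_Sum_any_fun)
  show "finite {d. ((t ^ T) powi (- int d)) *\<^sub>C component (mgrade M) v d \<noteq> 0}" for v
    by (rule finite_subset[OF _ component_finite[OF mgrading, of v]]) (auto simp: complex_vs.scale_zero_right)
qed (intro clinear_const_scale component_linear[OF mgrading])

text \<open>Once the recursion is expressed through J, linearity in each argument is inherited from
  J. The sum over weights is finite because J vanishes on zero components.\<close>

lemma correlation_of_length_multilinear:
  assumes \<phi>: "trilinear \<phi>"
  shows "cor_multilinear T (correlation_of_length \<phi> n)"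
proof (induction n)
  case 0
  have "clinear (\<lambda>u3. transport T M \<phi> t u3 v u2)" "clinear (\<lambda>v. transport T M \<phi> t u3 v u2)"
    "clinear (\<lambda>u2. transport T M \<phi> t u3 v u2)" for u3 v u2 t
    unfolding transport_def
    using \<phi> clinear_compose[OF _ transport_linear, of "\<lambda>v. \<phi> u3 v u2" t] by (simp_all add: trilinear_def)
  note transport = this
  show ?case
    unfolding cor_multilinear_def
  proof (intro conjI allI impI)
    show "trilinear (\<lambda>u3 v u2. correlation_of_length \<phi> 0 u3 xs (v, t) u2)" for xs t
      by (cases "xs = []"; cases "t = 0") (simp_all add: trilinear_def clinear_zero transport)
  qed (auto simp: clinear_zero config_def)
next
  case (Suc n)
  define C where "C = correlation_of_length \<phi> n"
  interpret multilinear_system V g T M U2 U3 h1 h2 h3 h C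
    by (rule multilinear_system.intro[OF twisted_datum], rule multilinear_system_axioms.intro)
       (simp add: C_def Suc)
  let ?b = "\<lambda>r k a. eigenproj g T r (component (grade V) a k)"
  let ?J = "\<lambda>r k a s u3 xs v t u2. J (?b r k a) (cauchy_kernel T (int T * (int k - 1) + int r) s)
      0 ((s ^ T) powi (- int k)) u3 xs v t u2"
  let ?R = "\<lambda>a s u3 xs v t u2. \<Sum>r<T. Sum_any (\<lambda>k. ?J r k a s u3 xs v t u2)"
  have b: "clinear (\<lambda>a. ?b r k a)" for r k
    by (rule clinear_compose[OF eigenproj_linear[OF voa aut T gT] component_linear[OF voa_grading[OF voa]]])
  have fin: "finite {k. ?J r k a s u3 xs v t u2 \<noteq> 0}" for r a s u3 xs v t u2
    by (rule finite_subset[OF _ component_finite[OF voa_grading[OF voa], of a]])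
       (auto simp: clinear_0[OF J_linear_b] clinear_0[OF eigenproj_linear[OF voa aut T gT]])
  have R: "clinear (\<lambda>a. ?R a s u3 xs v t u2)" "clinear (\<lambda>u3. ?R a s u3 xs v t u2)"
    "clinear (\<lambda>v. ?R a s u3 xs v t u2)" "clinear (\<lambda>u2. ?R a s u3 xs v t u2)"
    "clinear (\<lambda>c. ?R a s u3 (xs @ (c, s') # ys) v t u2)" for a s u3 xs v t u2 s' ys
    by (intro clinear_sum_fun clinear_Sum_any_fun fin J_linear_u3 J_linear_v J_linear_u2 J_linear_entry
        clinear_compose[OF J_linear_b b])+
  have eq: "correlation_of_length \<phi> (Suc n) u3 xs vq u2 =
    (if length xs = Suc n \<and> config T (map snd xs) (snd vq)
     then ?R (fst (hd xs)) (snd (hd xs)) u3 (tl xs) (fst vq) (snd vq) u2 else 0)" for u3 xs vq u2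
  proof (cases xs)
    case (Cons x xs')
    obtain a s where x: "x = (a, s)" by (cases x)
    obtain v t where "vq = (v, t)" by (cases vq)
    then show ?thesis using left_recursion_J[OF multilinear, of s xs' t] Cons x by (simp add: C_def)
  qed simp
  show ?case
    unfolding cor_multilinear_def
  proof (intro conjI allI impI)
    fix xs t
    show "trilinear (\<lambda>u3 v u2. correlation_of_length \<phi> (Suc n) u3 xs (v, t) u2)"
      by (cases "length xs = Suc n \<and> config T (map snd xs) t")
         (simp_all only: trilinear_def eq fst_conv snd_conv if_True if_False clinear_zero R simp_thms)
  next
    fix u3 xs ys s vq u2
    show "clinear (\<lambda>a. correlation_of_length \<phi> (Suc n) u3 (xs @ (a, s) # ys) vq u2)"
    proof (cases "length (xs @ ys) = n \<and> config T (map snd xs @ s # map snd ys) (snd vq)")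
      case True
      then show ?thesis unfolding eq
        by (cases xs) (simp_all only: R hd_append list.sel append.simps list.simps map_append length_append fst_conv snd_conv, auto simp: R)
    next
      case False
      then have "correlation_of_length \<phi> (Suc n) u3 (xs @ (a, s) # ys) vq u2 = 0" for a
        unfolding eq by auto
      then show ?thesis by (simp only: clinear_zero)
    qed
  next
    fix u3 v t u2 and xs :: "('v \<times> complex) list" assume "\<not> config T (map snd xs) t"
    then show "correlation_of_length \<phi> (Suc n) u3 xs (v, t) u2 = 0" unfolding eq by simp
  qed
qed

lemma correlation_of_multilinear:
  assumes "trilinear \<phi>" shows "cor_multilinear T (correlation_of \<phi>)"
  using correlation_of_length_multilinear[OF assms]
  unfolding cor_multilinear_def correlation_of_def trilinear_def
  by (simp only: length_append list.size) blast

lemma correlation_of_Nil: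
  "correlation_of \<phi> u3 [] (v, t) u2 = (if t \<noteq> 0 then transport T M \<phi> t u3 v u2 else 0)"
  by (simp add: correlation_of_def)

text \<open>On a vector of V_k lying in V^r the double sum in the definition reduces to the single
  term with these indices.\<close>

lemma recursive_system_correlation_of:
  assumes \<phi>: "trilinear \<phi>"
  shows "recursive_system V g T M U2 U3 h1 h2 h3 h (correlation_of \<phi>)"
proof -
  interpret multilinear_system V g T M U2 U3 h1 h2 h3 h "correlation_of \<phi>"
    by (rule multilinear_system.intro[OF twisted_datum], rule multilinear_system_axioms.intro)
       (rule correlation_of_multilinear[OF \<phi>])
  show ?thesis
  proof unfold_locales
    fix r k a u3 s v t u2 and xs :: "('v \<times> complex) list"
    assume a: "r < T" "a \<in> grade V k \<inter> eigensp g T r" and cf: "config T (s # map snd xs) t"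
    let ?C = "correlation_of_length \<phi> (length xs)"
    interpret C: multilinear_system V g T M U2 U3 h1 h2 h3 h ?C
      by (rule multilinear_system.intro[OF twisted_datum], rule multilinear_system_axioms.intro)
         (rule correlation_of_length_multilinear[OF \<phi>])
    have b: "eigenproj g T r' (component (grade V) a k') = (if r' = r \<and> k' = k then a else 0)" if "r' < T" for r' k'
      using a that clinear_0[OF eigenproj_linear[OF voa aut T gT]] eigenproj_eigen[OF voa aut T gT, of a r r']
      by (auto simp: component_homogeneous[OF voa_grading[OF voa]])
    have "correlation_of \<phi> u3 ((a, s) # xs) (v, t) u2 =
      (\<Sum>r'<T. Sum_any (\<lambda>k'. left_recursion ?C r' k'
       (eigenproj g T r' (component (grade V) a k')) s u3 xs (v, t) u2))"
      using cf by (simp add: correlation_of_def)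
    also have "\<dots> = (\<Sum>r'<T. if r' = r then left_recursion ?C r k a s u3 xs (v, t) u2 else 0)"
    proof (intro sum.cong refl)
      fix r' assume "r' \<in> {..<T}"
      then have "Sum_any (\<lambda>k'. left_recursion ?C r' k' (eigenproj g T r' (component (grade V) a k')) s u3 xs (v, t) u2)
        = (\<Sum>k'\<in>{k}. left_recursion ?C r' k' (eigenproj g T r' (component (grade V) a k')) s u3 xs (v, t) u2)"
        by (intro Sum_any_superset)
           (auto simp: b left_recursion_J[OF C.multilinear cf] clinear_0[OF C.J_linear_b])
      with \<open>r' \<in> {..<T}\<close> show "Sum_any (\<lambda>k'. left_recursion ?C r' k' (eigenproj g T r' (component (grade V) a k')) s u3 xs (v, t) u2)
        = (if r' = r then left_recursion ?C r k a s u3 xs (v, t) u2 else 0)"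
        by (auto simp: b left_recursion_J[OF C.multilinear cf] clinear_0[OF C.J_linear_b])
    qed
    also have "\<dots> = left_recursion ?C r k a s u3 xs (v, t) u2" using a(1) by simp
    also have "\<dots> = (s ^ T) powi (- int k) * correlation_of \<phi> u3 xs (v, t) (U2 (cls a) u2)
        + recursion_sum V T M (correlation_of \<phi>) (int T * (int k - 1) + int r) a s u3 xs v t u2"
      by (simp add: left_recursion_def correlation_of_def recursion_sum_def)
    finally show "correlation_of \<phi> u3 ((a, s) # xs) (v, t) u2 = (s ^ T) powi (- int k) * correlation_of \<phi> u3 xs (v, t) (U2 (cls a) u2)
        + recursion_sum V T M (correlation_of \<phi>) (int T * (int k - 1) + int r) a s u3 xs v t u2" .
  qed
qed

text \<open>The recursive formula determines a system by its values without insertions.\<close>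

lemma recursive_system_combination:
  assumes S: "recursive_system V g T M U2 U3 h1 h2 h3 h S"
    and S': "recursive_system V g T M U2 U3 h1 h2 h3 h S'"
    and S'': "recursive_system V g T M U2 U3 h1 h2 h3 h S''"
    and base: "\<And>u3 v t u2. t \<noteq> 0 \<Longrightarrow> S u3 [] (v, t) u2 = c * S' u3 [] (v, t) u2 + d * S'' u3 [] (v, t) u2"
  shows "S u3 xs vq u2 = c * S' u3 xs vq u2 + d * S'' u3 xs vq u2"
proof -
  interpret S: recursive_system V g T M U2 U3 h1 h2 h3 h S by (rule S)
  interpret S': recursive_system V g T M U2 U3 h1 h2 h3 h S' by (rule S')
  interpret S'': recursive_system V g T M U2 U3 h1 h2 h3 h S'' by (rule S'')
  obtain v t where vq: "vq = (v, t)" by (cases vq)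
  have "S u3 xs (v, t) u2 = c * S' u3 xs (v, t) u2 + d * S'' u3 xs (v, t) u2"
  proof (induction "length xs" arbitrary: xs u3 v u2)
    case 0
    then show ?case
      using base S.S_off[of "[]"] S'.S_off[of "[]"] S''.S_off[of "[]"] by (cases "t = 0") (auto simp: config_def)
  next
    case (Suc n)
    obtain a s ys where xs: "xs = (a, s) # ys" using Suc(2) by (cases xs) auto
    have IH: "S u3 zs (v, t) u2 = c * S' u3 zs (v, t) u2 + d * S'' u3 zs (v, t) u2" if "length zs = length ys" for zs u3 v u2
      using Suc that xs by auto
    show ?case
    proof (cases "config T (s # map snd ys) t")
      case False
      then show ?thesis using xs S.S_off[of xs] S'.S_off[of xs] S''.S_off[of xs] by simp
    next
      case cf: True
      show ?thesis
        unfolding xs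
      proof (induction a rule: hom_induct)
        case (1 k r a)
        obtain N where N: "\<forall>i\<ge>N. act M a (int i) v = 0" "\<forall>b\<in>fst ` set ys. \<forall>i\<ge>N. mode V a (int i) b = 0"
          using S.common_bound[of a v "map fst ys"] by auto
        show ?case
          unfolding S.recursion[OF 1 cf] S'.recursion[OF 1 cf] S''.recursion[OF 1 cf]
            S.recursion_sum_finite[OF N] S'.recursion_sum_finite[OF N] S''.recursion_sum_finite[OF N]
          by (simp add: IH sum.distrib sum_distrib_left algebra_simps)
      next
        case (2 a b)
        then show ?case
          by (simp add: clinear_add[OF S.S_linear_first] clinear_add[OF S'.S_linear_first]
              clinear_add[OF S''.S_linear_first] algebra_simps)
      qed
    qed
  qed
  then show ?thesis by (simp add: vq)
qed

end

section \<open>From a block at the point 1 to invariance without insertions\<close>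

lemma (in wmod) smear_shifted_fps:
  "smear A (fps_to_fls F * fls_X_intpow (- int j)) a w = Sum_any (\<lambda>i. (F $ i) *\<^sub>C A a (int i - int j) w)"
proof -
  obtain N where N: "\<And>n. n \<ge> N \<Longrightarrow> A a n w = 0" using truncation[of a w] by blast
  define N' where "N' = nat (N + int j)"
  have L: "(fps_to_fls F * fls_X_intpow (- int j)) $$ n = fps_to_fls F $$ (n + int j)" for n
    by (simp only: fls_X_intpow_times_conv_shift) simp
  have "smear A (fps_to_fls F * fls_X_intpow (- int j)) a w =
      (\<Sum>n\<in>(\<lambda>i. int i - int j) ` {..<N'}. (fps_to_fls F $$ (n + int j)) *\<^sub>C A a n w)"
    unfolding smear_def L
  proof (rule Sum_any_superset)
    fix n assume n: "n \<notin> (\<lambda>i. int i - int j) ` {..<N'}"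
    show "(fps_to_fls F $$ (n + int j)) *\<^sub>C A a n w = 0"
    proof (cases "n + int j < 0")
      case False
      then have e: "n = int (nat (n + int j)) - int j" by simp
      have "nat (n + int j) \<ge> N'"
      proof (rule ccontr)
        assume "\<not> nat (n + int j) \<ge> N'"
        then have "nat (n + int j) \<in> {..<N'}" by simp
        then show False using n imageI e by metis
      qed
      then have "n \<ge> N" using False unfolding N'_def by linarith
      then show ?thesis using N by (simp add: complex_vs.scale_zero_right)
    qed (simp add: complex_vs.scale_zero_left)
  qed simp
  also have "\<dots> = (\<Sum>i<N'. (F $ i) *\<^sub>C A a (int i - int j) w)"
    by (subst sum.reindex) (auto simp: inj_on_def)
  also have "\<dots> = Sum_any (\<lambda>i. (F $ i) *\<^sub>C A a (int i - int j) w)"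
  proof (rule Sum_any_superset[symmetric])
    fix i assume "i \<notin> {..<N'}"
    then have "int i - int j \<ge> N" unfolding N'_def by auto
    then show "(F $ i) *\<^sub>C A a (int i - int j) w = 0" using N by (simp add: complex_vs.scale_zero_right)
  qed simp
  finally show ?thesis .
qed

context twisted_datum
begin

text \<open>The action on $M^1$ of $a\otimes z^{K/T}(z-1)^{-j}dz$ at $z=1$.\<close>

definition unit_action :: "int \<Rightarrow> nat \<Rightarrow> 'v \<Rightarrow> 'm \<Rightarrow> 'm" where
  "unit_action K j a v = Sum_any (\<lambda>i::nat. ((of_int K / of_nat T) gchoose i) *\<^sub>C act M a (int i - int j) v)"

lemma act_shift_bound: "\<exists>N. \<forall>i\<ge>N. act M a (int i - int j) v = 0"
proof -
  obtain N where N: "\<And>n. n \<ge> N \<Longrightarrow> act M a n v = 0" using MM.truncation by blast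
  show ?thesis by (rule exI[of _ "nat (N + int j)"]) (use N in \<open>auto simp: nat_le_iff\<close>)
qed

lemma transport_graded: "trilinear \<phi> \<Longrightarrow> v \<in> mgrade M d \<Longrightarrow>
    transport T M \<phi> t u3 v u2 = (t ^ T) powi (- int d) * \<phi> u3 v u2"
proof -
  assume \<phi>: "trilinear \<phi>" and v: "v \<in> mgrade M d"
  have "Sum_any (\<lambda>e. ((t ^ T) powi (- int e)) *\<^sub>C component (mgrade M) v e) = (t ^ T) powi (- int d) *\<^sub>C v"
    unfolding component_homogeneous[OF mgrading v]
    by (subst Sum_any_superset[of "{d}"]) (auto simp: complex_vs.scale_zero_right)
  moreover have "clinear (\<lambda>v. \<phi> u3 v u2)" using \<phi> by (simp add: trilinear_def)
  from clinear_scale[OF this]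
  have "\<phi> u3 (c *\<^sub>C v) u2 = c * \<phi> u3 v u2" for c by (simp add: scaleC_complex_def)
  ultimately show ?thesis by (simp add: transport_def)
qed

text \<open>Conjugation by w^(-L_0) moves the action at t to the one at 1. The i-th coefficient of
  the kernel carries t^(K - Ti), and the degree of a_(i-j)v contributes a power of t which
  compensates the dependence on i, so a single power can be taken out.\<close>

lemma transport_smear:
  assumes \<phi>: "trilinear \<phi>" and t: "t \<noteq> 0" and a: "a \<in> grade V k" and v: "v \<in> mgrade M d"
    and K: "K = int T * (int k - 1) + int r"
  shows "transport T M \<phi> t u3 (smear (act M) (expansion T t (kernel T K t j)) a v) u2 =
    t powi (int r - int T * (int j + int d)) * \<phi> u3 (unit_action K j a v) u2"
proof -
  define D where "D x = Sum_any (\<lambda>e. ((t ^ T) powi (- int e)) *\<^sub>C component (mgrade M) x e)" for x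
  have D: "clinear D" unfolding D_def by (rule transport_linear)
  have Dgr: "D x = (t ^ T) powi (- int e) *\<^sub>C x" if "x \<in> mgrade M e" for x e
    unfolding D_def component_homogeneous[OF mgrading that]
    by (subst Sum_any_superset[of "{e}"]) (auto simp: complex_vs.scale_zero_right)
  have \<phi>v: "clinear (\<lambda>v. \<phi> u3 v u2)" using \<phi> by (simp add: trilinear_def)
  obtain N where N: "\<And>i. i \<ge> N \<Longrightarrow> act M a (int i - int j) v = 0" using act_shift_bound by blast
  let ?c = "\<lambda>i. (of_int K / of_nat T :: complex) gchoose i"
  let ?E = "int r - int T * (int j + int d)"
  have "smear (act M) (expansion T t (kernel T K t j)) a v =
      Sum_any (\<lambda>i. (power_fps T K t $ i) *\<^sub>C act M a (int i - int j) v)"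
    unfolding expansion_eq[OF expands_kernel_at[OF T t refl]] by (rule MM.smear_shifted_fps)
  also have "\<dots> = (\<Sum>i<N. (power_fps T K t $ i) *\<^sub>C act M a (int i - int j) v)"
    by (rule Sum_any_superset) (use N in \<open>auto simp: complex_vs.scale_zero_right\<close>)
  finally have "D (smear (act M) (expansion T t (kernel T K t j)) a v) =
      (\<Sum>i<N. (power_fps T K t $ i) *\<^sub>C D (act M a (int i - int j) v))"
    by (simp add: clinear_sum[OF D] clinear_scale[OF D])
  also have "\<dots> = (\<Sum>i<N. (t powi ?E) *\<^sub>C ?c i *\<^sub>C act M a (int i - int j) v)"
  proof (intro sum.cong refl)
    fix i
    define e where "e = int k - (int i - int j) - 1 + int d"
    have deg: "in_degree (mgrade M) e (act M a (int i - int j) v)"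
      using adm a v unfolding admissible_module_def e_def by blast
    show "(power_fps T K t $ i) *\<^sub>C D (act M a (int i - int j) v) = (t powi ?E) *\<^sub>C ?c i *\<^sub>C act M a (int i - int j) v"
    proof (cases "e < 0")
      case True
      then show ?thesis using deg by (simp add: in_degree_def clinear_0[OF D] complex_vs.scale_zero_right)
    next
      case False
      then have "D (act M a (int i - int j) v) = (t ^ T) powi (- e) *\<^sub>C act M a (int i - int j) v"
        using Dgr[of _ "nat e"] deg by (simp add: in_degree_def)
      moreover have "t powi (K - int T * int i) * (t ^ T) powi (- e) = t powi ?E"
      proof -
        have "(t ^ T) powi (- e) = t powi (int T * (- e))" using power_int_mult[of t "int T" "- e"] by simp
        then have "t powi (K - int T * int i) * (t ^ T) powi (- e) = t powi (K - int T * int i + int T * (- e))"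
          by (subst power_int_add) (use t in auto)
        also have "K - int T * int i + int T * (- e) = ?E" by (simp add: K e_def algebra_simps)
        finally show ?thesis .
      qed
      ultimately show ?thesis by (simp add: power_fps_def scaleC_scaleC mult_ac)
    qed
  qed
  also have "\<dots> = (t powi ?E) *\<^sub>C unit_action K j a v"
    unfolding unit_action_def sum_scaleC_right[symmetric]
    by (subst Sum_any_superset[of "{..<N}"]) (use N in \<open>auto simp: complex_vs.scale_zero_right\<close>)
  finally show ?thesis
    unfolding transport_def D_def by (simp add: clinear_scale[OF \<phi>v] scaleC_complex_def)
qed

lemma block_trilinear: "\<phi> \<in> blocks V g T M U3 U2 one \<Longrightarrow> trilinear \<phi>"
  by (simp add: blocks_def)

text \<open>The block condition for the exponent m = wt a - 1. All integral powers of z at the point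
  1 are 1, so its coordinate enters only through \<open>one ^ r\<close>, and the two equalities of
  exponents become j = 0 and r = 0.\<close>

lemma block_equation:
  assumes \<phi>: "\<phi> \<in> blocks V g T M U3 U2 one" and one: "one ^ T = 1"
    and a: "r < T" "a \<in> grade V k \<inter> eigensp g T r" and j: "j \<ge> 1 \<or> r = 0"
  shows "one ^ r * \<phi> u3 (unit_action (int T * (int k - 1) + int r) j a v) u2 =
    (if j = 0 then \<phi> (U3 u3 (cls a)) v u2 else 0) - (- 1) powi (- int j) * \<phi> u3 v (U2 (cls a) u2)"
proof -
  let ?K = "int T * (int k - 1) + int r"
  have tri: "clinear (\<lambda>u3. \<phi> u3 v u2)" "clinear (\<lambda>v. \<phi> u3 v u2)" "clinear (\<lambda>u2. \<phi> u3 v u2)" for u3 v u2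
    using block_trilinear[OF \<phi>] by (simp_all add: trilinear_def)
  have rT: "real r / real T < 1" "0 \<le> real r / real T" using a(1) by simp_all
  have T0: "real T > 0" using T by simp
  have c1: "real r / real T + real_of_int (int k - 1) - real j = real k - 1 \<longleftrightarrow> j = 0"
  proof -
    have "real r / real T = real j \<longleftrightarrow> j = 0"
    proof
      assume "real r / real T = real j" then have "real j < 1" using rT by simp then show "j = 0" by simp
    next
      assume "j = 0" then show "real r / real T = real j" using j by simp
    qed
    then show ?thesis by auto
  qed
  have c2: "real r / real T + real_of_int (int k - 1) = real k - 1 \<longleftrightarrow> r = 0" using T0 by auto
  have le: "real r / real T + real_of_int (int k - 1) - real j \<le> real k - 1"
    using j rT by (cases "j = 0") auto
  have "r < T \<and> real r / real T + real_of_int (int k - 1) - real j \<le> real k - 1 \<and>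
      real k - 1 \<le> real r / real T + real_of_int (int k - 1)"
    using a le rT by simp
  with \<phi> a(2) have "\<phi> (if real r / real T + real_of_int (int k - 1) - real j = real k - 1
         then - U3 u3 (cls a) else 0) v u2
      + \<phi> u3 (Sum_any (\<lambda>i::nat.
          (((of_nat r / of_nat T + of_int (int k - 1)) gchoose i) * one powi (int r + int T * (int k - 1 - int i))) *\<^sub>C
          act M a (int i - int j) v)) u2
      + \<phi> u3 v (if real r / real T + real_of_int (int k - 1) = real k - 1
         then ((- (one ^ T)) powi (- int j)) *\<^sub>C U2 (cls a) u2 else 0) = 0"
    unfolding blocks_def by blast
  moreover have "Sum_any (\<lambda>i::nat.
          (((of_nat r / of_nat T + of_int (int k - 1)) gchoose i) * one powi (int r + int T * (int k - 1 - int i))) *\<^sub>C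
          act M a (int i - int j) v) = one ^ r *\<^sub>C unit_action ?K j a v"
  proof -
    have one0: "one \<noteq> 0" using one T by (metis power_0_left zero_neq_one neq0_conv)
    have p: "one powi (int r + int T * m) = one ^ r" for m
    proof -
      have "one powi (int T * m) = 1" by (simp only: power_int_mult power_int_of_nat one power_int_1_left)
      then show ?thesis using one0 by (simp add: power_int_add)
    qed
    have q: "of_nat r / of_nat T + of_int (int k - 1) = (of_int ?K / of_nat T :: complex)"
      using T by (simp add: field_simps)
    obtain N where N: "\<And>i. i \<ge> N \<Longrightarrow> act M a (int i - int j) v = 0" using act_shift_bound by blast
    show ?thesis
      unfolding unit_action_def p q
      by (subst (1 2) Sum_any_superset[of "{..<N}"])
         (use N in \<open>auto simp: complex_vs.scale_zero_right sum_scaleC_right scaleC_scaleC mult.commute\<close>)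
  qed
  ultimately have eq: "\<phi> (if j = 0 then - U3 u3 (cls a) else 0) v u2 + one ^ r * \<phi> u3 (unit_action ?K j a v) u2
      + \<phi> u3 v (if r = 0 then ((- 1) powi (- int j)) *\<^sub>C U2 (cls a) u2 else 0) = 0"
    unfolding c1 c2 one by (simp add: clinear_scale[OF tri(2)] scaleC_complex_def)
  show ?thesis
  proof (cases "r = 0")
    case True
    have "B = A - C" if "- A + B + C = 0" for A B C :: complex
      using that by (metis add.commute add_eq_0_iff add_uminus_conv_diff minus_add_cancel)
    moreover have "- (if j = 0 then \<phi> (U3 u3 (cls a)) v u2 else 0) + one ^ r * \<phi> u3 (unit_action ?K j a v) u2
      + (- 1) powi (- int j) * \<phi> u3 v (U2 (cls a) u2) = 0"
      using eq True
      by (cases "j = 0") (simp_all add: clinear_minus[OF tri(1)] clinear_0[OF tri(1)] clinear_scale[OF tri(3)] scaleC_complex_def)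
    ultimately show ?thesis by blast
  next
    case False
    then show ?thesis using eq j
      by (simp add: twisted_acts_zero[OF a(1) False a(2)] clinear_0[OF tri(1)] clinear_0[OF tri(3)])
  qed
qed

text \<open>By homogeneity, the block sum at t on a vector of degree d is a power of t times the
  block condition at the point 1; for nonzero r all boundary terms vanish and the module term alone
  is zero.\<close>

lemma block_system_correlation_of:
  assumes \<phi>: "\<phi> \<in> blocks V g T M U3 U2 one" and one: "one ^ T = 1"
  shows "block_system V g T M U2 U3 h1 h2 h3 h (correlation_of \<phi>)"
proof -
  note tri = block_trilinear[OF \<phi>]
  interpret recursive_system V g T M U2 U3 h1 h2 h3 h "correlation_of \<phi>"
    by (rule recursive_system_correlation_of[OF tri])
  show ?thesis
  proof unfold_locales
    show "cor_monomial T M (correlation_of \<phi>)"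
      unfolding cor_monomial_def
      by (auto simp: correlation_of_Nil transport_graded[OF tri] mult.commute)
    show "invariant 0"
      unfolding invariant_def
    proof (intro allI impI, elim conjE)
      fix xs :: "('v \<times> complex) list" and k r j :: nat and b p u3 v t u2
      assume "length xs = 0" and cf: "config T (map snd xs) t" and b: "r < T" "b \<in> grade V k \<inter> eigensp g T r"
        and "p \<in> set (pts xs t)" and j: "1 \<le> j \<or> r = 0"
      then have xs: "xs = []" and p: "p = t" and t: "t \<noteq> 0" by (auto simp: config_def)
      let ?K = "int T * (int k - 1) + int r"
      show "block_sum b k r p j u3 xs v t u2 = 0"
        unfolding xs p
      proof (induction v rule: graded_induct[OF mgrading])
        case (1 d v)
        let ?X = "\<phi> u3 (unit_action ?K j b v) u2"
        have one0: "one \<noteq> 0" using one T by (metis power_0_left zero_neq_one neq0_conv)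
        have "block_sum b k r t j u3 [] v t u2 =
          (if j = 0 then - 1 else 0) * ((t ^ T) powi (- int d) * \<phi> (U3 u3 (cls b)) v u2)
          + t powi (int r - int T * (int j + int d)) * ?X
          + (- (t ^ T)) powi (- int j) * ((t ^ T) powi (- int d) * \<phi> u3 v (U2 (cls b) u2))"
          using t transport_smear[OF tri t _ 1 refl, of b k u3 r j u2] b(2)
          by (simp add: block_sum_def J_def correlation_of_Nil transport_graded[OF tri 1])
        also have "\<dots> = 0"
        proof (cases "r = 0")
          case True
          have p1: "t powi (int r - int T * (int j + int d)) = (t ^ T) powi (- int j) * (t ^ T) powi (- int d)"
          proof -
            have "(t ^ T) powi (- int j) * (t ^ T) powi (- int d) = (t ^ T) powi (- int j + - int d)"
              using t by (subst power_int_add) auto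
            also have "\<dots> = t powi (int T * (- int j + - int d))"
              using power_int_mult[of t "int T" "- int j + - int d"] by simp
            also have "int T * (- int j + - int d) = int r - int T * (int j + int d)"
              using True by (simp add: algebra_simps)
            finally show ?thesis ..
          qed
          have p2: "(- (t ^ T)) powi (- int j) = (- 1) powi (- int j) * (t ^ T) powi (- int j)"
            using power_int_mult_distrib[of "- 1" "t ^ T" "- int j"] by simp
          have X: "?X = (if j = 0 then \<phi> (U3 u3 (cls b)) v u2 else 0) - (- 1) powi (- int j) * \<phi> u3 v (U2 (cls b) u2)"
            using block_equation[OF \<phi> one b j, of u3 v u2] True by simp
          show ?thesis unfolding p1 p2 X by (simp add: algebra_simps)
        next
          case False
          note z = twisted_acts_zero[OF b(1) False b(2)]
          have tr: "clinear (\<lambda>u3. \<phi> u3 v u2)" "clinear (\<lambda>u2. \<phi> u3 v u2)" for u3 v u2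
            using tri by (simp_all add: trilinear_def)
          have "one ^ r * ?X = 0"
            using block_equation[OF \<phi> one b j, of u3 v u2] False by (simp add: z clinear_0[OF tr(1)] clinear_0[OF tr(2)])
          then show ?thesis using one0 by (simp add: z clinear_0[OF tr(1)] clinear_0[OF tr(2)])
        qed
        finally show ?case .
      next
        case (2 v w)
        then show ?case by (simp add: block_sum_def clinear_add[OF J_linear_v])
      qed
    qed
  qed
qed

end

section \<open>Blocks with additional insertions\<close>

context block_system
begin

definition extension :: "complex list \<Rightarrow> complex \<Rightarrow> 'u3 \<Rightarrow> 'v list \<Rightarrow> 'm \<Rightarrow> 'u2 \<Rightarrow> complex" where
  "extension ss t u3 as v u2 = (if length as = length ss then S u3 (zip as ss) (v, t) u2 else 0)"

text \<open>The condition on an extended block is the vanishing of J for the test function with its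
  true coefficients at 0 and infinity.\<close>

lemma extension_in_ext_blocks:
  assumes cf: "config T ss t"
  shows "extension ss t \<in> ext_blocks V g T M U3 U2 ss t"
  unfolding ext_blocks_def
proof (intro CollectI conjI allI ballI impI)
  show "block_multilinear (length ss) (extension ss t)"
    unfolding block_multilinear_def
  proof (intro conjI allI impI)
    show "trilinear (\<lambda>u3. extension ss t u3 as)" for as
      by (cases "length as = length ss") (simp_all add: trilinear_def extension_def S_linear clinear_zero)
  next
    fix u3 and as bs :: "'v list" and v u2 assume len: "length as + length bs + 1 = length ss"
    then have "drop (length as) ss = ss ! length as # drop (Suc (length as)) ss"
      by (simp add: Cons_nth_drop_Suc)
    then have "zip (as @ a # bs) ss = zip as (take (length as) ss) @ (a, ss ! length as) # zip bs (drop (Suc (length as)) ss)" for a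
      by (simp add: zip_append1)
    then show "clinear (\<lambda>a. extension ss t u3 (as @ a # bs) v u2)"
      using len by (simp add: extension_def S_linear_mid)
  next
    fix u3 and as :: "'v list" and v u2 assume "length as \<noteq> length ss"
    then show "extension ss t u3 as v u2 = 0" by (simp add: extension_def)
  qed
next
  fix r k a f u3 v u2 and as :: "'v list"
  assume a: "a \<in> grade V k \<inter> eigensp g T r" and f: "f \<in> constrained_functions T (insert t (set ss)) r k"
    and "r < T \<and> length as = length ss"
  then have r: "r < T" and len: "length as = length ss" by simp_all
  let ?xs = "zip as ss"
  have snd_xs: "map snd ?xs = ss" and len_xs: "length ?xs = length ss" using len by simp_all
  have set_xs: "snd ` set ?xs = set ss" using arg_cong[OF snd_xs, of set] by simp
  have fc: "f \<in> curve_functions T (insert t (set ss))" using f by (simp add: constrained_functions_def)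
  have coeff: "coeff_at T f p n = expansion T p f $$ n" if "p \<noteq> 0" for p n
    by (rule coeff_at_expands[OF T that expands_expansion[OF T that fc]])
  have nz: "t \<noteq> 0" "ss ! i \<noteq> 0" if "i < length ss" for i
    using config_nonzero[OF cf] that by auto
  have "extension ss t u3 (as[i := Sum_any (\<lambda>n. coeff_at T f (ss ! i) n *\<^sub>C mode V a n (as ! i))]) v u2 =
    S u3 (?xs[i := (smear (mode V) (expansion T (snd (?xs ! i)) f) a (fst (?xs ! i)), snd (?xs ! i))]) (v, t) u2"
    if i: "i < length ss" for i
  proof -
    have "zip (as[i := x]) ss = ?xs[i := (x, ss ! i)]" for x
      using zip_update[of as i x ss "ss ! i"] by simp
    then show ?thesis
      using i len nz[OF i] by (simp add: extension_def smear_def coeff)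
  qed
  moreover have "extension ss t u3 as (Sum_any (\<lambda>n. coeff_at T f t n *\<^sub>C act M a n v)) u2 =
    S u3 ?xs (smear (act M) (expansion T t f) a v, t) u2"
    using config_nonzero(1)[OF cf] len by (simp add: extension_def smear_def coeff)
  moreover have "extension ss t (- (coeff_infinity T f (int k - 1) *\<^sub>C U3 u3 (cls a))) as v u2 =
    - coeff_infinity T f (int k - 1) * S (U3 u3 (cls a)) ?xs (v, t) u2"
    using len by (simp add: extension_def clinear_minus[OF S_linear(1)] clinear_scale[OF S_linear(1)] scaleC_complex_def)
  moreover have "extension ss t u3 as v (coeff_zero T f (int k - 1) *\<^sub>C U2 (cls a) u2) =
    coeff_zero T f (int k - 1) * S u3 ?xs (v, t) (U2 (cls a) u2)"
    using len by (simp add: extension_def clinear_scale[OF S_linear(3)] scaleC_complex_def)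
  moreover have "J a f (- coeff_infinity T f (int k - 1)) (coeff_zero T f (int k - 1)) u3 ?xs v t u2 = 0"
    by (rule J_constrained[OF invariant _ r a]) (simp_all only: snd_xs set_xs cf f)
  ultimately show "extension ss t (- (coeff_infinity T f (int k - 1) *\<^sub>C U3 u3 (cls a))) as v u2
      + (\<Sum>i<length ss. extension ss t u3
          (as[i := Sum_any (\<lambda>n. coeff_at T f (ss ! i) n *\<^sub>C mode V a n (as ! i))]) v u2)
      + extension ss t u3 as (Sum_any (\<lambda>n. coeff_at T f t n *\<^sub>C act M a n v)) u2
      + extension ss t u3 as v (coeff_zero T f (int k - 1) *\<^sub>C U2 (cls a) u2) = 0"
    unfolding J_def len_xs by simp
qed

lemma extension_vacuum:
  assumes "config T ss t"
  shows "extension ss t u3 (replicate (length ss) (vac V)) v u2 = S u3 [] (v, t) u2"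
proof -
  have "S u3 (zip (replicate (length ss) (vac V)) ss) (v, t) u2 = S u3 [] (v, t) u2"
    using assms
  proof (induction ss)
    case (Cons s ss)
    then show ?case
      using vacuum_first[of s "zip (replicate (length ss) (vac V)) ss" t u3 v u2] by (simp add: config_Cons)
  qed simp
  then show ?thesis by (simp add: extension_def)
qed

end

context twisted_datum
begin

text \<open>Testing against $a\otimes z^{K/T}(z-z_m)^{-1}dz$ replaces a vacuum at $p_m$ by $a$, modulo
  terms with vacua at $p_m$ and all later points.\<close>

lemma ext_blocks_determined:
  assumes \<psi>: "\<psi> \<in> ext_blocks V g T M U3 U2 ss t" and \<psi>': "\<psi>' \<in> ext_blocks V g T M U3 U2 ss t"
    and cf: "config T ss t"
    and vac: "\<And>u3 v u2. \<psi> u3 (replicate (length ss) (vac V)) v u2 = \<psi>' u3 (replicate (length ss) (vac V)) v u2"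
  shows "\<psi> = \<psi>'"
proof -
  let ?n = "length ss"
  have step: "\<psi> u3 (as @ replicate (?n - m) (vac V)) v u2 = \<psi>' u3 (as @ replicate (?n - m) (vac V)) v u2"
    if "m \<le> ?n" "length as = m" for m as u3 v u2
    using that
  proof (induction m arbitrary: as u3 v u2)
    case 0
    then show ?case using vac by simp
  next
    case (Suc m)
    then obtain bs b where as: "as = bs @ [b]" and bs: "length bs = m" by (metis length_Suc_conv_rev)
    define cs where "cs = replicate (?n - Suc m) (vac V)"
    have m: "m < ?n" using Suc by simp
    then have rep: "replicate (?n - m) (vac V) = vac V # cs"
      unfolding cs_def by (metis Suc_diff_Suc replicate_Suc)
    have IH: "\<psi> u3 (ds @ vac V # cs) v u2 = \<psi>' u3 (ds @ vac V # cs) v u2" if "length ds = m" for ds u3 v u2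
      using Suc.IH[of ds u3 v u2] that m rep by simp
    have lin: "clinear (\<lambda>a. \<chi> u3 (ds @ a # es) v u2)"
      if "\<chi> \<in> {\<psi>, \<psi>'}" "length ds + length es + 1 = ?n" for \<chi> u3 ds es v u2
      using that \<psi> \<psi>' by (auto simp: ext_blocks_def block_multilinear_def)
    have len_cs: "length bs + length cs + 1 = ?n" using bs m by (simp add: cs_def)
    have "\<psi> u3 (bs @ b # cs) v u2 = \<psi>' u3 (bs @ b # cs) v u2"
    proof (induction b rule: hom_induct)
      case (1 k r a)
      let ?K = "int T * (int k - 1) + int r"
      let ?p = "ss ! m"
      let ?f = "kernel T ?K ?p 1"
      let ?L = "bs @ vac V # cs"
      have ss0: "ss ! i \<noteq> 0" if "i < ?n" for i using config_nonzero(2)[OF cf] that by simp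
      have p0: "?p \<noteq> 0" by (rule ss0[OF m])
      have len: "length ?L = ?n" using len_cs by simp
      define X where "X i = Sum_any (\<lambda>n. coeff_at T ?f (ss ! i) n *\<^sub>C mode V a n (?L ! i))" for i
      have "?p \<in> insert t (set ss)" using m by simp
      moreover have "?K = int r + int T * (int k - 1)" by simp
      ultimately have f: "?f \<in> constrained_functions T (insert t (set ss)) r k"
        by (rule kernel_constrained[OF T 1(1) _ p0]) (use 1(1) in auto)
      have fc: "?f \<in> curve_functions T {?p}" by (rule kernel_in_curve_functions) simp
      have inv: "\<chi> (- (coeff_infinity T ?f (int k - 1) *\<^sub>C U3 u3 (cls a))) ?L v u2
        + (\<Sum>i<?n. \<chi> u3 (?L[i := X i]) v u2)
        + \<chi> u3 ?L (Sum_any (\<lambda>n. coeff_at T ?f t n *\<^sub>C act M a n v)) u2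
        + \<chi> u3 ?L v (coeff_zero T ?f (int k - 1) *\<^sub>C U2 (cls a) u2) = 0"
        if "\<chi> \<in> {\<psi>, \<psi>'}" for \<chi>
        using that \<psi> \<psi>' 1 f len unfolding ext_blocks_def X_def by blast
      have creation: "mode V a (-1) (vac V) = a" "\<And>n. n \<ge> 0 \<Longrightarrow> mode V a n (vac V) = 0"
        using voa_creation[OF voa] by auto
      \<comment> \<open>The test function has a simple pole at p_m with leading coefficient
        z_m^(K/T), and the vacuum is annihilated by all nonnegative modes, so only the mode -1
        contributes, and it creates a.\<close>
      have Xm: "X m = ?p powi ?K *\<^sub>C a"
      proof -
        have "coeff_at T ?f ?p n = fps_to_fls (power_fps T ?K ?p) $$ (n + 1)" for n
          using coeff_at_expands[OF T p0 expands_kernel_at[OF T p0 refl]]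
          by (simp only: fls_X_intpow_times_conv_shift) simp
        then have "X m = Sum_any (\<lambda>n. (fps_to_fls (power_fps T ?K ?p) $$ (n + 1)) *\<^sub>C mode V a n (vac V))"
          using bs by (simp add: X_def nth_append)
        also have "\<dots> = (\<Sum>n\<in>{-1}. (fps_to_fls (power_fps T ?K ?p) $$ (n + 1)) *\<^sub>C mode V a n (vac V))"
        proof (rule Sum_any_superset)
          fix n :: int assume "n \<notin> {-1}"
          then consider "n < -1" | "n \<ge> 0" by fastforce
          then show "(fps_to_fls (power_fps T ?K ?p) $$ (n + 1)) *\<^sub>C mode V a n (vac V) = 0"
            by cases (simp_all add: creation complex_vs.scale_zero_left complex_vs.scale_zero_right)
        qed simp
        finally show ?thesis by (simp add: creation power_fps_0_nth)
      qed
      have Xi: "X i = 0" if i: "i < ?n" "i > m" for i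
      proof -
        have "?L ! i = vac V" using i bs by (simp add: nth_append cs_def nth_Cons split: nat.split)
        moreover have "(ss ! m) ^ T \<noteq> (ss ! i) ^ T"
        proof -
          have "distinct (map (\<lambda>s. s ^ T) ss)" using cf by (simp add: config_def)
          then show ?thesis using i m nth_eq_iff_index_eq[of "map (\<lambda>s. s ^ T) ss" m i] by simp
        qed
        then have "coeff_at T ?f (ss ! i) n = 0" if "n < 0" for n
          using coeff_at_expands[OF T ss0[OF i(1)] expands_kernel_away[OF T ss0[OF i(1)]], of ?p ?K 1 n] that by simp
        ultimately have "coeff_at T ?f (ss ! i) n *\<^sub>C mode V a n (?L ! i) = 0" for n
          by (cases "n < 0") (simp_all add: creation complex_vs.scale_zero_left complex_vs.scale_zero_right)
        then have "X i = (\<Sum>n\<in>{}. coeff_at T ?f (ss ! i) n *\<^sub>C mode V a n (?L ! i))"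
          unfolding X_def by (intro Sum_any_superset) simp_all
        then show ?thesis by simp
      qed
      \<comment> \<open>For i < m the vacuum at p_m is still in place and the induction hypothesis
        applies; for i > m the test function is regular at a vacuum, so the entry is zero.\<close>
      have other: "\<psi> u3 (?L[i := X i]) v u2 = \<psi>' u3 (?L[i := X i]) v u2" if i: "i < ?n" "i \<noteq> m" for i
      proof (cases "i < m")
        case True
        then show ?thesis using IH[of "bs[i := X i]" u3 v u2] bs by (simp add: list_update_append)
      next
        case False
        then have im: "i > m" using i by simp
        have "?L[i := 0] = take i ?L @ 0 # drop (Suc i) ?L"
          using i len by (simp add: upd_conv_take_nth_drop)
        moreover have "length (take i ?L) + length (drop (Suc i) ?L) + 1 = ?n" using i len by auto
        ultimately have z: "\<chi> u3 (?L[i := 0]) v u2 = 0" if "\<chi> \<in> {\<psi>, \<psi>'}" for \<chi>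
          using clinear_0[OF lin[OF that]] by metis
        show ?thesis by (simp add: Xi[OF i(1) im] z[of \<psi>] z[of \<psi>'])
      qed
      have split: "(\<Sum>i<?n. \<chi> u3 (?L[i := X i]) v u2) =
         ?p powi ?K * \<chi> u3 (bs @ a # cs) v u2 + (\<Sum>i\<in>{..<?n} - {m}. \<chi> u3 (?L[i := X i]) v u2)"
        if "\<chi> \<in> {\<psi>, \<psi>'}" for \<chi>
      proof -
        have "?L[m := X m] = bs @ (?p powi ?K *\<^sub>C a) # cs" using bs by (simp add: Xm list_update_append)
        then have "\<chi> u3 (?L[m := X m]) v u2 = ?p powi ?K * \<chi> u3 (bs @ a # cs) v u2"
          using clinear_scale[OF lin[OF that len_cs]] by (simp add: scaleC_complex_def)
        then show ?thesis using m by (subst sum.remove[of _ m]) auto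
      qed
      have rest: "(\<Sum>i\<in>{..<?n} - {m}. \<psi> u3 (?L[i := X i]) v u2) = (\<Sum>i\<in>{..<?n} - {m}. \<psi>' u3 (?L[i := X i]) v u2)"
        by (intro sum.cong refl other) auto
      have "?p powi ?K * \<psi> u3 (bs @ a # cs) v u2 = ?p powi ?K * \<psi>' u3 (bs @ a # cs) v u2"
      proof -
        have cancel: "x = y" if "A + (x + R) + B + C = 0" "A + (y + R) + B + C = 0" for x y A B C R :: complex
        proof -
          have "x = (A + (x + R) + B + C) - (A + R + B + C)" "y = (A + (y + R) + B + C) - (A + R + B + C)" by simp_all
          then show ?thesis using that by simp
        qed
        have 1: "\<psi> \<in> {\<psi>, \<psi>'}" "\<psi>' \<in> {\<psi>, \<psi>'}" by simp_all
        show ?thesis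
          by (rule cancel[OF inv[OF 1(1), unfolded split[OF 1(1)] IH[OF bs] rest] inv[OF 1(2), unfolded split[OF 1(2)]]])
      qed
      then show ?case using p0 by simp
    next
      case (2 a b)
      then show ?case
        using clinear_add[OF lin[OF _ len_cs, of \<psi>]] clinear_add[OF lin[OF _ len_cs, of \<psi>']] by simp
    qed
    then show ?case by (simp add: as cs_def)
  qed
  have "\<psi> u3 as v u2 = \<psi>' u3 as v u2" for u3 as v u2
  proof (cases "length as = ?n")
    case True
    then show ?thesis using step[of ?n as u3 v u2] by simp
  next
    case False
    then show ?thesis using \<psi> \<psi>' by (simp add: ext_blocks_def block_multilinear_def)
  qed
  then show ?thesis by blast
qed

text \<open>Existence of the extended block comes from the constructed system and uniqueness from
  its determination on vacua; together they evaluate the definite description in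
  \<open>S_map\<close>.\<close>

lemma S_map_eq:
  assumes \<phi>: "\<phi> \<in> blocks V g T M U3 U2 one" and one: "one ^ T = 1"
  shows "S_map V g T M U3 U2 \<phi> = correlation_of \<phi>"
proof (intro ext)
  fix u3 u2 and xs :: "('v \<times> complex) list" and vq :: "'m \<times> complex"
  interpret block_system V g T M U2 U3 h1 h2 h3 h "correlation_of \<phi>"
    by (rule block_system_correlation_of[OF \<phi> one])
  obtain v t where vq: "vq = (v, t)" by (cases vq)
  let ?ss = "map snd xs"
  show "S_map V g T M U3 U2 \<phi> u3 xs vq u2 = correlation_of \<phi> u3 xs vq u2"
  proof (cases "config T ?ss t")
    case False
    then show ?thesis using S_off by (simp add: S_map_def vq)
  next
    case cf: True
    have t: "t \<noteq> 0" by (rule config_nonzero(1)[OF cf])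
    have "(THE \<psi>. \<psi> \<in> ext_blocks V g T M U3 U2 ?ss t \<and>
        (\<forall>u3 v u2. \<psi> u3 (replicate (length ?ss) (vac V)) v u2 = transport T M \<phi> t u3 v u2)) = extension ?ss t"
    proof (rule the_equality, intro conjI allI)
      show "extension ?ss t \<in> ext_blocks V g T M U3 U2 ?ss t" by (rule extension_in_ext_blocks[OF cf])
      show "extension ?ss t u3 (replicate (length ?ss) (vac V)) v u2 = transport T M \<phi> t u3 v u2" for u3 v u2
        using extension_vacuum[OF cf, of u3 v u2] t by (simp add: correlation_of_Nil)
      fix \<psi> assume "\<psi> \<in> ext_blocks V g T M U3 U2 ?ss t \<and>
        (\<forall>u3 v u2. \<psi> u3 (replicate (length ?ss) (vac V)) v u2 = transport T M \<phi> t u3 v u2)"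
      then show "\<psi> = extension ?ss t"
        using extension_vacuum[OF cf] t
        by (intro ext_blocks_determined[OF _ extension_in_ext_blocks[OF cf] cf]) (simp_all add: correlation_of_Nil)
    qed
    then show ?thesis
      using cf by (simp add: S_map_def vq extension_def zip_map_fst_snd)
  qed
qed

end

section \<open>The isomorphism\<close>

context twisted_datum
begin

lemma CorD:
  assumes "S \<in> Cor V g T M U3 U2 h"
  shows "cor_multilinear T S" "cor_rational T S" "cor_monomial T M S" "cor_associative V T M S"
    "cor_recursive V g T M U3 U2 S"
  using assms by (simp_all add: Cor_def)

lemma recursive_system_Cor:
  assumes S: "S \<in> Cor V g T M U3 U2 h"
  shows "recursive_system V g T M U2 U3 h1 h2 h3 h S"
proof -
  interpret multilinear_system V g T M U2 U3 h1 h2 h3 h S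
    by (rule multilinear_system.intro[OF twisted_datum], rule multilinear_system_axioms.intro) (rule CorD(1)[OF S])
  show ?thesis
    by unfold_locales (use CorD(5)[OF S] in \<open>auto simp: cor_recursive_def\<close>)
qed

lemma config_function_1:
  "f \<in> config_functions T 1 \<Longrightarrow> (\<lambda>s. f [s] t) \<in> curve_functions T {t}"
proof (induction rule: config_functions.induct)
  case gf_diff_last
  then show ?case using cf_pole[of t "{t}" T] by simp
qed (auto intro: curve_functions.intros)

text \<open>Rationality provides an expansion at t with one insertion, and associativity identifies
  its coefficients. By the residue criterion this is invariance for pole orders j at least 1. For j
  = 0 the two recursive formulas are subtracted.\<close>

lemma block_system_Cor:
  assumes S: "S \<in> Cor V g T M U3 U2 h"
  shows "block_system V g T M U2 U3 h1 h2 h3 h S"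
proof -
  interpret recursive_system V g T M U2 U3 h1 h2 h3 h S by (rule recursive_system_Cor[OF S])
  have expansion: "expands T t (\<lambda>s. S u3 [(a, s)] (v, t) u2) (matrix_series (act M) (\<lambda>w. S u3 [] (w, t) u2) a v)"
    if t: "t \<noteq> 0" for a u3 v t u2
  proof -
    obtain f where f: "f \<in> config_functions T 1"
      and eq: "\<And>s. config T [s] t \<Longrightarrow> S u3 [(a, s)] (v, t) u2 = f [s] t"
      using CorD(2)[OF S] unfolding cor_rational_def by (metis length_Cons list.size(3) One_nat_def zip_Cons_Cons zip_Nil)
    obtain L where "expands T t (\<lambda>s. f [s] t) L"
      using curve_functions_expands[OF T t config_function_1[OF f]] by blast
    moreover have "S u3 [(a, s)] (v, t) u2 = f [s] t" if "s \<in> punctured T {t}" for s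
      by (rule eq) (use that t in \<open>auto simp: config_def punctured_def\<close>)
    ultimately have L: "expands T t (\<lambda>s. S u3 [(a, s)] (v, t) u2) L"
      using expands_cong[of "{t}" T t "\<lambda>s. S u3 [(a, s)] (v, t) u2" "\<lambda>s. f [s] t" L] T t by simp
    have "config T (map snd ([] :: ('v \<times> complex) list)) t" using t by (simp add: config_def)
    then have "res_dz T (\<lambda>s. S u3 [(a, s)] (v, t) u2 * (s ^ T - t ^ T) powi n) t = S u3 [] (act M a n v, t) u2" for n
      using CorD(4)[OF S] unfolding cor_associative_def by blast
    then have "L = matrix_series (act M) (\<lambda>w. S u3 [] (w, t) u2) a v"
      using res_dz_expands_shift[OF T t L refl]
      by (intro fls_eqI_residue) (simp add: matrix_series_S_nth[OF S_linear(2)])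
    then show ?thesis using L by simp
  qed
  show ?thesis
  proof unfold_locales
    show "cor_monomial T M S" by (rule CorD(3)[OF S])
    show "invariant 0"
      unfolding invariant_def
    proof (intro allI impI, elim conjE)
      fix xs :: "('v \<times> complex) list" and k r j :: nat and b p u3 v t u2
      assume "length xs = 0" and cf: "config T (map snd xs) t" and b: "r < T" "b \<in> grade V k \<inter> eigensp g T r"
        and "p \<in> set (pts xs t)" and j: "1 \<le> j \<or> r = 0"
      then have xs: "xs = []" and p: "p = t" and t: "t \<noteq> 0" by (auto simp: config_def)
      show "block_sum b k r p j u3 xs v t u2 = 0"
      proof (cases "j = 0")
        case False
        have "expands T (pts xs t ! 0) (\<lambda>s. S u3 ((b, s) # xs) (v, t) u2) (slot_series b u3 xs v t u2 0)"
          using expansion[OF t] by (simp add: xs slot_series_def)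
        then show ?thesis
          using associativity_iff[OF b cf, of 0 u3 v u2] False by (simp add: xs p)
      next
        case True
        then have r: "r = 0" using j by simp
        have b0: "b \<in> grade V k \<inter> eigensp g T 0" using b r by simp
        \<comment> \<open>The point 2t serves only as some point that is not in the fibre of
          t.\<close>
        have "norm ((2::complex) ^ T) \<noteq> norm (1::complex)"
          using one_less_power[OF _ T, of "2::real"] by (simp add: norm_power)
        then have "(2::complex) ^ T \<noteq> 1" by metis
        then have "t ^ T \<noteq> 2 ^ T * t ^ T" using t by simp
        then have cf2: "config T (2 * t # map snd xs) t"
          using t by (auto simp: xs config_def power_mult_distrib)
        have "S u3 ((b, 2 * t) # xs) (v, t) u2 = ((2 * t) ^ T) powi (- int k) * S (U3 u3 (cls b)) xs (v, t) u2
            + recursion_sum V T M S (int T * (int k - 1 + int (delta r)) + int r) b (2 * t) u3 xs v t u2"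
          using CorD(5)[OF S] b cf2 unfolding cor_recursive_def by blast
        then show ?thesis
          using right_recursion_defect[OF b0 cf2, of u3 v u2] t by (simp add: r delta_def True xs p)
      qed
    qed
  qed
qed

text \<open>The blocks are tested against all admissible exponents, whereas \<open>invariant\<close>
  speaks of kernels with exponent wt a - 1 + r/T. Invariance under arbitrary constrained functions
  bridges the difference.\<close>

lemma restriction_in_blocks:
  assumes S: "block_system V g T M U2 U3 h1 h2 h3 h S" and one: "one ^ T = 1"
  shows "(\<lambda>u3 v u2. S u3 [] (v, one) u2) \<in> blocks V g T M U3 U2 one"
  unfolding blocks_def
proof (intro CollectI conjI allI ballI impI)
  interpret block_system V g T M U2 U3 h1 h2 h3 h S by (rule S)
  show "trilinear (\<lambda>u3 v u2. S u3 [] (v, one) u2)" by (simp add: trilinear_def S_linear)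
  fix r k n :: nat and m :: int and a u3 v u2
  assume a: "a \<in> grade V k \<inter> eigensp g T r"
    and b: "r < T \<and> real r / real T + real_of_int m - real n \<le> real k - 1 \<and> real k - 1 \<le> real r / real T + real_of_int m"
  then have r: "r < T" by simp
  have one0: "one \<noteq> 0" using one T by (metis power_0_left zero_neq_one neq0_conv)
  then have cf: "config T (map snd ([] :: ('v \<times> complex) list)) one" by (simp add: config_def)
  let ?K = "int r + int T * m"
  let ?f = "kernel T ?K one n"
  have scaled: "real T * (real r / real T + x) = real r + real T * x" for x
    using T by (simp add: algebra_simps)
  have "real T * (real r / real T + (real_of_int m - real n)) \<le> real T * (real k - 1)"
    "real T * (real k - 1) \<le> real T * (real r / real T + real_of_int m)"
    using b by (intro mult_left_mono; simp)+
  then have "real_of_int (?K - int T * int n) \<le> real_of_int (int T * (int k - 1))"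
    "real_of_int (int T * (int k - 1)) \<le> real_of_int ?K"
    unfolding scaled by (simp_all add: algebra_simps)
  then have bounds: "?K - int T * int n \<le> int T * (int k - 1)" "int T * (int k - 1) \<le> ?K"
    by (simp_all only: of_int_le_iff)
  have "?f \<in> constrained_functions T (insert one (snd ` set ([] :: ('v \<times> complex) list))) r k"
    by (rule kernel_constrained[OF T r _ one0 refl bounds]) simp
  from J_constrained[OF invariant cf r a this, of u3 v u2]
  have J0: "J a ?f (- coeff_infinity T ?f (int k - 1)) (coeff_zero T ?f (int k - 1)) u3 [] v one u2 = 0" .
  let ?ci = "if real r / real T + real_of_int m - real n = real k - 1 then 1 else 0 :: complex"
  let ?cz = "if real r / real T + real_of_int m = real k - 1 then (- (one ^ T)) powi (- int n) else 0"
  have J1: "J a ?f (- ?ci) ?cz u3 [] v one u2 = 0"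
  proof (cases "r = 0")
    case True
    have "real_of_int (m - int n) \<le> real_of_int (int k - 1)" "real_of_int (int k - 1) \<le> real_of_int m"
      using b True by simp_all
    then have m: "m - int n \<le> int k - 1" "int k - 1 \<le> m" by (simp_all only: of_int_le_iff)
    have eqs: "real r / real T + real_of_int m - real n = real k - 1 \<longleftrightarrow> m - int n = int k - 1"
      "real r / real T + real_of_int m = real k - 1 \<longleftrightarrow> m = int k - 1"
      using True by auto
    show ?thesis
      using J0 coeff_zero_kernel[OF T one0 m(2), of n] coeff_infinity_kernel[OF T m(1), of one]
      unfolding eqs by (simp add: True)
  next
    case False
    show ?thesis using J0 J_no_coeffs[OF r False a] by metis
  qed
  have smear: "smear (act M) (expansion T one ?f) a v = Sum_any (\<lambda>j::nat.
          (((of_nat r / of_nat T + of_int m) gchoose j) * one powi (int r + int T * (m - int j))) *\<^sub>C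
          act M a (int j - int n) v)"
  proof -
    have "of_int ?K / of_nat T = (of_nat r / of_nat T + of_int m :: complex)" using T by (simp add: field_simps)
    then have "power_fps T ?K one $ j = ((of_nat r / of_nat T + of_int m) gchoose j) * one powi (int r + int T * (m - int j))" for j
      by (simp add: power_fps_def algebra_simps)
    then show ?thesis
      unfolding expansion_eq[OF expands_kernel_at[OF T one0 refl]] by (simp only: MM.smear_shifted_fps)
  qed
  show "S (if real r / real T + real_of_int m - real n = real k - 1 then - U3 u3 (cls a) else 0) [] (v, one) u2
      + S u3 [] (Sum_any (\<lambda>j::nat.
          (((of_nat r / of_nat T + of_int m) gchoose j) * one powi (int r + int T * (m - int j))) *\<^sub>C
          act M a (int j - int n) v), one) u2
      + S u3 [] (v, one) (if real r / real T + real_of_int m = real k - 1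
         then ((- (one ^ T)) powi (- int n)) *\<^sub>C U2 (cls a) u2 else 0) = 0"
    unfolding smear[symmetric]
    using J1 clinear_minus[OF S_linear(1)] clinear_0[OF S_linear(1)] clinear_0[OF S_linear(3)] clinear_scale[OF S_linear(3)]
    by (auto simp: J_def scaleC_complex_def split: if_splits)
qed

lemma transport_one:
  assumes "one ^ T = 1"
  shows "transport T M \<phi> one u3 v u2 = \<phi> u3 v u2"
  using component_Sum_any[OF mgrading, of v] by (simp add: transport_def assms scaleC_one)

text \<open>The monomial property recovers all values without insertions from those at the point 1,
  and the recursion then determines the rest.\<close>

lemma correlation_of_restriction:
  assumes S: "S \<in> Cor V g T M U3 U2 h" and one: "one ^ T = 1"
  shows "correlation_of (\<lambda>u3 v u2. S u3 [] (v, one) u2) = S"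
proof (intro ext)
  fix u3 u2 and xs :: "('v \<times> complex) list" and vq :: "'m \<times> complex"
  let ?\<phi> = "\<lambda>u3 v u2. S u3 [] (v, one) u2"
  interpret block_system V g T M U2 U3 h1 h2 h3 h S by (rule block_system_Cor[OF S])
  have tri: "trilinear ?\<phi>" by (simp add: trilinear_def S_linear)
  have one0: "one \<noteq> 0" using one T by (metis power_0_left zero_neq_one neq0_conv)
  \<comment> \<open>Written as a combination with coefficients 1 and 0, so that uniqueness is an
    instance of the statement on linear combinations.\<close>
  have "correlation_of ?\<phi> u3 [] (v, t) u2 = 1 * S u3 [] (v, t) u2 + 0 * S u3 [] (v, t) u2" if t: "t \<noteq> 0" for u3 v t u2
  proof (induction v rule: graded_induct[OF mgrading])
    case (1 d v)
    then obtain c where c: "\<And>t. t \<noteq> 0 \<Longrightarrow> S u3 [] (v, t) u2 = c * (t ^ T) powi (- int d)"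
      using monomial unfolding cor_monomial_def by blast
    show ?case using c[OF t] c[OF one0] t by (simp add: correlation_of_Nil transport_graded[OF tri 1] one)
  next
    case (2 v w)
    interpret C: multilinear_system V g T M U2 U3 h1 h2 h3 h "correlation_of ?\<phi>"
      by (rule multilinear_system.intro[OF twisted_datum], rule multilinear_system_axioms.intro)
         (rule correlation_of_multilinear[OF tri])
    show ?case using 2 by (simp add: clinear_add[OF C.S_linear(2)] clinear_add[OF S_linear(2)])
  qed
  then have "correlation_of ?\<phi> u3 xs vq u2 = 1 * S u3 xs vq u2 + 0 * S u3 xs vq u2"
    by (rule recursive_system_combination[OF recursive_system_correlation_of[OF tri]
        recursive_system_Cor[OF S] recursive_system_Cor[OF S]])
  then show "correlation_of ?\<phi> u3 xs vq u2 = S u3 xs vq u2" by simp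
qed

lemma trilinear_combination:
  assumes "trilinear \<phi>" "trilinear \<psi>"
  shows "trilinear (\<lambda>u3 v u2. c * \<phi> u3 v u2 + d * \<psi> u3 v u2)"
  using assms unfolding trilinear_def by (auto intro!: clinear_plus clinear_cmult)

lemma correlation_of_combination:
  assumes \<phi>: "trilinear \<phi>" and \<psi>: "trilinear \<psi>"
  shows "correlation_of (\<lambda>u3 v u2. c * \<phi> u3 v u2 + d * \<psi> u3 v u2) u3 xs vq u2 =
    c * correlation_of \<phi> u3 xs vq u2 + d * correlation_of \<psi> u3 xs vq u2"
  by (rule recursive_system_combination[OF recursive_system_correlation_of[OF trilinear_combination[OF \<phi> \<psi>]]
        recursive_system_correlation_of[OF \<phi>] recursive_system_correlation_of[OF \<psi>]])
     (simp add: correlation_of_Nil transport_def)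

lemma blocks_combination:
  assumes \<phi>: "\<phi> \<in> blocks V g T M U3 U2 one" and \<psi>: "\<psi> \<in> blocks V g T M U3 U2 one"
  shows "(\<lambda>u3 v u2. c * \<phi> u3 v u2 + d * \<psi> u3 v u2) \<in> blocks V g T M U3 U2 one"
  unfolding blocks_def
proof (intro CollectI conjI allI ballI impI trilinear_combination block_trilinear[OF \<phi>] block_trilinear[OF \<psi>])
  fix r k n :: nat and m :: int and a u3 v u2
  let ?A = "if real r / real T + real_of_int m - real n = real k - 1 then - U3 u3 (cls a) else 0"
  let ?B = "Sum_any (\<lambda>j::nat.
          (((of_nat r / of_nat T + of_int m) gchoose j) * one powi (int r + int T * (m - int j))) *\<^sub>C
          act M a (int j - int n) v)"
  let ?C = "if real r / real T + real_of_int m = real k - 1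
         then ((- (one ^ T)) powi (- int n)) *\<^sub>C U2 (cls a) u2 else 0"
  assume a: "a \<in> grade V k \<inter> eigensp g T r" and
    b: "r < T \<and> real r / real T + real_of_int m - real n \<le> real k - 1 \<and> real k - 1 \<le> real r / real T + real_of_int m"
  have "\<phi> ?A v u2 + \<phi> u3 ?B u2 + \<phi> u3 v ?C = 0" "\<psi> ?A v u2 + \<psi> u3 ?B u2 + \<psi> u3 v ?C = 0"
    using \<phi> \<psi> a b unfolding blocks_def by blast+
  moreover have "(c * \<phi> ?A v u2 + d * \<psi> ?A v u2) + (c * \<phi> u3 ?B u2 + d * \<psi> u3 ?B u2) + (c * \<phi> u3 v ?C + d * \<psi> u3 v ?C)
    = c * (\<phi> ?A v u2 + \<phi> u3 ?B u2 + \<phi> u3 v ?C) + d * (\<psi> ?A v u2 + \<psi> u3 ?B u2 + \<psi> u3 v ?C)"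
    by (simp only: algebra_simps)
  ultimately show "(c * \<phi> ?A v u2 + d * \<psi> ?A v u2) + (c * \<phi> u3 ?B u2 + d * \<psi> u3 ?B u2) + (c * \<phi> u3 v ?C + d * \<psi> u3 v ?C) = 0"
    by simp
qed

lemma csubspace_blocks: "csubspace (blocks V g T M U3 U2 one)"
proof (rule complex_vs.subspaceI)
  have "trilinear (\<lambda>u3 v u2. 0 :: complex)" by (simp add: trilinear_def clinear_zero)
  then show "0 \<in> blocks V g T M U3 U2 one" by (simp add: blocks_def zero_fun_def)
  fix \<phi> assume \<phi>: "\<phi> \<in> blocks V g T M U3 U2 one"
  show "\<phi> + \<psi> \<in> blocks V g T M U3 U2 one" if "\<psi> \<in> blocks V g T M U3 U2 one" for \<psi>
    using blocks_combination[OF \<phi> that, of 1 1] by (simp add: plus_fun_def)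
  show "c *\<^sub>C \<phi> \<in> blocks V g T M U3 U2 one" for c
    using blocks_combination[OF \<phi> \<phi>, of c 0] by (simp add: scaleC_fun_def scaleC_complex_def)
qed

text \<open>The inverse map is evaluation at the point 1 without insertions.\<close>

theorem correlation_isomorphism:
  assumes one: "one ^ T = 1"
  shows "vs_isomorphism_on (S_map V g T M U3 U2) (blocks V g T M U3 U2 one) (Cor V g T M U3 U2 h)"
proof -
  let ?B = "blocks V g T M U3 U2 one" and ?F = "S_map V g T M U3 U2"
  have add: "?F (\<phi> + \<psi>) = ?F \<phi> + ?F \<psi>" if "\<phi> \<in> ?B" "\<psi> \<in> ?B" for \<phi> \<psi>
  proof -
    have "\<phi> + \<psi> \<in> ?B" using that csubspace_blocks complex_vs.subspace_add by blast
    moreover have "correlation_of (\<phi> + \<psi>) u3 xs vq u2 = correlation_of \<phi> u3 xs vq u2 + correlation_of \<psi> u3 xs vq u2" for u3 xs vq u2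
      using correlation_of_combination[of \<phi> \<psi> 1 1] that block_trilinear by (simp add: plus_fun_def)
    ultimately show ?thesis using that by (simp add: S_map_eq[OF _ one] fun_eq_iff)
  qed
  have scale: "?F (c *\<^sub>C \<phi>) = c *\<^sub>C ?F \<phi>" if "\<phi> \<in> ?B" for \<phi> c
  proof -
    have "c *\<^sub>C \<phi> \<in> ?B" using that csubspace_blocks complex_vs.subspace_scale by blast
    moreover have "correlation_of (c *\<^sub>C \<phi>) u3 xs vq u2 = c * correlation_of \<phi> u3 xs vq u2" for u3 xs vq u2
      using correlation_of_combination[of \<phi> \<phi> c 0] that block_trilinear by (simp add: scaleC_fun_def scaleC_complex_def)
    ultimately show ?thesis using that by (simp add: S_map_eq[OF _ one] fun_eq_iff scaleC_fun_def scaleC_complex_def)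
  qed
  have one0: "one \<noteq> 0" using one T by (metis power_0_left zero_neq_one neq0_conv)
  have restrict: "(\<lambda>u3 v u2. ?F \<phi> u3 [] (v, one) u2) = \<phi>" if "\<phi> \<in> ?B" for \<phi>
    using one0 by (simp add: S_map_eq[OF that one] correlation_of_Nil transport_one[OF one])
  have inj: "inj_on ?F ?B"
    by (rule inj_on_inverseI[where g = "\<lambda>S u3 v u2. S u3 [] (v, one) u2"]) (rule restrict)
  have image: "?F ` ?B = Cor V g T M U3 U2 h"
  proof (intro subset_antisym subsetI)
    fix S assume "S \<in> ?F ` ?B"
    then obtain \<phi> where \<phi>: "\<phi> \<in> ?B" "S = correlation_of \<phi>" by (auto simp: S_map_eq[OF _ one])
    then show "S \<in> Cor V g T M U3 U2 h"
      using block_system.in_Cor[OF block_system_correlation_of[OF \<phi>(1) one]] by simp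
  next
    fix S assume S: "S \<in> Cor V g T M U3 U2 h"
    have "(\<lambda>u3 v u2. S u3 [] (v, one) u2) \<in> ?B"
      by (rule restriction_in_blocks[OF block_system_Cor[OF S] one])
    then show "S \<in> ?F ` ?B"
      using S_map_eq[OF _ one] correlation_of_restriction[OF S one] by (metis imageI)
  qed
  \<comment> \<open>The space is the image of a subspace under a map that is linear on it.\<close>
  have "csubspace (Cor V g T M U3 U2 h)"
    unfolding image[symmetric]
  proof (rule complex_vs.subspaceI)
    note sub = csubspace_blocks[of one]
    have "?F 0 = 0"
      using scale[OF complex_vs.subspace_0[OF sub], of 0] by (simp add: complex_vs.scale_zero_left)
    then show "0 \<in> ?F ` ?B" using complex_vs.subspace_0[OF sub] by (metis imageI)
    show "x + y \<in> ?F ` ?B" if "x \<in> ?F ` ?B" "y \<in> ?F ` ?B" for x y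
      using that complex_vs.subspace_add[OF sub] by (elim imageE) (simp flip: add)
    show "c *\<^sub>C x \<in> ?F ` ?B" if "x \<in> ?F ` ?B" for c x
      using that complex_vs.subspace_scale[OF sub] by (elim imageE) (simp flip: scale)
  qed
  then show ?thesis
    unfolding vs_isomorphism_on_def using csubspace_blocks add scale inj image by (auto simp: bij_betw_def)
qed

end

theorem theorem3:
  fixes V :: "'v::complex_vs voa_data" and g :: "'v \<Rightarrow> 'v" and T :: nat
    and M1 :: "('v, 'm::complex_vs) module_data"
    and U2 :: "'v set \<Rightarrow> 'u2::complex_vs \<Rightarrow> 'u2"
    and U3 :: "'u3::complex_vs \<Rightarrow> 'v set \<Rightarrow> 'u3"
    and h1 h2 h3 h one :: complex
  assumes "voa V"
    and "voa_automorphism V g" and "T > 0" and "g ^^ T = id"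
    and "admissible_module V M1" and "has_conformal_weight V M1 h1"
    and "zhu_left_module V g T U2" and "\<And>u. U2 (zhu_class V g T (conf V)) u = h2 *\<^sub>C u"
    and "zhu_right_module V g T U3" and "\<And>u. U3 u (zhu_class V g T (conf V)) = h3 *\<^sub>C u"
    and "h = h1 + h2 - h3"
    and "one ^ T = 1"
  shows "vs_isomorphism_on (S_map V g T M1 U3 U2)
    (blocks V g T M1 U3 U2 one) (Cor V g T M1 U3 U2 h)"
proof -
  interpret twisted_datum V g T M1 U2 U3 h1 h2 h3 h
    by unfold_locales (rule assms)+
  show ?thesis by (rule correlation_isomorphism[OF assms(12)])
qed

end
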